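(* Let $\{\{X_{\alpha,t}\}_{t\ge0}\}_{\alpha\in\mathbb{R}}$ be the dyadic grand coupling of Brownian motion (defined in the context). Fix any $\alpha<\beta$, and let $(\{\hat X_{\alpha,t}\}_{t\ge0},\{\hat X_{\beta,t}\}_{t\ge0})$ be the reflection coupling of $\mathrm{BM}(\alpha),\mathrm{BM}(\beta)$. Let $$\Upsilon_{\alpha,\beta}:=\inf\{s\ge0: X_{\gamma_1,t}=X_{\gamma_2,t}\ \forall\,\gamma_1,\gamma_2\in[\alpha,\beta],\,t\ge s\},\qquad \hat\Upsilon_{\alpha,\beta}:=\inf\{s\ge0:\hat X_{\alpha,t}=\hat X_{\beta,t}\ \forall\,t\ge s\}.$$ Let $F^{-1}_{\Upsilon_{\alpha,\beta}}(p):=\inf\{s:\mathbf{P}(\Upsilon_{\alpha,\beta}\le s)\ge p\}$ and $F^{-1}_{\hat\Upsilon_{\alpha,\beta}}(p):=\inf\{s:\mathbf{P}(\hat\Upsilon_{\alpha,\beta}\le s)\ge p\}$. For $s>0$ write $\psi:=|\alpha-\beta|/\sqrt{s}$. Then: 1. For any $s>0$, $\mathbf{P}(\Upsilon_{\alpha,\beta}>s)\le\dfrac{\psi}{\sqrt{2\pi}}$. As a result, $$\lim_{s\to\infty}\frac{\mathbf{P}(\Upsilon_{\alpha,\beta}>s)}{\mathbf{P}(\hat\Upsilon_{\alpha,\beta}>s)}=1\qquad\text{and}\qquad \lim_{p\to1}\frac{F^{-1}_{\Upsilon_{\alpha,\beta}}(p)}{F^{-1}_{\hat\Upsilon_{\alpha,\beta}}(p)}=1.$$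 2. For any $s>0$ such that $\psi\ge2\sqrt2$, $$\mathbf{P}(\Upsilon_{\alpha,\beta}>s)\le1-\left(1-\left(\mathrm{erf}\left(\frac{\psi+8/\psi}{2\sqrt2}\right)\right)^3\right)\frac{\ln(1+8/\psi^2)+(1+8/\psi^2)^{-1}-1}{\ln2}.$$ As a result, $$\lim_{p\to0}\frac{F^{-1}_{\Upsilon_{\alpha,\beta}}(p)}{F^{-1}_{\hat\Upsilon_{\alpha,\beta}}(p)}=1.$$ 3. For any $s>0$, $\mathbf{P}(\Upsilon_{\alpha,\beta}>s)\le\mathrm{erf}\left(\dfrac{e\psi}{2}\right)$. As a result, $2e^2\hat\Upsilon_{\alpha,\beta}$ first-order stochastically dominates $\Upsilon_{\alpha,\beta}$, i.e., $\mathbf{P}(\Upsilon_{\alpha,\beta}\ge t)\le\mathbf{P}(2e^2\hat\Upsilon_{\alpha,\beta}\ge t)$ for all $t\in\mathbb{R}$.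
   Context: $\mathrm{BM}(\alpha)$ denotes the law of standard one-dimensional Brownian motion started at $\alpha\in\mathbb{R}$. $\mathrm{erf}(\gamma):=\int_{-\gamma}^{\gamma}\frac{e^{-x^2}}{\sqrt\pi}\,\mathrm{d}x$. Reflection coupling of $\mathrm{BM}(\alpha),\mathrm{BM}(\beta)$: let $\{\hat X_{\alpha,t}\}_{t\ge0}\sim\mathrm{BM}(\alpha)$, $T:=\inf\{t\ge0:\hat X_{\alpha,t}=(\alpha+\beta)/2\}$, and set $\hat X_{\beta,t}=\alpha+\beta-\hat X_{\alpha,t}$ for $t<T$ and $\hat X_{\beta,t}=\hat X_{\alpha,t}$ for $t\ge T$. Dyadic grand coupling: Let $\{Y_t\}_{t\ge0}$ be a Bessel process of dimension $3$ started at $0$, let $W_i$ ($i\in\mathbb{Z}$) be i.i.d. uniform on $\{1,-1\}$, independent of $\{Y_t\}$, and let $\Theta\sim\mathrm{Unif}[0,1]$ be independent of $(\{Y_t\}_{t\ge 0},\{W_i\}_i)$. Write $a\bmod b:=a-b\lfloor a/b\rfloor$ for $b>0$. For $\theta\in[0,1]$, $\alpha\in\mathbb{R}$, $j\in\mathbb{Z}$ let $$G_{\theta,\alpha,j}:=\begin{cases}W_j&\text{if }\left(\alpha-\sum_{k=-\infty}^{j-1}W_k2^{k+\theta-1}+2^{j+\theta-1}\right)\bmod 2^{j+\theta+1}\in[0,2^{j+\theta}),\\-W_j&\text{otherwise.}\end{cases}$$ For $i\in\mathbb{Z}$ let $T_{\theta,i}:=\inf\{t\ge0:Y_t=2^{i+\theta}\}$.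 Let $X_{\theta,\alpha,0}:=\alpha$, and for $t>0$, with $i$ the integer satisfying $T_{\theta,i-1}<t\le T_{\theta,i}$, let $$X_{\theta,\alpha,t}:=\alpha+\sum_{j=-\infty}^{i-1}G_{\theta,\alpha,j}2^{j+\theta-1}+(Y_t-2^{i+\theta-1})G_{\theta,\alpha,i}.$$ Finally $X_{\alpha,t}:=X_{\Theta,\alpha,t}$. (Each $\{X_{\alpha,t}\}_{t\ge0}$ has law $\mathrm{BM}(\alpha)$.) *)

theory Defs
  imports
    "HOL-Probability.Probability"
    "HOL-Library.Real_Mod"
begin

text \<open>
  Processes are indexed by \<open>real\<close>; only times \<open>t \<ge> 0\<close> are meaningful.
  Path properties are required almost surely. Events about coalescence times can then differ from
  a measurable set by a possibly non-measurable subset of a null set, so their probabilities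
  are taken in \<open>completion M\<close>, which agrees with \<open>M\<close> on \<open>sets M\<close>.
\<close>

definition erf :: "real \<Rightarrow> real" where
  "erf \<gamma> = (LBINT x=ereal (-\<gamma>)..ereal \<gamma>. exp (- x\<^sup>2) / sqrt pi)"

section \<open>Brownian motion and the three-dimensional Bessel process\<close>

abbreviation path_space :: "(real \<Rightarrow> 'b::topological_space) measure" where
  "path_space \<equiv> PiM {0..} (\<lambda>_. borel)"

definition path_of :: "(real \<Rightarrow> 'a \<Rightarrow> 'b) \<Rightarrow> 'a \<Rightarrow> real \<Rightarrow> 'b" where
  "path_of B \<omega> = (\<lambda>t\<in>{0..}. B t \<omega>)"

definition brownian_motion :: "'a measure \<Rightarrow> real \<Rightarrow> (real \<Rightarrow> 'a \<Rightarrow> real) \<Rightarrow> bool" where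
  "brownian_motion M a B \<longleftrightarrow>
     prob_space M \<and>
     (\<forall>t\<ge>0. B t \<in> borel_measurable M) \<and>
     (AE \<omega> in M. B 0 \<omega> = a) \<and>
     (\<forall>n (\<tau> :: nat \<Rightarrow> real). (\<forall>k<n. 0 \<le> \<tau> k \<and> \<tau> k \<le> \<tau> (Suc k)) \<longrightarrow>
        prob_space.indep_vars M (\<lambda>_. borel) (\<lambda>k \<omega>. B (\<tau> (Suc k)) \<omega> - B (\<tau> k) \<omega>) {..<n}) \<and>
     (\<forall>s t. 0 \<le> s \<and> s < t \<longrightarrow>
        distributed M lborel (\<lambda>\<omega>. B t \<omega> - B s \<omega>) (normal_density 0 (sqrt (t - s)))) \<and>
     (AE \<omega> in M. continuous_on {0..} (\<lambda>t. B t \<omega>))"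

definition brownian_motion_3d_0 :: "'a measure \<Rightarrow> (real \<Rightarrow> 'a \<Rightarrow> real ^ 3) \<Rightarrow> bool" where
  "brownian_motion_3d_0 M B \<longleftrightarrow>
     (\<forall>i. brownian_motion M 0 (\<lambda>t \<omega>. B t \<omega> $ i)) \<and>
     prob_space.indep_vars M (\<lambda>_. path_space) (\<lambda>i. path_of (\<lambda>t \<omega>. B t \<omega> $ i)) UNIV"

text \<open>
  A continuous process with the law of the Euclidean norm of a three-dimensional Brownian motion
  started at the origin. The latter may live on another probability space; path space is
  large enough to carry it, so the existential quantifier over \<open>N\<close> is no restriction.
\<close>

definition bessel3_0 :: "'a measure \<Rightarrow> (real \<Rightarrow> 'a \<Rightarrow> real) \<Rightarrow> bool" where
  "bessel3_0 M Y \<longleftrightarrow>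
     prob_space M \<and>
     (\<forall>t\<ge>0. Y t \<in> borel_measurable M) \<and>
     (AE \<omega> in M. continuous_on {0..} (\<lambda>t. Y t \<omega>)) \<and>
     (\<exists>(N :: (real \<Rightarrow> real ^ 3) measure) B.
        brownian_motion_3d_0 N B \<and>
        distr M path_space (path_of Y) = distr N path_space (path_of (\<lambda>t \<omega>. norm (B t \<omega>))))"

section \<open>Hitting, coalescence and quantiles\<close>

definition hitting_time :: "(real \<Rightarrow> real) \<Rightarrow> real \<Rightarrow> ereal" where
  "hitting_time x a = Inf {ereal t |t. 0 \<le> t \<and> x t = a}"

definition coalescence_time :: "real set \<Rightarrow> (real \<Rightarrow> real \<Rightarrow> real) \<Rightarrow> ereal" where
  "coalescence_time I x =
     Inf {ereal s |s. 0 \<le> s \<and> (\<forall>\<gamma>\<^sub>1\<in>I. \<forall>\<gamma>\<^sub>2\<in>I. \<forall>t\<ge>s. x \<gamma>\<^sub>1 t = x \<gamma>\<^sub>2 t)}"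

definition quantile :: "'a measure \<Rightarrow> ('a \<Rightarrow> ereal) \<Rightarrow> real \<Rightarrow> real" where
  "quantile M Z p = Inf {s. \<P>(\<omega> in completion M. Z \<omega> \<le> ereal s) \<ge> p}"

section \<open>Reflection coupling\<close>

definition reflected :: "real \<Rightarrow> real \<Rightarrow> (real \<Rightarrow> real) \<Rightarrow> real \<Rightarrow> real" where
  "reflected \<alpha> \<beta> x t =
     (if ereal t < hitting_time x ((\<alpha> + \<beta>) / 2) then \<alpha> + \<beta> - x t else x t)"

definition reflection_time :: "real \<Rightarrow> real \<Rightarrow> (real \<Rightarrow> real) \<Rightarrow> ereal" where
  "reflection_time \<alpha> \<beta> x = Inf {ereal s |s. 0 \<le> s \<and> (\<forall>t\<ge>s. x t = reflected \<alpha> \<beta> x t)}"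

section \<open>Dyadic grand coupling\<close>

definition indep_of ::
    "'a measure \<Rightarrow> 'b measure \<Rightarrow> ('a \<Rightarrow> 'b) \<Rightarrow> 'c measure \<Rightarrow> ('a \<Rightarrow> 'c) \<Rightarrow> bool" where
  \<comment> \<open>The library's \<open>indep_var\<close> needs both variables to have the same codomain type.\<close>
  "indep_of M N X N' X' \<longleftrightarrow>
     X \<in> measurable M N \<and> X' \<in> measurable M N' \<and>
     prob_space.indep_set M
       (sets (vimage_algebra (space M) X N)) (sets (vimage_algebra (space M) X' N'))"

abbreviation sign_space :: "(int \<Rightarrow> int) measure" where
  "sign_space \<equiv> PiM UNIV (\<lambda>_. count_space UNIV)"

definition dyadic_driving ::
    "'a measure \<Rightarrow> (real \<Rightarrow> 'a \<Rightarrow> real) \<Rightarrow> (int \<Rightarrow> 'a \<Rightarrow> int) \<Rightarrow> ('a \<Rightarrow> real) \<Rightarrow> bool" where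
  "dyadic_driving M Y W \<Theta> \<longleftrightarrow>
     prob_space M \<and>
     bessel3_0 M Y \<and>
     prob_space.indep_vars M (\<lambda>_. count_space UNIV) W UNIV \<and>
     (\<forall>i. distr M (count_space UNIV) (W i) = measure_pmf (pmf_of_set {1, -1})) \<and>
     \<Theta> \<in> borel_measurable M \<and> distr M borel \<Theta> = uniform_measure lborel {0..1} \<and>
     indep_of M path_space (path_of Y) sign_space (\<lambda>\<omega> i. W i \<omega>) \<and>
     indep_of M borel \<Theta> (path_space \<Otimes>\<^sub>M sign_space) (\<lambda>\<omega>. (path_of Y \<omega>, \<lambda>i. W i \<omega>))"

text \<open>
  The following are deterministic functionals of a Bessel path \<open>y\<close>, a sign sequence \<open>w\<close> and
  the scale offset \<open>\<theta>\<close>.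
\<close>

definition dyadic_G :: "(int \<Rightarrow> int) \<Rightarrow> real \<Rightarrow> real \<Rightarrow> int \<Rightarrow> real" where
  "dyadic_G w \<theta> \<alpha> j =
     (if (\<alpha> - (\<Sum>\<^sub>\<infinity>k\<in>{..j - 1}. of_int (w k) * 2 powr (of_int k + \<theta> - 1))
            + 2 powr (of_int j + \<theta> - 1)) rmod (2 powr (of_int j + \<theta> + 1))
          \<in> {0..<2 powr (of_int j + \<theta>)}
      then of_int (w j) else - of_int (w j))"

definition dyadic_T :: "(real \<Rightarrow> real) \<Rightarrow> real \<Rightarrow> int \<Rightarrow> ereal" where
  "dyadic_T y \<theta> i = hitting_time y (2 powr (of_int i + \<theta>))"

definition dyadic_X ::
    "(real \<Rightarrow> real) \<Rightarrow> (int \<Rightarrow> int) \<Rightarrow> real \<Rightarrow> real \<Rightarrow> real \<Rightarrow> real" where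
  "dyadic_X y w \<theta> \<alpha> t =
     (if t = 0 then \<alpha>
      else let i = (THE i. dyadic_T y \<theta> (i - 1) < ereal t \<and> ereal t \<le> dyadic_T y \<theta> i) in
        \<alpha> + (\<Sum>\<^sub>\<infinity>j\<in>{..i - 1}. dyadic_G w \<theta> \<alpha> j * 2 powr (of_int j + \<theta> - 1))
          + (y t - 2 powr (of_int i + \<theta> - 1)) * dyadic_G w \<theta> \<alpha> i)"

end

(*
  When Y first reaches the level 2^(j+theta-1), the process started in gamma sits on a grid of
  mesh 2^(j+theta) that is shifted by a random binary expansion, in the cell containing gamma.
  Hence X_alpha and X_beta have met by time s iff alpha and beta lie in the same cell at the last
  level reached by the running maximum m of Y on [0,s]. The shift is uniform and independent of m,
  so the survival function is E min(1, |alpha - beta| / (2 L)) with L the largest level below m.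

  The law of m follows from the method of images for three-dimensional Brownian motion killed
  outside a ball: P(m <= R) = E[saw_R(Y_s) / Y_s] for a sawtooth function saw_R. Summed over the
  dyadic radii the sawtooths telescope, which gives E[1/L] = sqrt(2/(pi s)) for every theta and
  hence the first bound. The others come from restricting to {Y_s > R}, where the average over
  theta is explicit, and from P(Y_s <= R) <= erf(R / sqrt(2 s))^3, the ball being contained in a
  cube. The reflection coupling survives with probability erf(psi / (2 sqrt 2)), so the limits
  follow by comparing the tails at infinity and at zero.
*)

theory Submission
  imports Defs "HOL-Real_Asymp.Real_Asymp"
begin

text \<open>Dimension three makes the method of images exact: if f(|x|) solves the heat equation in
  space, then r f(r) solves it on the line. So the mean of \<open>saw_ratio\<close> after a start at
  distance r is a one-dimensional Gaussian mean of \<open>saw\<close> divided by r, and it vanishes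
  at r = R because \<open>saw\<close> is antisymmetric about R. No stopping times in continuous time
  are used. First exits are sought on dyadic time grids, the Markov property is applied at grid
  times only, and continuity of the path carries the grid exits to a boundary point. The same scheme
  gives the reflection principle on the line. Theta drops out of E[1/L] for this reason: up to ties,
  the inverses of all levels above m sum to 1/L, and the telescoped expectation is E[2u/Y_s] with u
  the fractional part of Y_s at a mesh that may be taken arbitrarily fine, so that 2u averages to 1.
  With D = |alpha - beta|, the bound with e uses the linear estimate up to psi = sqrt 2 and the
  radius R = D beyond. Small times need R just above D/2, where the exponent D^2/8 of the reflection
  coupling appears.\<close>

section \<open>The coupling along a fixed driving path\<close>

text \<open>When the driving path first reaches \<open>dlevel \<theta> j\<close>, the process started in
  \<open>\<gamma>\<close> is at \<open>node w \<theta> j \<gamma>\<close>, the midpoint of the interval of length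
  \<open>2 * dlevel \<theta> j\<close> with number \<open>cell w \<theta> j \<gamma>\<close>.\<close>

definition bit_shift :: "(int \<Rightarrow> int) \<Rightarrow> int \<Rightarrow> real" where
  "bit_shift w j = (\<Sum>n. (if w (j - 1 - int n) = -1 then 1 else 0) / 2 ^ Suc n)"

text \<open>The index lags by one: this is the level whose hitting time is \<open>dyadic_T\<close>
  with index j - 1, the moment at which scale j takes over.\<close>

definition dlevel :: "real \<Rightarrow> int \<Rightarrow> real" where
  "dlevel \<theta> j = 2 powr (of_int j + \<theta> - 1)"

definition cell :: "(int \<Rightarrow> int) \<Rightarrow> real \<Rightarrow> int \<Rightarrow> real \<Rightarrow> int" where
  "cell w \<theta> j \<gamma> = \<lfloor>\<gamma> / (2 * dlevel \<theta> j) + bit_shift w j\<rfloor>"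

definition node :: "(int \<Rightarrow> int) \<Rightarrow> real \<Rightarrow> int \<Rightarrow> real \<Rightarrow> real" where
  "node w \<theta> j \<gamma> = 2 * dlevel \<theta> j * (of_int (cell w \<theta> j \<gamma>) + 1/2 - bit_shift w j)"

lemma dlevel_pos [simp]: "dlevel \<theta> j > 0"
  by (simp add: dlevel_def)

lemma dlevel_nonneg [simp]: "0 \<le> dlevel \<theta> j"
  using dlevel_pos[of \<theta> j] by linarith

lemma dlevel_nz [simp]: "dlevel \<theta> j \<noteq> 0"
  using dlevel_pos[of \<theta> j] by linarith

lemma dlevel_Suc: "dlevel \<theta> (j + 1) = 2 * dlevel \<theta> j"
  by (simp add: dlevel_def powr_add powr_diff)

lemma dlevel_diff_nat: "dlevel \<theta> (j - int n) = dlevel \<theta> j / 2 ^ n"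
  by (simp add: dlevel_def powr_diff powr_add powr_realpow [symmetric] field_simps)

lemma dlevel_mono: "i \<le> j \<Longrightarrow> dlevel \<theta> i \<le> dlevel \<theta> j"
  by (simp add: dlevel_def)

section \<open>The random shift as a binary expansion\<close>

lemma summable_bits: "summable (\<lambda>n. (if P n then 1 else 0) / 2 ^ Suc n :: real)"
  by (rule summable_comparison_test'[OF summable_geometric[of "1/2::real"], of 0])
     (auto simp: power_one_over field_simps)

text \<open>Going up one scale prepends one binary digit; the sign -1 is the digit 1.\<close>

lemma bit_shift_rec: "bit_shift w j = ((if w (j - 1) = -1 then 1 else 0) + bit_shift w (j - 1)) / 2"
proof -
  let ?f = "\<lambda>n. (if w (j - 1 - int n) = -1 then 1 else 0) / 2 ^ Suc n :: real"
  have "bit_shift w j = ?f 0 + (\<Sum>n. ?f (Suc n))"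
    unfolding bit_shift_def using suminf_split_head[OF summable_bits[of "\<lambda>n. w (j - 1 - int n) = -1"]]
    by simp
  also have "(\<Sum>n. ?f (Suc n)) = (\<Sum>n. (1/2) * ((if w (j - 1 - 1 - int n) = -1 then 1 else 0) / 2 ^ Suc n))"
    by (intro suminf_cong) (simp add: algebra_simps)
  also have "\<dots> = (1/2) * bit_shift w (j - 1)"
    unfolding bit_shift_def by (intro suminf_mult summable_bits)
  finally show ?thesis by (simp add: add_divide_distrib)
qed

lemma bit_shift_bounds: "0 \<le> bit_shift w j" "bit_shift w j \<le> 1"
proof -
  show "0 \<le> bit_shift w j"
    unfolding bit_shift_def by (intro suminf_nonneg summable_bits) auto
  have "bit_shift w j \<le> (\<Sum>n. (1/2) ^ Suc n :: real)"
    unfolding bit_shift_def using power_half_series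
    by (intro suminf_le summable_bits) (auto simp: power_one_over divide_simps sums_iff)
  also have "\<dots> = 1" using power_half_series by (simp add: sums_iff)
  finally show "bit_shift w j \<le> 1" .
qed

text \<open>A sign is 1 - 2b for its digit b, so the series is a full geometric series, worth
  \<open>dlevel \<theta> j\<close>, minus twice the same series weighted by digits.\<close>

lemma sign_series_has_sum:
  assumes w: "\<And>k. w k \<in> {1, -1 :: int}"
  shows "((\<lambda>k. of_int (w k) * 2 powr (of_int k + \<theta> - 1)) has_sum
          2 * dlevel \<theta> j * (1/2 - bit_shift w j)) {..j - 1}"
proof -
  let ?b = "\<lambda>n. if w (j - 1 - int n) = -1 then 1 else 0 :: real"
  let ?h = "\<lambda>n. dlevel \<theta> j / 2 ^ Suc n - 2 * dlevel \<theta> j * (?b n / 2 ^ Suc n)"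
  have eq: "of_int (w (j - 1 - int n)) * 2 powr (of_int (j - 1 - int n) + \<theta> - 1) = ?h n" for n
  proof -
    have "2 powr (of_int (j - 1 - int n) + \<theta> - 1) = dlevel \<theta> (j - int (Suc n))"
      by (simp add: dlevel_def algebra_simps)
    also have "\<dots> = dlevel \<theta> j / 2 ^ Suc n" by (rule dlevel_diff_nat)
    finally show ?thesis using w[of "j - 1 - int n"] by (auto simp: field_simps)
  qed
  have s1: "(\<lambda>n. dlevel \<theta> j / 2 ^ Suc n) sums dlevel \<theta> j"
    using sums_mult[OF power_half_series, of "dlevel \<theta> j"] by (simp add: power_one_over)
  have s2: "(\<lambda>n. 2 * dlevel \<theta> j * (?b n / 2 ^ Suc n)) sums (2 * dlevel \<theta> j * bit_shift w j)"
    unfolding bit_shift_def by (intro sums_mult summable_sums summable_bits)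
  have "?h sums (dlevel \<theta> j - 2 * dlevel \<theta> j * bit_shift w j)"
    by (intro sums_diff s1 s2)
  moreover have sn: "summable (\<lambda>n. norm (?h n))"
  proof (rule summable_comparison_test'[of _ 0])
    show "summable (\<lambda>n. dlevel \<theta> j / 2 ^ Suc n)" using s1 by (simp add: sums_iff)
    show "norm (norm (?h n)) \<le> dlevel \<theta> j / 2 ^ Suc n" for n
      by (auto simp: field_simps less_imp_le)
  qed
  ultimately have hs: "(?h has_sum (dlevel \<theta> j - 2 * dlevel \<theta> j * bit_shift w j)) UNIV"
    by (intro norm_summable_imp_has_sum)
  have bij: "bij_betw (\<lambda>n. j - 1 - int n) UNIV {..j - 1}"
    by (rule bij_betwI[of _ _ _ "\<lambda>k. nat (j - 1 - k)"]) auto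
  have e2: "2 * dlevel \<theta> j * (1/2 - bit_shift w j) = dlevel \<theta> j - 2 * dlevel \<theta> j * bit_shift w j"
    by (simp add: right_diff_distrib)
  show ?thesis
    unfolding has_sum_reindex_bij_betw[OF bij, symmetric] eq e2 by (rule hs)
qed

text \<open>After division by the mesh the mod condition of the definition says that z/2 has
  fractional part below 1/2, that is, that the cell number is even. Points in even cells move with
  the sign, points in odd cells against it, so neighbouring cells move in opposite
  directions.\<close>

lemma dyadic_G_eq:
  assumes w: "\<And>k. w k \<in> {1, -1 :: int}"
  shows "dyadic_G w \<theta> \<gamma> j = of_int (if even (cell w \<theta> j \<gamma>) then w j else - w j)"
proof -
  let ?R = "dlevel \<theta> j"
  define z where "z = \<gamma> / (2 * ?R) + bit_shift w j"
  have inf: "(\<Sum>\<^sub>\<infinity>k\<in>{..j - 1}. of_int (w k) * 2 powr (of_int k + \<theta> - 1)) = 2 * ?R * (1/2 - bit_shift w j)"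
    using sign_series_has_sum[of w, OF w] by (rule infsumI)
  have p1: "2 powr (of_int j + \<theta> - 1) = ?R" "2 powr (of_int j + \<theta>) = 2 * ?R" "2 powr (of_int j + \<theta> + 1) = 4 * ?R"
    by (simp_all add: dlevel_def powr_add powr_diff)
  have e: "\<gamma> - 2 * ?R * (1/2 - bit_shift w j) + ?R = 2 * ?R * z"
    using dlevel_pos[of \<theta> j] by (simp add: z_def field_simps)
  have "(2 * ?R * z) rmod (4 * ?R) = frac (z / 2) * (4 * ?R)"
  proof -
    have "(2 * ?R * z) / (4 * ?R) = z / 2" by simp
    then show ?thesis using dlevel_pos[of \<theta> j] by (simp add: rmod_conv_frac abs_of_pos)
  qed
  moreover have "frac (z/2) * (4 * ?R) \<in> {0..<2 * ?R} \<longleftrightarrow> frac (z/2) < 1/2"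
    using dlevel_pos[of \<theta> j] by (auto simp: field_simps)
  moreover have "frac (z/2) < 1/2 \<longleftrightarrow> even \<lfloor>z\<rfloor>"
  proof
    assume "frac (z/2) < 1/2"
    then have "\<lfloor>z\<rfloor> = 2 * \<lfloor>z/2\<rfloor>" unfolding frac_def by linarith
    then show "even \<lfloor>z\<rfloor>" by simp
  next
    assume "even \<lfloor>z\<rfloor>"
    then obtain m where m: "\<lfloor>z\<rfloor> = 2 * m" by auto
    then have "\<lfloor>z/2\<rfloor> = m" by linarith
    then show "frac (z/2) < 1/2" unfolding frac_def using m by linarith
  qed
  ultimately show ?thesis
    unfolding dyadic_G_def inf p1 e cell_def z_def[symmetric] by simp
qed

text \<open>A cell of the next scale is the union of two cells of the current one, and the digit of
  \<open>w j\<close> decides in which of the two possible ways neighbours are paired.\<close>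

lemma cell_Suc:
  assumes w: "w j \<in> {1, -1 :: int}"
  shows "cell w \<theta> (j + 1) \<gamma> = (cell w \<theta> j \<gamma> + (if w j = -1 then 1 else 0)) div 2"
proof -
  define z where "z = \<gamma> / (2 * dlevel \<theta> j) + bit_shift w j"
  define e :: int where "e = (if w j = -1 then 1 else 0)"
  have "bit_shift w (j + 1) = (of_int e + bit_shift w j) / 2"
    using bit_shift_rec[of w "j + 1"] by (simp add: e_def)
  then have "\<gamma> / (2 * dlevel \<theta> (j + 1)) + bit_shift w (j + 1) = (z + of_int e) / 2"
    unfolding dlevel_Suc z_def by (simp add: add_divide_distrib)
  then have "cell w \<theta> (j + 1) \<gamma> = \<lfloor>(z + of_int e) / 2\<rfloor>"
    unfolding cell_def by (rule arg_cong)
  also have "\<dots> = (\<lfloor>z\<rfloor> + e) div 2"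
    using floor_divide_real_eq_div[of 2 "z + of_int e"] by simp
  finally show ?thesis by (simp add: cell_def z_def e_def)
qed

text \<open>The midpoint of a coarse cell lies at distance \<open>dlevel \<theta> j\<close> from the
  midpoints of its two halves, to the right of one and to the left of the other;
  \<open>dyadic_G\<close> is the matching direction.\<close>

lemma dyadic_G_step:
  assumes w: "\<And>k. w k \<in> {1, -1 :: int}"
  shows "dyadic_G w \<theta> \<gamma> j * dlevel \<theta> j = node w \<theta> (j + 1) \<gamma> - node w \<theta> j \<gamma>"
proof -
  let ?c = "cell w \<theta> j \<gamma>"
  have b: "bit_shift w (j + 1) = ((if w j = -1 then 1 else 0) + bit_shift w j) / 2"
    using bit_shift_rec[of w "j + 1"] by simp
  define q where "q = (?c + (if w j = -1 then 1 else 0)) div 2"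
  \<comment> \<open>The subtracted term is the remainder modulo 2: cell number plus digit is odd
    exactly when the cell is even and the digit 1, or the cell odd and the digit 0.\<close>
  have "2 * q = ?c + (if w j = -1 then 1 else 0) - (if even ?c = (w j = -1) then 1 else 0)"
    unfolding q_def using w[of j] by (auto elim!: evenE oddE)
  then have q: "real_of_int q = (of_int ?c + (if w j = -1 then 1 else 0) - (if even ?c = (w j = -1) then 1 else 0)) / 2"
    by (auto split: if_splits)
  show ?thesis using w[of j]
    unfolding dyadic_G_eq[of w, OF w] node_def cell_Suc[of w j, OF w] dlevel_Suc b q_def[symmetric] q
    by (cases "even ?c"; auto) (simp_all add: algebra_simps add_divide_distrib diff_divide_distrib)
qed

lemma node_near: "\<bar>node w \<theta> j \<gamma> - \<gamma>\<bar> \<le> dlevel \<theta> j"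
proof -
  have "\<gamma> = 2 * dlevel \<theta> j * (\<gamma> / (2 * dlevel \<theta> j))"
    using dlevel_pos[of \<theta> j] by (simp add: field_simps)
  then have "node w \<theta> j \<gamma> - \<gamma> = 2 * dlevel \<theta> j * (of_int (cell w \<theta> j \<gamma>) + 1/2 - (\<gamma> / (2 * dlevel \<theta> j) + bit_shift w j))"
    unfolding node_def by (simp add: algebra_simps)
  also have "\<bar>\<dots>\<bar> \<le> 2 * dlevel \<theta> j * (1/2)"
  proof -
    have "\<bar>real_of_int \<lfloor>z\<rfloor> + 1/2 - z\<bar> \<le> 1/2" for z by linarith
    then show ?thesis unfolding abs_mult cell_def
      using dlevel_pos[of \<theta> j] by (intro mult_mono) auto
  qed
  finally show ?thesis by simp
qed

lemma dyadic_G_abs: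
  assumes w: "\<And>k. w k \<in> {1, -1 :: int}"
  shows "\<bar>dyadic_G w \<theta> \<gamma> j\<bar> = 1"
  using w[of j] by (auto simp: dyadic_G_eq[of w, OF w])

text \<open>Each summand is a difference of consecutive nodes, so the series telescopes; at fine
  scales the nodes tend to the starting point by \<open>node_near\<close>.\<close>

lemma dyadic_G_infsum:
  assumes w: "\<And>k. w k \<in> {1, -1 :: int}"
  shows "(\<Sum>\<^sub>\<infinity>j\<in>{..i - 1}. dyadic_G w \<theta> \<gamma> j * 2 powr (of_int j + \<theta> - 1)) = node w \<theta> i \<gamma> - \<gamma>"
proof -
  let ?g = "\<lambda>j. dyadic_G w \<theta> \<gamma> j * 2 powr (of_int j + \<theta> - 1)"
  have g: "?g j = node w \<theta> (j + 1) \<gamma> - node w \<theta> j \<gamma>" for j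
    using dyadic_G_step[of w, OF w, of \<theta> \<gamma> j] by (simp add: dlevel_def)
  have lim: "(\<lambda>n. node w \<theta> (i - int n) \<gamma>) \<longlonglongrightarrow> \<gamma>"
  proof (rule LIM_zero_cancel, rule Lim_null_comparison)
    show "\<forall>\<^sub>F n in sequentially. norm (node w \<theta> (i - int n) \<gamma> - \<gamma>) \<le> dlevel \<theta> i * (1/2) ^ n"
      using node_near[of w \<theta> "i - int n" \<gamma> for n]
      by (simp add: dlevel_diff_nat[of \<theta> i] power_one_over)
    show "(\<lambda>n. dlevel \<theta> i * (1/2) ^ n) \<longlonglongrightarrow> 0"
      by (intro tendsto_mult_right_zero LIMSEQ_realpow_zero) auto
  qed
  have "(\<lambda>n. node w \<theta> (i - int n) \<gamma> - node w \<theta> (i - int (Suc n)) \<gamma>) sums (node w \<theta> (i - int 0) \<gamma> - \<gamma>)"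
    by (rule telescope_sums'[OF lim])
  then have s: "(\<lambda>n. ?g (i - 1 - int n)) sums (node w \<theta> i \<gamma> - \<gamma>)"
    unfolding g by (simp add: algebra_simps)
  moreover have "summable (\<lambda>n. norm (?g (i - 1 - int n)))"
  proof (rule summable_comparison_test'[of _ 0])
    show "summable (\<lambda>n. dlevel \<theta> (i - 1) * (1/2) ^ n)"
      by (intro summable_mult summable_geometric) auto
    show "norm (norm (?g (i - 1 - int n))) \<le> dlevel \<theta> (i - 1) * (1/2) ^ n" for n
      using dlevel_diff_nat[of \<theta> "i - 1" n] dyadic_G_abs[of w, OF w, of \<theta> \<gamma> "i - 1 - int n"]
      by (simp add: abs_mult dlevel_def power_one_over)
  qed
  ultimately have hs: "((\<lambda>n. ?g (i - 1 - int n)) has_sum (node w \<theta> i \<gamma> - \<gamma>)) UNIV"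
    by (intro norm_summable_imp_has_sum)
  have bij: "bij_betw (\<lambda>n. i - 1 - int n) UNIV {..i - 1}"
    by (rule bij_betwI[of _ _ _ "\<lambda>k. nat (i - 1 - k)"]) auto
  have "(?g has_sum (node w \<theta> i \<gamma> - \<gamma>)) {..i - 1}"
    unfolding has_sum_reindex_bij_betw[OF bij, symmetric] by (rule hs)
  then show ?thesis by (rule infsumI)
qed

text \<open>The index of the last level reached by a path with maximum \<open>m\<close>.\<close>

definition dindex :: "real \<Rightarrow> real \<Rightarrow> int" where
  "dindex \<theta> m = \<lfloor>log 2 m - \<theta>\<rfloor> + 1"

lemma dlevel_dindex:
  assumes "m > 0"
  shows "dlevel \<theta> (dindex \<theta> m) \<le> m" "m < dlevel \<theta> (dindex \<theta> m + 1)"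
proof -
  have m: "m = 2 powr (log 2 m)" using assms by simp
  have "of_int (dindex \<theta> m) + \<theta> - 1 \<le> log 2 m" by (simp add: dindex_def) linarith
  then show "dlevel \<theta> (dindex \<theta> m) \<le> m" unfolding dlevel_def by (subst m) (rule powr_mono, auto)
  have "log 2 m < of_int (dindex \<theta> m + 1) + \<theta> - 1" by (simp add: dindex_def) linarith
  then show "m < dlevel \<theta> (dindex \<theta> m + 1)" unfolding dlevel_def by (subst m) (rule powr_less_mono, auto)
qed

lemma dlevel_le_iff: "m > 0 \<Longrightarrow> dlevel \<theta> i \<le> m \<longleftrightarrow> i \<le> dindex \<theta> m"
  using dlevel_dindex[of m \<theta>] dlevel_mono[of i "dindex \<theta> m" \<theta>] dlevel_mono[of "dindex \<theta> m + 1" i \<theta>]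
  by (cases "i \<le> dindex \<theta> m") auto

lemma cell_eq_upward:
  assumes w: "\<And>k. w k \<in> {1, -1 :: int}" and "cell w \<theta> i \<alpha> = cell w \<theta> i \<beta>" "i \<le> j"
  shows "cell w \<theta> j \<alpha> = cell w \<theta> j \<beta>"
  using assms(3,2)
  by (induction j rule: int_ge_induct) (auto simp: cell_Suc[of w, OF w])

lemma cell_mono: "\<gamma> \<le> \<delta> \<Longrightarrow> cell w \<theta> j \<gamma> \<le> cell w \<theta> j \<delta>"
  unfolding cell_def by (intro floor_mono add_right_mono divide_right_mono) (auto simp: less_imp_le)

section \<open>Levels reached by one path and its coalescence time\<close>

lemma hitting_time_less_iff:
  assumes y: "continuous_on {0..} y" "y 0 = 0" and "a > 0"
  shows "hitting_time y a < ereal t \<longleftrightarrow> (\<exists>u\<in>{0..<t}. a \<le> y u)"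
proof
  assume "hitting_time y a < ereal t"
  then show "\<exists>u\<in>{0..<t}. a \<le> y u"
    unfolding hitting_time_def Inf_less_iff by auto
next
  assume "\<exists>u\<in>{0..<t}. a \<le> y u"
  then obtain u where u: "0 \<le> u" "u < t" "a \<le> y u" by auto
  \<comment> \<open>Being above the level is enough: a continuous path from 0 has met the level
    exactly on the way.\<close>
  have "\<exists>x\<ge>0. x \<le> u \<and> y x = a"
    using u assms by (intro IVT') (auto intro: continuous_on_subset)
  then obtain x where "0 \<le> x" "x \<le> u" "y x = a" by auto
  then show "hitting_time y a < ereal t"
    unfolding hitting_time_def Inf_less_iff using u by (intro bexI[of _ "ereal x"]) auto
qed

text \<open>Properties of almost every realisation. By \<open>leaves\<close> some level has been
  passed before any positive time; without it no scale would be in force at small times.\<close>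

locale dyadic_path =
  fixes w :: "int \<Rightarrow> int" and y :: "real \<Rightarrow> real" and \<theta> :: real
  assumes w: "\<And>k. w k \<in> {1, -1}"
    and cont: "continuous_on {0..} y" and y0: "y 0 = 0"
    and leaves: "\<And>t. t > 0 \<Longrightarrow> \<exists>u\<in>{0..t}. y u > 0"
begin

text \<open>The half-open time range mirrors the condition that t lies after one hitting time and
  not after the next: at the very moment when the next level is hit, the old scale is still in
  force.\<close>

definition active :: "real \<Rightarrow> int \<Rightarrow> bool" where
  "active t i \<longleftrightarrow> (\<exists>u\<in>{0..<t}. dlevel \<theta> i \<le> y u) \<and> (\<forall>u\<in>{0..<t}. y u < dlevel \<theta> (i + 1))"

lemma dyadic_T_active:
  "dyadic_T y \<theta> (i - 1) < ereal t \<and> ereal t \<le> dyadic_T y \<theta> i \<longleftrightarrow> active t i"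
proof -
  have e: "2 powr (of_int (i - 1) + \<theta>) = dlevel \<theta> i" "2 powr (of_int i + \<theta>) = dlevel \<theta> (i + 1)"
    by (simp_all add: dlevel_def algebra_simps)
  show ?thesis
    unfolding dyadic_T_def e active_def not_less[symmetric]
      hitting_time_less_iff[OF cont y0 dlevel_pos]
    by auto
qed

lemma active_unique: "active t i \<Longrightarrow> active t j \<Longrightarrow> i = j"
proof (rule ccontr)
  assume a: "active t i" "active t j" and "i \<noteq> j"
  have "False" if "active t i" "active t j" "i < j" for i j
    using that dlevel_mono[of "i + 1" j \<theta>] unfolding active_def by force
  from this[of i j] this[of j i] a \<open>i \<noteq> j\<close> show False by linarith
qed

lemma active_exists:
  assumes "t > 0"
  shows "\<exists>i. active t i"
proof -
  define P where "P i \<longleftrightarrow> (\<exists>u\<in>{0..<t}. dlevel \<theta> i \<le> y u)" for i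
  obtain u where u: "0 \<le> u" "u < t" "y u > 0"
    using leaves[of "t / 2"] assms by auto
  define i0 where "i0 = dindex \<theta> (y u)"
  have P0: "P i0" unfolding P_def i0_def using u dlevel_dindex[of "y u" \<theta>] by auto
  have "compact (y ` {0..t})"
    using cont by (intro compact_continuous_image) (auto intro: continuous_on_subset)
  then obtain b where b: "\<And>u. u \<in> {0..t} \<Longrightarrow> \<bar>y u\<bar> \<le> b"
    using compact_imp_bounded bounded_iff by (metis imageI real_norm_def)
  define b' where "b' = max b 1"
  have bp: "b' > 0" "\<And>u. u \<in> {0..t} \<Longrightarrow> y u \<le> b'"
    using b unfolding b'_def by (auto simp: abs_le_iff le_max_iff_disj)
  have nP: "\<not> P j" if "j > dindex \<theta> b'" for j
    using bp that dlevel_le_iff[of b' \<theta> j] unfolding P_def by force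
  \<comment> \<open>Counting upwards from a level that was reached, the first unreached one exists
    because the path is bounded on the compact interval; the scale just below it is active.\<close>
  define n where "n = (LEAST n. \<not> P (i0 + int n))"
  have "\<not> P (i0 + int (nat (dindex \<theta> b' + 1 - i0)))"
    using nP[of "i0 + int (nat (dindex \<theta> b' + 1 - i0))"] by linarith
  then have n: "\<not> P (i0 + int n)" unfolding n_def by (rule LeastI)
  then have "n \<noteq> 0" using P0 by (auto intro: ccontr)
  then obtain k where k: "n = Suc k" using not0_implies_Suc by blast
  have "P (i0 + int k)" using not_less_Least[of k "\<lambda>n. \<not> P (i0 + int n)"] k unfolding n_def by auto
  then have "active t (i0 + int k)"
    using n unfolding k active_def P_def by (auto simp: not_le algebra_simps)
  then show ?thesis ..
qed

lemma dyadic_X_active: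
  assumes "t > 0" "active t i"
  shows "dyadic_X y w \<theta> \<gamma> t = node w \<theta> i \<gamma> + (y t - dlevel \<theta> i) * dyadic_G w \<theta> \<gamma> i"
proof -
  have "(THE i. dyadic_T y \<theta> (i - 1) < ereal t \<and> ereal t \<le> dyadic_T y \<theta> i) = i"
    unfolding dyadic_T_active using assms(2) active_unique by blast
  then show ?thesis
    using assms(1) unfolding dyadic_X_def by (simp add: dyadic_G_infsum[of w, OF w] dlevel_def)
qed

text \<open>Equal cells stay equal at all coarser scales, and since cells are monotone in the
  starting point everything between alpha and beta is caught in the same cell.\<close>

lemma coalescence_time_le:
  assumes c: "cell w \<theta> j \<alpha> = cell w \<theta> j \<beta>" and s: "0 \<le> s" and u: "u \<in> {0..s}" "dlevel \<theta> j \<le> y u"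
  shows "coalescence_time {\<alpha>..\<beta>} (\<lambda>\<gamma> t. dyadic_X y w \<theta> \<gamma> t) \<le> ereal s"
\<comment> \<open>Slack is needed because the level may be reached only at time s itself, when scale
  j is not yet in force; it is from any later time on.\<close>
proof (rule ereal_le_epsilon2)
  fix e :: real assume e: "0 < e"
  have eq: "dyadic_X y w \<theta> \<gamma>\<^sub>1 t = dyadic_X y w \<theta> \<gamma>\<^sub>2 t"
    if g: "\<gamma>\<^sub>1 \<in> {\<alpha>..\<beta>}" "\<gamma>\<^sub>2 \<in> {\<alpha>..\<beta>}" and t: "t \<ge> s + e" for \<gamma>\<^sub>1 \<gamma>\<^sub>2 t
  proof -
    have tp: "t > 0" using t e s by linarith
    obtain i where i: "active t i" using active_exists[OF tp] by blast
    have "j \<le> i"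
    proof (rule ccontr)
      assume "\<not> j \<le> i"
      then have "dlevel \<theta> (i + 1) \<le> dlevel \<theta> j" by (intro dlevel_mono) auto
      moreover have "y u < dlevel \<theta> (i + 1)" using i u t e unfolding active_def by auto
      ultimately show False using u by linarith
    qed
    then have "cell w \<theta> i \<alpha> = cell w \<theta> i \<beta>" using cell_eq_upward[of w, OF w c] by blast
    then have "cell w \<theta> i \<gamma>\<^sub>1 = cell w \<theta> i \<gamma>\<^sub>2"
      using cell_mono[of \<alpha> \<gamma>\<^sub>1 w \<theta> i] cell_mono[of \<gamma>\<^sub>1 \<beta> w \<theta> i]
        cell_mono[of \<alpha> \<gamma>\<^sub>2 w \<theta> i] cell_mono[of \<gamma>\<^sub>2 \<beta> w \<theta> i] g by auto
    then show ?thesis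
      unfolding dyadic_X_active[OF tp i] node_def dyadic_G_eq[of w, OF w] by simp
  qed
  have "0 \<le> s + e" using s e by simp
  then have "coalescence_time {\<alpha>..\<beta>} (\<lambda>\<gamma> t. dyadic_X y w \<theta> \<gamma> t) \<le> ereal (s + e)"
    unfolding coalescence_time_def by (intro Inf_lower CollectI exI[of _ "s + e"] conjI ballI allI impI refl) (assumption, rule eq)
  then show "coalescence_time {\<alpha>..\<beta>} (\<lambda>\<gamma> t. dyadic_X y w \<theta> \<gamma> t) \<le> ereal s + ereal e"
    by simp
qed

text \<open>Before the level after \<open>dlevel \<theta> j\<close> is reached, the scale in force
  is at most j, and there the cells still differ. It remains to see that motion inside a scale does
  not make the two processes meet at time s.\<close>

lemma coalescence_time_ge:
  assumes c: "cell w \<theta> j \<alpha> \<noteq> cell w \<theta> j \<beta>" and ab: "\<alpha> \<le> \<beta>" and s: "0 < s" and ys: "0 < y s"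
    and u: "\<And>u. u \<in> {0..s} \<Longrightarrow> y u < dlevel \<theta> (j + 1)"
  shows "ereal s \<le> coalescence_time {\<alpha>..\<beta>} (\<lambda>\<gamma> t. dyadic_X y w \<theta> \<gamma> t)"
proof -
  obtain i where i: "active s i" using active_exists[OF s] by blast
  have ij: "i \<le> j"
  proof (rule ccontr)
    assume "\<not> i \<le> j"
    then have "dlevel \<theta> (j + 1) \<le> dlevel \<theta> i" by (intro dlevel_mono) auto
    moreover obtain v where "v \<in> {0..<s}" "dlevel \<theta> i \<le> y v" using i unfolding active_def by blast
    ultimately show False using u[of v] by auto
  qed
  have "cell w \<theta> k \<alpha> \<noteq> cell w \<theta> k \<beta>" if "k \<le> j" for k
    using cell_eq_upward[of w \<theta> k \<alpha> \<beta> j, OF w _ that] c by blast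
  then have ne: "node w \<theta> k \<alpha> \<noteq> node w \<theta> k \<beta>" if "k \<le> j" for k
    using that unfolding node_def by simp
  let ?R = "dlevel \<theta> i"
  have y2: "y s \<le> dlevel \<theta> (i + 1)"
  proof -
    have "continuous_on {0..s} y" using cont by (rule continuous_on_subset) auto
    then have "continuous_on (closure {0..<s}) y" using s by simp
    moreover have "s \<in> closure {0..<s}" using s by simp
    moreover have "y u \<le> dlevel \<theta> (i + 1)" if "u \<in> {0..<s}" for u
      using i that unfolding active_def by (auto intro: less_imp_le)
    ultimately show ?thesis by (rule continuous_le_on_closure)
  qed
  have "dyadic_X y w \<theta> \<alpha> s \<noteq> dyadic_X y w \<theta> \<beta> s"
  proof (cases "y s = dlevel \<theta> (i + 1)")
    \<comment> \<open>The next level is hit exactly at s, so both processes already sit on nodes of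
      scale i + 1. These differ because i + 1 is still at most j.\<close>
    case True
    then have "dlevel \<theta> (i + 1) < dlevel \<theta> (j + 1)" using u[of s] s by simp
    then have "i + 1 \<le> j" using dlevel_mono[of "j + 1" "i + 1" \<theta>] by linarith
    moreover have "dyadic_X y w \<theta> \<gamma> s = node w \<theta> (i + 1) \<gamma>" for \<gamma>
      unfolding dyadic_X_active[OF s i] True dlevel_Suc
      using dyadic_G_step[of w, OF w, of \<theta> \<gamma> i] by (simp add: algebra_simps)
    ultimately show ?thesis using ne by auto
  next
    case False
    define d where "d = cell w \<theta> i \<beta> - cell w \<theta> i \<alpha>"
    have "d \<noteq> 0" using ne[OF ij] unfolding node_def d_def by auto
    then have d: "d \<ge> 1" using cell_mono[OF ab, of w \<theta> i] unfolding d_def by auto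
    \<comment> \<open>While y lies strictly between 0 and twice the level, each process is closer
      than \<open>?R\<close> to its node, which cannot close a gap of at least twice
      \<open>?R\<close> between distinct nodes.\<close>
    have yR: "\<bar>y s - ?R\<bar> < ?R" using False y2 ys unfolding dlevel_Suc by auto
    have G: "\<bar>dyadic_G w \<theta> \<beta> i - dyadic_G w \<theta> \<alpha> i\<bar> \<le> 2"
      using dyadic_G_abs[of w, OF w, of \<theta> \<beta> i] dyadic_G_abs[of w, OF w, of \<theta> \<alpha> i] by linarith
    have "\<bar>(y s - ?R) * (dyadic_G w \<theta> \<beta> i - dyadic_G w \<theta> \<alpha> i)\<bar> \<le> \<bar>y s - ?R\<bar> * 2"
      unfolding abs_mult using G by (intro mult_left_mono) auto
    also have "\<dots> < 2 * ?R" using yR by simp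
    also have "2 * ?R \<le> 2 * ?R * of_int d" using d by simp
    finally have "2 * ?R * of_int d + (y s - ?R) * (dyadic_G w \<theta> \<beta> i - dyadic_G w \<theta> \<alpha> i) > 0"
      by linarith
    moreover have "dyadic_X y w \<theta> \<beta> s - dyadic_X y w \<theta> \<alpha> s =
      2 * ?R * of_int d + (y s - ?R) * (dyadic_G w \<theta> \<beta> i - dyadic_G w \<theta> \<alpha> i)"
      unfolding dyadic_X_active[OF s i] node_def d_def by (simp add: algebra_simps)
    ultimately show ?thesis by linarith
  qed
  then have "\<not> s' \<le> s"
    if "\<forall>\<gamma>\<^sub>1\<in>{\<alpha>..\<beta>}. \<forall>\<gamma>\<^sub>2\<in>{\<alpha>..\<beta>}. \<forall>t\<ge>s'. dyadic_X y w \<theta> \<gamma>\<^sub>1 t = dyadic_X y w \<theta> \<gamma>\<^sub>2 t" for s'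
    using that ab by force
  then show ?thesis
    unfolding coalescence_time_def by (intro Inf_greatest) force
qed

end

section \<open>Radial law of a Gaussian vector\<close>

lemma nn_integral_shear_fst:
  assumes [measurable]: "case_prod F \<in> borel_measurable (borel \<Otimes>\<^sub>M borel)"
  shows "(\<integral>\<^sup>+x. \<integral>\<^sup>+y. F (x + k * y) y \<partial>lborel \<partial>lborel) = (\<integral>\<^sup>+x. \<integral>\<^sup>+y. F x y \<partial>lborel \<partial>(lborel :: real measure))"
proof -
  have "(\<integral>\<^sup>+x. \<integral>\<^sup>+y. F (x + k * y) y \<partial>lborel \<partial>lborel) = (\<integral>\<^sup>+y. \<integral>\<^sup>+x. F (x + k * y) y \<partial>lborel \<partial>lborel)"
    by (rule lborel_pair.Fubini') measurable
  also have "\<dots> = (\<integral>\<^sup>+y. \<integral>\<^sup>+x. F x y \<partial>lborel \<partial>lborel)"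
  proof (rule nn_integral_cong)
    fix y :: real
    show "(\<integral>\<^sup>+x. F (x + k * y) y \<partial>lborel) = (\<integral>\<^sup>+x. F x y \<partial>lborel)"
      by (subst nn_integral_real_affine[where c = 1 and t = "k * y" and f = "\<lambda>x. F x y"]) (simp_all add: add.commute)
  qed
  also have "\<dots> = (\<integral>\<^sup>+x. \<integral>\<^sup>+y. F x y \<partial>lborel \<partial>lborel)"
    by (rule lborel_pair.Fubini') measurable
  finally show ?thesis .
qed

lemma nn_integral_shear_snd:
  assumes [measurable]: "case_prod F \<in> borel_measurable (borel \<Otimes>\<^sub>M borel)"
  shows "(\<integral>\<^sup>+x. \<integral>\<^sup>+y. F x (y + k * x) \<partial>lborel \<partial>lborel) = (\<integral>\<^sup>+x. \<integral>\<^sup>+y. F x y \<partial>lborel \<partial>(lborel :: real measure))"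
proof (rule nn_integral_cong)
  fix x :: real
  show "(\<integral>\<^sup>+y. F x (y + k * x) \<partial>lborel) = (\<integral>\<^sup>+y. F x y \<partial>lborel)"
    by (subst nn_integral_real_affine[where c = 1 and t = "k * x" and f = "\<lambda>y. F x y"]) (simp_all add: add.commute)
qed

text \<open>A planar rotation is a product of three shears.\<close>

lemma nn_integral_rotation:
  assumes F[measurable]: "case_prod F \<in> borel_measurable (borel \<Otimes>\<^sub>M borel)"
    and cs: "c\<^sup>2 + s\<^sup>2 = 1" "c \<noteq> -1"
  shows "(\<integral>\<^sup>+x. \<integral>\<^sup>+y. F (c * x - s * y) (s * x + c * y) \<partial>lborel \<partial>lborel) =
         (\<integral>\<^sup>+x. \<integral>\<^sup>+y. F x y \<partial>lborel \<partial>(lborel :: real measure))"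
proof -
  \<comment> \<open>Minus the tangent of half the rotation angle; the half turn c = -1 is therefore
    excluded.\<close>
  define k where "k = - s / (1 + c)"
  have c1: "1 + c \<noteq> 0" using cs by auto
  have ks: "k * s = c - 1"
  proof -
    have "- (s * s) = (c - 1) * (1 + c)" using cs by (simp add: power2_eq_square algebra_simps)
    then show ?thesis using c1 by (simp add: k_def field_simps)
  qed
  have kc: "k * (1 + c) = - s" using c1 by (simp add: k_def)
  have "(\<integral>\<^sup>+x. \<integral>\<^sup>+y. F x y \<partial>lborel \<partial>lborel) = (\<integral>\<^sup>+x. \<integral>\<^sup>+y. F (x + k * y) y \<partial>lborel \<partial>lborel)"
    by (rule nn_integral_shear_fst[symmetric]) measurable
  also have "\<dots> = (\<integral>\<^sup>+x. \<integral>\<^sup>+y. F (x + k * (y + s * x)) (y + s * x) \<partial>lborel \<partial>lborel)"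
    by (rule nn_integral_shear_snd[symmetric, where F = "\<lambda>x y. F (x + k * y) y"]) measurable
  also have "\<dots> = (\<integral>\<^sup>+x. \<integral>\<^sup>+y. F ((x + k * y) + k * (y + s * (x + k * y))) (y + s * (x + k * y)) \<partial>lborel \<partial>lborel)"
    by (rule nn_integral_shear_fst[symmetric, where F = "\<lambda>x y. F (x + k * (y + s * x)) (y + s * x)"]) measurable
  also have "\<dots> = (\<integral>\<^sup>+x. \<integral>\<^sup>+y. F (c * x - s * y) (s * x + c * y) \<partial>lborel \<partial>lborel)"
  proof (intro nn_integral_cong arg_cong2[where f = F])
    fix x y :: real
    have "(x + k * y) + k * (y + s * (x + k * y)) = x + k * s * x + (k + k + k * s * k) * y"
      by (simp add: algebra_simps)
    also have "k + k + k * s * k = k * (1 + c)" unfolding ks by (simp add: algebra_simps)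
    finally show "(x + k * y) + k * (y + s * (x + k * y)) = c * x - s * y" unfolding kc ks by (simp add: algebra_simps)
    have "y + s * (x + k * y) = s * x + (1 + k * s) * y" by (simp add: algebra_simps)
    then show "y + s * (x + k * y) = s * x + c * y" unfolding ks by simp
  qed
  finally show ?thesis by simp
qed

lemma normal_density_shift_prod:
  assumes "\<sigma> > 0"
  shows "normal_density a \<sigma> x * normal_density b \<sigma> y =
    exp (- (x\<^sup>2 + y\<^sup>2 + (a\<^sup>2 + b\<^sup>2) - 2 * (a * x + b * y)) / (2 * \<sigma>\<^sup>2)) / (2 * pi * \<sigma>\<^sup>2)"
  using assms
  by (simp add: normal_density_def exp_add[symmetric] add_divide_distrib[symmetric] power2_eq_square field_simps)

text \<open>The joint density depends on the point only through its norm and its inner product with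
  the mean, so a rotation may carry the mean to the first axis.\<close>

lemma nn_integral_normal2_radial:
  assumes [measurable]: "f \<in> borel_measurable borel" and s: "\<sigma> > 0"
  shows "(\<integral>\<^sup>+x. \<integral>\<^sup>+y. f (x\<^sup>2 + y\<^sup>2) * ennreal (normal_density a \<sigma> x) * ennreal (normal_density b \<sigma> y) \<partial>lborel \<partial>lborel) =
    (\<integral>\<^sup>+x. \<integral>\<^sup>+y. f (x\<^sup>2 + y\<^sup>2) * ennreal (normal_density (sqrt (a\<^sup>2 + b\<^sup>2)) \<sigma> x) * ennreal (normal_density 0 \<sigma> y) \<partial>lborel \<partial>lborel)"
proof -
  define r where "r = sqrt (a\<^sup>2 + b\<^sup>2)"
  have r2: "r\<^sup>2 = a\<^sup>2 + b\<^sup>2" by (simp add: r_def)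
  show ?thesis
  \<comment> \<open>With b = 0 and a negative the rotation would be the excluded half turn;
    reflecting x replaces it.\<close>
  proof (cases "b = 0")
    case True
    show ?thesis
    proof (cases "a \<ge> 0")
      case True then show ?thesis using \<open>b = 0\<close> by simp
    next
      case False
      then have "sqrt (a\<^sup>2 + b\<^sup>2) = - a" using \<open>b = 0\<close> by simp
      moreover have "(\<integral>\<^sup>+x. \<integral>\<^sup>+y. f (x\<^sup>2 + y\<^sup>2) * ennreal (normal_density a \<sigma> x) * ennreal (normal_density 0 \<sigma> y) \<partial>lborel \<partial>lborel) =
        (\<integral>\<^sup>+x. \<integral>\<^sup>+y. f (x\<^sup>2 + y\<^sup>2) * ennreal (normal_density a \<sigma> (-x)) * ennreal (normal_density 0 \<sigma> y) \<partial>lborel \<partial>lborel)"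
        by (subst nn_integral_real_affine[where c = "-1" and t = 0]) simp_all
      moreover have "normal_density a \<sigma> (-x) = normal_density (-a) \<sigma> x" for x
        unfolding normal_density_def by (simp add: power2_eq_square algebra_simps)
      ultimately show ?thesis using \<open>b = 0\<close> by simp
    qed
  next
    case False
    then have rp: "r > 0" unfolding r_def by (simp add: sum_power2_gt_zero_iff)
    \<comment> \<open>Cosine and sine of the rotation that takes (r, 0) to (a, b).\<close>
    define c s where "c = a / r" and "s = b / r"
    have c: "c\<^sup>2 + s\<^sup>2 = 1" using rp unfolding c_def s_def by (simp add: power_divide r2[symmetric] add_divide_distrib[symmetric])
    have "s \<noteq> 0" using False rp by (simp add: s_def)
    then have c1: "c \<noteq> -1" using c by auto
    have acbs: "a * c + b * s = r" "b * c - a * s = 0"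
      using rp r2 unfolding c_def s_def by (simp_all add: field_simps power2_eq_square)
    have "(\<integral>\<^sup>+x. \<integral>\<^sup>+y. f (x\<^sup>2 + y\<^sup>2) * ennreal (normal_density a \<sigma> x * normal_density b \<sigma> y) \<partial>lborel \<partial>lborel) =
      (\<integral>\<^sup>+x. \<integral>\<^sup>+y. f ((c * x - s * y)\<^sup>2 + (s * x + c * y)\<^sup>2) *
          ennreal (normal_density a \<sigma> (c * x - s * y) * normal_density b \<sigma> (s * x + c * y)) \<partial>lborel \<partial>lborel)"
      by (rule nn_integral_rotation[symmetric, OF _ c c1]) measurable
    also have "\<dots> = (\<integral>\<^sup>+x. \<integral>\<^sup>+y. f (x\<^sup>2 + y\<^sup>2) * ennreal (normal_density r \<sigma> x * normal_density 0 \<sigma> y) \<partial>lborel \<partial>lborel)"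
    proof (intro nn_integral_cong)
      fix x y :: real
      have "(c * x - s * y)\<^sup>2 + (s * x + c * y)\<^sup>2 = (c\<^sup>2 + s\<^sup>2) * (x\<^sup>2 + y\<^sup>2)"
        by (simp add: power2_eq_square algebra_simps)
      then have e1: "(c * x - s * y)\<^sup>2 + (s * x + c * y)\<^sup>2 = x\<^sup>2 + y\<^sup>2" using c by simp
      have "a * (c * x - s * y) + b * (s * x + c * y) = (a * c + b * s) * x + (b * c - a * s) * y"
        by (simp add: algebra_simps)
      then have e2: "a * (c * x - s * y) + b * (s * x + c * y) = r * x + 0 * y"
        using acbs by simp
      have "normal_density a \<sigma> (c * x - s * y) * normal_density b \<sigma> (s * x + c * y) = normal_density r \<sigma> x * normal_density 0 \<sigma> y"
        unfolding normal_density_shift_prod[OF s] e1 e2 r2 by simp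
      then show "f ((c * x - s * y)\<^sup>2 + (s * x + c * y)\<^sup>2) *
          ennreal (normal_density a \<sigma> (c * x - s * y) * normal_density b \<sigma> (s * x + c * y)) =
          f (x\<^sup>2 + y\<^sup>2) * ennreal (normal_density r \<sigma> x * normal_density 0 \<sigma> y)"
        unfolding e1 by simp
    qed
    finally show ?thesis by (simp add: ennreal_mult' mult.assoc r_def)
  qed
qed

text \<open>Two planar rotations: the last two components of the mean are merged into one, the
  coordinates are permuted cyclically, and that component is merged with the first.\<close>

lemma nn_integral_normal3_radial:
  assumes [measurable]: "f \<in> borel_measurable borel" and s: "\<sigma> > 0"
  defines "n \<equiv> (\<lambda>a x. ennreal (normal_density a \<sigma> x))"
  shows "(\<integral>\<^sup>+x. \<integral>\<^sup>+y. \<integral>\<^sup>+z. f (x\<^sup>2 + y\<^sup>2 + z\<^sup>2) * n a x * n b y * n c z \<partial>lborel \<partial>lborel \<partial>lborel) =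
    (\<integral>\<^sup>+x. \<integral>\<^sup>+y. \<integral>\<^sup>+z. f (x\<^sup>2 + y\<^sup>2 + z\<^sup>2) * n (sqrt (a\<^sup>2 + b\<^sup>2 + c\<^sup>2)) x * n 0 y * n 0 z \<partial>lborel \<partial>lborel \<partial>lborel)"
proof -
  let ?d = "sqrt (b\<^sup>2 + c\<^sup>2)"
  have [measurable]: "n a \<in> borel_measurable borel" for a unfolding n_def by measurable
  have *: "(\<integral>\<^sup>+y. \<integral>\<^sup>+z. f (x\<^sup>2 + y\<^sup>2 + z\<^sup>2) * n a' x * n b y * n c z \<partial>lborel \<partial>lborel) =
      (\<integral>\<^sup>+y. \<integral>\<^sup>+z. f (x\<^sup>2 + y\<^sup>2 + z\<^sup>2) * n a' x * n (sqrt (b\<^sup>2 + c\<^sup>2)) y * n 0 z \<partial>lborel \<partial>lborel)" for x a' b c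
    unfolding n_def
    using nn_integral_normal2_radial[of "\<lambda>v. f (x\<^sup>2 + v) * n a' x" \<sigma> b c] s by (simp add: n_def add.assoc)
  have **: "(\<integral>\<^sup>+x. \<integral>\<^sup>+y. \<integral>\<^sup>+z. f (x\<^sup>2 + y\<^sup>2 + z\<^sup>2) * n a x * n b y * n c z \<partial>lborel \<partial>lborel \<partial>lborel) =
      (\<integral>\<^sup>+z. \<integral>\<^sup>+x. \<integral>\<^sup>+y. f (z\<^sup>2 + x\<^sup>2 + y\<^sup>2) * n c z * n a x * n b y \<partial>lborel \<partial>lborel \<partial>lborel)" for a b c
  proof -
    have "(\<integral>\<^sup>+x. \<integral>\<^sup>+y. \<integral>\<^sup>+z. f (x\<^sup>2 + y\<^sup>2 + z\<^sup>2) * n a x * n b y * n c z \<partial>lborel \<partial>lborel \<partial>lborel)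
       = (\<integral>\<^sup>+x. \<integral>\<^sup>+z. \<integral>\<^sup>+y. f (x\<^sup>2 + y\<^sup>2 + z\<^sup>2) * n a x * n b y * n c z \<partial>lborel \<partial>lborel \<partial>lborel)"
      by (intro nn_integral_cong lborel_pair.Fubini') measurable
    also have "\<dots> = (\<integral>\<^sup>+z. \<integral>\<^sup>+x. \<integral>\<^sup>+y. f (x\<^sup>2 + y\<^sup>2 + z\<^sup>2) * n a x * n b y * n c z \<partial>lborel \<partial>lborel \<partial>lborel)"
      by (rule lborel_pair.Fubini') measurable
    finally show ?thesis by (simp add: mult_ac add_ac)
  qed
  have "(\<integral>\<^sup>+x. \<integral>\<^sup>+y. \<integral>\<^sup>+z. f (x\<^sup>2 + y\<^sup>2 + z\<^sup>2) * n a x * n b y * n c z \<partial>lborel \<partial>lborel \<partial>lborel)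
    = (\<integral>\<^sup>+x. \<integral>\<^sup>+y. \<integral>\<^sup>+z. f (x\<^sup>2 + y\<^sup>2 + z\<^sup>2) * n a x * n ?d y * n 0 z \<partial>lborel \<partial>lborel \<partial>lborel)"
    by (intro nn_integral_cong *)
  also have "\<dots> = (\<integral>\<^sup>+z. \<integral>\<^sup>+x. \<integral>\<^sup>+y. f (z\<^sup>2 + x\<^sup>2 + y\<^sup>2) * n 0 z * n a x * n ?d y \<partial>lborel \<partial>lborel \<partial>lborel)"
    by (rule **)
  also have "\<dots> = (\<integral>\<^sup>+z. \<integral>\<^sup>+x. \<integral>\<^sup>+y. f (z\<^sup>2 + x\<^sup>2 + y\<^sup>2) * n 0 z * n (sqrt (a\<^sup>2 + ?d\<^sup>2)) x * n 0 y \<partial>lborel \<partial>lborel \<partial>lborel)"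
    by (intro nn_integral_cong *)
  also have "\<dots> = (\<integral>\<^sup>+x. \<integral>\<^sup>+y. \<integral>\<^sup>+z. f (x\<^sup>2 + y\<^sup>2 + z\<^sup>2) * n (sqrt (a\<^sup>2 + ?d\<^sup>2)) x * n 0 y * n 0 z \<partial>lborel \<partial>lborel \<partial>lborel)"
    by (rule **[symmetric])
  finally show ?thesis by (simp add: add.assoc)
qed

text \<open>A disc of squared radius a has area pi times a, so the squared norm has constant density
  pi on the positive half line. This is polar integration with the angle integrated out.\<close>

lemma distr_lborel_square_norm:
  "distr lborel borel (\<lambda>p::real \<times> real. (fst p)\<^sup>2 + (snd p)\<^sup>2) = density lborel (\<lambda>w. ennreal pi * indicator {0<..} w)"
    (is "?M = ?N")
proof (rule measure_eqI_generator_eq[where E = "range (\<lambda>a. {..a::real})" and A = "\<lambda>n. {..real n}" and \<Omega> = UNIV])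
  have [measurable]: "(\<lambda>p::real \<times> real. (fst p)\<^sup>2 + (snd p)\<^sup>2) \<in> borel_measurable borel"
    by (intro borel_measurable_continuous_onI continuous_intros)
  have *: "emeasure ?M {..a} = ennreal (pi * max 0 a)" for a
  proof -
    have "emeasure ?M {..a} = emeasure lborel {p::real \<times> real. (fst p)\<^sup>2 + (snd p)\<^sup>2 \<le> a}"
      by (subst emeasure_distr) (auto intro!: arg_cong2[where f=emeasure])
    also have "{p::real \<times> real. (fst p)\<^sup>2 + (snd p)\<^sup>2 \<le> a} = (if a \<ge> 0 then cball 0 (sqrt a) else {})"
    proof -
      have "sqrt (x\<^sup>2 + y\<^sup>2) \<le> sqrt a \<longleftrightarrow> x\<^sup>2 + y\<^sup>2 \<le> a" for x y by simp
      moreover have "\<not> x\<^sup>2 + y\<^sup>2 \<le> a" if "a < 0" for x y using that by (smt (verit) zero_le_power2)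
      ultimately show ?thesis by (auto simp: dist_norm norm_prod_def)
    qed
    also have "emeasure lborel \<dots> = ennreal (pi * max 0 a)"
      by (simp add: emeasure_cball unit_ball_vol_2 max_def)
    finally show ?thesis .
  qed
  have **: "emeasure ?N {..a} = ennreal (pi * max 0 a)" for a
  proof -
    have "emeasure ?N {..a} = ennreal pi * emeasure lborel ({0<..} \<inter> {..a})"
      by (simp add: emeasure_density nn_integral_cmult mult.assoc indicator_inter_arith[symmetric])
    also have "{0<..} \<inter> {..a} = {0<..a}" by auto
    finally show ?thesis by (cases "a \<ge> 0") (auto simp: ennreal_mult' max_def)
  qed
  show "emeasure ?M X = emeasure ?N X" if "X \<in> range (\<lambda>a. {..a})" for X
    using that * ** by auto
  show "emeasure ?M {..real n} \<noteq> \<infinity>" for n unfolding * by simp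
  show "Int_stable (range (\<lambda>a. {..a::real}))"
    by (auto simp: Int_stable_def intro!: image_eqI[of _ _ "min _ _"])
  show "(\<Union>n. {..real n}) = UNIV" by (auto intro: real_arch_simple)
qed (auto simp: borel_eq_atMost)

lemma nn_integral_planar_radial:
  fixes g :: "real \<Rightarrow> ennreal"
  assumes [measurable]: "g \<in> borel_measurable borel"
  shows "(\<integral>\<^sup>+y. \<integral>\<^sup>+z. g (y\<^sup>2 + z\<^sup>2) \<partial>lborel \<partial>lborel) = (\<integral>\<^sup>+w. ennreal pi * indicator {0<..} w * g w \<partial>lborel)"
proof -
  have [measurable]: "(\<lambda>p::real \<times> real. (fst p)\<^sup>2 + (snd p)\<^sup>2) \<in> borel_measurable borel"
    by (intro borel_measurable_continuous_onI continuous_intros)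
  have [measurable]: "(\<lambda>p::real \<times> real. g ((fst p)\<^sup>2 + (snd p)\<^sup>2)) \<in> borel_measurable borel"
    by (rule measurable_compose[OF _ assms]) measurable
  have "(\<integral>\<^sup>+y. \<integral>\<^sup>+z. g (y\<^sup>2 + z\<^sup>2) \<partial>lborel \<partial>lborel) = (\<integral>\<^sup>+p. g ((fst p)\<^sup>2 + (snd p)\<^sup>2) \<partial>(lborel \<Otimes>\<^sub>M lborel))"
    by (subst lborel.nn_integral_fst[symmetric]) (simp_all add: lborel_prod)
  also have "\<dots> = (\<integral>\<^sup>+w. g w \<partial>distr lborel borel (\<lambda>p::real \<times> real. (fst p)\<^sup>2 + (snd p)\<^sup>2))"
    unfolding lborel_prod by (subst nn_integral_distr) simp_all
  also have "\<dots> = (\<integral>\<^sup>+w. ennreal pi * indicator {0<..} w * g w \<partial>lborel)"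
    unfolding distr_lborel_square_norm by (subst nn_integral_density) simp_all
  finally show ?thesis .
qed

text \<open>The substitution is made on the compact ranges from 0 to n^2 and extended to the half
  line by monotone convergence.\<close>

lemma nn_integral_sqrt_substitution:
  assumes [measurable]: "h \<in> borel_measurable borel"
  shows "(\<integral>\<^sup>+v. h (sqrt v) * indicator {0<..} v \<partial>lborel) = (\<integral>\<^sup>+\<rho>. h \<rho> * ennreal (2 * \<rho>) * indicator {0<..} \<rho> \<partial>lborel)"
proof -
  have *: "(\<integral>\<^sup>+v. h (sqrt v) * indicator {0..(real n)\<^sup>2} v \<partial>lborel) = (\<integral>\<^sup>+\<rho>. h \<rho> * ennreal (2 * \<rho>) * indicator {0..real n} \<rho> \<partial>lborel)"
    if "n > 0" for n
  proof -
    have "(\<integral>\<^sup>+v. h (sqrt v) * indicator {0\<^sup>2..(real n)\<^sup>2} v \<partial>lborel) =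
       (\<integral>\<^sup>+\<rho>. h (sqrt (\<rho>\<^sup>2)) * ennreal (2 * \<rho>) * indicator {0..real n} \<rho> \<partial>lborel)"
      using that
      by (intro nn_integral_substitution_aux[where g = "\<lambda>x. x\<^sup>2" and g' = "\<lambda>x. 2 * x"])
         (auto intro!: derivative_eq_intros continuous_intros)
    also have "\<dots> = (\<integral>\<^sup>+\<rho>. h \<rho> * ennreal (2 * \<rho>) * indicator {0..real n} \<rho> \<partial>lborel)"
      by (intro nn_integral_cong) (auto split: split_indicator)
    finally show ?thesis by simp
  qed
  have AE0: "AE x in lborel. x \<noteq> (0::real)" by (rule AE_lborel_singleton)
  have "(\<integral>\<^sup>+v. h (sqrt v) * indicator {0<..} v \<partial>lborel) = (\<integral>\<^sup>+v. (SUP n. h (sqrt v) * indicator {0..(real (Suc n))\<^sup>2} v) \<partial>lborel)"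
  proof (intro nn_integral_cong_AE eventually_mono[OF AE0])
    fix v :: real assume "v \<noteq> 0"
    obtain n where n: "\<bar>v\<bar> \<le> real n" using real_arch_simple by blast
    have "v \<le> (real (Suc n))\<^sup>2" if "v > 0"
    proof -
      have "v \<le> real (Suc n)" using n that by simp
      also have "\<dots> \<le> (real (Suc n))\<^sup>2" unfolding power2_eq_square by simp
      finally show ?thesis .
    qed
    then show "h (sqrt v) * indicator {0<..} v = (SUP n. h (sqrt v) * indicator {0..(real (Suc n))\<^sup>2} v)"
      using \<open>v \<noteq> 0\<close>
      by (intro antisym SUP_upper2[of n] SUP_least) (auto split: split_indicator)
  qed
  also have "\<dots> = (SUP n. \<integral>\<^sup>+v. h (sqrt v) * indicator {0..(real (Suc n))\<^sup>2} v \<partial>lborel)"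
    by (intro nn_integral_monotone_convergence_SUP)
       (auto simp: incseq_def le_fun_def split: split_indicator intro: order_trans power_mono)
  also have "\<dots> = (SUP n. \<integral>\<^sup>+\<rho>. h \<rho> * ennreal (2 * \<rho>) * indicator {0..real (Suc n)} \<rho> \<partial>lborel)"
    by (intro SUP_cong refl *) simp
  also have "\<dots> = (\<integral>\<^sup>+\<rho>. (SUP n. h \<rho> * ennreal (2 * \<rho>) * indicator {0..real (Suc n)} \<rho>) \<partial>lborel)"
    by (intro nn_integral_monotone_convergence_SUP[symmetric])
       (auto simp: incseq_def le_fun_def split: split_indicator)
  also have "\<dots> = (\<integral>\<^sup>+\<rho>. h \<rho> * ennreal (2 * \<rho>) * indicator {0<..} \<rho> \<partial>lborel)"
  proof (intro nn_integral_cong_AE eventually_mono[OF AE0])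
    fix v :: real assume "v \<noteq> 0"
    obtain n where n: "\<bar>v\<bar> \<le> real n" using real_arch_simple by blast
    then show "(SUP n. h v * ennreal (2 * v) * indicator {0..real (Suc n)} v) = h v * ennreal (2 * v) * indicator {0<..} v"
      using \<open>v \<noteq> 0\<close>
      by (intro antisym SUP_upper2[of n] SUP_least) (auto split: split_indicator)
  qed
  finally show ?thesis .
qed

lemma nn_integral_exp_strip:
  assumes "r \<noteq> 0" "\<sigma> > 0" "\<rho> \<ge> 0"
  shows "(\<integral>\<^sup>+x. ennreal (exp (x * r / \<sigma>\<^sup>2)) * indicator {-\<rho>..\<rho>} x \<partial>lborel) =
    ennreal (\<sigma>\<^sup>2 / r * (exp (\<rho> * r / \<sigma>\<^sup>2) - exp (- \<rho> * r / \<sigma>\<^sup>2)))"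
proof -
  let ?F = "\<lambda>x. \<sigma>\<^sup>2 / r * exp (x * r / \<sigma>\<^sup>2)"
  have "(\<integral>\<^sup>+x. ennreal (exp (x * r / \<sigma>\<^sup>2)) * indicator {-\<rho>..\<rho>} x \<partial>lborel) = ennreal (?F \<rho> - ?F (- \<rho>))"
    using assms by (intro nn_integral_FTC_Icc) (auto intro!: derivative_eq_intros)
  then show ?thesis by (simp add: right_diff_distrib)
qed

text \<open>Density of the norm of a Gaussian vector in space with standard deviation
  \<open>\<sigma>\<close> per coordinate and mean at distance r from 0. Up to the factor
  \<open>\<rho>\<close> / r it is the Gaussian kernel on the half line killed at 0; the value for r
  = 0 is the limit, the Maxwell density.\<close>

definition radial_density :: "real \<Rightarrow> real \<Rightarrow> real \<Rightarrow> real" where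
  "radial_density \<sigma> r \<rho> = (if \<rho> \<le> 0 then 0 else
     if r = 0 then 2 * \<rho>\<^sup>2 / \<sigma>\<^sup>2 * normal_density 0 \<sigma> \<rho>
     else \<rho> / r * (normal_density r \<sigma> \<rho> - normal_density (-r) \<sigma> \<rho>))"

lemma radial_density_measurable [measurable]: "radial_density \<sigma> r \<in> borel_measurable borel"
  unfolding radial_density_def by measurable

text \<open>Contribution of the sphere of radius \<open>\<rho>\<close>: the first coordinate ranges
  over the diameter, the plane orthogonal to it contributes the exponential weight, and the last
  factor comes from passing from the squared norm to the norm.\<close>

lemma radial_weight:
  assumes s: "\<sigma> > 0" and "r \<ge> 0" and "\<rho> > 0"
  shows "(\<integral>\<^sup>+x. ennreal (normal_density r \<sigma> x * exp (x\<^sup>2 / (2 * \<sigma>\<^sup>2))) * indicator {-\<rho>..\<rho>} x \<partial>lborel) *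
     ennreal (exp (- \<rho>\<^sup>2 / (2 * \<sigma>\<^sup>2)) / (2 * \<sigma>\<^sup>2)) * ennreal (2 * \<rho>) = ennreal (radial_density \<sigma> r \<rho>)"
proof -
  define C where "C = exp (- r\<^sup>2 / (2 * \<sigma>\<^sup>2)) / sqrt (2 * pi * \<sigma>\<^sup>2)"
  have C: "C \<ge> 0" unfolding C_def by simp
  have e: "normal_density r \<sigma> x * exp (x\<^sup>2 / (2 * \<sigma>\<^sup>2)) = C * exp (x * r / \<sigma>\<^sup>2)" for x
  proof -
    have "exp (- (x - r)\<^sup>2 / (2 * \<sigma>\<^sup>2)) * exp (x\<^sup>2 / (2 * \<sigma>\<^sup>2)) = exp (- r\<^sup>2 / (2 * \<sigma>\<^sup>2)) * exp (x * r / \<sigma>\<^sup>2)"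
      unfolding exp_add[symmetric] using s by (intro arg_cong[where f = exp]) (simp add: field_simps power2_eq_square)
    then show ?thesis unfolding normal_density_def C_def by (simp add: field_simps)
  qed
  have "(\<integral>\<^sup>+x. ennreal (normal_density r \<sigma> x * exp (x\<^sup>2 / (2 * \<sigma>\<^sup>2))) * indicator {-\<rho>..\<rho>} x \<partial>lborel) =
     ennreal C * (\<integral>\<^sup>+x. ennreal (exp (x * r / \<sigma>\<^sup>2)) * indicator {-\<rho>..\<rho>} x \<partial>lborel)"
    unfolding e using C by (subst nn_integral_cmult[symmetric]) (simp_all add: ennreal_mult mult.assoc)
  also have "\<dots> * ennreal (exp (- \<rho>\<^sup>2 / (2 * \<sigma>\<^sup>2)) / (2 * \<sigma>\<^sup>2)) * ennreal (2 * \<rho>) = ennreal (radial_density \<sigma> r \<rho>)"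
  proof (cases "r = 0")
    case True
    have i: "(\<integral>\<^sup>+x. ennreal (exp (x * r / \<sigma>\<^sup>2)) * indicator {-\<rho>..\<rho>} x \<partial>lborel) = ennreal (2 * \<rho>)"
      using True assms by simp
    have "C * (2 * \<rho>) * (exp (- \<rho>\<^sup>2 / (2 * \<sigma>\<^sup>2)) / (2 * \<sigma>\<^sup>2)) * (2 * \<rho>) = radial_density \<sigma> r \<rho>"
      using True assms unfolding radial_density_def normal_density_def C_def
      by (simp add: field_simps power2_eq_square)
    then show ?thesis unfolding i using C assms by (simp add: ennreal_mult[symmetric])
  next
    case False
    then have r: "r > 0" using assms by simp
    let ?E = "\<sigma>\<^sup>2 / r * (exp (\<rho> * r / \<sigma>\<^sup>2) - exp (- \<rho> * r / \<sigma>\<^sup>2))"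
    have i: "(\<integral>\<^sup>+x. ennreal (exp (x * r / \<sigma>\<^sup>2)) * indicator {-\<rho>..\<rho>} x \<partial>lborel) = ennreal ?E"
      using r assms by (intro nn_integral_exp_strip) auto
    have E: "?E \<ge> 0" using r assms by (simp add: divide_right_mono)
    have n: "normal_density (c * r) \<sigma> \<rho> = C * exp (c * \<rho> * r / \<sigma>\<^sup>2) * exp (- \<rho>\<^sup>2 / (2 * \<sigma>\<^sup>2))" if "c = 1 \<or> c = -1" for c
    proof -
      have "exp (- (\<rho> - c * r)\<^sup>2 / (2 * \<sigma>\<^sup>2)) = exp (- r\<^sup>2 / (2 * \<sigma>\<^sup>2)) * exp (c * \<rho> * r / \<sigma>\<^sup>2) * exp (- \<rho>\<^sup>2 / (2 * \<sigma>\<^sup>2))"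
        unfolding exp_add[symmetric] using s that by (intro arg_cong[where f = exp]) (auto simp: field_simps power2_eq_square)
      then show ?thesis unfolding normal_density_def C_def by (simp add: field_simps)
    qed
    have "C * ?E * (exp (- \<rho>\<^sup>2 / (2 * \<sigma>\<^sup>2)) / (2 * \<sigma>\<^sup>2)) * (2 * \<rho>) = radial_density \<sigma> r \<rho>"
      using n[of 1] n[of "-1"] False assms unfolding radial_density_def
      by (simp add: field_simps)
    then show ?thesis unfolding i using C E assms by (simp add: ennreal_mult[symmetric])
  qed
  finally show ?thesis .
qed

text \<open>With the mean on the first axis the other two coordinates are integrated radially. The
  squared norm v then becomes the outer variable, and v is replaced by the square of
  \<open>\<rho>\<close>.\<close>

lemma nn_integral_normal3_norm:
  assumes [measurable]: "h \<in> borel_measurable borel" and s: "\<sigma> > 0"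
  shows "(\<integral>\<^sup>+x. \<integral>\<^sup>+y. \<integral>\<^sup>+z. h (sqrt (x\<^sup>2 + y\<^sup>2 + z\<^sup>2)) * ennreal (normal_density a \<sigma> x) *
      ennreal (normal_density b \<sigma> y) * ennreal (normal_density c \<sigma> z) \<partial>lborel \<partial>lborel \<partial>lborel) =
    (\<integral>\<^sup>+\<rho>. h \<rho> * ennreal (radial_density \<sigma> (sqrt (a\<^sup>2 + b\<^sup>2 + c\<^sup>2)) \<rho>) \<partial>lborel)"
proof -
  define r where "r = sqrt (a\<^sup>2 + b\<^sup>2 + c\<^sup>2)"
  have r: "r \<ge> 0" by (simp add: r_def)
  let ?n = "\<lambda>x. ennreal (normal_density r \<sigma> x)"
  let ?e = "\<lambda>w. ennreal (exp (- w / (2 * \<sigma>\<^sup>2)) / (2 * \<sigma>\<^sup>2))"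
  have s2: "normal_density 0 \<sigma> y * normal_density 0 \<sigma> z = exp (- (y\<^sup>2 + z\<^sup>2) / (2 * \<sigma>\<^sup>2)) / (2 * pi * \<sigma>\<^sup>2)" for y z
    using normal_density_shift_prod[OF s, of 0 y 0 z] by simp
  have pe: "ennreal pi * ennreal (exp (- w / (2 * \<sigma>\<^sup>2)) / (2 * pi * \<sigma>\<^sup>2)) = ?e w" for w
    by (subst ennreal_mult[symmetric]) (auto simp: field_simps)
  have inner: "(\<integral>\<^sup>+y. \<integral>\<^sup>+z. h (sqrt (x\<^sup>2 + y\<^sup>2 + z\<^sup>2)) * ?n x * ennreal (normal_density 0 \<sigma> y) * ennreal (normal_density 0 \<sigma> z) \<partial>lborel \<partial>lborel)
     = (\<integral>\<^sup>+v. h (sqrt v) * (?n x * ?e (v - x\<^sup>2)) * indicator {x\<^sup>2<..} v \<partial>lborel)" for x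
  proof -
    have "(\<integral>\<^sup>+y. \<integral>\<^sup>+z. h (sqrt (x\<^sup>2 + y\<^sup>2 + z\<^sup>2)) * ?n x * ennreal (normal_density 0 \<sigma> y) * ennreal (normal_density 0 \<sigma> z) \<partial>lborel \<partial>lborel)
      = (\<integral>\<^sup>+y. \<integral>\<^sup>+z. h (sqrt (x\<^sup>2 + (y\<^sup>2 + z\<^sup>2))) * ?n x * ennreal (exp (- (y\<^sup>2 + z\<^sup>2) / (2 * \<sigma>\<^sup>2)) / (2 * pi * \<sigma>\<^sup>2)) \<partial>lborel \<partial>lborel)"
      unfolding s2[symmetric] by (simp add: ennreal_mult mult.assoc add.assoc)
    also have "\<dots> = (\<integral>\<^sup>+w. ennreal pi * indicator {0<..} w * (h (sqrt (x\<^sup>2 + w)) * ?n x * ennreal (exp (- w / (2 * \<sigma>\<^sup>2)) / (2 * pi * \<sigma>\<^sup>2))) \<partial>lborel)"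
      by (rule nn_integral_planar_radial[where g = "\<lambda>w. h (sqrt (x\<^sup>2 + w)) * ?n x * ennreal (exp (- w / (2 * \<sigma>\<^sup>2)) / (2 * pi * \<sigma>\<^sup>2))"]) measurable
    also have "\<dots> = (\<integral>\<^sup>+w. h (sqrt (x\<^sup>2 + w)) * (?n x * ?e w) * indicator {0<..} w \<partial>lborel)"
      unfolding pe[symmetric] by (intro nn_integral_cong) (simp add: mult_ac)
    also have "\<dots> = (\<integral>\<^sup>+v. h (sqrt v) * (?n x * ?e (v - x\<^sup>2)) * indicator {x\<^sup>2<..} v \<partial>lborel)"
      by (subst nn_integral_real_affine[where c = 1 and t = "- x\<^sup>2" and f = "\<lambda>w. h (sqrt (x\<^sup>2 + w)) * (?n x * ?e w) * indicator {0<..} w"])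
         (auto intro!: nn_integral_cong split: split_indicator)
    finally show ?thesis .
  qed
  have "(\<integral>\<^sup>+x. \<integral>\<^sup>+y. \<integral>\<^sup>+z. h (sqrt (x\<^sup>2 + y\<^sup>2 + z\<^sup>2)) * ennreal (normal_density a \<sigma> x) *
      ennreal (normal_density b \<sigma> y) * ennreal (normal_density c \<sigma> z) \<partial>lborel \<partial>lborel \<partial>lborel) =
     (\<integral>\<^sup>+x. \<integral>\<^sup>+y. \<integral>\<^sup>+z. h (sqrt (x\<^sup>2 + y\<^sup>2 + z\<^sup>2)) * ?n x * ennreal (normal_density 0 \<sigma> y) * ennreal (normal_density 0 \<sigma> z) \<partial>lborel \<partial>lborel \<partial>lborel)"
    unfolding r_def by (rule nn_integral_normal3_radial[where f = "\<lambda>v. h (sqrt v)", OF _ s]) measurable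
  also have "\<dots> = (\<integral>\<^sup>+x. \<integral>\<^sup>+v. h (sqrt v) * (?n x * ?e (v - x\<^sup>2)) * indicator {x\<^sup>2<..} v \<partial>lborel \<partial>lborel)"
    by (intro nn_integral_cong inner)
  \<comment> \<open>Exchanging the order makes the squared norm v the outer variable; for fixed v
    the first coordinate ranges between the two square roots of v.\<close>
  also have "\<dots> = (\<integral>\<^sup>+v. \<integral>\<^sup>+x. h (sqrt v) * (?n x * ?e (v - x\<^sup>2)) * indicator {x\<^sup>2<..} v \<partial>lborel \<partial>lborel)"
  proof (rule lborel_pair.Fubini')
    have ind: "indicator {x\<^sup>2<..} v = (if x\<^sup>2 < v then 1 else 0 :: ennreal)" for x v :: real
      by simp
    show "(\<lambda>(v, x). h (sqrt v) * (?n x * ?e (v - x\<^sup>2)) * indicator {x\<^sup>2<..} v) \<in> borel_measurable (lborel \<Otimes>\<^sub>M lborel)"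
      unfolding case_prod_beta' ind by measurable
  qed
  also have "\<dots> = (\<integral>\<^sup>+v. (h (sqrt v) * ((\<integral>\<^sup>+x. ennreal (normal_density r \<sigma> x * exp (x\<^sup>2 / (2 * \<sigma>\<^sup>2))) * indicator {-sqrt v..sqrt v} x \<partial>lborel) *
     ennreal (exp (- (sqrt v)\<^sup>2 / (2 * \<sigma>\<^sup>2)) / (2 * \<sigma>\<^sup>2)))) * indicator {0<..} v \<partial>lborel)"
  proof (rule nn_integral_cong)
    fix v :: real
    show "(\<integral>\<^sup>+x. h (sqrt v) * (?n x * ?e (v - x\<^sup>2)) * indicator {x\<^sup>2<..} v \<partial>lborel) =
      (h (sqrt v) * ((\<integral>\<^sup>+x. ennreal (normal_density r \<sigma> x * exp (x\<^sup>2 / (2 * \<sigma>\<^sup>2))) * indicator {-sqrt v..sqrt v} x \<partial>lborel) *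
     ennreal (exp (- (sqrt v)\<^sup>2 / (2 * \<sigma>\<^sup>2)) / (2 * \<sigma>\<^sup>2)))) * indicator {0<..} v"
    proof (cases "v > 0")
      case False
      then have "(\<integral>\<^sup>+x. h (sqrt v) * (?n x * ?e (v - x\<^sup>2)) * indicator {x\<^sup>2<..} v \<partial>lborel) = (\<integral>\<^sup>+x. 0 \<partial>(lborel :: real measure))"
        by (intro nn_integral_cong) (auto split: split_indicator, smt (verit) zero_le_power2)
      then show ?thesis using False by simp
    next
      case True
      have "(\<integral>\<^sup>+x. h (sqrt v) * (?n x * ?e (v - x\<^sup>2)) * indicator {x\<^sup>2<..} v \<partial>lborel) =
        (\<integral>\<^sup>+x. h (sqrt v) * (ennreal (normal_density r \<sigma> x * exp (x\<^sup>2 / (2 * \<sigma>\<^sup>2))) * indicator {-sqrt v..sqrt v} x * ?e v) \<partial>lborel)"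
      \<comment> \<open>The open condition on the square and the closed interval differ only at the
        two points left out here.\<close>
      proof (intro nn_integral_cong_AE eventually_mono[OF eventually_conj[OF AE_lborel_singleton AE_lborel_singleton]])
        fix x assume x: "x \<noteq> sqrt v \<and> x \<noteq> - sqrt v"
        have iff: "x\<^sup>2 < v \<longleftrightarrow> x \<in> {-sqrt v..sqrt v}"
          using True x real_sqrt_less_iff[of "x\<^sup>2" v] by auto
        have "normal_density r \<sigma> x * (exp (- (v - x\<^sup>2) / (2 * \<sigma>\<^sup>2)) / (2 * \<sigma>\<^sup>2)) =
          normal_density r \<sigma> x * exp (x\<^sup>2 / (2 * \<sigma>\<^sup>2)) * (exp (- v / (2 * \<sigma>\<^sup>2)) / (2 * \<sigma>\<^sup>2))"
          by (simp add: exp_add[symmetric] diff_divide_distrib exp_diff exp_minus field_simps)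
        then have "?n x * ?e (v - x\<^sup>2) = ennreal (normal_density r \<sigma> x * exp (x\<^sup>2 / (2 * \<sigma>\<^sup>2))) * ?e v"
          by (simp add: ennreal_mult[symmetric])
        then show "h (sqrt v) * (?n x * ?e (v - x\<^sup>2)) * indicator {x\<^sup>2<..} v =
          h (sqrt v) * (ennreal (normal_density r \<sigma> x * exp (x\<^sup>2 / (2 * \<sigma>\<^sup>2))) * indicator {-sqrt v..sqrt v} x * ?e v)"
          using iff by (auto simp: indicator_def)
      qed
      also have "\<dots> = h (sqrt v) * ((\<integral>\<^sup>+x. ennreal (normal_density r \<sigma> x * exp (x\<^sup>2 / (2 * \<sigma>\<^sup>2))) * indicator {-sqrt v..sqrt v} x \<partial>lborel) * ?e v)"
        by (subst nn_integral_cmult) (auto simp: nn_integral_multc)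
      finally show ?thesis using True by simp
    qed
  qed
  also have "\<dots> = (\<integral>\<^sup>+\<rho>. (h \<rho> * ((\<integral>\<^sup>+x. ennreal (normal_density r \<sigma> x * exp (x\<^sup>2 / (2 * \<sigma>\<^sup>2))) * indicator {-\<rho>..\<rho>} x \<partial>lborel) *
     ennreal (exp (- \<rho>\<^sup>2 / (2 * \<sigma>\<^sup>2)) / (2 * \<sigma>\<^sup>2)))) * ennreal (2 * \<rho>) * indicator {0<..} \<rho> \<partial>lborel)"
  proof (rule nn_integral_sqrt_substitution)
    have ind: "indicator {-\<rho>..\<rho>} x = (if - \<rho> \<le> x \<and> x \<le> \<rho> then 1 else 0 :: ennreal)" for x \<rho> :: real
      by simp
    have [measurable]: "(\<lambda>\<rho>. \<integral>\<^sup>+x. ennreal (normal_density r \<sigma> x * exp (x\<^sup>2 / (2 * \<sigma>\<^sup>2))) * indicator {-\<rho>..\<rho>} x \<partial>lborel) \<in> borel_measurable borel"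
      by (intro lborel.borel_measurable_nn_integral) (unfold case_prod_beta' ind, measurable)
    show "(\<lambda>\<rho>. h \<rho> * ((\<integral>\<^sup>+x. ennreal (normal_density r \<sigma> x * exp (x\<^sup>2 / (2 * \<sigma>\<^sup>2))) * indicator {-\<rho>..\<rho>} x \<partial>lborel) *
     ennreal (exp (- \<rho>\<^sup>2 / (2 * \<sigma>\<^sup>2)) / (2 * \<sigma>\<^sup>2)))) \<in> borel_measurable borel"
      by measurable
  qed
  also have "\<dots> = (\<integral>\<^sup>+\<rho>. h \<rho> * ennreal (radial_density \<sigma> r \<rho>) \<partial>lborel)"
  proof (rule nn_integral_cong)
    fix \<rho> :: real
    show "(h \<rho> * ((\<integral>\<^sup>+x. ennreal (normal_density r \<sigma> x * exp (x\<^sup>2 / (2 * \<sigma>\<^sup>2))) * indicator {-\<rho>..\<rho>} x \<partial>lborel) *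
     ennreal (exp (- \<rho>\<^sup>2 / (2 * \<sigma>\<^sup>2)) / (2 * \<sigma>\<^sup>2)))) * ennreal (2 * \<rho>) * indicator {0<..} \<rho> = h \<rho> * ennreal (radial_density \<sigma> r \<rho>)"
      using radial_weight[OF s r, of \<rho>]
      by (cases "\<rho> > 0") (simp_all add: mult.assoc, simp add: radial_density_def)
  qed
  finally show ?thesis unfolding r_def .
qed

section \<open>Exit probabilities of processes with independent increments\<close>

text \<open>Freezing: the joint law is a product, so by Fubini one variable may be held fixed while
  the other is averaged over an independent copy.\<close>

lemma (in prob_space) integral_indep_var_pair:
  fixes g :: "'b \<Rightarrow> 'b \<Rightarrow> real"
  assumes ind: "indep_var S X T Y"
    and g[measurable]: "case_prod g \<in> borel_measurable (S \<Otimes>\<^sub>M T)" and bnd: "\<And>x y. \<bar>g x y\<bar> \<le> c"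
  shows "(\<integral>\<omega>. g (X \<omega>) (Y \<omega>) \<partial>M) = (\<integral>\<omega>. (\<integral>\<omega>'. g (X \<omega>) (Y \<omega>') \<partial>M) \<partial>M)"
proof -
  have X[measurable]: "random_variable S X" and Y[measurable]: "random_variable T Y"
    and d: "distr M S X \<Otimes>\<^sub>M distr M T Y = distr M (S \<Otimes>\<^sub>M T) (\<lambda>x. (X x, Y x))"
    using ind unfolding indep_var_distribution_eq by auto
  interpret X: prob_space "distr M S X" by (rule prob_space_distr) fact
  interpret Y: prob_space "distr M T Y" by (rule prob_space_distr) fact
  interpret XY: pair_prob_space "distr M S X" "distr M T Y" ..
  have int: "integrable (distr M S X \<Otimes>\<^sub>M distr M T Y) (case_prod g)"
    by (rule XY.integrable_const_bound[where B = c]) (use bnd in \<open>auto simp: case_prod_beta'\<close>)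
  have "(\<integral>\<omega>. g (X \<omega>) (Y \<omega>) \<partial>M) = (\<integral>p. case_prod g p \<partial>distr M (S \<Otimes>\<^sub>M T) (\<lambda>x. (X x, Y x)))"
    by (subst integral_distr) auto
  also have "\<dots> = (\<integral>x. (\<integral>y. g x y \<partial>distr M T Y) \<partial>distr M S X)"
    unfolding d[symmetric] using XY.integral_fst[OF int] by simp
  also have "\<dots> = (\<integral>\<omega>. (\<integral>y. g (X \<omega>) y \<partial>distr M T Y) \<partial>M)"
    by (subst integral_distr) auto
  also have "\<dots> = (\<integral>\<omega>. (\<integral>\<omega>'. g (X \<omega>) (Y \<omega>') \<partial>M) \<partial>M)"
  proof (intro Bochner_Integration.integral_cong refl)
    fix \<omega> assume "\<omega> \<in> space M"
    then have "X \<omega> \<in> space S" using measurable_space[OF X] by simp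
    then have "(\<lambda>y. case_prod g (X \<omega>, y)) \<in> borel_measurable T"
      by (rule measurable_compose[OF measurable_Pair1' g])
    then show "(\<integral>y. g (X \<omega>) y \<partial>distr M T Y) = (\<integral>\<omega>'. g (X \<omega>) (Y \<omega>') \<partial>M)"
      by (intro integral_distr[OF Y]) simp
  qed
  finally show ?thesis .
qed

text \<open>Common ground of Brownian motion on the line and in space. The law of the increments is
  left open and enters only through the hypothesis \<open>law\<close> of the exit estimate.\<close>

locale independent_increments = prob_space M for M :: "'a measure" +
  fixes B :: "real \<Rightarrow> 'a \<Rightarrow> 'e::euclidean_space" and x0 :: 'e
  assumes B_measurable: "\<And>t. 0 \<le> t \<Longrightarrow> B t \<in> borel_measurable M"
    and start: "AE \<omega> in M. B 0 \<omega> = x0"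
    and indep: "\<And>n (\<tau>::nat \<Rightarrow> real). (\<And>k. k < n \<Longrightarrow> 0 \<le> \<tau> k \<and> \<tau> k \<le> \<tau> (Suc k)) \<Longrightarrow>
        indep_vars (\<lambda>_. borel) (\<lambda>k \<omega>. B (\<tau> (Suc k)) \<omega> - B (\<tau> k) \<omega>) {..<n}"
    and path_continuous: "AE \<omega> in M. continuous_on {0..} (\<lambda>t. B t \<omega>)"
begin

text \<open>Markov property on a grid: the constraints up to step k depend only on the first k
  increments, which are independent of the increments that lead from step k to step n.\<close>

lemma markov_step:
  fixes Q :: "nat \<Rightarrow> 'e \<Rightarrow> bool" and \<psi> :: "'e \<Rightarrow> real"
  assumes h: "h \<ge> 0" and k: "k \<le> n"
    and Q[measurable]: "\<And>j. Measurable.pred borel (Q j)"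
    and psi[measurable]: "\<psi> \<in> borel_measurable borel" and bnd: "\<And>x. \<bar>\<psi> x\<bar> \<le> 1"
  shows "(\<integral>\<omega>. indicator {\<omega>. \<forall>j\<le>k. Q j (B (real j * h) \<omega>)} \<omega> * \<psi> (B (real n * h) \<omega>) \<partial>M) =
     (\<integral>\<omega>. indicator {\<omega>. \<forall>j\<le>k. Q j (B (real j * h) \<omega>)} \<omega> *
        (\<integral>\<omega>'. \<psi> (B (real k * h) \<omega> + (B (real n * h) \<omega>' - B (real k * h) \<omega>')) \<partial>M) \<partial>M)"
proof -
  define D where "D i \<omega> = B (real (Suc i) * h) \<omega> - B (real i * h) \<omega>" for i \<omega>
  define X where "X \<omega> = (\<lambda>i\<in>{..<k}. D i \<omega>)" for \<omega>
  define Z where "Z \<omega> = (\<lambda>i\<in>{k..<n}. D i \<omega>)" for \<omega>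
  have [measurable]: "B (real j * h) \<in> borel_measurable M" for j
    using h by (intro B_measurable) simp
  have iv: "indep_vars (\<lambda>_. borel) D {..<n}"
    unfolding D_def using h by (intro indep[of n "\<lambda>i. real i * h"]) (auto intro: mult_right_mono)
  have XZ: "indep_var (PiM {..<k} (\<lambda>_. borel)) X (PiM {k..<n} (\<lambda>_. borel)) Z"
    unfolding X_def Z_def using k by (intro indep_var_restrict[OF iv]) auto
  \<comment> \<open>Rebuilds the position at step j from the starting point and the increments; the
    minimum keeps the indices among the first k increments for every j.\<close>
  define pos where "pos j f = x0 + (\<Sum>i<min j k. f i)" for j and f :: "nat \<Rightarrow> 'e"
  have posX: "pos j (X \<omega>) = B (real j * h) \<omega>" if "j \<le> k" "B 0 \<omega> = x0" for j \<omega>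
  proof -
    have "(\<Sum>i<j. X \<omega> i) = (\<Sum>i<j. D i \<omega>)"
      using that by (intro sum.cong) (auto simp: X_def)
    also have "\<dots> = B (real j * h) \<omega> - B (real 0 * h) \<omega>"
      unfolding D_def by (rule sum_lessThan_telescope)
    finally show ?thesis using that by (simp add: pos_def min_absorb1)
  qed
  have sumZ: "(\<Sum>i\<in>{k..<n}. Z \<omega> i) = B (real n * h) \<omega> - B (real k * h) \<omega>" for \<omega>
  proof -
    have "(\<Sum>i\<in>{k..<n}. Z \<omega> i) = (\<Sum>i\<in>{k..<n}. D i \<omega>)"
      by (intro sum.cong) (auto simp: Z_def)
    then show ?thesis unfolding D_def by (simp only: sum_Suc_diff'[OF k, of "\<lambda>i. B (real i * h) \<omega>"])
  qed
  define g :: "(nat \<Rightarrow> 'e) \<Rightarrow> (nat \<Rightarrow> 'e) \<Rightarrow> real" where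
    "g f f' = (if \<forall>j\<in>{..k}. Q j (pos j f) then 1 else 0) * \<psi> (pos k f + (\<Sum>i\<in>{k..<n}. f' i))" for f f'
  have [measurable]: "pos j \<in> borel_measurable (PiM {..<k} (\<lambda>_. borel))" for j
  proof -
    have "(\<lambda>f. \<Sum>i<min j k. f i) \<in> borel_measurable (PiM {..<k} (\<lambda>_. borel :: 'e measure))"
      by (intro borel_measurable_sum measurable_component_singleton) auto
    then show ?thesis unfolding pos_def by measurable
  qed
  have [measurable]: "Measurable.pred (PiM {..<k} (\<lambda>_. borel)) (\<lambda>f. Q j (pos j f))" for j
    by measurable
  have [measurable]: "Measurable.pred (PiM {..<k} (\<lambda>_. borel)) (\<lambda>f. \<forall>j\<in>{..k}. Q j (pos j f))"
    by (intro pred_intros_finite) simp_all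
  have g: "case_prod g \<in> borel_measurable (PiM {..<k} (\<lambda>_. borel) \<Otimes>\<^sub>M PiM {k..<n} (\<lambda>_. borel))"
    unfolding g_def by measurable
  have gb: "\<bar>g f f'\<bar> \<le> 1" for f f' using bnd unfolding g_def by simp
  have "(\<integral>\<omega>. indicator {\<omega>. \<forall>j\<le>k. Q j (B (real j * h) \<omega>)} \<omega> * \<psi> (B (real n * h) \<omega>) \<partial>M) = (\<integral>\<omega>. g (X \<omega>) (Z \<omega>) \<partial>M)"
  proof (rule integral_cong_AE)
    have "(\<lambda>\<omega>. case_prod g (X \<omega>, Z \<omega>)) \<in> borel_measurable M"
      using g XZ by (intro measurable_compose[OF _ g] measurable_Pair) (auto simp: indep_var_eq)
    then show "(\<lambda>\<omega>. g (X \<omega>) (Z \<omega>)) \<in> borel_measurable M" by simp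
    show "AE \<omega> in M. indicator {\<omega>. \<forall>j\<le>k. Q j (B (real j * h) \<omega>)} \<omega> * \<psi> (B (real n * h) \<omega>) = g (X \<omega>) (Z \<omega>)"
      using start by eventually_elim (auto simp: g_def posX sumZ split: split_indicator)
  qed measurable
  also have "\<dots> = (\<integral>\<omega>. (\<integral>\<omega>'. g (X \<omega>) (Z \<omega>') \<partial>M) \<partial>M)"
    by (rule integral_indep_var_pair[OF XZ g gb])
  also have "\<dots> = (\<integral>\<omega>. indicator {\<omega>. \<forall>j\<le>k. Q j (B (real j * h) \<omega>)} \<omega> *
        (\<integral>\<omega>'. \<psi> (B (real k * h) \<omega> + (B (real n * h) \<omega>' - B (real k * h) \<omega>')) \<partial>M) \<partial>M)"
  proof (rule integral_cong_AE)
    have "(\<lambda>(\<omega>,\<omega>'). case_prod g (X \<omega>, Z \<omega>')) \<in> borel_measurable (M \<Otimes>\<^sub>M M)"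
      unfolding case_prod_beta'[of "\<lambda>\<omega> \<omega>'. case_prod g (X \<omega>, Z \<omega>')"]
      using g XZ by (intro measurable_compose[OF _ g] measurable_Pair) (auto simp: indep_var_eq)
    then have [measurable]: "(\<lambda>(\<omega>,\<omega>'). g (X \<omega>) (Z \<omega>')) \<in> borel_measurable (M \<Otimes>\<^sub>M M)" by simp
    show "(\<lambda>\<omega>. \<integral>\<omega>'. g (X \<omega>) (Z \<omega>') \<partial>M) \<in> borel_measurable M" by measurable
    show "AE \<omega> in M. (\<integral>\<omega>'. g (X \<omega>) (Z \<omega>') \<partial>M) = indicator {\<omega>. \<forall>j\<le>k. Q j (B (real j * h) \<omega>)} \<omega> *
        (\<integral>\<omega>'. \<psi> (B (real k * h) \<omega> + (B (real n * h) \<omega>' - B (real k * h) \<omega>')) \<partial>M)"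
      using start by eventually_elim (auto simp: g_def posX sumZ split: split_indicator)
  qed measurable
  finally show ?thesis .
qed

lemma first_failure_partition:
  "(if \<forall>k\<le>N. P k then 1 else 0) + (\<Sum>k\<le>N. if (\<forall>j<k. P j) \<and> \<not> P k then 1 else 0) = (1::real)" for P :: "nat \<Rightarrow> bool"
proof (induction N)
  case (Suc N)
  have "(\<forall>k\<le>Suc N. P k) \<longleftrightarrow> (\<forall>k\<le>N. P k) \<and> P (Suc N)" "(\<forall>j<Suc N. P j) \<longleftrightarrow> (\<forall>k\<le>N. P k)"
    by (auto simp: le_Suc_eq less_Suc_eq_le)
  then show ?case using Suc by (auto split: if_splits)
qed auto

text \<open>The limit is the infimum of the times with f > R, not the first visit to R: f may touch
  R earlier without crossing it. By continuity f equals R at this infimum, and arbitrarily soon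
  afterwards there are short intervals with f > R, which every sufficiently fine grid meets.\<close>

lemma first_grid_exit_tendsto:
  fixes f :: "real \<Rightarrow> real"
  assumes f: "continuous_on {0..} f" and f0: "f 0 \<le> R" and s: "s > 0" and u: "0 \<le> u" "u \<le> s" "f u > R"
  shows "\<exists>\<tau>\<in>{0..<s}. \<exists>k n0. f \<tau> = R \<and> (\<lambda>n. real (k n) * (s / 2 ^ n)) \<longlonglongrightarrow> \<tau> \<and>
    (\<forall>n\<ge>n0. k n < 2 ^ n \<and> (\<forall>j<k n. f (real j * (s / 2 ^ n)) \<le> R) \<and> f (real (k n) * (s / 2 ^ n)) > R)"
proof -
  define O' where "O' = {x\<in>{0..s}. f x > R}"
  have "O' \<noteq> {}" and bdd: "bdd_below O'" using u unfolding O'_def by (auto intro: bdd_belowI[of _ 0])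
  define \<tau> where "\<tau> = Inf O'"
  have tau0: "0 \<le> \<tau>" unfolding \<tau>_def using \<open>O' \<noteq> {}\<close> by (intro cInf_greatest) (auto simp: O'_def)
  have nbhd: "\<exists>d>0. \<forall>y\<ge>0. \<bar>y - x\<bar> < d \<longrightarrow> f y > R" if x: "x \<ge> 0" "f x > R" for x
  proof -
    have "continuous (at x within {0..}) f" using f x by (auto simp: continuous_on_eq_continuous_within)
    then obtain d where "d > 0" "\<And>y. y \<in> {0..} \<Longrightarrow> dist y x < d \<Longrightarrow> dist (f y) (f x) < f x - R"
      using x unfolding continuous_within_eps_delta by (elim allE[of _ "f x - R"]) auto
    then show ?thesis by (intro exI[of _ d]) (force simp: dist_real_def abs_less_iff)
  qed
  \<comment> \<open>Continuity makes the set of exceedance times open to the left, hence without a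
    least element; its infimum therefore lies outside it.\<close>
  have left: "\<exists>y\<in>O'. y < x" if "x \<in> O'" for x
  proof -
    have x: "x \<ge> 0" "x \<le> s" "f x > R" using that by (auto simp: O'_def)
    then obtain d where d: "d > 0" "\<And>y. y \<ge> 0 \<Longrightarrow> \<bar>y - x\<bar> < d \<Longrightarrow> f y > R" using nbhd by blast
    have "x > 0" using x f0 by (cases "x = 0") auto
    then have "max (x / 2) (x - d / 2) \<in> O'" using x d by (auto simp: O'_def max_def field_simps)
    moreover have "max (x / 2) (x - d / 2) < x" using \<open>x > 0\<close> d by auto
    ultimately show ?thesis by blast
  qed
  have tau_notin: "\<tau> \<notin> O'" using left cInf_lower[OF _ bdd] unfolding \<tau>_def by force
  have tau_s: "\<tau> < s"
  proof -
    obtain y where "y \<in> O'" "y < u" using left[of u] u by (auto simp: O'_def)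
    then show ?thesis using cInf_lower[OF _ bdd, of y] u unfolding \<tau>_def by linarith
  qed
  have le_R: "f \<tau> \<le> R" using tau_notin tau0 tau_s by (auto simp: O'_def)
  have near: "\<exists>x\<in>O'. \<tau> < x \<and> x < \<tau> + e" if e: "e > 0" for e
  proof -
    obtain x where "x \<in> O'" "x < \<tau> + e"
      using cInf_lessD[OF \<open>O' \<noteq> {}\<close>, of "\<tau> + e"] e unfolding \<tau>_def by auto
    moreover have "\<tau> \<le> x" using cInf_lower[OF \<open>x \<in> O'\<close> bdd] by (simp add: \<tau>_def)
    ultimately show ?thesis using tau_notin by (metis less_eq_real_def)
  qed
  have ge_R: "f \<tau> \<ge> R"
  proof (rule ccontr)
    assume "\<not> R \<le> f \<tau>"
    then have lt: "f \<tau> < R" by simp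
    have "continuous (at \<tau> within {0..}) f" using f tau0 by (auto simp: continuous_on_eq_continuous_within)
    then obtain d where d: "d > 0" "\<And>y. y \<in> {0..} \<Longrightarrow> dist y \<tau> < d \<Longrightarrow> dist (f y) (f \<tau>) < R - f \<tau>"
      using lt unfolding continuous_within_eps_delta by (elim allE[of _ "R - f \<tau>"]) auto
    obtain x where "x \<in> O'" "\<tau> < x" "x < \<tau> + d" using near[OF d(1)] by blast
    then show False using d(2)[of x] by (auto simp: O'_def dist_real_def)
  qed
  define g where "g n j = real j * (s / 2 ^ n)" for n j :: nat
  define k where "k n = (LEAST j. f (g n j) > R)" for n
  \<comment> \<open>An interval of exceedance close behind the infimum contains a grid point as soon
    as its size is larger than the mesh.\<close>
  have hit: "\<exists>n0. \<forall>n\<ge>n0. \<exists>j. f (g n j) > R \<and> g n j < \<tau> + e \<and> g n j < s" if "e > 0" for e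
  proof -
    have "min e (s - \<tau>) > 0" using that tau_s by simp
    then obtain x where x: "x \<in> O'" "\<tau> < x" "x < \<tau> + min e (s - \<tau>)" using near by blast
    then have "x \<ge> 0" "f x > R" by (auto simp: O'_def)
    then obtain d where d: "d > 0" "\<And>y. y \<ge> 0 \<Longrightarrow> \<bar>y - x\<bar> < d \<Longrightarrow> f y > R" using nbhd by blast
    have "(\<lambda>n. s * (1/2) ^ n) \<longlonglongrightarrow> 0" by (intro tendsto_mult_right_zero LIMSEQ_realpow_zero) auto
    then have "\<forall>\<^sub>F n in sequentially. s * (1/2) ^ n < d" using d(1) by (rule order_tendstoD)
    then obtain n0 where n0: "\<And>n. n \<ge> n0 \<Longrightarrow> s / 2 ^ n < d"
      unfolding eventually_sequentially by (auto simp: power_one_over)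
    have "\<exists>j. f (g n j) > R \<and> g n j < \<tau> + e \<and> g n j < s" if n: "n \<ge> n0" for n
    proof -
      define j where "j = nat \<lfloor>x / (s / 2 ^ n)\<rfloor>"
      have h: "s / 2 ^ n > 0" using s by simp
      have "0 \<le> x / (s / 2 ^ n)" using \<open>x \<ge> 0\<close> h by (rule divide_nonneg_pos)
      then have "real j \<le> x / (s / 2 ^ n)" "x / (s / 2 ^ n) < real j + 1" unfolding j_def by linarith+
      then have "g n j \<le> x" "x < g n j + s / 2 ^ n"
        using h unfolding g_def by (simp_all add: field_simps)
      moreover have "0 \<le> g n j" using s by (simp add: g_def)
      ultimately show ?thesis using d(2)[of "g n j"] n0[OF n] x by (intro exI[of _ j]) auto
    qed
    then show ?thesis by blast
  qed
  have kprop: "f (g n (k n)) > R \<and> (\<forall>j<k n. f (g n j) \<le> R) \<and> g n (k n) \<le> g n j" if "f (g n j) > R" for n j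
  proof -
    have "f (g n (k n)) > R" unfolding k_def by (rule LeastI) (rule that)
    moreover have "f (g n j) \<le> R" if "j < k n" for j using that not_less_Least unfolding k_def by force
    moreover have "k n \<le> j" unfolding k_def by (rule Least_le) (rule that)
    then have "g n (k n) \<le> g n j" using s unfolding g_def by (intro mult_right_mono) auto
    ultimately show ?thesis by blast
  qed
  obtain n0 where n0: "\<And>n. n \<ge> n0 \<Longrightarrow> \<exists>j. f (g n j) > R \<and> g n j < \<tau> + 1 \<and> g n j < s"
    using hit[of 1] by auto
  have lim: "(\<lambda>n. g n (k n)) \<longlonglongrightarrow> \<tau>"
  proof (rule LIMSEQ_I)
    fix e :: real assume "e > 0"
    then obtain n1 where n1: "\<And>n. n \<ge> n1 \<Longrightarrow> \<exists>j. f (g n j) > R \<and> g n j < \<tau> + e \<and> g n j < s"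
      using hit by blast
    have "norm (g n (k n) - \<tau>) < e" if n: "n \<ge> n1" for n
    proof -
      obtain j where j: "f (g n j) > R" "g n j < \<tau> + e" "g n j < s" using n1[OF n] by blast
      have kp: "f (g n (k n)) > R" "g n (k n) \<le> g n j" using kprop[OF j(1)] by auto
      moreover have "0 \<le> g n (k n)" using s by (simp add: g_def)
      ultimately have "g n (k n) \<in> O'" using j by (auto simp: O'_def)
      then have "\<tau> \<le> g n (k n)" unfolding \<tau>_def by (rule cInf_lower[OF _ bdd])
      then show ?thesis using kp j by simp
    qed
    then show "\<exists>no. \<forall>n\<ge>no. norm (g n (k n) - \<tau>) < e" by blast
  qed
  have "k n < 2 ^ n \<and> (\<forall>j<k n. f (g n j) \<le> R) \<and> f (g n (k n)) > R" if n: "n \<ge> n0" for n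
  proof -
    obtain j where j: "f (g n j) > R" "g n j < s" using n0[OF n] by blast
    have kp: "f (g n (k n)) > R \<and> (\<forall>j<k n. f (g n j) \<le> R) \<and> g n (k n) \<le> g n j" by (rule kprop) fact
    then have "g n (k n) < s" using j by linarith
    then have "real (k n) < 2 ^ n" using s unfolding g_def by (simp add: field_simps)
    then have "k n < 2 ^ n" by (metis of_nat_less_iff of_nat_numeral of_nat_power)
    then show ?thesis using kp by blast
  qed
  then show ?thesis
    using lim tau0 tau_s le_R ge_R unfolding g_def by (intro bexI[of _ \<tau>] exI[of _ k] exI[of _ n0]) auto
qed

text \<open>If \<open>v t x\<close>, the mean of \<open>\<psi>\<close> at time \<open>t\<close> after a start in \<open>x\<close>, vanishes
  on the boundary \<open>\<rho> = R\<close>, then stopping at the first exit from \<open>\<rho> \<le> R\<close> leaves only the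
  contribution of the paths that do not exit.\<close>

lemma grid_exit_probability:
  fixes \<rho> \<psi> :: "'e \<Rightarrow> real" and v :: "real \<Rightarrow> 'e \<Rightarrow> real"
  assumes s: "s > 0" and rho: "continuous_on UNIV \<rho>" and x0: "\<rho> x0 \<le> R"
    and psi[measurable]: "\<psi> \<in> borel_measurable borel" and bnd: "\<And>x. \<bar>\<psi> x\<bar> \<le> 1"
    and one: "\<And>x. \<rho> x \<le> R \<Longrightarrow> \<psi> x = 1"
    and law: "\<And>u x. 0 \<le> u \<Longrightarrow> u < s \<Longrightarrow> (\<integral>\<omega>. \<psi> (x + (B s \<omega> - B u \<omega>)) \<partial>M) = v (s - u) x"
    and vlim: "\<And>t x tn xn. t > 0 \<Longrightarrow> \<rho> x = R \<Longrightarrow> tn \<longlonglongrightarrow> t \<Longrightarrow> xn \<longlonglongrightarrow> x \<Longrightarrow> (\<And>n. tn n > 0) \<Longrightarrow>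
        (\<lambda>n. v (tn n) (xn n)) \<longlonglongrightarrow> 0"
  shows "(\<lambda>n. measure M {\<omega>\<in>space M. \<forall>k\<le>2^n. \<rho> (B (real k * (s / 2 ^ n)) \<omega>) \<le> R}) \<longlonglongrightarrow> (\<integral>\<omega>. \<psi> (B s \<omega>) \<partial>M)"
proof -
  define t where "t n k = real k * (s / 2 ^ n)" for n k :: nat
  have t0: "0 \<le> t n k" for n k using s by (simp add: t_def)
  have ts: "t n k < s" if "k < 2 ^ n" for n k
  proof -
    have "real k < 2 ^ n" using that by (metis of_nat_less_iff of_nat_numeral of_nat_power)
    then show ?thesis using s by (simp add: t_def field_simps)
  qed
  have tN: "t n (2 ^ n) = s" for n by (simp add: t_def)
  have [measurable]: "\<rho> \<in> borel_measurable borel" using rho by (rule borel_measurable_continuous_onI)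
  have [measurable]: "B (t n k) \<in> borel_measurable M" for n k using t0 by (rule B_measurable)
  have [measurable]: "B s \<in> borel_measurable M" using s by (intro B_measurable) simp
  have vmeas[measurable]: "v (s - t n k) \<in> borel_measurable borel" if "k < 2 ^ n" for n k
    unfolding law[OF t0 ts[OF that], symmetric] by measurable
  have vb: "\<bar>v (s - t n k) x\<bar> \<le> 1" if "k < 2 ^ n" for n k x
  proof -
    have i: "integrable M (\<lambda>\<omega>. \<psi> (x + (B s \<omega> - B (t n k) \<omega>)))"
      by (rule integrable_const_bound[where B = 1]) (use bnd in auto)
    have "\<bar>\<integral>\<omega>. \<psi> (x + (B s \<omega> - B (t n k) \<omega>)) \<partial>M\<bar> \<le> (\<integral>\<omega>. \<bar>\<psi> (x + (B s \<omega> - B (t n k) \<omega>))\<bar> \<partial>M)"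
      by (rule integral_abs_bound)
    also have "\<dots> \<le> (\<integral>\<omega>. 1 \<partial>M)" using i bnd by (intro integral_mono) auto
    finally show ?thesis unfolding law[OF t0 ts[OF that]] by (simp add: prob_space)
  qed
  define F where "F n k = {\<omega>. (\<forall>j<k. \<rho> (B (t n j) \<omega>) \<le> R) \<and> \<not> \<rho> (B (t n k) \<omega>) \<le> R}" for n k
  define A where "A n = {\<omega>. \<forall>k\<le>2^n. \<rho> (B (t n k) \<omega>) \<le> R}" for n :: nat
  have [measurable]: "(\<lambda>\<omega>. indicator (F n k) \<omega> :: real) \<in> borel_measurable M" for n k
  proof -
    have "(\<lambda>\<omega>. indicator (F n k) \<omega> :: real) = (\<lambda>\<omega>. if (\<forall>j\<in>{..<k}. \<rho> (B (t n j) \<omega>) \<le> R) \<and> \<not> \<rho> (B (t n k) \<omega>) \<le> R then 1 else 0)"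
      by (auto simp: F_def split: split_indicator)
    then show ?thesis by simp
  qed
  have Am[measurable]: "{\<omega>\<in>space M. \<omega> \<in> A n} \<in> sets M" for n
  proof -
    have "{\<omega>\<in>space M. \<omega> \<in> A n} = {\<omega>\<in>space M. \<forall>k\<in>{..2^n}. \<rho> (B (t n k) \<omega>) \<le> R}" by (auto simp: A_def)
    then show ?thesis by simp
  qed
  \<comment> \<open>On a first failure at step k the terminal value is replaced by its mean from
    that moment on. The last grid time is kept apart because \<open>law\<close> covers only times
    before s.\<close>
  define V where "V n \<omega> = (\<Sum>k<2^n. indicator (F n k) \<omega> * v (s - t n k) (B (t n k) \<omega>)) + indicator (F n (2^n)) \<omega> * \<psi> (B s \<omega>)" for n \<omega>
  have part: "indicator (A n) \<omega> + (\<Sum>k\<le>2^n. indicator (F n k) \<omega>) = (1::real)" for n \<omega>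
    using first_failure_partition[of "2^n" "\<lambda>k. \<rho> (B (t n k) \<omega>) \<le> R"]
    by (simp add: A_def F_def indicator_def of_bool_def cong: if_cong)
  \<comment> \<open>The event of a first failure at step k is a constraint on the first k steps, so
    the Markov step turns the terminal value into its conditional mean.\<close>
  have step: "(\<integral>\<omega>. indicator (F n k) \<omega> * \<psi> (B s \<omega>) \<partial>M) = (\<integral>\<omega>. indicator (F n k) \<omega> * v (s - t n k) (B (t n k) \<omega>) \<partial>M)"
    if "k < 2 ^ n" for n k
  proof -
    have F: "F n k = {\<omega>. \<forall>j\<le>k. (if j < k then \<rho> (B (t n j) \<omega>) \<le> R else \<not> \<rho> (B (t n j) \<omega>) \<le> R)}"
      by (auto simp: F_def le_less)
    show ?thesis
      using markov_step[of "s / 2 ^ n" k "2 ^ n" "\<lambda>j x. if j < k then \<rho> x \<le> R else \<not> \<rho> x \<le> R" \<psi>] s that bnd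
      unfolding t_def[symmetric] F[symmetric] tN law[OF t0 ts[OF that]] by simp
  qed
  have int_F: "integrable M (\<lambda>\<omega>. indicator (F n k) \<omega> * \<psi> (B s \<omega>))" for n k
    by (rule integrable_const_bound[where B = 1]) (use bnd in \<open>auto split: split_indicator\<close>)
  have int_Fv: "integrable M (\<lambda>\<omega>. indicator (F n k) \<omega> * v (s - t n k) (B (t n k) \<omega>))" if "k < 2 ^ n" for n k
  proof -
    note [measurable] = vmeas[OF that]
    show ?thesis
      by (rule integrable_const_bound[where B = 1]) (use vb[OF that] in \<open>auto split: split_indicator\<close>)
  qed
  have V_int: "integrable M (V n)" for n
    unfolding V_def using int_Fv int_F by (intro Bochner_Integration.integrable_add Bochner_Integration.integrable_sum) auto
  have decomp: "(\<integral>\<omega>. \<psi> (B s \<omega>) \<partial>M) = measure M {\<omega>\<in>space M. \<omega> \<in> A n} + (\<integral>\<omega>. V n \<omega> \<partial>M)" for n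
  proof -
    have A_ind: "integrable M (\<lambda>\<omega>. indicator {\<omega>\<in>space M. \<omega> \<in> A n} \<omega> :: real)" by (rule integrable_const_bound[where B=1]) auto
    have "(\<integral>\<omega>. \<psi> (B s \<omega>) \<partial>M) = (\<integral>\<omega>. indicator {\<omega>\<in>space M. \<omega> \<in> A n} \<omega> + (\<Sum>k\<le>2^n. indicator (F n k) \<omega> * \<psi> (B s \<omega>)) \<partial>M)"
    proof (rule Bochner_Integration.integral_cong[OF refl])
      fix \<omega> assume w: "\<omega> \<in> space M"
      have "\<psi> (B s \<omega>) = (indicator (A n) \<omega> + (\<Sum>k\<le>2^n. indicator (F n k) \<omega>)) * \<psi> (B s \<omega>)"
        unfolding part by simp
      also have "\<dots> = indicator (A n) \<omega> * \<psi> (B s \<omega>) + (\<Sum>k\<le>2^n. indicator (F n k) \<omega> * \<psi> (B s \<omega>))"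
        by (simp add: distrib_right sum_distrib_right)
      \<comment> \<open>The last grid time is s, so a path that never fails on the grid ends in the
        region where \<open>\<psi>\<close> is 1.\<close>
      also have "indicator (A n) \<omega> * \<psi> (B s \<omega>) = indicator {\<omega>\<in>space M. \<omega> \<in> A n} \<omega>"
        using one[of "B s \<omega>"] w tN[of n] by (auto simp: A_def split: split_indicator)
      finally show "\<psi> (B s \<omega>) = indicator {\<omega>\<in>space M. \<omega> \<in> A n} \<omega> + (\<Sum>k\<le>2^n. indicator (F n k) \<omega> * \<psi> (B s \<omega>))" .
    qed
    also have "\<dots> = measure M {\<omega>\<in>space M. \<omega> \<in> A n} + (\<Sum>k\<le>2^n. \<integral>\<omega>. indicator (F n k) \<omega> * \<psi> (B s \<omega>) \<partial>M)"
    proof (subst Bochner_Integration.integral_add[OF A_ind])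
      show "integrable M (\<lambda>\<omega>. \<Sum>k\<le>2^n. indicator (F n k) \<omega> * \<psi> (B s \<omega>))"
        by (intro Bochner_Integration.integrable_sum int_F)
      have "(\<integral>\<omega>. (\<Sum>k\<le>2^n. indicator (F n k) \<omega> * \<psi> (B s \<omega>)) \<partial>M) = (\<Sum>k\<le>2^n. \<integral>\<omega>. indicator (F n k) \<omega> * \<psi> (B s \<omega>) \<partial>M)"
        by (intro Bochner_Integration.integral_sum int_F)
      then show "(\<integral>\<omega>. indicator {\<omega>\<in>space M. \<omega> \<in> A n} \<omega> \<partial>M) + (\<integral>\<omega>. (\<Sum>k\<le>2^n. indicator (F n k) \<omega> * \<psi> (B s \<omega>)) \<partial>M) =
         measure M {\<omega>\<in>space M. \<omega> \<in> A n} + (\<Sum>k\<le>2^n. \<integral>\<omega>. indicator (F n k) \<omega> * \<psi> (B s \<omega>) \<partial>M)"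
        by simp
    qed
    also have "(\<Sum>k\<le>2^n. \<integral>\<omega>. indicator (F n k) \<omega> * \<psi> (B s \<omega>) \<partial>M) =
        (\<Sum>k<2^n. \<integral>\<omega>. indicator (F n k) \<omega> * v (s - t n k) (B (t n k) \<omega>) \<partial>M) + (\<integral>\<omega>. indicator (F n (2^n)) \<omega> * \<psi> (B s \<omega>) \<partial>M)"
      unfolding lessThan_Suc_atMost[symmetric] by (simp add: step)
    also have "\<dots> = (\<integral>\<omega>. V n \<omega> \<partial>M)"
    proof -
      have "integrable M (\<lambda>\<omega>. \<Sum>k<2^n. indicator (F n k) \<omega> * v (s - t n k) (B (t n k) \<omega>))"
        by (intro Bochner_Integration.integrable_sum int_Fv) simp
      moreover have "(\<integral>\<omega>. (\<Sum>k<2^n. indicator (F n k) \<omega> * v (s - t n k) (B (t n k) \<omega>)) \<partial>M) =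
          (\<Sum>k<2^n. \<integral>\<omega>. indicator (F n k) \<omega> * v (s - t n k) (B (t n k) \<omega>) \<partial>M)"
        by (intro Bochner_Integration.integral_sum int_Fv) simp
      ultimately show ?thesis
        unfolding V_def by (simp only: Bochner_Integration.integral_add[OF _ int_F])
    qed
    finally show ?thesis .
  qed
  have Vb: "\<bar>V n \<omega>\<bar> \<le> 1" for n \<omega>
  proof -
    have "\<bar>V n \<omega>\<bar> \<le> (\<Sum>k<2^n. indicator (F n k) \<omega>) + indicator (F n (2^n)) \<omega>"
      unfolding V_def using vb bnd
      by (intro order_trans[OF abs_triangle_ineq] add_mono order_trans[OF sum_abs] sum_mono)
         (auto split: split_indicator)
    also have "\<dots> = (\<Sum>k\<le>2^n. indicator (F n k) \<omega>)" unfolding lessThan_Suc_atMost[symmetric] by simp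
    also have "\<dots> \<le> 1" using part[of n \<omega>] by (auto split: split_indicator_asm)
    finally show ?thesis .
  qed
  have Vlim: "AE \<omega> in M. (\<lambda>n. V n \<omega>) \<longlonglongrightarrow> 0"
    using start path_continuous
  proof eventually_elim
    case (elim \<omega>)
    define f where "f u = \<rho> (B u \<omega>)" for u
    have f: "continuous_on {0..} f"
      unfolding f_def using continuous_on_compose2[OF rho elim(2)] by simp
    show ?case
    proof (cases "\<exists>u\<in>{0..s}. f u > R")
      \<comment> \<open>No exceedance up to s means no failure on any grid, so every
        \<open>V n\<close> is 0.\<close>
      case False
      have tle: "t n k \<in> {0..s}" if "k \<le> 2 ^ n" for n k
        using that ts[of k n] t0[of n k] tN[of n] by (cases "k = 2 ^ n") auto
      have "\<omega> \<notin> F n k" if "k \<le> 2 ^ n" for n k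
      proof -
        have "f (t n k) \<le> R" using False tle[OF that] by force
        then show ?thesis by (simp add: F_def f_def)
      qed
      then have "V n \<omega> = 0" for n unfolding V_def by simp
      then show ?thesis by simp
    next
      case True
      then obtain u where u: "0 \<le> u" "u \<le> s" "f u > R" by auto
      have f0: "f 0 \<le> R" using x0 elim(1) by (simp add: f_def)
      obtain \<tau> k n0 where tau: "\<tau> \<in> {0..<s}" "f \<tau> = R" "(\<lambda>n. t n (k n)) \<longlonglongrightarrow> \<tau>"
        and k: "\<And>n. n \<ge> n0 \<Longrightarrow> k n < 2 ^ n \<and> (\<forall>j<k n. f (t n j) \<le> R) \<and> f (t n (k n)) > R"
        using first_grid_exit_tendsto[OF f f0 s u] unfolding t_def by blast
      \<comment> \<open>Only the event of a first failure at step \<open>k n\<close> contains this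
        path, so a single term of the sum survives.\<close>
      have Veq: "V n \<omega> = v (s - t n (k n)) (B (t n (k n)) \<omega>)" if n: "n \<ge> n0" for n
      proof -
        have iff: "\<omega> \<in> F n j \<longleftrightarrow> j = k n" for j
        proof
          assume "\<omega> \<in> F n j"
          then have "\<not> j < k n" "\<not> k n < j" using k[OF n] by (auto simp: F_def f_def)
          then show "j = k n" by simp
        next
          assume "j = k n" then show "\<omega> \<in> F n j" using k[OF n] by (auto simp: F_def f_def)
        qed
        have "(\<Sum>j<2^n. indicator (F n j) \<omega> * v (s - t n j) (B (t n j) \<omega>)) = (\<Sum>j<2^n. if j = k n then v (s - t n j) (B (t n j) \<omega>) else 0)"
          by (intro sum.cong) (auto simp: iff indicator_def)
        then show ?thesis unfolding V_def using k[OF n] by (simp add: iff)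
      qed
      have "(\<lambda>n. v (s - t (n + n0) (k (n + n0))) (B (t (n + n0) (k (n + n0))) \<omega>)) \<longlonglongrightarrow> 0"
      proof (rule vlim[of "s - \<tau>" "B \<tau> \<omega>"])
        show "s - \<tau> > 0" "\<rho> (B \<tau> \<omega>) = R" using tau by (auto simp: f_def)
        have l: "(\<lambda>n. t (n + n0) (k (n + n0))) \<longlonglongrightarrow> \<tau>" using tau(3) by (rule LIMSEQ_ignore_initial_segment)
        then show "(\<lambda>n. s - t (n + n0) (k (n + n0))) \<longlonglongrightarrow> s - \<tau>" by (intro tendsto_intros)
        show "(\<lambda>n. B (t (n + n0) (k (n + n0))) \<omega>) \<longlonglongrightarrow> B \<tau> \<omega>"
          by (rule continuous_on_tendsto_compose[OF elim(2) l]) (use tau t0 in auto)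
        show "0 < s - t (n + n0) (k (n + n0))" for n using ts k[of "n + n0"] by simp
      qed
      then have "(\<lambda>n. V (n + n0) \<omega>) \<longlonglongrightarrow> 0" by (simp add: Veq)
      then show ?thesis by (rule LIMSEQ_offset)
    qed
  qed
  \<comment> \<open>Bounded convergence removes the contribution of the exiting paths.\<close>
  have "(\<lambda>n. \<integral>\<omega>. V n \<omega> \<partial>M) \<longlonglongrightarrow> (\<integral>\<omega>. 0 \<partial>M)"
    by (rule integral_dominated_convergence[where w = "\<lambda>_. 1"])
       (use Vlim Vb V_int in \<open>auto intro: borel_measurable_integrable\<close>)
  then have "(\<lambda>n. (\<integral>\<omega>. \<psi> (B s \<omega>) \<partial>M) - (\<integral>\<omega>. V n \<omega> \<partial>M)) \<longlonglongrightarrow> (\<integral>\<omega>. \<psi> (B s \<omega>) \<partial>M) - 0"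
    by (intro tendsto_intros) simp
  moreover have "(\<integral>\<omega>. \<psi> (B s \<omega>) \<partial>M) - (\<integral>\<omega>. V n \<omega> \<partial>M) = measure M {\<omega>\<in>space M. \<forall>k\<le>2^n. \<rho> (B (real k * (s / 2 ^ n)) \<omega>) \<le> R}" for n
    using decomp[of n] by (simp add: A_def t_def)
  ultimately show ?thesis by simp
qed

end

section \<open>Brownian motion on the line and in space\<close>

lemma independent_increments_brownian_motion:
  assumes "brownian_motion M a X"
  shows "independent_increments M X a"
proof -
  interpret prob_space M using assms by (simp add: brownian_motion_def)
  show ?thesis
    by unfold_locales (use assms in \<open>auto simp: brownian_motion_def\<close>)
qed

text \<open>An isometric copy as nested pairs, on which measurability and integration proceed
  coordinate by coordinate.\<close>

definition coords3 :: "real ^ 3 \<Rightarrow> real \<times> real \<times> real" where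
  "coords3 x = (x $ 1, x $ 2, x $ 3)"

lemma norm_coords3: "norm (coords3 x) = norm x"
  by (simp add: coords3_def norm_prod_def norm_vec_def L2_set_def sum_3 add.assoc)

text \<open>Independence across coordinates and independence over time combine: the increments of
  all coordinates and all time steps form one independent family, which is then regrouped by time
  step.\<close>

lemma independent_increments_brownian_motion_3d:
  assumes B: "brownian_motion_3d_0 M X"
  shows "independent_increments M (\<lambda>t \<omega>. coords3 (X t \<omega>)) 0"
proof -
  have bm: "brownian_motion M 0 (\<lambda>t \<omega>. X t \<omega> $ i)" for i
    using B by (simp add: brownian_motion_3d_0_def)
  interpret prob_space M using bm[of 1] by (simp add: brownian_motion_def)
  have paths: "indep_vars (\<lambda>_. path_space) (\<lambda>i. path_of (\<lambda>t \<omega>. X t \<omega> $ i)) UNIV"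
    using B by (simp add: brownian_motion_3d_0_def)
  have [measurable]: "(\<lambda>\<omega>. X t \<omega> $ i) \<in> borel_measurable M" if "0 \<le> t" for t i
    using bm[of i] that by (simp add: brownian_motion_def)
  show ?thesis
  proof
    show "(\<lambda>\<omega>. coords3 (X t \<omega>)) \<in> borel_measurable M" if "0 \<le> t" for t
      unfolding coords3_def using that by measurable
    have "AE \<omega> in M. \<forall>i. X 0 \<omega> $ i = 0"
      using bm by (intro AE_finite_allI[of UNIV, simplified]) (auto simp: brownian_motion_def)
    then show "AE \<omega> in M. coords3 (X 0 \<omega>) = 0"
      by eventually_elim (simp add: coords3_def zero_prod_def)
    have "AE \<omega> in M. \<forall>i. continuous_on {0..} (\<lambda>t. X t \<omega> $ i)"
      using bm by (intro AE_finite_allI[of UNIV, simplified]) (auto simp: brownian_motion_def)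
    then show "AE \<omega> in M. continuous_on {0..} (\<lambda>t. coords3 (X t \<omega>))"
      unfolding coords3_def by eventually_elim (intro continuous_on_Pair; blast)
  next
    fix n and \<tau> :: "nat \<Rightarrow> real"
    assume tau: "\<And>k. k < n \<Longrightarrow> 0 \<le> \<tau> k \<and> \<tau> k \<le> \<tau> (Suc k)"
    define D where "D = (\<lambda>(i, k) \<omega>. X (\<tau> (Suc k)) \<omega> $ i - X (\<tau> k) \<omega> $ i)"
    have tau': "0 \<le> \<tau> k" "0 \<le> \<tau> (Suc k)" if "k < n" for k using tau[OF that] by auto
    have iv: "indep_vars (\<lambda>_. borel) (\<lambda>k \<omega>. D (i, k) \<omega>) {..<n}" for i
      using bm[of i] tau unfolding brownian_motion_def D_def by auto
    have Dm: "D j \<in> borel_measurable M" if "j \<in> UNIV \<times> {..<n}" for j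
      using that iv[of "fst j"] by (auto simp: indep_vars_def)
    show "indep_vars (\<lambda>_. borel) (\<lambda>k \<omega>. coords3 (X (\<tau> (Suc k)) \<omega>) - coords3 (X (\<tau> k) \<omega>)) {..<n}"
    \<comment> \<open>The product criterion below is applied to a nonempty index set.\<close>
    proof (cases "n = 0")
      case True
      then show ?thesis by (simp add: indep_vars_def indep_sets_def)
    next
      case False
      have "indep_vars (\<lambda>_. borel) D (UNIV \<times> {..<n})"
      proof (rule indep_vars_finite[THEN iffD2])
        show "UNIV \<times> {..<n} \<noteq> ({} :: (3 \<times> nat) set)" using False by auto
        show "finite (UNIV \<times> {..<n} :: (3 \<times> nat) set)" by simp
        show "D j \<in> borel_measurable M" if "j \<in> UNIV \<times> {..<n}" for j using that by (rule Dm)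
        show "sets (borel :: real measure) = sigma_sets (space borel) (sets borel)"
          by (rule sets.sigma_sets_eq[symmetric])
        show "Int_stable (sets (borel :: real measure))" by (rule sets.Int_stable)
        show "space (borel :: real measure) \<in> sets borel" by simp
        show "sets (borel :: real measure) \<subseteq> Pow (space borel)" by (rule sets.space_closed)
        show "\<forall>A\<in>\<Pi> j\<in>(UNIV :: 3 set) \<times> {..<n}. sets borel.
          prob (\<Inter>j\<in>UNIV \<times> {..<n}. D j -` A j \<inter> space M) = (\<Prod>j\<in>UNIV \<times> {..<n}. prob (D j -` A j \<inter> space M))"
        proof
          fix A :: "3 \<times> nat \<Rightarrow> real set" assume A: "A \<in> (\<Pi> j\<in>UNIV \<times> {..<n}. sets (borel :: real measure))"
          \<comment> \<open>All conditions on coordinate i gathered into one set of paths, so that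
            independence of the coordinate paths applies first and independence of increments inside
            each coordinate afterwards.\<close>
          define C where "C i = {p \<in> space path_space. \<forall>k\<in>{..<n}. p (\<tau> (Suc k)) - p (\<tau> k) \<in> A (i, k)}" for i :: 3
          have C: "C i \<in> sets path_space" for i
          proof -
            have "{p \<in> space path_space. p (\<tau> (Suc k)) - p (\<tau> k) \<in> A (i, k)} \<in> sets path_space" if "k \<in> {..<n}" for k
            proof -
              have f: "(\<lambda>p. p (\<tau> (Suc k)) - p (\<tau> k) :: real) \<in> borel_measurable path_space"
                using that tau' by (intro borel_measurable_diff measurable_component_singleton) auto
              have Ai: "A (i, k) \<in> sets borel" using A that by auto
              have eq: "{p \<in> space path_space. p (\<tau> (Suc k)) - p (\<tau> k) \<in> A (i, k)} =
                  (\<lambda>p. p (\<tau> (Suc k)) - p (\<tau> k)) -` A (i, k) \<inter> space path_space"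
                by blast
              show ?thesis unfolding eq by (rule measurable_sets[OF f Ai])
            qed
            then show ?thesis unfolding C_def by (intro sets.sets_Collect_finite_All) simp_all
          qed
          have eq: "path_of (\<lambda>t \<omega>. X t \<omega> $ i) -` C i \<inter> space M = (\<Inter>k\<in>{..<n}. D (i, k) -` A (i, k) \<inter> space M)" for i
          proof -
            have "path_of (\<lambda>t \<omega>. X t \<omega> $ i) \<omega> \<in> C i \<longleftrightarrow> (\<forall>k\<in>{..<n}. D (i, k) \<omega> \<in> A (i, k))" if "\<omega> \<in> space M" for \<omega>
              using tau' by (auto simp: C_def path_of_def D_def space_PiM)
            then show ?thesis using False by auto
          qed
          have "(\<Inter>j\<in>UNIV \<times> {..<n}. D j -` A j \<inter> space M) = (\<Inter>i\<in>UNIV. path_of (\<lambda>t \<omega>. X t \<omega> $ i) -` C i \<inter> space M)"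
            unfolding eq by auto
          also have "prob \<dots> = (\<Prod>i\<in>UNIV. prob (path_of (\<lambda>t \<omega>. X t \<omega> $ i) -` C i \<inter> space M))"
            by (intro indep_varsD[OF paths]) (auto simp: C)
          also have "\<dots> = (\<Prod>i\<in>UNIV. \<Prod>k\<in>{..<n}. prob (D (i, k) -` A (i, k) \<inter> space M))"
            unfolding eq using False A
            by (intro prod.cong refl indep_varsD[OF iv, unfolded D_def[symmetric]]) auto
          also have "\<dots> = (\<Prod>j\<in>UNIV \<times> {..<n}. prob (D j -` A j \<inter> space M))"
            by (subst prod.cartesian_product) (simp add: case_prod_beta')
          finally show "prob (\<Inter>j\<in>UNIV \<times> {..<n}. D j -` A j \<inter> space M) = (\<Prod>j\<in>UNIV \<times> {..<n}. prob (D j -` A j \<inter> space M))" .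
        qed
      qed
      \<comment> \<open>Regrouping: the three coordinate increments of one time step form one
        block.\<close>
      then have "indep_vars (\<lambda>k. PiM (UNIV \<times> {k}) (\<lambda>_. borel)) (\<lambda>k \<omega>. restrict (\<lambda>j. D j \<omega>) (UNIV \<times> {k})) {..<n}"
        by (rule indep_vars_restrict) (auto simp: disjoint_family_on_def)
      then have "indep_vars (\<lambda>_. borel) (\<lambda>k \<omega>. (\<lambda>f. (f (1, k), f (2, k), f (3, k))) (restrict (\<lambda>j. D j \<omega>) (UNIV \<times> {k}))) {..<n}"
        by (rule indep_vars_compose2)
           (intro borel_measurable_Pair measurable_component_singleton; simp)
      then show ?thesis by (simp add: D_def coords3_def)
    qed
  qed
qed

section \<open>Law of the norm of a spatial Brownian increment\<close>

lemma (in prob_space) nn_integral_indep_var_pair: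
  assumes ind: "indep_var S X T Y"
    and g[measurable]: "case_prod g \<in> borel_measurable (S \<Otimes>\<^sub>M T)"
  shows "(\<integral>\<^sup>+\<omega>. g (X \<omega>) (Y \<omega>) \<partial>M) = (\<integral>\<^sup>+\<omega>. (\<integral>\<^sup>+\<omega>'. g (X \<omega>) (Y \<omega>') \<partial>M) \<partial>M)"
proof -
  have X[measurable]: "random_variable S X" and Y[measurable]: "random_variable T Y"
    and d: "distr M S X \<Otimes>\<^sub>M distr M T Y = distr M (S \<Otimes>\<^sub>M T) (\<lambda>x. (X x, Y x))"
    using ind unfolding indep_var_distribution_eq by auto
  interpret Y: prob_space "distr M T Y" by (rule prob_space_distr) fact
  have "(\<integral>\<^sup>+\<omega>. g (X \<omega>) (Y \<omega>) \<partial>M) = (\<integral>\<^sup>+p. case_prod g p \<partial>distr M (S \<Otimes>\<^sub>M T) (\<lambda>x. (X x, Y x)))"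
    by (subst nn_integral_distr) auto
  also have "\<dots> = (\<integral>\<^sup>+x. (\<integral>\<^sup>+y. g x y \<partial>distr M T Y) \<partial>distr M S X)"
    unfolding d[symmetric] by (subst Y.nn_integral_fst[symmetric]) auto
  also have "\<dots> = (\<integral>\<^sup>+\<omega>. (\<integral>\<^sup>+y. g (X \<omega>) y \<partial>distr M T Y) \<partial>M)"
    by (subst nn_integral_distr) auto
  also have "\<dots> = (\<integral>\<^sup>+\<omega>. (\<integral>\<^sup>+\<omega>'. g (X \<omega>) (Y \<omega>') \<partial>M) \<partial>M)"
  proof (intro nn_integral_cong)
    fix \<omega> assume "\<omega> \<in> space M"
    then have "X \<omega> \<in> space S" using measurable_space[OF X] by simp
    then have "(\<lambda>y. case_prod g (X \<omega>, y)) \<in> borel_measurable T"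
      by (rule measurable_compose[OF measurable_Pair1' g])
    then show "(\<integral>\<^sup>+y. g (X \<omega>) y \<partial>distr M T Y) = (\<integral>\<^sup>+\<omega>'. g (X \<omega>) (Y \<omega>') \<partial>M)"
      by (intro nn_integral_distr[OF Y]) simp
  qed
  finally show ?thesis .
qed

text \<open>The library's \<open>indep_var\<close> needs equal codomain types, so the first coordinate is padded
  with \<open>0\<close> when it is split off from the other two.\<close>

lemma (in prob_space) nn_integral_indep_normal3:
  fixes D :: "3 \<Rightarrow> 'a \<Rightarrow> real"
  assumes iv: "indep_vars (\<lambda>_. borel) D UNIV"
    and D: "\<And>i. distributed M lborel (D i) (\<lambda>x. ennreal (normal_density (m i) \<sigma> x))"
    and g[measurable]: "(\<lambda>(x, y, z). g x y z) \<in> borel_measurable (borel \<Otimes>\<^sub>M borel \<Otimes>\<^sub>M borel)"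
  shows "(\<integral>\<^sup>+\<omega>. g (D 1 \<omega>) (D 2 \<omega>) (D 3 \<omega>) \<partial>M) =
    (\<integral>\<^sup>+x. \<integral>\<^sup>+y. \<integral>\<^sup>+z. g x y z * ennreal (normal_density (m 1) \<sigma> x) * ennreal (normal_density (m 2) \<sigma> y) * ennreal (normal_density (m 3) \<sigma> z)
       \<partial>lborel \<partial>lborel \<partial>lborel)"
proof -
  have [measurable]: "D i \<in> borel_measurable M" for i
    using iv by (simp add: indep_vars_def)
  have "indep_var (PiM {1} (\<lambda>_. borel)) (\<lambda>\<omega>. restrict (\<lambda>i. D i \<omega>) {1}) (PiM {2, 3} (\<lambda>_. borel)) (\<lambda>\<omega>. restrict (\<lambda>i. D i \<omega>) {2, 3})"
    by (intro indep_var_restrict[OF iv]) auto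
  then have "indep_var borel ((\<lambda>f. (f 1, 0)) \<circ> (\<lambda>\<omega>. restrict (\<lambda>i. D i \<omega>) {1})) borel ((\<lambda>f. (f 2, f 3)) \<circ> (\<lambda>\<omega>. restrict (\<lambda>i. D i \<omega>) {2, 3}))"
    by (rule indep_var_compose)
       (intro borel_measurable_Pair measurable_component_singleton measurable_const; simp)+
  then have i1: "indep_var borel (\<lambda>\<omega>. (D 1 \<omega>, 0::real)) borel (\<lambda>\<omega>. (D 2 \<omega>, D 3 \<omega>))"
    by (simp add: comp_def)
  have "indep_var (PiM {2} (\<lambda>_. borel)) (\<lambda>\<omega>. restrict (\<lambda>i. D i \<omega>) {2}) (PiM {3} (\<lambda>_. borel)) (\<lambda>\<omega>. restrict (\<lambda>i. D i \<omega>) {3})"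
    by (intro indep_var_restrict[OF iv]) auto
  then have "indep_var borel ((\<lambda>f. f 2) \<circ> (\<lambda>\<omega>. restrict (\<lambda>i. D i \<omega>) {2})) borel ((\<lambda>f. f 3) \<circ> (\<lambda>\<omega>. restrict (\<lambda>i. D i \<omega>) {3}))"
    by (rule indep_var_compose) (intro measurable_component_singleton; simp)+
  then have i2: "indep_var borel (D 2) borel (D 3)" by (simp add: comp_def)
  have g'[measurable]: "(\<lambda>p. g (fst p) (fst (snd p)) (snd (snd p))) \<in> borel_measurable (borel \<Otimes>\<^sub>M borel \<Otimes>\<^sub>M borel)"
    using g by (simp add: case_prod_beta')
  have [measurable]: "(\<lambda>p. g (f p) (h p) (k p)) \<in> borel_measurable N"
    if [measurable]: "f \<in> borel_measurable N" "h \<in> borel_measurable N" "k \<in> borel_measurable N" for f h k and N :: "'c measure"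
  proof -
    have "(\<lambda>p. (f p, h p, k p)) \<in> N \<rightarrow>\<^sub>M borel \<Otimes>\<^sub>M borel \<Otimes>\<^sub>M borel" by measurable
    from measurable_compose[OF this g'] show ?thesis by simp
  qed
  let ?n = "\<lambda>i x. ennreal (normal_density (m i) \<sigma> x)"
  have dens: "(\<integral>\<^sup>+\<omega>. f (D i \<omega>) \<partial>M) = (\<integral>\<^sup>+x. ?n i x * f x \<partial>lborel)" if "f \<in> borel_measurable borel" for f i
    using distributed_nn_integral[OF D[of i], of f] that by simp
  have "(\<integral>\<^sup>+\<omega>. g (D 1 \<omega>) (D 2 \<omega>) (D 3 \<omega>) \<partial>M) = (\<integral>\<^sup>+\<omega>. (\<integral>\<^sup>+\<omega>'. g (D 1 \<omega>) (D 2 \<omega>') (D 3 \<omega>') \<partial>M) \<partial>M)"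
  proof -
    have "case_prod (\<lambda>(a::real, b::real) (c, d). g a c d) \<in> borel_measurable (borel \<Otimes>\<^sub>M borel)"
      unfolding case_prod_beta' borel_prod[symmetric] by measurable
    from nn_integral_indep_var_pair[OF i1 this] show ?thesis by simp
  qed
  also have "\<dots> = (\<integral>\<^sup>+\<omega>. (\<integral>\<^sup>+\<omega>'. (\<integral>\<^sup>+\<omega>''. g (D 1 \<omega>) (D 2 \<omega>') (D 3 \<omega>'') \<partial>M) \<partial>M) \<partial>M)"
  proof (rule nn_integral_cong)
    fix \<omega>
    have "case_prod (\<lambda>c d. g (D 1 \<omega>) c d) \<in> borel_measurable (borel \<Otimes>\<^sub>M borel)"
      unfolding case_prod_beta' by measurable
    from nn_integral_indep_var_pair[OF i2 this]
    show "(\<integral>\<^sup>+\<omega>'. g (D 1 \<omega>) (D 2 \<omega>') (D 3 \<omega>') \<partial>M) = (\<integral>\<^sup>+\<omega>'. (\<integral>\<^sup>+\<omega>''. g (D 1 \<omega>) (D 2 \<omega>') (D 3 \<omega>'') \<partial>M) \<partial>M)" .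
  qed
  also have "\<dots> = (\<integral>\<^sup>+\<omega>. (\<integral>\<^sup>+\<omega>'. (\<integral>\<^sup>+z. ?n 3 z * g (D 1 \<omega>) (D 2 \<omega>') z \<partial>lborel) \<partial>M) \<partial>M)"
    by (subst dens) simp_all
  also have "\<dots> = (\<integral>\<^sup>+\<omega>. (\<integral>\<^sup>+y. ?n 2 y * (\<integral>\<^sup>+z. ?n 3 z * g (D 1 \<omega>) y z \<partial>lborel) \<partial>lborel) \<partial>M)"
    by (subst dens) simp_all
  also have "\<dots> = (\<integral>\<^sup>+x. ?n 1 x * (\<integral>\<^sup>+y. ?n 2 y * (\<integral>\<^sup>+z. ?n 3 z * g x y z \<partial>lborel) \<partial>lborel) \<partial>lborel)"
    by (subst dens) simp_all
  also have "\<dots> = (\<integral>\<^sup>+x. \<integral>\<^sup>+y. \<integral>\<^sup>+z. g x y z * ?n 1 x * ?n 2 y * ?n 3 z \<partial>lborel \<partial>lborel \<partial>lborel)"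
    by (simp add: nn_integral_cmult[symmetric] mult_ac)
  finally show ?thesis .
qed

text \<open>The coordinates are independent normals of variance t - u centred at those of x, so the
  law depends on x only through its norm.\<close>

lemma brownian_motion_3d_norm_law:
  assumes B: "brownian_motion_3d_0 M X" and u: "0 \<le> u" "u < t"
  shows "distributed M lborel (\<lambda>\<omega>. norm (x + (coords3 (X t \<omega>) - coords3 (X u \<omega>))))
    (\<lambda>\<rho>. ennreal (radial_density (sqrt (t - u)) (norm x) \<rho>))"
proof -
  have bm: "brownian_motion M 0 (\<lambda>t \<omega>. X t \<omega> $ i)" for i
    using B by (simp add: brownian_motion_3d_0_def)
  interpret prob_space M using bm[of 1] by (simp add: brownian_motion_def)
  have paths: "indep_vars (\<lambda>_. path_space) (\<lambda>i. path_of (\<lambda>t \<omega>. X t \<omega> $ i)) UNIV"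
    using B by (simp add: brownian_motion_3d_0_def)
  define \<sigma> where "\<sigma> = sqrt (t - u)"
  have s: "\<sigma> > 0" using u by (simp add: \<sigma>_def)
  define m :: "3 \<Rightarrow> real" where "m i = (if i = 1 then fst x else if i = 2 then fst (snd x) else snd (snd x))" for i
  define D where "D i \<omega> = m i + (X t \<omega> $ i - X u \<omega> $ i)" for i \<omega>
  have ne: "(2::3) \<noteq> 1" "(3::3) \<noteq> 1" "(3::3) \<noteq> 2" by simp_all
  have m3: "m 1 = fst x" "m 2 = fst (snd x)" "m 3 = snd (snd x)" unfolding m_def using ne by auto
  have "indep_vars (\<lambda>_. borel) (\<lambda>i \<omega>. (\<lambda>p. m i + (p t - p u)) (path_of (\<lambda>t \<omega>. X t \<omega> $ i) \<omega>)) UNIV"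
    by (rule indep_vars_compose2[OF paths])
       (use u in \<open>intro borel_measurable_add borel_measurable_diff measurable_component_singleton borel_measurable_const; auto\<close>)
  then have iv: "indep_vars (\<lambda>_. borel) D UNIV"
    using u by (simp add: D_def[abs_def] path_of_def)
  have [measurable]: "D i \<in> borel_measurable M" for i
    using iv by (simp add: indep_vars_def)
  have dist: "distributed M lborel (D i) (\<lambda>x. ennreal (normal_density (m i) \<sigma> x))" for i
  proof -
    have "distributed M lborel (\<lambda>\<omega>. X t \<omega> $ i - X u \<omega> $ i) (normal_density 0 \<sigma>)"
      using bm[of i] u by (simp add: brownian_motion_def \<sigma>_def)
    from normal_density_affine[OF this s, of 1 "m i"] show ?thesis by (simp add: D_def[abs_def])
  qed
  have nrm: "norm (x + (coords3 (X t \<omega>) - coords3 (X u \<omega>))) = sqrt ((D 1 \<omega>)\<^sup>2 + (D 2 \<omega>)\<^sup>2 + (D 3 \<omega>)\<^sup>2)" for \<omega>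
    by (simp add: D_def m3 coords3_def norm_prod_def add.assoc split: prod.split)
  have nx: "norm x = sqrt ((m 1)\<^sup>2 + (m 2)\<^sup>2 + (m 3)\<^sup>2)"
    unfolding m3 by (cases x) (simp add: norm_prod_def add.assoc)
  show ?thesis
    unfolding distributed_def nrm nx \<sigma>_def[symmetric]
  proof (intro conjI)
    show "distr M lborel (\<lambda>\<omega>. sqrt ((D 1 \<omega>)\<^sup>2 + (D 2 \<omega>)\<^sup>2 + (D 3 \<omega>)\<^sup>2)) = density lborel (\<lambda>\<rho>. ennreal (radial_density \<sigma> (sqrt ((m 1)\<^sup>2 + (m 2)\<^sup>2 + (m 3)\<^sup>2)) \<rho>))"
    proof (rule measure_eqI)
      fix A assume "A \<in> sets (distr M lborel (\<lambda>\<omega>. sqrt ((D 1 \<omega>)\<^sup>2 + (D 2 \<omega>)\<^sup>2 + (D 3 \<omega>)\<^sup>2)))"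
      then have [measurable]: "A \<in> sets borel" by simp
      have "emeasure (distr M lborel (\<lambda>\<omega>. sqrt ((D 1 \<omega>)\<^sup>2 + (D 2 \<omega>)\<^sup>2 + (D 3 \<omega>)\<^sup>2))) A =
        (\<integral>\<^sup>+\<rho>. indicator A \<rho> \<partial>distr M lborel (\<lambda>\<omega>. sqrt ((D 1 \<omega>)\<^sup>2 + (D 2 \<omega>)\<^sup>2 + (D 3 \<omega>)\<^sup>2)))"
        by simp
      also have "\<dots> = (\<integral>\<^sup>+\<omega>. indicator A (sqrt ((D 1 \<omega>)\<^sup>2 + (D 2 \<omega>)\<^sup>2 + (D 3 \<omega>)\<^sup>2)) \<partial>M)"
        by (subst nn_integral_distr) auto
      also have "\<dots> = (\<integral>\<^sup>+x. \<integral>\<^sup>+y. \<integral>\<^sup>+z. indicator A (sqrt (x\<^sup>2 + y\<^sup>2 + z\<^sup>2)) * ennreal (normal_density (m 1) \<sigma> x) *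
         ennreal (normal_density (m 2) \<sigma> y) * ennreal (normal_density (m 3) \<sigma> z) \<partial>lborel \<partial>lborel \<partial>lborel)"
        by (rule nn_integral_indep_normal3[OF iv dist, of "\<lambda>x y z. indicator A (sqrt (x\<^sup>2 + y\<^sup>2 + z\<^sup>2))"])
           (unfold case_prod_beta', measurable)
      also have "\<dots> = (\<integral>\<^sup>+\<rho>. indicator A \<rho> * ennreal (radial_density \<sigma> (sqrt ((m 1)\<^sup>2 + (m 2)\<^sup>2 + (m 3)\<^sup>2)) \<rho>) \<partial>lborel)"
        by (rule nn_integral_normal3_norm[OF _ s]) simp
      also have "\<dots> = emeasure (density lborel (\<lambda>\<rho>. ennreal (radial_density \<sigma> (sqrt ((m 1)\<^sup>2 + (m 2)\<^sup>2 + (m 3)\<^sup>2)) \<rho>))) A"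
        by (subst emeasure_density) (auto simp: mult.commute)
      finally show "emeasure (distr M lborel (\<lambda>\<omega>. sqrt ((D 1 \<omega>)\<^sup>2 + (D 2 \<omega>)\<^sup>2 + (D 3 \<omega>)\<^sup>2))) A =
        emeasure (density lborel (\<lambda>\<rho>. ennreal (radial_density \<sigma> (sqrt ((m 1)\<^sup>2 + (m 2)\<^sup>2 + (m 3)\<^sup>2)) \<rho>))) A" .
    qed simp
  qed measurable
qed

section \<open>The running maximum of the Bessel process\<close>

text \<open>Method of images: \<open>saw R y / y\<close> is the extension of the constant \<open>1\<close> on the ball of radius
  \<open>R\<close> whose mean under Brownian motion vanishes for every start on the sphere of radius \<open>R\<close>.\<close>

definition saw :: "real \<Rightarrow> real \<Rightarrow> real" where
  "saw R y = y - 2 * R * of_int \<lceil>y / (2 * R) - 1 / 2\<rceil>"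

text \<open>The value at 0 is the limit, since \<open>saw R\<close> is the identity near 0 for
  positive R.\<close>

definition saw_ratio :: "real \<Rightarrow> real \<Rightarrow> real" where
  "saw_ratio R y = (if y = 0 then 1 else saw R y / y)"

lemma saw_measurable [measurable]: "saw R \<in> borel_measurable borel"
  unfolding saw_def by measurable

lemma saw_ratio_measurable [measurable]: "saw_ratio R \<in> borel_measurable borel"
  unfolding saw_ratio_def by measurable

lemma saw_small:
  assumes "R > 0" "-R < y" "y \<le> R"
  shows "saw R y = y"
proof -
  have "-1 < y / (2 * R) - 1 / 2" "y / (2 * R) - 1 / 2 \<le> 0" using assms by (auto simp: field_simps)
  then have "\<lceil>y / (2 * R) - 1 / 2\<rceil> = 0" by linarith
  then show ?thesis by (simp add: saw_def)
qed

lemma saw_bounds: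
  assumes "R > 0"
  shows "-R < saw R y" "saw R y \<le> R"
proof -
  define w where "w = y / (2 * R) - 1 / 2"
  have y: "y = 2 * R * w + R" using assms by (simp add: w_def field_simps)
  have s: "saw R y = R - 2 * R * (of_int \<lceil>w\<rceil> - w)" unfolding saw_def w_def[symmetric] by (simp add: y algebra_simps)
  have "0 \<le> of_int \<lceil>w\<rceil> - w" "of_int \<lceil>w\<rceil> - w < 1" by linarith+
  then have "0 \<le> 2 * R * (of_int \<lceil>w\<rceil> - w)" "2 * R * (of_int \<lceil>w\<rceil> - w) < 2 * R * 1"
    using assms by (auto intro!: mult_strict_left_mono)
  then show "-R < saw R y" "saw R y \<le> R" unfolding s by linarith+
qed

lemma saw_abs_le: "R > 0 \<Longrightarrow> \<bar>saw R y\<bar> \<le> R"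
  using saw_bounds[of R y] by auto

lemma saw_ratio_abs_le:
  assumes "R > 0"
  shows "\<bar>saw_ratio R y\<bar> \<le> 1"
proof (cases "\<bar>y\<bar> < R")
  case True
  then show ?thesis using assms saw_small[of R y] by (auto simp: saw_ratio_def)
next
  case False
  then have "\<bar>saw R y\<bar> \<le> \<bar>y\<bar>" "y \<noteq> 0" using saw_abs_le[OF assms, of y] assms by auto
  then show ?thesis by (simp add: saw_ratio_def field_simps)
qed

lemma saw_ratio_small: "R > 0 \<Longrightarrow> 0 \<le> y \<Longrightarrow> y \<le> R \<Longrightarrow> saw_ratio R y = 1"
  by (simp add: saw_ratio_def saw_small)

lemma ceiling_minus_floor_Ints: "x \<notin> \<int> \<Longrightarrow> \<lceil>x::real\<rceil> = \<lfloor>x\<rfloor> + 1"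
  by (simp add: ceiling_altdef) (metis Ints_of_int)

text \<open>The function is odd except at its jumps, the odd multiples of R, where the ceiling picks
  one side; these form a null set.\<close>

lemma saw_minus:
  assumes "y / (2 * R) - 1 / 2 \<notin> \<int>"
  shows "saw R (- y) = - saw R y"
proof -
  define w where "w = y / (2 * R) - 1 / 2"
  have "\<lceil>(- y) / (2 * R) - 1 / 2\<rceil> = - \<lfloor>w + 1\<rfloor>"
    by (simp add: w_def ceiling_def)
  also have "\<lfloor>w + 1\<rfloor> = \<lceil>w\<rceil>"
    using ceiling_minus_floor_Ints[of w] assms unfolding w_def[symmetric] by linarith
  finally show ?thesis by (simp add: saw_def w_def)
qed

text \<open>Oddness combined with the period 2R gives antisymmetry about R, again off the jumps.
  This is the image principle: mass reflected at R enters with the opposite sign.\<close>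

lemma saw_reflect:
  assumes "R > 0" "x / (2 * R) \<notin> \<int>"
  shows "saw R (R - x) = - saw R (R + x)"
proof -
  define c where "c = \<lceil>x / (2 * R)\<rceil>"
  have e: "(R + x) / (2 * R) - 1 / 2 = x / (2 * R)" "(R - x) / (2 * R) - 1 / 2 = - (x / (2 * R))"
    using assms by (simp_all add: field_simps)
  have "\<lceil>- (x / (2 * R))\<rceil> = 1 - c"
    using ceiling_minus_floor_Ints[OF assms(2)] unfolding c_def ceiling_minus by linarith
  then have "saw R (R - x) = R - x - 2 * R * (1 - of_int c)" "saw R (R + x) = R + x - 2 * R * of_int c"
    unfolding saw_def e c_def[symmetric] by simp_all
  then show ?thesis by (simp add: algebra_simps)
qed

lemma saw_tendsto:
  assumes R: "R > 0" and x: "x / (2 * R) - 1 / 2 \<notin> \<int>" and lim: "f \<longlonglongrightarrow> x"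
  shows "(\<lambda>n. saw R (f n)) \<longlonglongrightarrow> saw R x"
proof -
  define w where "w = x / (2 * R) - 1 / 2"
  have l: "(\<lambda>n. f n / (2 * R) - 1 / 2) \<longlonglongrightarrow> w"
    unfolding w_def using lim R by (intro tendsto_intros) auto
  have "w \<noteq> of_int \<lceil>w\<rceil>" using x by (metis Ints_of_int w_def)
  then have "of_int \<lceil>w\<rceil> - 1 < w" "w < of_int \<lceil>w\<rceil>" by linarith+
  then have "\<forall>\<^sub>F n in sequentially. of_int \<lceil>w\<rceil> - 1 < f n / (2 * R) - 1 / 2"
    "\<forall>\<^sub>F n in sequentially. f n / (2 * R) - 1 / 2 < of_int \<lceil>w\<rceil>"
    using l by (auto intro: order_tendstoD)
  then have "\<forall>\<^sub>F n in sequentially. \<lceil>f n / (2 * R) - 1 / 2\<rceil> = \<lceil>w\<rceil>"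
    by eventually_elim linarith
  then have "\<forall>\<^sub>F n in sequentially. f n - 2 * R * of_int \<lceil>w\<rceil> = saw R (f n)"
    by eventually_elim (simp add: saw_def)
  moreover have "(\<lambda>n. f n - 2 * R * of_int \<lceil>w\<rceil>) \<longlonglongrightarrow> x - 2 * R * of_int \<lceil>w\<rceil>"
    by (intro tendsto_intros lim)
  ultimately show ?thesis unfolding saw_def[of R x] w_def[symmetric] by (rule Lim_transform_eventually[rotated])
qed

lemma AE_not_lattice:
  assumes "a \<noteq> 0"
  shows "AE z in lborel. a * z + b \<notin> (\<int> :: real set)"
proof (rule AE_I)
  show "{z\<in>space lborel. \<not> a * z + b \<notin> \<int>} \<subseteq> range (\<lambda>k::int. (of_int k - b) / a)"
  proof
    fix z assume "z \<in> {z\<in>space lborel. \<not> a * z + b \<notin> \<int>}"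
    then obtain k :: int where "a * z + b = of_int k" by (auto elim: Ints_cases)
    then have "z = (of_int k - b) / a" using assms by (simp add: field_simps)
    then show "z \<in> range (\<lambda>k::int. (of_int k - b) / a)" by blast
  qed
  have "range (\<lambda>k::int. (of_int k - b) / a) \<in> null_sets lborel"
    by (intro countable_imp_null_set_lborel) simp
  then show "emeasure lborel (range (\<lambda>k::int. (of_int k - b) / a)) = 0" "range (\<lambda>k::int. (of_int k - b) / a) \<in> sets lborel"
    by auto
qed

lemma saw_normal_integrable:
  assumes "R > 0" "\<sigma> > 0"
  shows "integrable lborel (\<lambda>z. saw R z * normal_density m \<sigma> z)"
proof (rule Bochner_Integration.integrable_bound)
  show "integrable lborel (\<lambda>z. R * normal_density m \<sigma> z)" using assms by simp
  show "AE z in lborel. norm (saw R z * normal_density m \<sigma> z) \<le> norm (R * normal_density m \<sigma> z)"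
    using saw_abs_le[OF assms(1)] assms by (auto simp: abs_mult intro!: mult_right_mono)
qed simp

text \<open>The reduction to one dimension. The factor \<open>\<rho>\<close> / r of the density
  cancels the denominator of \<open>saw_ratio\<close>, and the subtracted Gaussian centred at -r
  becomes, by oddness of \<open>saw\<close>, the missing negative half of the integral.\<close>

lemma integral_saw_ratio_radial:
  assumes R: "R > 0" and s: "\<sigma> > 0" and r: "r > 0"
  shows "(\<integral>\<rho>. radial_density \<sigma> r \<rho> * saw_ratio R \<rho> \<partial>lborel) = (\<integral>z. saw R z * normal_density r \<sigma> z \<partial>lborel) / r"
proof -
  let ?P = "\<lambda>m z. indicator {0<..} z * (saw R z * normal_density m \<sigma> z)"
  let ?N = "\<lambda>z. indicator {..<0} z * (saw R z * normal_density r \<sigma> z)"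
  have intP: "integrable lborel (?P m)" for m
    using integrable_mult_indicator[OF _ saw_normal_integrable[OF R s], of "{0<..}" m] by simp
  have intN: "integrable lborel ?N"
    using integrable_mult_indicator[OF _ saw_normal_integrable[OF R s], of "{..<0}" r] by simp
  have "(\<integral>\<rho>. radial_density \<sigma> r \<rho> * saw_ratio R \<rho> \<partial>lborel) = (\<integral>\<rho>. (?P r \<rho> - ?P (-r) \<rho>) / r \<partial>lborel)"
    using r by (intro Bochner_Integration.integral_cong)
      (auto simp: radial_density_def saw_ratio_def field_simps split: split_indicator)
  also have "\<dots> = ((\<integral>\<rho>. ?P r \<rho> \<partial>lborel) - (\<integral>\<rho>. ?P (-r) \<rho> \<partial>lborel)) / r"
    using intP by simp
  also have "(\<integral>\<rho>. ?P (-r) \<rho> \<partial>lborel) = (\<integral>z. ?P (-r) (- z) \<partial>lborel)"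
    by (subst lborel_integral_real_affine[where c = "-1" and t = 0]) simp_all
  also have "\<dots> = (\<integral>z. - ?N z \<partial>lborel)"
  proof (rule integral_cong_AE)
    have "AE z in lborel. (1 / (2 * R)) * z + (- 1 / 2) \<notin> \<int>" using R by (intro AE_not_lattice) simp
    then show "AE z in lborel. ?P (-r) (- z) = - ?N z"
    proof eventually_elim
      case (elim z)
      then have "saw R (- z) = - saw R z" by (intro saw_minus) simp
      moreover have "normal_density (-r) \<sigma> (-z) = normal_density r \<sigma> z"
        by (simp add: normal_density_def power2_eq_square algebra_simps)
      ultimately show ?case by (auto split: split_indicator)
    qed
  qed measurable
  also have "\<dots> = - (\<integral>z. ?N z \<partial>lborel)" by simp
  also have "(\<integral>\<rho>. ?P r \<rho> \<partial>lborel) - - (\<integral>z. ?N z \<partial>lborel) = (\<integral>z. ?P r z + ?N z \<partial>lborel)"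
    using intP intN by simp
  also have "\<dots> = (\<integral>z. saw R z * normal_density r \<sigma> z \<partial>lborel)"
    by (intro Bochner_Integration.integral_cong) (use saw_small[OF R, of 0] R in \<open>auto split: split_indicator\<close>)
  finally show ?thesis .
qed

text \<open>Moves mean and variance into the argument of \<open>saw\<close>, so that dominated
  convergence can work with one fixed Gaussian weight.\<close>

lemma integral_saw_normal_standardize:
  assumes s: "\<sigma> > 0"
  shows "(\<integral>z. saw R z * normal_density r \<sigma> z \<partial>lborel) = (\<integral>z. saw R (r + \<sigma> * z) * std_normal_density z \<partial>lborel)"
proof -
  have "\<sigma> * normal_density r \<sigma> (r + \<sigma> * z) = std_normal_density z" for z
    using s by (simp add: normal_density_def real_sqrt_mult power_mult_distrib field_simps)
  then have "(\<lambda>z. \<sigma> * (saw R (r + \<sigma> * z) * normal_density r \<sigma> (r + \<sigma> * z))) = (\<lambda>z. saw R (r + \<sigma> * z) * std_normal_density z)"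
    by (auto simp: fun_eq_iff mult.left_commute[of \<sigma>])
  then show ?thesis
    using s by (subst lborel_integral_real_affine[where c = \<sigma> and t = r])
      (simp_all add: integral_mult_right_zero[symmetric] del: integral_mult_right_zero)
qed

lemma integral_saw_boundary:
  assumes R: "R > 0" and s: "\<sigma> > 0"
  shows "(\<integral>z. saw R (R + \<sigma> * z) * std_normal_density z \<partial>lborel) = 0"
proof -
  let ?g = "\<lambda>z. saw R (R + \<sigma> * z) * std_normal_density z"
  have "(\<integral>z. ?g z \<partial>lborel) = (\<integral>z. ?g (- z) \<partial>lborel)"
    by (subst lborel_integral_real_affine[where c = "-1" and t = 0]) simp_all
  also have "\<dots> = (\<integral>z. - ?g z \<partial>lborel)"
  proof (rule integral_cong_AE)
    have "AE z in lborel. (\<sigma> / (2 * R)) * z + 0 \<notin> \<int>" using R s by (intro AE_not_lattice) simp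
    then show "AE z in lborel. ?g (- z) = - ?g z"
    proof eventually_elim
      case (elim z)
      then have "saw R (R - \<sigma> * z) = - saw R (R + \<sigma> * z)" using R by (intro saw_reflect) auto
      then show ?case by (simp add: std_normal_density_def)
    qed
  qed measurable
  finally show ?thesis by simp
qed

text \<open>Provides the boundary hypothesis \<open>vlim\<close> of the exit estimate. The
  standardised integrands converge off the jumps of the limit and are dominated by R times the
  Gaussian density; the limit vanishes by antisymmetry about R.\<close>

lemma saw_radial_boundary_limit:
  fixes xn :: "nat \<Rightarrow> 'e::real_normed_vector"
  assumes R: "R > 0" and t: "t > 0" and x: "norm x = R" and tn: "tn \<longlonglongrightarrow> t" and xn: "xn \<longlonglongrightarrow> x"
    and tp: "\<And>n. tn n > 0"
  shows "(\<lambda>n. \<integral>\<rho>. radial_density (sqrt (tn n)) (norm (xn n)) \<rho> * saw_ratio R \<rho> \<partial>lborel) \<longlonglongrightarrow> 0"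
proof -
  have nl: "(\<lambda>n. norm (xn n)) \<longlonglongrightarrow> R" using tendsto_norm[OF xn] x by simp
  have "(\<lambda>n. \<integral>z. saw R (norm (xn n) + sqrt (tn n) * z) * std_normal_density z \<partial>lborel) \<longlonglongrightarrow>
     (\<integral>z. saw R (R + sqrt t * z) * std_normal_density z \<partial>lborel)"
  proof (rule integral_dominated_convergence[where w = "\<lambda>z. R * std_normal_density z"])
    show "integrable lborel (\<lambda>z. R * std_normal_density z)" by simp
    have "AE z in lborel. (sqrt t / (2 * R)) * z + 0 \<notin> \<int>" using R t by (intro AE_not_lattice) simp
    then show "AE z in lborel. (\<lambda>n. saw R (norm (xn n) + sqrt (tn n) * z) * std_normal_density z) \<longlonglongrightarrow>
       saw R (R + sqrt t * z) * std_normal_density z"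
    proof eventually_elim
      case (elim z)
      have "(R + sqrt t * z) / (2 * R) - 1 / 2 = (sqrt t / (2 * R)) * z + 0" using R by (simp add: field_simps)
      then show ?case using elim R
        by (intro tendsto_intros saw_tendsto nl tn) auto
    qed
    show "AE z in lborel. norm (saw R (norm (xn n) + sqrt (tn n) * z) * std_normal_density z) \<le> R * std_normal_density z" for n
      using saw_abs_le[OF R] by (auto simp: abs_mult intro!: mult_right_mono)
  qed measurable
  then have "(\<lambda>n. (\<integral>z. saw R (norm (xn n) + sqrt (tn n) * z) * std_normal_density z \<partial>lborel) / norm (xn n)) \<longlonglongrightarrow> 0 / R"
    unfolding integral_saw_boundary[OF R real_sqrt_gt_zero[OF t]] using R by (intro tendsto_divide nl) auto
  moreover have "\<forall>\<^sub>F n in sequentially. norm (xn n) > 0" using nl R by (rule order_tendstoD)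
  then have "\<forall>\<^sub>F n in sequentially. (\<integral>z. saw R (norm (xn n) + sqrt (tn n) * z) * std_normal_density z \<partial>lborel) / norm (xn n) =
     (\<integral>\<rho>. radial_density (sqrt (tn n)) (norm (xn n)) \<rho> * saw_ratio R \<rho> \<partial>lborel)"
    by eventually_elim (use R tp in \<open>simp add: integral_saw_ratio_radial integral_saw_normal_standardize\<close>)
  ultimately show ?thesis by (simp add: Lim_transform_eventually)
qed

lemma radial_density_nonneg:
  assumes "\<sigma> > 0" "r \<ge> 0"
  shows "0 \<le> radial_density \<sigma> r \<rho>"
proof (cases "\<rho> > 0 \<and> r \<noteq> 0")
  case True
  have "- (\<rho> + r)\<^sup>2 \<le> - (\<rho> - r)\<^sup>2" using True assms by (simp add: power2_eq_square algebra_simps)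
  then have "normal_density (-r) \<sigma> \<rho> \<le> normal_density r \<sigma> \<rho>"
    unfolding normal_density_def using assms
    by (intro mult_left_mono) (auto intro!: divide_right_mono)
  then show ?thesis using True assms by (simp add: radial_density_def)
next
  case False
  then show ?thesis using assms by (auto simp: radial_density_def)
qed

text \<open>The exit estimate for the norm, with \<open>saw_ratio R\<close> of the norm as terminal
  function.\<close>

lemma brownian_motion_3d_grid:
  assumes B: "brownian_motion_3d_0 N X" and s: "s > 0" and R: "R > 0"
  shows "(\<lambda>n. measure N {\<omega>\<in>space N. \<forall>k\<le>2^n. norm (X (real k * (s / 2 ^ n)) \<omega>) \<le> R}) \<longlonglongrightarrow>
    (\<integral>\<rho>. radial_density (sqrt s) 0 \<rho> * saw_ratio R \<rho> \<partial>lborel)"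
proof -
  interpret independent_increments N "\<lambda>t \<omega>. coords3 (X t \<omega>)" 0
    by (rule independent_increments_brownian_motion_3d[OF B])
  have law: "(\<integral>\<omega>. saw_ratio R (norm (x + (coords3 (X s \<omega>) - coords3 (X u \<omega>)))) \<partial>N) =
      (\<integral>\<rho>. radial_density (sqrt (s - u)) (norm x) \<rho> * saw_ratio R \<rho> \<partial>lborel)" if "0 \<le> u" "u < s" for u x
    using that by (intro distributed_integral[symmetric, OF brownian_motion_3d_norm_law[OF B that]])
      (auto intro!: radial_density_nonneg)
  have "(\<lambda>n. measure N {\<omega>\<in>space N. \<forall>k\<le>2^n. norm (coords3 (X (real k * (s / 2 ^ n)) \<omega>)) \<le> R}) \<longlonglongrightarrow>
      (\<integral>\<omega>. saw_ratio R (norm (coords3 (X s \<omega>))) \<partial>N)"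
  proof (rule grid_exit_probability[OF s, where v = "\<lambda>t x. \<integral>\<rho>. radial_density (sqrt t) (norm x) \<rho> * saw_ratio R \<rho> \<partial>lborel"])
    show "continuous_on UNIV (norm :: real \<times> real \<times> real \<Rightarrow> real)" by (intro continuous_intros)
  qed (use R in \<open>auto simp: law saw_ratio_abs_le saw_ratio_small intro!: saw_radial_boundary_limit\<close>)
  also have "(\<integral>\<omega>. saw_ratio R (norm (coords3 (X s \<omega>))) \<partial>N) =
      (\<integral>\<omega>. saw_ratio R (norm (0 + (coords3 (X s \<omega>) - coords3 (X 0 \<omega>)))) \<partial>N)"
  proof (rule integral_cong_AE)
    have [measurable]: "(\<lambda>\<omega>. coords3 (X s \<omega>)) \<in> borel_measurable N" "(\<lambda>\<omega>. coords3 (X 0 \<omega>)) \<in> borel_measurable N"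
      using B_measurable s by auto
    show "(\<lambda>\<omega>. saw_ratio R (norm (coords3 (X s \<omega>)))) \<in> borel_measurable N"
      "(\<lambda>\<omega>. saw_ratio R (norm (0 + (coords3 (X s \<omega>) - coords3 (X 0 \<omega>))))) \<in> borel_measurable N"
      by measurable
    show "AE \<omega> in N. saw_ratio R (norm (coords3 (X s \<omega>))) = saw_ratio R (norm (0 + (coords3 (X s \<omega>) - coords3 (X 0 \<omega>))))"
      using start by eventually_elim simp
  qed
  also have "\<dots> = (\<integral>\<rho>. radial_density (sqrt s) 0 \<rho> * saw_ratio R \<rho> \<partial>lborel)"
    using law[of 0 0] s by simp
  finally show ?thesis by (simp add: norm_coords3)
qed

section \<open>Transfer from the spatial norm to the Bessel process\<close>

lemma path_of_measurable:
  assumes "\<And>t. 0 \<le> t \<Longrightarrow> Y t \<in> borel_measurable M"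
  shows "path_of Y \<in> M \<rightarrow>\<^sub>M path_space"
  unfolding path_of_def using assms by (intro measurable_restrict) auto

locale bessel =
  fixes M :: "'a measure" and Y :: "real \<Rightarrow> 'a \<Rightarrow> real"
  assumes bessel: "bessel3_0 M Y"
begin

sublocale prob_space M using bessel by (simp add: bessel3_0_def)

lemma Y_measurable: "0 \<le> t \<Longrightarrow> Y t \<in> borel_measurable M"
  using bessel by (simp add: bessel3_0_def)

lemma Y_continuous: "AE \<omega> in M. continuous_on {0..} (\<lambda>t. Y t \<omega>)"
  using bessel by (simp add: bessel3_0_def)

lemma norm_brownian_law:
  obtains N :: "(real \<Rightarrow> real ^ 3) measure" and X where "brownian_motion_3d_0 N X"
    "distr M path_space (path_of Y) = distr N path_space (path_of (\<lambda>t \<omega>. norm (X t \<omega>)))"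
    "path_of (\<lambda>t \<omega>. norm (X t \<omega>)) \<in> N \<rightarrow>\<^sub>M path_space"
proof -
  obtain N :: "(real \<Rightarrow> real ^ 3) measure" and X where X: "brownian_motion_3d_0 N X"
    "distr M path_space (path_of Y) = distr N path_space (path_of (\<lambda>t \<omega>. norm (X t \<omega>)))"
    using bessel by (auto simp: bessel3_0_def)
  note N = independent_increments_brownian_motion_3d[OF X(1)]
  have "(\<lambda>\<omega>. norm (X t \<omega>)) \<in> borel_measurable N" if "0 \<le> t" for t
    using measurable_compose[OF independent_increments.B_measurable[OF N that] borel_measurable_norm] by (simp add: norm_coords3)
  then show ?thesis using X by (intro that[of N X] path_of_measurable) auto
qed

lemma Y_start: "AE \<omega> in M. Y 0 \<omega> = 0"
proof -
  obtain N :: "(real \<Rightarrow> real ^ 3) measure" and X where X: "brownian_motion_3d_0 N X"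
    "distr M path_space (path_of Y) = distr N path_space (path_of (\<lambda>t \<omega>. norm (X t \<omega>)))"
    "path_of (\<lambda>t \<omega>. norm (X t \<omega>)) \<in> N \<rightarrow>\<^sub>M path_space"
    by (rule norm_brownian_law)
  note N = independent_increments_brownian_motion_3d[OF X(1)]
  have m[measurable]: "(\<lambda>p. p 0) \<in> borel_measurable (path_space :: (real \<Rightarrow> real) measure)"
    by (rule measurable_component_singleton) simp
  have s: "{p \<in> space path_space. p 0 = (0::real)} \<in> sets path_space" by measurable
  have "AE \<omega> in N. norm (X 0 \<omega>) = 0"
    using independent_increments.start[OF N] by eventually_elim (simp add: norm_coords3[symmetric])
  then have "AE p in distr N path_space (path_of (\<lambda>t \<omega>. norm (X t \<omega>))). p 0 = 0"
    by (subst AE_distr_iff[OF X(3) s]) (simp add: path_of_def)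
  then show ?thesis
    unfolding X(2)[symmetric] by (subst (asm) AE_distr_iff[OF path_of_measurable[OF Y_measurable] s]) (simp_all add: path_of_def)
qed

lemma Y_law:
  assumes s: "s > 0"
  shows "distributed M lborel (Y s) (\<lambda>\<rho>. ennreal (radial_density (sqrt s) 0 \<rho>))"
proof -
  obtain N :: "(real \<Rightarrow> real ^ 3) measure" and X where X: "brownian_motion_3d_0 N X"
    "distr M path_space (path_of Y) = distr N path_space (path_of (\<lambda>t \<omega>. norm (X t \<omega>)))"
    "path_of (\<lambda>t \<omega>. norm (X t \<omega>)) \<in> N \<rightarrow>\<^sub>M path_space"
    by (rule norm_brownian_law)
  note N = independent_increments_brownian_motion_3d[OF X(1)]
  have m[measurable]: "(\<lambda>p. p s) \<in> borel_measurable (path_space :: (real \<Rightarrow> real) measure)"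
    using s by (intro measurable_component_singleton) simp
  have m': "(\<lambda>p. p s) \<in> (path_space :: (real \<Rightarrow> real) measure) \<rightarrow>\<^sub>M lborel" using m by simp
  have [measurable]: "(\<lambda>\<omega>. norm (X s \<omega>)) \<in> borel_measurable N"
    using measurable_compose[OF X(3) m] s by (simp add: path_of_def)
  have "distr M lborel (Y s) = distr (distr M path_space (path_of Y)) lborel (\<lambda>p. p s)"
    by (subst distr_distr[OF m' path_of_measurable[OF Y_measurable]]) (use s in \<open>simp_all add: comp_def path_of_def\<close>)
  also have "\<dots> = distr N lborel (\<lambda>\<omega>. norm (X s \<omega>))"
    unfolding X(2) by (subst distr_distr[OF m' X(3)]) (use s in \<open>simp add: comp_def path_of_def\<close>)
  also have "\<dots> = distr N lborel (\<lambda>\<omega>. norm (0 + (coords3 (X s \<omega>) - coords3 (X 0 \<omega>))))"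
  proof (rule distr_cong_AE[OF refl refl])
    show "AE \<omega> in N. norm (X s \<omega>) = norm (0 + (coords3 (X s \<omega>) - coords3 (X 0 \<omega>)))"
      using independent_increments.start[OF N] by eventually_elim (simp add: norm_coords3)
  qed (use independent_increments.B_measurable[OF N, of s] independent_increments.B_measurable[OF N, of 0] s in simp_all)
  also have "\<dots> = density lborel (\<lambda>\<rho>. ennreal (radial_density (sqrt s) 0 \<rho>))"
    using brownian_motion_3d_norm_law[OF X(1), of 0 s 0] s by (simp add: distributed_def)
  finally show ?thesis using Y_measurable[of s] s by (simp add: distributed_def)
qed

lemma Y_integral:
  assumes "s > 0" "h \<in> borel_measurable borel"
  shows "(\<integral>\<omega>. h (Y s \<omega>) \<partial>M) = (\<integral>\<rho>. radial_density (sqrt s) 0 \<rho> * h \<rho> \<partial>lborel)"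
  using assms by (intro distributed_integral[symmetric, OF Y_law]) (auto intro: radial_density_nonneg)

lemma Y_pos:
  assumes "s > 0"
  shows "AE \<omega> in M. Y s \<omega> > 0"
proof -
  have "AE \<rho> in lborel. 0 < ennreal (radial_density (sqrt s) 0 \<rho>) \<longrightarrow> 0 < \<rho>"
    by (auto simp: radial_density_def)
  then show ?thesis using distributed_AE2[OF Y_law[OF assms], of "\<lambda>\<rho>. 0 < \<rho>"] by simp
qed

text \<open>A condition on finitely many grid times is an event of path space, so its probability is
  shared by all processes with the same path law.\<close>

lemma Y_grid:
  assumes s: "s > 0" and R: "R > 0"
  shows "(\<lambda>n. prob {\<omega>\<in>space M. \<forall>k\<le>2^n. Y (real k * (s / 2 ^ n)) \<omega> \<le> R}) \<longlonglongrightarrow> (\<integral>\<omega>. saw_ratio R (Y s \<omega>) \<partial>M)"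
proof -
  obtain N :: "(real \<Rightarrow> real ^ 3) measure" and X where X: "brownian_motion_3d_0 N X"
    "distr M path_space (path_of Y) = distr N path_space (path_of (\<lambda>t \<omega>. norm (X t \<omega>)))"
    "path_of (\<lambda>t \<omega>. norm (X t \<omega>)) \<in> N \<rightarrow>\<^sub>M path_space"
    by (rule norm_brownian_law)
  have "prob {\<omega>\<in>space M. \<forall>k\<le>2^n. Y (real k * (s / 2 ^ n)) \<omega> \<le> R} =
    measure N {\<omega>\<in>space N. \<forall>k\<le>2^n. norm (X (real k * (s / 2 ^ n)) \<omega>) \<le> R}" for n
  proof -
    let ?A = "{p \<in> space path_space. \<forall>k\<in>{..2^n}. p (real k * (s / 2 ^ n)) \<le> R}"
    have k0: "0 \<le> real k * (s / 2 ^ n)" for k using s by simp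
    have "{p \<in> space path_space. p (real k * (s / 2 ^ n)) \<le> R} \<in> sets path_space" for k
    proof -
      have [measurable]: "(\<lambda>p. p (real k * (s / 2 ^ n))) \<in> borel_measurable (path_space :: (real \<Rightarrow> real) measure)"
        using k0 by (intro measurable_component_singleton) simp
      show ?thesis by measurable
    qed
    then have A: "?A \<in> sets path_space" by (intro sets.sets_Collect_finite_All) simp_all
    have "prob {\<omega>\<in>space M. \<forall>k\<le>2^n. Y (real k * (s / 2 ^ n)) \<omega> \<le> R} = measure (distr M path_space (path_of Y)) ?A"
      by (subst measure_distr[OF path_of_measurable[OF Y_measurable] A])
         (use k0 in \<open>auto intro!: arg_cong[where f = prob] simp: path_of_def space_PiM\<close>)
    also have "\<dots> = measure N {\<omega>\<in>space N. \<forall>k\<le>2^n. norm (X (real k * (s / 2 ^ n)) \<omega>) \<le> R}"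
      unfolding X(2) by (subst measure_distr[OF X(3) A])
         (use k0 in \<open>auto intro!: arg_cong[where f = "measure N"] simp: path_of_def space_PiM\<close>)
    finally show ?thesis .
  qed
  then show ?thesis
    using brownian_motion_3d_grid[OF X(1) s R] Y_integral[OF s, of "saw_ratio R"] by simp
qed

end

section \<open>The running maximum through dyadic grids\<close>

definition grid_max :: "real \<Rightarrow> nat \<Rightarrow> (real \<Rightarrow> real) \<Rightarrow> real" where
  "grid_max s n y = Max ((\<lambda>k. y (real k * (s / 2 ^ n))) ` {..2 ^ n})"

text \<open>A limit over grids rather than a supremum over an interval: it uses countably many
  coordinates and is thus measurable on path space, while for continuous paths it is the true
  maximum.\<close>

definition runmax :: "real \<Rightarrow> (real \<Rightarrow> real) \<Rightarrow> real" where
  "runmax s y = lim (\<lambda>n. grid_max s n y)"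

lemma runmax_measurable:
  assumes "s > 0"
  shows "runmax s \<in> borel_measurable path_space"
proof -
  have [measurable]: "(\<lambda>p. p (real k * (s / 2 ^ n))) \<in> borel_measurable (path_space :: (real \<Rightarrow> real) measure)" for k n
    using assms by (intro measurable_component_singleton) simp
  have "grid_max s n \<in> borel_measurable path_space" for n
  proof -
    have "(\<lambda>y. Max ((\<lambda>k. y (real k * (s / 2 ^ n))) ` {..2 ^ n})) \<in> borel_measurable (path_space :: (real \<Rightarrow> real) measure)"
      by (rule borel_measurable_Max) measurable
    then show ?thesis unfolding grid_max_def[abs_def] .
  qed
  then show ?thesis unfolding runmax_def by measurable
qed

lemma runmax_path_of: "s > 0 \<Longrightarrow> runmax s (path_of Y \<omega>) = runmax s (\<lambda>u. Y u \<omega>)"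
  unfolding runmax_def grid_max_def path_of_def by simp

lemma grid_max_tendsto:
  assumes y: "continuous_on {0..} y" and s: "s > 0" and u: "u \<in> {0..s}" "\<And>v. v \<in> {0..s} \<Longrightarrow> y v \<le> y u"
  shows "(\<lambda>n. grid_max s n y) \<longlonglongrightarrow> y u"
proof (rule tendsto_sandwich)
  \<comment> \<open>The last grid point not after the maximiser u; its distance to u is below the
    mesh.\<close>
  define k where "k n = nat \<lfloor>u / (s / 2 ^ n)\<rfloor>" for n
  have h: "s / 2 ^ n > 0" for n using s by simp
  have kr: "real (k n) \<le> u / (s / 2 ^ n)" "u / (s / 2 ^ n) < real (k n) + 1" for n
  proof -
    have "0 \<le> u / (s / 2 ^ n)" using u h[of n] by (intro divide_nonneg_pos) auto
    then show "real (k n) \<le> u / (s / 2 ^ n)" "u / (s / 2 ^ n) < real (k n) + 1" unfolding k_def by linarith+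
  qed
  have ku: "real (k n) * (s / 2 ^ n) \<le> u" "u < real (k n) * (s / 2 ^ n) + s / 2 ^ n" for n
  proof -
    show "real (k n) * (s / 2 ^ n) \<le> u" using kr(1)[of n] h[of n] by (subst (asm) pos_le_divide_eq) auto
    have "u < (real (k n) + 1) * (s / 2 ^ n)" using kr(2)[of n] h[of n] by (subst (asm) pos_divide_less_eq) auto
    then show "u < real (k n) * (s / 2 ^ n) + s / 2 ^ n" by (simp only: distrib_right mult_1)
  qed
  have kN: "k n \<le> 2 ^ n" for n
  proof -
    have "real (k n) * (s / 2 ^ n) \<le> 2 ^ n * (s / 2 ^ n)" using ku(1)[of n] u by simp
    then have "real (k n) \<le> 2 ^ n" using h[of n] by (simp only: mult_le_cancel_right)
    then show ?thesis by (metis of_nat_le_iff of_nat_numeral of_nat_power)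
  qed
  have grid: "real j * (s / 2 ^ n) \<in> {0..s}" if "j \<le> 2 ^ n" for j n
  proof -
    have "real j \<le> 2 ^ n" using that by (metis of_nat_le_iff of_nat_numeral of_nat_power)
    then have "real j * (s / 2 ^ n) \<le> 2 ^ n * (s / 2 ^ n)" using h[of n] by (intro mult_right_mono) auto
    then show ?thesis using s by simp
  qed
  have "(\<lambda>n. s * (1/2) ^ n) \<longlonglongrightarrow> 0" by (intro tendsto_mult_right_zero LIMSEQ_realpow_zero) auto
  then have "(\<lambda>n. s / 2 ^ n) \<longlonglongrightarrow> 0" by (simp add: power_one_over)
  then have "(\<lambda>n. real (k n) * (s / 2 ^ n) - u) \<longlonglongrightarrow> 0"
  proof (rule Lim_null_comparison[rotated])
    show "\<forall>\<^sub>F n in sequentially. norm (real (k n) * (s / 2 ^ n) - u) \<le> s / 2 ^ n"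
    proof (rule always_eventually, rule allI)
      fix n
      have "\<bar>a - u\<bar> \<le> h" if "a \<le> u" "u < a + h" for a h :: real using that by linarith
      from this[OF ku] show "norm (real (k n) * (s / 2 ^ n) - u) \<le> s / 2 ^ n" by simp
    qed
  qed
  then have "(\<lambda>n. real (k n) * (s / 2 ^ n)) \<longlonglongrightarrow> u" by (rule LIM_zero_cancel)
  then show "(\<lambda>n. y (real (k n) * (s / 2 ^ n))) \<longlonglongrightarrow> y u"
    using u s by (intro continuous_on_tendsto_compose[OF y]) auto
  show "(\<lambda>n. y u) \<longlonglongrightarrow> y u" by simp
  show "\<forall>\<^sub>F n in sequentially. y (real (k n) * (s / 2 ^ n)) \<le> grid_max s n y"
    unfolding grid_max_def using kN by (intro always_eventually allI Max_ge) auto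
  show "\<forall>\<^sub>F n in sequentially. grid_max s n y \<le> y u"
    unfolding grid_max_def using u(2)[OF grid] by (intro always_eventually allI) (auto intro!: Max.boundedI)
qed

lemma runmax_attained:
  assumes y: "continuous_on {0..} y" and s: "s > 0"
  shows "\<exists>u\<in>{0..s}. runmax s y = y u \<and> (\<forall>v\<in>{0..s}. y v \<le> y u) \<and> (\<lambda>n. grid_max s n y) \<longlonglongrightarrow> y u"
proof -
  have "continuous_on {0..s} y" using y by (rule continuous_on_subset) auto
  then obtain u where u: "u \<in> {0..s}" "\<And>v. v \<in> {0..s} \<Longrightarrow> y v \<le> y u"
    using continuous_attains_sup[of "{0..s}" y] s by auto
  have "(\<lambda>n. grid_max s n y) \<longlonglongrightarrow> y u" by (rule grid_max_tendsto[OF y s u])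
  moreover from this have "runmax s y = y u" unfolding runmax_def by (rule limI)
  ultimately show ?thesis using u by blast
qed

lemma runmax_ge: "continuous_on {0..} y \<Longrightarrow> s > 0 \<Longrightarrow> u \<in> {0..s} \<Longrightarrow> y u \<le> runmax s y"
  using runmax_attained[of y s] by force

lemma runmax_le_iff_grid:
  assumes y: "continuous_on {0..} y" and s: "s > 0"
  shows "runmax s y \<le> R \<longleftrightarrow> (\<forall>n. \<forall>k\<le>2^n. y (real k * (s / 2 ^ n)) \<le> R)"
proof
  assume "runmax s y \<le> R"
  moreover have "y (real k * (s / 2 ^ n)) \<le> runmax s y" if "k \<le> 2 ^ n" for k n
  proof -
    have "real k \<le> 2 ^ n" using that by (metis of_nat_le_iff of_nat_numeral of_nat_power)
    then have "real k * (s / 2 ^ n) \<le> 2 ^ n * (s / 2 ^ n)" using s by (intro mult_right_mono) auto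
    then show ?thesis using s by (intro runmax_ge[OF y s]) simp
  qed
  ultimately show "\<forall>n. \<forall>k\<le>2^n. y (real k * (s / 2 ^ n)) \<le> R" by (meson order_trans)
next
  assume a: "\<forall>n. \<forall>k\<le>2^n. y (real k * (s / 2 ^ n)) \<le> R"
  obtain u where u: "runmax s y = y u" "(\<lambda>n. grid_max s n y) \<longlonglongrightarrow> y u" using runmax_attained[OF y s] by blast
  have "grid_max s n y \<le> R" for n unfolding grid_max_def using a by (intro Max.boundedI) auto
  then show "runmax s y \<le> R" unfolding u(1) by (intro LIMSEQ_le_const2[OF u(2)]) auto
qed

section \<open>Summing the sawtooths over dyadic radii\<close>

definition upfrac :: "real \<Rightarrow> real" where
  "upfrac x = x - of_int \<lceil>x\<rceil> + 1"

lemma upfrac_measurable [measurable]: "upfrac \<in> borel_measurable borel"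
  unfolding upfrac_def by measurable

lemma upfrac_bounds: "0 < upfrac x" "upfrac x \<le> 1"
  unfolding upfrac_def by linarith+

lemma ceiling_half_split: "\<lceil>x::real\<rceil> = \<lceil>x / 2\<rceil> + \<lceil>x / 2 - 1 / 2\<rceil>"
proof -
  define k where "k = \<lceil>x / 2\<rceil>"
  have k: "of_int k - 1 < x / 2" "x / 2 \<le> of_int k" unfolding k_def by linarith+
  show ?thesis
  proof (cases "x / 2 \<le> of_int k - 1 / 2")
    case True
    then have "\<lceil>x / 2 - 1 / 2\<rceil> = k - 1" "\<lceil>x\<rceil> = 2 * k - 1" using k by linarith+
    then show ?thesis unfolding k_def[symmetric] by simp
  next
    case False
    then have "\<lceil>x / 2 - 1 / 2\<rceil> = k" "\<lceil>x\<rceil> = 2 * k" using k by linarith+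
    then show ?thesis unfolding k_def[symmetric] by simp
  qed
qed

text \<open>By \<open>ceiling_half_split\<close> the term at radius 2^K r is 2 \<open>upfrac\<close>
  x - 2 \<open>upfrac\<close> (x / 2) with x = y / r / 2^K, so the sum telescopes.\<close>

lemma saw_dyadic_sum:
  assumes "r > 0"
  shows "(\<Sum>k<K. saw (2 ^ k * r) y / (2 ^ k * r)) = 2 * upfrac (y / r) - 2 * upfrac (y / r / 2 ^ K)"
proof (induction K)
  case (Suc K)
  define x where "x = y / r / 2 ^ K"
  have y: "y = 2 ^ K * r * x" using assms by (simp add: x_def)
  have "saw (2 ^ K * r) y / (2 ^ K * r) = x - 2 * of_int \<lceil>x / 2 - 1 / 2\<rceil>"
    using assms unfolding saw_def y by (simp add: field_simps)
  also have "\<dots> = x - 2 * (of_int \<lceil>x\<rceil> - of_int \<lceil>x / 2\<rceil>)"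
    using ceiling_half_split[of x] by simp
  also have "\<dots> = 2 * upfrac x - 2 * upfrac (x / 2)" by (simp add: upfrac_def)
  finally show ?case using Suc by (simp add: x_def field_simps)
qed simp

context bessel
begin

definition Mx :: "real \<Rightarrow> 'a \<Rightarrow> real" where
  "Mx s \<omega> = runmax s (\<lambda>u. Y u \<omega>)"

lemma Mx_measurable: "s > 0 \<Longrightarrow> Mx s \<in> borel_measurable M"
  using measurable_compose[OF path_of_measurable[OF Y_measurable] runmax_measurable[of s]]
  by (simp add: Mx_def[abs_def] runmax_path_of)

lemma Mx_ge_Y: "s > 0 \<Longrightarrow> AE \<omega> in M. Y s \<omega> \<le> Mx s \<omega>"
  using Y_continuous unfolding Mx_def by eventually_elim (auto intro: runmax_ge)

lemma Mx_pos: "s > 0 \<Longrightarrow> AE \<omega> in M. Mx s \<omega> > 0"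
  using Mx_ge_Y[of s] Y_pos[of s] by auto

text \<open>Each grid contains the previous one, so the grid events decrease; on continuous paths
  their intersection is the event for the true maximum.\<close>

lemma prob_Mx_le:
  assumes s: "s > 0" and R: "R > 0"
  shows "prob {\<omega>\<in>space M. Mx s \<omega> \<le> R} = (\<integral>\<omega>. saw_ratio R (Y s \<omega>) \<partial>M)"
proof -
  define A where "A n = {\<omega>\<in>space M. \<forall>k\<le>2^n. Y (real k * (s / 2 ^ n)) \<omega> \<le> R}" for n :: nat
  have Am: "A n \<in> sets M" for n
  proof -
    have [measurable]: "Y (real k * (s / 2 ^ n)) \<in> borel_measurable M" for k using s by (intro Y_measurable) simp
    have "A n = {\<omega>\<in>space M. \<forall>k\<in>{..2^n}. Y (real k * (s / 2 ^ n)) \<omega> \<le> R}" by (auto simp: A_def)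
    moreover have "{\<omega>\<in>space M. \<forall>k\<in>{..2^n}. Y (real k * (s / 2 ^ n)) \<omega> \<le> R} \<in> sets M" by measurable
    ultimately show ?thesis by simp
  qed
  have "decseq A"
  proof (rule decseq_SucI, rule subsetI)
    fix n \<omega> assume w: "\<omega> \<in> A (Suc n)"
    have "Y (real k * (s / 2 ^ n)) \<omega> \<le> R" if "k \<le> 2 ^ n" for k
    proof -
      have "\<forall>j\<le>2 ^ Suc n. Y (real j * (s / 2 ^ Suc n)) \<omega> \<le> R" using w unfolding A_def by blast
      moreover have "2 * k \<le> 2 ^ Suc n" using that by simp
      ultimately have "Y (real (2 * k) * (s / 2 ^ Suc n)) \<omega> \<le> R" by blast
      moreover have "real (2 * k) * (s / 2 ^ Suc n) = real k * (s / 2 ^ n)" by simp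
      ultimately show ?thesis by (simp only:)
    qed
    then show "\<omega> \<in> A n" using w by (simp add: A_def)
  qed
  then have "(\<lambda>n. prob (A n)) \<longlonglongrightarrow> prob (\<Inter>n. A n)"
    using Am by (intro finite_Lim_measure_decseq) auto
  moreover have "(\<lambda>n. prob (A n)) \<longlonglongrightarrow> (\<integral>\<omega>. saw_ratio R (Y s \<omega>) \<partial>M)"
    using Y_grid[OF s R] by (simp add: A_def)
  ultimately have "prob (\<Inter>n. A n) = (\<integral>\<omega>. saw_ratio R (Y s \<omega>) \<partial>M)" by (rule LIMSEQ_unique)
  moreover have "prob {\<omega>\<in>space M. Mx s \<omega> \<le> R} = prob (\<Inter>n. A n)"
  proof (rule finite_measure_eq_AE)
    show "AE \<omega> in M. \<omega> \<in> {\<omega>\<in>space M. Mx s \<omega> \<le> R} \<longleftrightarrow> \<omega> \<in> (\<Inter>n. A n)"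
      using Y_continuous AE_space by eventually_elim (auto simp: A_def Mx_def runmax_le_iff_grid s)
    show "{\<omega>\<in>space M. Mx s \<omega> \<le> R} \<in> sets M" using Mx_measurable[OF s] by measurable
    show "(\<Inter>n. A n) \<in> sets M" using Am by (intro sets.countable_INT) auto
  qed
  ultimately show ?thesis by simp
qed

text \<open>Since \<open>saw_ratio\<close> is 1 up to R and at least -1 beyond, 1 -
  \<open>saw_ratio\<close> is at most twice the indicator of Y exceeding R. This yields the factor 2
  of a reflection inequality.\<close>

lemma prob_Mx_gt_le:
  assumes s: "s > 0" and R: "R > 0"
  shows "prob {\<omega>\<in>space M. Mx s \<omega> > R} \<le> 2 * prob {\<omega>\<in>space M. Y s \<omega> > R}"
proof -
  have [measurable]: "Mx s \<in> borel_measurable M" "Y s \<in> borel_measurable M"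
    using s by (auto intro: Mx_measurable Y_measurable)
  have i: "integrable M (\<lambda>\<omega>. saw_ratio R (Y s \<omega>))"
    by (rule integrable_const_bound[where B = 1]) (use saw_ratio_abs_le[OF R] in auto)
  have "{\<omega>\<in>space M. Mx s \<omega> > R} = space M - {\<omega>\<in>space M. Mx s \<omega> \<le> R}" by auto
  then have "prob {\<omega>\<in>space M. Mx s \<omega> > R} = 1 - prob {\<omega>\<in>space M. Mx s \<omega> \<le> R}"
    by (simp add: prob_compl)
  also have "\<dots> = (\<integral>\<omega>. 1 - saw_ratio R (Y s \<omega>) \<partial>M)"
    unfolding prob_Mx_le[OF s R] using i by (simp add: prob_space)
  also have "\<dots> \<le> (\<integral>\<omega>. 2 * indicator {\<omega>\<in>space M. Y s \<omega> > R} \<omega> \<partial>M)"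
  proof (rule integral_mono_AE)
    show "AE \<omega> in M. 1 - saw_ratio R (Y s \<omega>) \<le> 2 * indicator {\<omega>\<in>space M. Y s \<omega> > R} \<omega>"
      using Y_pos[OF s] AE_space
    proof eventually_elim
      case (elim \<omega>)
      have "- 1 \<le> saw_ratio R (Y s \<omega>)" using saw_ratio_abs_le[OF R, of "Y s \<omega>"] by (simp add: abs_le_iff)
      then show ?case using saw_ratio_small[OF R, of "Y s \<omega>"] elim by (auto split: split_indicator)
    qed
    show "integrable M (\<lambda>\<omega>. 2 * indicator {\<omega>\<in>space M. Y s \<omega> > R} \<omega> :: real)"
      by (rule integrable_const_bound[where B = 2]) (auto split: split_indicator)
  qed (use i in simp)
  also have "\<dots> = 2 * prob {\<omega>\<in>space M. Y s \<omega> > R}" by simp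
  finally show ?thesis .
qed

end

text \<open>The inverses of all levels not below m, starting from index -n. Their geometric sum is
  the inverse of the level before the first of them, while the expectation of each summand is
  governed by \<open>prob_Mx_le\<close>. The cut at -n gives the telescoping sum a lower
  end.\<close>

definition level_sum :: "real \<Rightarrow> nat \<Rightarrow> real \<Rightarrow> real" where
  "level_sum \<theta> n m = (\<Sum>k. if m \<le> dlevel \<theta> (int k - int n) then 1 / dlevel \<theta> (int k - int n) else 0)"

lemma dlevel_geometric: "dlevel \<theta> (a + int k) = dlevel \<theta> a * 2 ^ k"
  using dlevel_diff_nat[of \<theta> "a + int k" k] by simp

lemma summable_inverse_dlevel: "summable (\<lambda>k. 1 / dlevel \<theta> (int k - int n))"
proof -
  have "summable (\<lambda>k. 1 / dlevel \<theta> (- int n) * (1/2) ^ k)" by (intro summable_mult summable_geometric) simp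
  also have "(\<lambda>k. 1 / dlevel \<theta> (- int n) * (1/2) ^ k) = (\<lambda>k. 1 / dlevel \<theta> (int k - int n))"
    using dlevel_geometric[of \<theta> "- int n"] by (simp add: fun_eq_iff power_one_over)
  finally show ?thesis .
qed

lemma summable_inverse_dlevel_if: "summable (\<lambda>k. if P k then 1 / dlevel \<theta> (int k - int n) else 0)"
  by (rule summable_comparison_test'[OF summable_inverse_dlevel[of \<theta> n], of 0]) simp

lemma level_sum_nonneg: "0 \<le> level_sum \<theta> n m"
  unfolding level_sum_def by (intro suminf_nonneg summable_inverse_dlevel_if) simp

lemma inverse_dlevel_tail: "(\<Sum>k. if a \<le> int k - int n then 1 / dlevel \<theta> (int k - int n) else 0) = 2 / dlevel \<theta> (max a (- int n))"
proof -
  define j where "j = nat (max a (- int n) + int n)"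
  have j: "int j = max a (- int n) + int n" unfolding j_def by simp
  have iff: "a \<le> int k - int n \<longleftrightarrow> j \<le> k" for k using j by linarith
  let ?f = "\<lambda>k. if a \<le> int k - int n then 1 / dlevel \<theta> (int k - int n) else 0"
  have "(\<lambda>k. ?f (k + j)) = (\<lambda>k. 1 / dlevel \<theta> (max a (- int n)) * (1/2) ^ k)"
  proof
    fix k
    have "int (k + j) - int n = max a (- int n) + int k" using j by simp
    then show "?f (k + j) = 1 / dlevel \<theta> (max a (- int n)) * (1/2) ^ k"
      by (simp only: iff dlevel_geometric) (simp add: power_one_over)
  qed
  moreover have "(\<lambda>k. 1 / dlevel \<theta> (max a (- int n)) * (1/2) ^ k) sums (1 / dlevel \<theta> (max a (- int n)) * (1 / (1 - 1/2)))"
    by (intro sums_mult geometric_sums) simp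
  ultimately have "(\<lambda>k. ?f (k + j)) sums (2 / dlevel \<theta> (max a (- int n)))" by simp
  moreover have "(\<Sum>k<j. ?f k) = 0" by (intro sum.neutral) (auto simp: iff)
  ultimately have "?f sums (2 / dlevel \<theta> (max a (- int n)))" using sums_iff_shift'[of ?f j] by simp
  then show ?thesis by (rule sums_unique[symmetric])
qed

text \<open>All levels beyond \<open>dindex \<theta> m\<close> exceed m, and their inverses add up
  to the inverse of the level at that index; the bound on n ensures that none of them is cut
  off.\<close>

lemma inverse_dlevel_le_level_sum:
  assumes m: "m > 0" and n: "- int n \<le> dindex \<theta> m + 1"
  shows "1 / dlevel \<theta> (dindex \<theta> m) \<le> level_sum \<theta> n m"
proof -
  let ?a = "dindex \<theta> m + 1"
  have "1 / dlevel \<theta> (dindex \<theta> m) = 2 / dlevel \<theta> (max ?a (- int n))"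
    using n by (simp add: max_def dlevel_Suc)
  also have "\<dots> = (\<Sum>k. if ?a \<le> int k - int n then 1 / dlevel \<theta> (int k - int n) else 0)"
    by (rule inverse_dlevel_tail[symmetric])
  also have "\<dots> \<le> level_sum \<theta> n m"
    unfolding level_sum_def
  proof (intro suminf_le summable_inverse_dlevel_if)
    fix k
    have "m \<le> dlevel \<theta> (int k - int n)" if "?a \<le> int k - int n"
      using dlevel_dindex(2)[OF m, of \<theta>] dlevel_mono[OF that, of \<theta>] by linarith
    then show "(if ?a \<le> int k - int n then 1 / dlevel \<theta> (int k - int n) else 0) \<le>
      (if m \<le> dlevel \<theta> (int k - int n) then 1 / dlevel \<theta> (int k - int n) else 0)"
      by auto
  qed
  finally show ?thesis .
qed

lemma dlevel_shift: "dlevel (\<theta> - e) j = 2 powr (- e) * dlevel \<theta> j"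
  by (simp add: dlevel_def powr_add[symmetric] algebra_simps)

text \<open>A level equal to m is counted in \<open>level_sum\<close> but also regarded as reached
  by \<open>dindex\<close>. Lowering the offset by e makes all levels strictly smaller and breaks
  such ties, at the price of a factor that tends to 1 with e.\<close>

lemma level_sum_le_inverse_dlevel:
  assumes m: "m > 0" and e: "e > 0"
  shows "level_sum (\<theta> - e) n m \<le> 2 powr e / dlevel \<theta> (dindex \<theta> m)"
proof -
  let ?a = "dindex \<theta> m + 1"
  have "level_sum (\<theta> - e) n m \<le> (\<Sum>k. if ?a \<le> int k - int n then 1 / dlevel (\<theta> - e) (int k - int n) else 0)"
    unfolding level_sum_def
  proof (intro suminf_le summable_inverse_dlevel_if)
    fix k
    have "?a \<le> int k - int n" if "m \<le> dlevel (\<theta> - e) (int k - int n)"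
    proof (rule ccontr)
      assume "\<not> ?a \<le> int k - int n"
      then have "dlevel \<theta> (int k - int n) \<le> dlevel \<theta> (dindex \<theta> m)" by (intro dlevel_mono) simp
      moreover have "dlevel (\<theta> - e) (int k - int n) < 1 * dlevel \<theta> (int k - int n)"
        unfolding dlevel_shift using e by (intro mult_strict_right_mono) (auto simp: powr_less_one)
      ultimately show False using that dlevel_dindex(1)[OF m, of \<theta>] by simp
    qed
    then show "(if m \<le> dlevel (\<theta> - e) (int k - int n) then 1 / dlevel (\<theta> - e) (int k - int n) else 0) \<le>
      (if ?a \<le> int k - int n then 1 / dlevel (\<theta> - e) (int k - int n) else 0)"
      by auto
  qed
  also have "\<dots> = 2 / dlevel (\<theta> - e) (max ?a (- int n))" by (rule inverse_dlevel_tail)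
  also have "\<dots> \<le> 2 / dlevel (\<theta> - e) ?a"
    by (intro divide_left_mono dlevel_mono mult_pos_pos) auto
  also have "\<dots> = 2 powr e / dlevel \<theta> (dindex \<theta> m)"
    unfolding dlevel_shift dlevel_Suc by (simp add: powr_minus field_simps)
  finally show ?thesis .
qed

text \<open>On the positive half line this is the density of Y_s divided by the variable, so it
  computes expectations of h(Y_s) / Y_s. Its odd extension to the whole line is smooth and vanishes
  at 0, as the integration by parts requires.\<close>

definition wdens :: "real \<Rightarrow> real \<Rightarrow> real" where
  "wdens s \<rho> = 2 * \<rho> / s * normal_density 0 (sqrt s) \<rho>"

lemma wdens_eq: "s > 0 \<Longrightarrow> \<rho> > 0 \<Longrightarrow> wdens s \<rho> = radial_density (sqrt s) 0 \<rho> * (1 / \<rho>)"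
  by (simp add: wdens_def radial_density_def power2_eq_square)

lemma wdens_integrable:
  assumes "s > 0" shows "integrable lborel (wdens s)"
proof -
  have "integrable lborel (\<lambda>x. normal_density 0 (sqrt s) x * (x - 0) ^ 1)"
    using assms by (intro integrable_normal_moment) simp
  then have "integrable lborel (\<lambda>x. (2 / s) * (normal_density 0 (sqrt s) x * (x - 0) ^ 1))" by simp
  also have "(\<lambda>x. (2 / s) * (normal_density 0 (sqrt s) x * (x - 0) ^ 1)) = wdens s"
    by (simp add: wdens_def fun_eq_iff)
  finally show ?thesis .
qed

definition wdens_deriv :: "real \<Rightarrow> real \<Rightarrow> real" where
  "wdens_deriv s \<rho> = (2 / s - 2 * \<rho>\<^sup>2 / s\<^sup>2) * normal_density 0 (sqrt s) \<rho>"

lemma normal_density_has_derivative: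
  assumes "s > 0"
  shows "(normal_density 0 (sqrt s) has_real_derivative (- \<rho> / s * normal_density 0 (sqrt s) \<rho>)) (at \<rho>)"
proof -
  have n: "normal_density 0 (sqrt s) = (\<lambda>x. 1 / sqrt (2 * pi * s) * exp (- x\<^sup>2 / (2 * s)))"
    using assms by (simp add: normal_density_def fun_eq_iff)
  show ?thesis
    unfolding n using assms by (auto intro!: derivative_eq_intros simp: field_simps)
qed

lemma wdens_has_derivative:
  assumes "s > 0" shows "(wdens s has_real_derivative wdens_deriv s \<rho>) (at \<rho>)"
  unfolding wdens_def[abs_def] wdens_deriv_def using assms
  by (auto intro!: derivative_eq_intros normal_density_has_derivative simp: field_simps power2_eq_square)

lemma wdens_deriv_integrable:
  assumes "s > 0" shows "integrable lborel (wdens_deriv s)"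
proof -
  have "integrable lborel (\<lambda>x. (2 / s) * normal_density 0 (sqrt s) x - (2 / s\<^sup>2) * (normal_density 0 (sqrt s) x * (x - 0) ^ 2))"
    using assms by (intro Bochner_Integration.integrable_diff integrable_mult_right integrable_normal_moment integrable_normal_density) simp_all
  also have "(\<lambda>x. (2 / s) * normal_density 0 (sqrt s) x - (2 / s\<^sup>2) * (normal_density 0 (sqrt s) x * (x - 0) ^ 2)) = wdens_deriv s"
    by (simp add: wdens_deriv_def fun_eq_iff left_diff_distrib)
  finally show ?thesis .
qed

lemma integral_wdens_Icc:
  assumes s: "s > 0" and b: "b \<ge> 0"
  shows "(\<integral>\<rho>. wdens s \<rho> * indicator {0..b} \<rho> \<partial>lborel) = 2 * normal_density 0 (sqrt s) 0 - 2 * normal_density 0 (sqrt s) b"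
proof -
  have "(\<integral>\<rho>. wdens s \<rho> * indicator {0..b} \<rho> \<partial>lborel) = (- 2 * normal_density 0 (sqrt s) b) - (- 2 * normal_density 0 (sqrt s) 0)"
  proof (rule integral_FTC_Icc_real[OF b])
    fix x :: real
    show "((\<lambda>x. - 2 * normal_density 0 (sqrt s) x) has_real_derivative wdens s x) (at x)"
      unfolding wdens_def using s
      by (auto intro!: derivative_eq_intros normal_density_has_derivative simp: field_simps)
    show "isCont (wdens s) x" using wdens_has_derivative[OF s] by (rule DERIV_isCont)
  qed
  then show ?thesis by simp
qed

text \<open>The continuous periodic antiderivative of 2 \<open>upfrac\<close> - 1 that vanishes at
  the integers.\<close>

definition sawint :: "real \<Rightarrow> real" where
  "sawint x = (upfrac x)\<^sup>2 - upfrac x"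

lemma sawint_measurable [measurable]: "sawint \<in> borel_measurable borel"
  unfolding sawint_def by measurable

lemma sawint_bound: "\<bar>sawint x\<bar> \<le> 1"
proof -
  have "0 \<le> upfrac x * (1 - upfrac x)" "upfrac x * (1 - upfrac x) \<le> 1"
    using upfrac_bounds[of x] by (auto intro!: mult_le_one mult_nonneg_nonneg)
  moreover have "sawint x = - (upfrac x * (1 - upfrac x))" by (simp add: sawint_def power2_eq_square algebra_simps)
  ultimately show ?thesis by simp
qed

text \<open>Both one-sided formulas agree at integers, since \<open>sawint\<close> vanishes there.\<close>

lemma sawint_local:
  assumes "of_int k \<le> x" "x \<le> of_int k + 1"
  shows "sawint x = (x - of_int k)\<^sup>2 - (x - of_int k)"
proof (cases "x = of_int k")
  case True
  then show ?thesis by (simp add: sawint_def upfrac_def)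
next
  case False
  then have "\<lceil>x\<rceil> = k + 1" using assms by linarith
  then show ?thesis by (simp add: sawint_def upfrac_def)
qed

lemma sawint_continuous: "continuous_on UNIV sawint"
proof -
  have "isCont sawint x" for x
  proof -
    let ?k = "\<lfloor>x\<rfloor>"
    have "continuous_on {of_int ?k - 1..of_int ?k} sawint"
    proof (subst continuous_on_cong[OF refl])
      show "sawint y = (y - of_int (?k - 1))\<^sup>2 - (y - of_int (?k - 1))" if "y \<in> {of_int ?k - 1..of_int ?k}" for y
        using that by (intro sawint_local) auto
    qed (intro continuous_intros)
    moreover have "continuous_on {of_int ?k..of_int ?k + 1} sawint"
    proof (subst continuous_on_cong[OF refl])
      show "sawint y = (y - of_int ?k)\<^sup>2 - (y - of_int ?k)" if "y \<in> {of_int ?k..of_int ?k + 1}" for y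
        using that by (intro sawint_local) auto
    qed (intro continuous_intros)
    ultimately have "continuous_on ({of_int ?k - 1..of_int ?k} \<union> {of_int ?k..of_int ?k + 1}) sawint"
      by (intro continuous_on_closed_Un) auto
    moreover have "x \<in> interior ({of_int ?k - 1..of_int ?k} \<union> {of_int ?k..of_int ?k + 1})"
    proof (rule interiorI[of "{of_int ?k - 1<..<of_int ?k + 1}"])
      show "x \<in> {of_int ?k - 1<..<of_int ?k + 1}" by simp linarith
    qed auto
    ultimately show ?thesis by (rule continuous_on_interior)
  qed
  then show ?thesis by (simp add: continuous_on_eq_continuous_at)
qed

lemma sawint_derivative:
  assumes "x \<notin> \<int>"
  shows "(sawint has_real_derivative (2 * upfrac x - 1)) (at x)"
proof -
  let ?k = "\<lfloor>x\<rfloor>"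
  have x: "of_int ?k < x" "x < of_int ?k + 1"
    using assms by (metis Ints_of_int floor_correct less_eq_real_def) linarith
  have "\<lceil>x\<rceil> = ?k + 1" using x by linarith
  then have u: "upfrac x = x - of_int ?k" by (simp add: upfrac_def)
  have "\<forall>\<^sub>F y in nhds x. y \<in> {of_int ?k<..<of_int ?k + 1}"
    using x by (intro eventually_nhds_in_open) auto
  then have ev: "\<forall>\<^sub>F y in nhds x. sawint y = (y - of_int ?k)\<^sup>2 - (y - of_int ?k)"
    by eventually_elim (auto intro!: sawint_local)
  have D: "((\<lambda>y. (y - of_int ?k)\<^sup>2 - (y - of_int ?k)) has_real_derivative (2 * upfrac x - 1)) (at x)"
    unfolding u by (auto intro!: derivative_eq_intros)
  show ?thesis by (rule DERIV_cong_ev[OF refl ev refl, THEN iffD2, OF D])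
qed

text \<open>Integration by parts in product form: the integrand is the derivative of
  \<open>wdens\<close> times \<open>sawint\<close> (N \<open>\<rho>\<close>) / N, and the boundary
  term at 0 vanishes with \<open>wdens\<close>.\<close>

lemma wdens_sawint_Icc:
  assumes s: "s > 0" and N: "N > 0" and b: "b \<ge> 0"
  shows "(\<integral>\<rho>. (wdens s \<rho> * (2 * upfrac (N * \<rho>) - 1) + wdens_deriv s \<rho> * sawint (N * \<rho>) / N) * indicator {0..b} \<rho> \<partial>lborel)
    = wdens s b * sawint (N * b) / N"
proof -
  let ?f = "\<lambda>\<rho>. wdens s \<rho> * (2 * upfrac (N * \<rho>) - 1) + wdens_deriv s \<rho> * sawint (N * \<rho>) / N"
  let ?F = "\<lambda>\<rho>. wdens s \<rho> * sawint (N * \<rho>) / N"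
  have cw: "continuous_on A (wdens s)" for A
    using wdens_has_derivative[OF s] by (meson DERIV_isCont continuous_at_imp_continuous_on)
  have H: "(?f has_integral (?F b - ?F 0)) {0..b}"
  \<comment> \<open>The exceptional points are the corners of the periodic factor, finitely many in
    a bounded interval.\<close>
  proof (rule fundamental_theorem_of_calculus_strong[where S = "(\<lambda>k::int. of_int k / N) ` {0..\<lceil>N * b\<rceil>}"])
    show "finite ((\<lambda>k::int. of_int k / N) ` {0..\<lceil>N * b\<rceil>})" by simp
    show "continuous_on {0..b} ?F"
      using continuous_on_compose2[OF sawint_continuous, of "{0..b}" "\<lambda>\<rho>. N * \<rho>"] N
      by (auto intro!: continuous_intros cw)
    show "(?F has_vector_derivative ?f x) (at x)" if x: "x \<in> {0..b} - (\<lambda>k::int. of_int k / N) ` {0..\<lceil>N * b\<rceil>}" for x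
    proof -
      have "N * x \<notin> \<int>"
      proof
        assume "N * x \<in> \<int>"
        then obtain k :: int where k: "N * x = of_int k" by (elim Ints_cases)
        then have "x = of_int k / N" using N by (simp add: field_simps)
        moreover have "0 \<le> N * x" "N * x \<le> N * b" using x N by auto
        then have "k \<in> {0..\<lceil>N * b\<rceil>}" unfolding k by (auto simp: le_ceiling_iff)
        ultimately show False using x by blast
      qed
      then have "((\<lambda>x. sawint (N * x)) has_real_derivative ((2 * upfrac (N * x) - 1) * N)) (at x)"
        by (intro DERIV_chain2[OF sawint_derivative]) (auto intro!: derivative_eq_intros)
      then have "(?F has_real_derivative ?f x) (at x)"
        using N by (auto intro!: derivative_eq_intros wdens_has_derivative[OF s] simp: field_simps)
      then show ?thesis by (simp add: has_real_derivative_iff_has_vector_derivative)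
    qed
  qed (rule b)
  have si: "set_integrable lborel {0..b} ?f"
  proof -
    have i: "integrable lborel ?f"
    proof (rule Bochner_Integration.integrable_bound)
      show "integrable lborel (\<lambda>\<rho>. \<bar>wdens s \<rho>\<bar> + \<bar>wdens_deriv s \<rho>\<bar> / N)"
        using wdens_integrable[OF s] wdens_deriv_integrable[OF s] by simp
      show "?f \<in> borel_measurable lborel"
        using wdens_integrable[OF s] wdens_deriv_integrable[OF s] by (auto dest!: borel_measurable_integrable)
      have "\<bar>wdens s \<rho> * (2 * upfrac (N * \<rho>) - 1)\<bar> \<le> \<bar>wdens s \<rho>\<bar> * 1" "\<bar>wdens_deriv s \<rho> * sawint (N * \<rho>) / N\<bar> \<le> \<bar>wdens_deriv s \<rho>\<bar> * 1 / N" for \<rho>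
      proof -
        have "\<bar>2 * upfrac (N * \<rho>) - 1\<bar> \<le> 1" using upfrac_bounds[of "N * \<rho>"] by linarith
        then show "\<bar>wdens s \<rho> * (2 * upfrac (N * \<rho>) - 1)\<bar> \<le> \<bar>wdens s \<rho>\<bar> * 1"
          unfolding abs_mult by (rule mult_left_mono) simp
        have "\<bar>wdens_deriv s \<rho>\<bar> * \<bar>sawint (N * \<rho>)\<bar> \<le> \<bar>wdens_deriv s \<rho>\<bar> * 1"
          using sawint_bound[of "N * \<rho>"] by (rule mult_left_mono) simp
        then show "\<bar>wdens_deriv s \<rho> * sawint (N * \<rho>) / N\<bar> \<le> \<bar>wdens_deriv s \<rho>\<bar> * 1 / N"
          unfolding abs_mult abs_divide using N by (simp only: abs_of_pos) (rule divide_right_mono, auto)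
      qed
      then show "AE \<rho> in lborel. norm (?f \<rho>) \<le> norm (\<bar>wdens s \<rho>\<bar> + \<bar>wdens_deriv s \<rho>\<bar> / N)"
        using N by (intro always_eventually allI) (auto intro!: order_trans[OF abs_triangle_ineq] add_mono)
    qed
    then show ?thesis unfolding set_integrable_def by (intro integrable_mult_indicator) auto
  qed
  have "(LINT \<rho>:{0..b}|lborel. ?f \<rho>) = integral {0..b} ?f"
    by (rule set_borel_integral_eq_integral(2)[OF si])
  also have "\<dots> = ?F b - ?F 0" using H by (rule integral_unique)
  finally have "(LINT \<rho>:{0..b}|lborel. ?f \<rho>) = ?F b - ?F 0" .
  then show ?thesis by (simp add: set_lebesgue_integral_def wdens_def mult.commute)
qed

text \<open>A Riemann-Lebesgue estimate with rate: the factor 2 \<open>upfrac\<close> - 1 oscillates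
  with mean 0 and frequency N, and integration by parts gains 1/N.\<close>

lemma wdens_upfrac_bound:
  assumes s: "s > 0" and N: "N > 0"
  shows "\<bar>\<integral>\<rho>. wdens s \<rho> * (2 * upfrac (N * \<rho>) - 1) * indicator {0..} \<rho> \<partial>lborel\<bar> \<le>
    2 * (\<integral>\<rho>. \<bar>wdens_deriv s \<rho>\<bar> \<partial>lborel) / N"
proof -
  define C where "C = (\<integral>\<rho>. \<bar>wdens_deriv s \<rho>\<bar> \<partial>lborel)"
  have [measurable]: "wdens s \<in> borel_measurable borel" "wdens_deriv s \<in> borel_measurable borel"
    using wdens_integrable[OF s] wdens_deriv_integrable[OF s] by (auto dest: borel_measurable_integrable)
  let ?g = "\<lambda>\<rho>. wdens s \<rho> * (2 * upfrac (N * \<rho>) - 1)"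
  have gb: "\<bar>?g \<rho>\<bar> \<le> \<bar>wdens s \<rho>\<bar>" for \<rho>
  proof -
    have "\<bar>2 * upfrac (N * \<rho>) - 1\<bar> \<le> 1" using upfrac_bounds[of "N * \<rho>"] by linarith
    then show ?thesis unfolding abs_mult by (rule mult_left_le) simp
  qed
  have ig: "integrable lborel (\<lambda>\<rho>. ?g \<rho> * indicator A \<rho>)" if [measurable]: "A \<in> sets borel" for A
    by (rule Bochner_Integration.integrable_bound[OF wdens_integrable[OF s]])
       (use gb in \<open>auto split: split_indicator\<close>)
  have id: "integrable lborel (\<lambda>\<rho>. wdens_deriv s \<rho> * h \<rho> * indicator A \<rho>)"
    if [measurable]: "A \<in> sets borel" "h \<in> borel_measurable borel" and h: "\<And>\<rho>. \<bar>h \<rho>\<bar> \<le> 1" for h A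
    by (rule Bochner_Integration.integrable_bound[OF wdens_deriv_integrable[OF s]])
       (use h in \<open>auto split: split_indicator simp: abs_mult intro!: mult_left_le\<close>)
  have db: "\<bar>\<integral>\<rho>. wdens_deriv s \<rho> * h \<rho> * indicator A \<rho> \<partial>lborel\<bar> \<le> C"
    if A: "A \<in> sets borel" "h \<in> borel_measurable borel" and h: "\<And>\<rho>. \<bar>h \<rho>\<bar> \<le> 1" for h A
    unfolding C_def
  proof (rule order_trans[OF integral_abs_bound], rule integral_mono)
    show "integrable lborel (\<lambda>\<rho>. \<bar>wdens_deriv s \<rho> * h \<rho> * indicator A \<rho>\<bar>)"
      using id[OF A h] by (rule integrable_abs)
    show "integrable lborel (\<lambda>\<rho>. \<bar>wdens_deriv s \<rho>\<bar>)" using wdens_deriv_integrable[OF s] by (rule integrable_abs)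
    show "\<bar>wdens_deriv s \<rho> * h \<rho> * indicator A \<rho>\<bar> \<le> \<bar>wdens_deriv s \<rho>\<bar>" for \<rho>
      using h[of \<rho>] by (auto split: split_indicator simp: abs_mult intro!: mult_left_le)
  qed
  \<comment> \<open>As \<open>wdens\<close> vanishes at 0, its values are bounded by its total
    variation. So the boundary term obeys the same bound C as the integral, whence the factor
    2.\<close>
  have wb: "\<bar>wdens s b\<bar> \<le> C" if "b \<ge> 0" for b
  proof -
    have "(\<integral>\<rho>. wdens_deriv s \<rho> * indicator {0..b} \<rho> \<partial>lborel) = wdens s b - wdens s 0"
    proof (rule integral_FTC_Icc_real[OF that wdens_has_derivative[OF s]])
      fix x
      have "isCont (normal_density 0 (sqrt s)) x" using normal_density_has_derivative[OF s] by (rule DERIV_isCont)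
      then show "isCont (wdens_deriv s) x" unfolding wdens_deriv_def[abs_def] using s by (intro continuous_intros) auto
    qed
    then show ?thesis using db[of "{0..b}" "\<lambda>_. 1"] by (simp add: wdens_def)
  qed
  have main: "\<bar>\<integral>\<rho>. ?g \<rho> * indicator {0..b} \<rho> \<partial>lborel\<bar> \<le> 2 * C / N" if b: "b \<ge> 0" for b
  proof -
    let ?h = "\<lambda>\<rho>. wdens_deriv s \<rho> * sawint (N * \<rho>) * indicator {0..b} \<rho>"
    have ih: "integrable lborel ?h" by (rule id) (use sawint_bound in auto)
    have "wdens s b * sawint (N * b) / N = (\<integral>\<rho>. ?g \<rho> * indicator {0..b} \<rho> + ?h \<rho> / N \<partial>lborel)"
      unfolding wdens_sawint_Icc[OF s N b, symmetric]
      by (intro Bochner_Integration.integral_cong) (auto simp: algebra_simps split: split_indicator)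
    also have "\<dots> = (\<integral>\<rho>. ?g \<rho> * indicator {0..b} \<rho> \<partial>lborel) + (\<integral>\<rho>. ?h \<rho> \<partial>lborel) / N"
      using ig[of "{0..b}"] ih by simp
    finally have "(\<integral>\<rho>. ?g \<rho> * indicator {0..b} \<rho> \<partial>lborel) = (wdens s b * sawint (N * b) - (\<integral>\<rho>. ?h \<rho> \<partial>lborel)) / N"
      by (simp add: diff_divide_distrib)
    moreover have "\<bar>wdens s b * sawint (N * b)\<bar> \<le> C"
      using wb[OF b] sawint_bound[of "N * b"] unfolding abs_mult by (intro order_trans[OF mult_left_le]) auto
    moreover have "\<bar>\<integral>\<rho>. ?h \<rho> \<partial>lborel\<bar> \<le> C" by (rule db) (use sawint_bound in auto)
    ultimately have "\<bar>\<integral>\<rho>. ?g \<rho> * indicator {0..b} \<rho> \<partial>lborel\<bar> \<le> (C + C) / N"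
      using N by (simp only: abs_divide) (auto intro!: divide_right_mono)
    then show ?thesis by simp
  qed
  have "(\<lambda>m. \<integral>\<rho>. ?g \<rho> * indicator {0..real m} \<rho> \<partial>lborel) \<longlonglongrightarrow> (\<integral>\<rho>. ?g \<rho> * indicator {0..} \<rho> \<partial>lborel)"
  proof (rule integral_dominated_convergence[where w = "\<lambda>\<rho>. \<bar>wdens s \<rho>\<bar>"])
    show "integrable lborel (\<lambda>\<rho>. \<bar>wdens s \<rho>\<bar>)" using wdens_integrable[OF s] by (rule integrable_abs)
    show "AE \<rho> in lborel. (\<lambda>m. ?g \<rho> * indicator {0..real m} \<rho>) \<longlonglongrightarrow> ?g \<rho> * indicator {0..} \<rho>"
    proof (rule always_eventually, rule allI, rule tendsto_eventually)
      fix \<rho> :: real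
      show "\<forall>\<^sub>F m in sequentially. ?g \<rho> * indicator {0..real m} \<rho> = ?g \<rho> * indicator {0..} \<rho>"
        using eventually_ge_at_top[of "nat \<lceil>\<rho>\<rceil>"]
      proof eventually_elim
        case (elim m)
        then have "\<rho> \<le> real m" by linarith
        then show ?case by (auto split: split_indicator)
      qed
    qed
    show "AE \<rho> in lborel. norm (?g \<rho> * indicator {0..real m} \<rho>) \<le> \<bar>wdens s \<rho>\<bar>" for m
      using gb by (auto split: split_indicator)
  qed measurable
  from tendsto_rabs[OF this] show ?thesis
    unfolding C_def[symmetric] using main by (intro LIMSEQ_le_const2) auto
qed

lemma integral_wdens_halfline:
  assumes s: "s > 0"
  shows "(\<integral>\<rho>. wdens s \<rho> * indicator {0..} \<rho> \<partial>lborel) = sqrt (2 / (pi * s))"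
proof -
  have [measurable]: "wdens s \<in> borel_measurable borel"
    using wdens_integrable[OF s] by (auto dest: borel_measurable_integrable)
  have "(\<lambda>m. \<integral>\<rho>. wdens s \<rho> * indicator {0..real m} \<rho> \<partial>lborel) \<longlonglongrightarrow> (\<integral>\<rho>. wdens s \<rho> * indicator {0..} \<rho> \<partial>lborel)"
  proof (rule integral_dominated_convergence[where w = "\<lambda>\<rho>. \<bar>wdens s \<rho>\<bar>"])
    show "integrable lborel (\<lambda>\<rho>. \<bar>wdens s \<rho>\<bar>)" using wdens_integrable[OF s] by (rule integrable_abs)
    show "AE \<rho> in lborel. (\<lambda>m. wdens s \<rho> * indicator {0..real m} \<rho>) \<longlonglongrightarrow> wdens s \<rho> * indicator {0..} \<rho>"
    proof (rule always_eventually, rule allI, rule tendsto_eventually)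
      fix \<rho> :: real
      show "\<forall>\<^sub>F m in sequentially. wdens s \<rho> * indicator {0..real m} \<rho> = wdens s \<rho> * indicator {0..} \<rho>"
        using eventually_ge_at_top[of "nat \<lceil>\<rho>\<rceil>"]
      proof eventually_elim
        case (elim m)
        then have "\<rho> \<le> real m" by linarith
        then show ?case by (auto split: split_indicator)
      qed
    qed
  qed (auto split: split_indicator)
  moreover have "(\<lambda>m. 2 * normal_density 0 (sqrt s) 0 - 2 * normal_density 0 (sqrt s) (real m)) \<longlonglongrightarrow> 2 * normal_density 0 (sqrt s) 0 - 2 * 0"
  proof (intro tendsto_intros)
    have "((\<lambda>x. c * exp (- x\<^sup>2 / (2 * s))) \<longlongrightarrow> 0) at_top" for c using s by real_asymp
    from filterlim_compose[OF this[of "1 / sqrt (2 * pi * s)"] filterlim_real_sequentially]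
    show "(\<lambda>m. normal_density 0 (sqrt s) (real m)) \<longlonglongrightarrow> 0" using s by (simp add: normal_density_def)
  qed
  ultimately have "(\<integral>\<rho>. wdens s \<rho> * indicator {0..} \<rho> \<partial>lborel) = 2 * normal_density 0 (sqrt s) 0"
    using LIMSEQ_unique by (fastforce simp: integral_wdens_Icc[OF s])
  also have "\<dots> = sqrt (2 / (pi * s))"
  proof -
    have "2 / sqrt (2 * (pi * s)) = sqrt 4 / sqrt (2 * (pi * s))" by simp
    also have "\<dots> = sqrt (2 / (pi * s))" unfolding real_sqrt_divide[symmetric] by (simp add: field_simps)
    finally show ?thesis using s by (simp add: normal_density_def mult.assoc)
  qed
  finally show ?thesis .
qed

section \<open>The expected inverse of the last level reached\<close>

context bessel
begin

lemma integral_over_Y: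
  assumes s: "s > 0" and [measurable]: "h \<in> borel_measurable borel"
  shows "(\<integral>\<omega>. h (Y s \<omega>) / Y s \<omega> \<partial>M) = (\<integral>\<rho>. wdens s \<rho> * h \<rho> * indicator {0..} \<rho> \<partial>lborel)"
proof -
  have "(\<integral>\<omega>. h (Y s \<omega>) / Y s \<omega> \<partial>M) = (\<integral>\<rho>. radial_density (sqrt s) 0 \<rho> * (h \<rho> / \<rho>) \<partial>lborel)"
    by (rule Y_integral[OF s]) measurable
  also have "\<dots> = (\<integral>\<rho>. wdens s \<rho> * h \<rho> * indicator {0..} \<rho> \<partial>lborel)"
  proof (rule Bochner_Integration.integral_cong[OF refl])
    fix \<rho> :: real
    show "radial_density (sqrt s) 0 \<rho> * (h \<rho> / \<rho>) = wdens s \<rho> * h \<rho> * indicator {0..} \<rho>"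
      using wdens_eq[OF s, of \<rho>] by (cases "\<rho> > 0") (auto simp: radial_density_def wdens_def split: split_indicator)
  qed
  finally show ?thesis .
qed

lemma inverse_Y_integrable:
  assumes s: "s > 0"
  shows "integrable M (\<lambda>\<omega>. 1 / Y s \<omega>)"
proof -
  have "integrable lborel (\<lambda>\<rho>. radial_density (sqrt s) 0 \<rho> * (1 / \<rho>))"
  proof (rule Bochner_Integration.integrable_bound[OF wdens_integrable[OF s]])
    show "AE \<rho> in lborel. norm (radial_density (sqrt s) 0 \<rho> * (1 / \<rho>)) \<le> norm (wdens s \<rho>)"
      using wdens_eq[OF s] by (auto simp: radial_density_def[of _ _ "_::real"] intro!: always_eventually)
  qed measurable
  then show ?thesis
    using distributed_integrable[OF Y_law[OF s], of "\<lambda>\<rho>. 1 / \<rho>"] radial_density_nonneg[of "sqrt s" 0] s by auto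
qed

lemma expectation_inverse_Y:
  assumes s: "s > 0"
  shows "(\<integral>\<omega>. 1 / Y s \<omega> \<partial>M) = sqrt (2 / (pi * s))"
  using integral_over_Y[OF s, of "\<lambda>_. 1"] integral_wdens_halfline[OF s] by simp

text \<open>Sum and expectation are exchanged, each probability is replaced by the mean of a
  sawtooth ratio, and the sum over the radii telescopes under the expectation.\<close>

lemma expectation_level_sum:
  assumes s: "s > 0"
  shows "integrable M (\<lambda>\<omega>. level_sum \<theta> n (Mx s \<omega>))"
    and "(\<integral>\<omega>. level_sum \<theta> n (Mx s \<omega>) \<partial>M) = (\<integral>\<omega>. 2 * upfrac (Y s \<omega> / dlevel \<theta> (- int n)) / Y s \<omega> \<partial>M)"
proof -
  have [measurable]: "Mx s \<in> borel_measurable M" "Y s \<in> borel_measurable M"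
    using s by (auto intro: Mx_measurable Y_measurable)
  define R where "R k = dlevel \<theta> (int k - int n)" for k
  define r where "r = dlevel \<theta> (- int n)"
  have r: "r > 0" by (simp add: r_def)
  have R: "R k > 0" "R k = 2 ^ k * r" for k
    using dlevel_geometric[of \<theta> "- int n" k] by (auto simp: R_def r_def)
  let ?f = "\<lambda>k \<omega>. if Mx s \<omega> \<le> R k then 1 / R k else 0"
  have fi: "integrable M (?f k)" for k
    by (rule integrable_const_bound[where B = "1 / R k"]) (use R(1)[of k] in \<open>auto simp: less_imp_le\<close>)
  have f_int: "(\<integral>\<omega>. ?f k \<omega> \<partial>M) = (\<integral>\<omega>. saw_ratio (R k) (Y s \<omega>) / R k \<partial>M)" for k
  proof -
    have "(\<integral>\<omega>. ?f k \<omega> \<partial>M) = (\<integral>\<omega>. 1 / R k * indicator {\<omega>\<in>space M. Mx s \<omega> \<le> R k} \<omega> \<partial>M)"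
      by (intro Bochner_Integration.integral_cong) (auto split: split_indicator)
    then show ?thesis using prob_Mx_le[OF s R(1)[of k]] by simp
  qed
  have sm: "summable (\<lambda>k. 1 / R k)" unfolding R_def by (rule summable_inverse_dlevel)
  have sum_int: "summable (\<lambda>k. \<integral>\<omega>. norm (?f k \<omega>) \<partial>M)"
  proof (rule summable_comparison_test'[OF sm, of 0])
    fix k
    have "(\<integral>\<omega>. norm (?f k \<omega>) \<partial>M) \<le> (\<integral>\<omega>. 1 / R k \<partial>M)"
      using fi[of k] R(1)[of k] by (intro integral_mono integrable_norm) auto
    then show "norm (\<integral>\<omega>. norm (?f k \<omega>) \<partial>M) \<le> 1 / R k" by (simp add: prob_space)
  qed
  have sum_ae: "AE \<omega> in M. summable (\<lambda>k. norm (?f k \<omega>))"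
    by (intro always_eventually allI summable_comparison_test'[OF sm, of 0]) (use R in \<open>auto simp: less_imp_le\<close>)
  have ls: "level_sum \<theta> n (Mx s \<omega>) = (\<Sum>k. ?f k \<omega>)" for \<omega> unfolding level_sum_def R_def ..
  show "integrable M (\<lambda>\<omega>. level_sum \<theta> n (Mx s \<omega>))"
    unfolding ls by (rule integrable_suminf[OF fi sum_ae sum_int])
  have "(\<lambda>k. \<integral>\<omega>. ?f k \<omega> \<partial>M) sums (\<integral>\<omega>. level_sum \<theta> n (Mx s \<omega>) \<partial>M)"
    unfolding ls by (rule sums_integral[OF fi sum_ae sum_int])
  then have lim1: "(\<lambda>K. \<Sum>k<K. \<integral>\<omega>. saw_ratio (R k) (Y s \<omega>) / R k \<partial>M) \<longlonglongrightarrow> (\<integral>\<omega>. level_sum \<theta> n (Mx s \<omega>) \<partial>M)"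
    unfolding sums_def f_int .
  have "(\<Sum>k<K. \<integral>\<omega>. saw_ratio (R k) (Y s \<omega>) / R k \<partial>M) =
      (\<integral>\<omega>. (2 * upfrac (Y s \<omega> / r) - 2 * upfrac (Y s \<omega> / r / 2 ^ K)) / Y s \<omega> \<partial>M)" for K
  proof -
    have "(\<Sum>k<K. \<integral>\<omega>. saw_ratio (R k) (Y s \<omega>) / R k \<partial>M) = (\<integral>\<omega>. (\<Sum>k<K. saw_ratio (R k) (Y s \<omega>) / R k) \<partial>M)"
    proof (rule Bochner_Integration.integral_sum[symmetric])
      fix k
      show "integrable M (\<lambda>\<omega>. saw_ratio (R k) (Y s \<omega>) / R k)"
      proof (rule integrable_const_bound[where B = "1 / R k"])
        have "norm (saw_ratio (R k) y / R k) \<le> 1 / R k" for y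
          using saw_ratio_abs_le[OF R(1)[of k], of y] R(1)[of k] by (simp add: divide_right_mono)
        then show "AE \<omega> in M. norm (saw_ratio (R k) (Y s \<omega>) / R k) \<le> 1 / R k" by simp
      qed measurable
    qed
    also have "\<dots> = (\<integral>\<omega>. (2 * upfrac (Y s \<omega> / r) - 2 * upfrac (Y s \<omega> / r / 2 ^ K)) / Y s \<omega> \<partial>M)"
    proof (rule integral_cong_AE)
      show "AE \<omega> in M. (\<Sum>k<K. saw_ratio (R k) (Y s \<omega>) / R k) = (2 * upfrac (Y s \<omega> / r) - 2 * upfrac (Y s \<omega> / r / 2 ^ K)) / Y s \<omega>"
        using Y_pos[OF s]
      proof eventually_elim
        case (elim \<omega>)
        have "(\<Sum>k<K. saw_ratio (R k) (Y s \<omega>) / R k) = (\<Sum>k<K. saw (2 ^ k * r) (Y s \<omega>) / (2 ^ k * r)) / Y s \<omega>"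
          unfolding sum_divide_distrib R(2) using elim by (intro sum.cong) (auto simp: saw_ratio_def)
        then show ?case unfolding saw_dyadic_sum[OF r] .
      qed
    qed measurable
    finally show ?thesis .
  qed
  moreover have "(\<lambda>K. \<integral>\<omega>. (2 * upfrac (Y s \<omega> / r) - 2 * upfrac (Y s \<omega> / r / 2 ^ K)) / Y s \<omega> \<partial>M) \<longlonglongrightarrow>
     (\<integral>\<omega>. (2 * upfrac (Y s \<omega> / r) - 2 * 0) / Y s \<omega> \<partial>M)"
  \<comment> \<open>The upper end of the telescope disappears as K grows; both fractional parts lie
    between 0 and 1, so 2 / Y dominates.\<close>
  proof (rule integral_dominated_convergence[where w = "\<lambda>\<omega>. 2 * (1 / Y s \<omega>)"])
    show "integrable M (\<lambda>\<omega>. 2 * (1 / Y s \<omega>))" by (intro integrable_mult_right inverse_Y_integrable s)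
    show "AE \<omega> in M. (\<lambda>K. (2 * upfrac (Y s \<omega> / r) - 2 * upfrac (Y s \<omega> / r / 2 ^ K)) / Y s \<omega>) \<longlonglongrightarrow> (2 * upfrac (Y s \<omega> / r) - 2 * 0) / Y s \<omega>"
      using Y_pos[OF s]
    proof eventually_elim
      case (elim \<omega>)
      define x where "x = Y s \<omega> / r"
      have x: "x > 0" using elim r by (simp add: x_def)
      have "(\<lambda>K. x * (1/2) ^ K) \<longlonglongrightarrow> 0" by (intro tendsto_mult_right_zero LIMSEQ_realpow_zero) auto
      then have xl: "(\<lambda>K. x / 2 ^ K) \<longlonglongrightarrow> 0" by (simp add: power_one_over)
      then have "\<forall>\<^sub>F K in sequentially. x / 2 ^ K < 1" by (rule order_tendstoD) simp
      \<comment> \<open>Once the argument lies between 0 and 1, the fractional part is the argument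
        itself.\<close>
      then have "\<forall>\<^sub>F K in sequentially. x / 2 ^ K = upfrac (x / 2 ^ K)"
      proof eventually_elim
        case (elim K)
        have "0 < x / 2 ^ K" using x by simp
        then have "\<lceil>x / 2 ^ K\<rceil> = 1" using elim by linarith
        then show ?case by (simp add: upfrac_def)
      qed
      with xl have "(\<lambda>K. upfrac (x / 2 ^ K)) \<longlonglongrightarrow> 0" by (rule Lim_transform_eventually)
      then show ?case unfolding x_def[symmetric] using elim by (intro tendsto_intros) auto
    qed
    show "AE \<omega> in M. norm ((2 * upfrac (Y s \<omega> / r) - 2 * upfrac (Y s \<omega> / r / 2 ^ K)) / Y s \<omega>) \<le> 2 * (1 / Y s \<omega>)" for K
      using Y_pos[OF s]
    proof eventually_elim
      case (elim \<omega>)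
      have "\<bar>2 * upfrac (Y s \<omega> / r) - 2 * upfrac (Y s \<omega> / r / 2 ^ K)\<bar> \<le> 2"
        using upfrac_bounds[of "Y s \<omega> / r"] upfrac_bounds[of "Y s \<omega> / r / 2 ^ K"] by linarith
      then show ?case using elim by (simp add: abs_divide divide_right_mono)
    qed
  qed measurable
  ultimately show "(\<integral>\<omega>. level_sum \<theta> n (Mx s \<omega>) \<partial>M) = (\<integral>\<omega>. 2 * upfrac (Y s \<omega> / dlevel \<theta> (- int n)) / Y s \<omega> \<partial>M)"
    using LIMSEQ_unique[OF lim1] unfolding r_def by simp
qed

text \<open>At mesh r / 2^n the factor 2 \<open>upfrac\<close> is equivalent to its mean 1 up to an
  error of order 2^(-n). The offset affects only r and so is lost in the limit.\<close>

lemma expectation_level_sum_tendsto: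
  assumes s: "s > 0"
  shows "(\<lambda>n. \<integral>\<omega>. level_sum \<theta> n (Mx s \<omega>) \<partial>M) \<longlonglongrightarrow> sqrt (2 / (pi * s))"
proof -
  define r where "r = dlevel \<theta> 0"
  define N where "N n = 2 ^ n / r" for n :: nat
  have r: "r > 0" by (simp add: r_def)
  have N: "N n > 0" for n using r by (simp add: N_def)
  have d: "dlevel \<theta> (- int n) = r / 2 ^ n" for n using dlevel_diff_nat[of \<theta> 0 n] by (simp add: r_def)
  have [measurable]: "Y s \<in> borel_measurable M" using s by (auto intro: Y_measurable)
  define C where "C = 2 * (\<integral>\<rho>. \<bar>wdens_deriv s \<rho>\<bar> \<partial>lborel)"
  have iu: "integrable M (\<lambda>\<omega>. 2 * upfrac (N n * Y s \<omega>) / Y s \<omega>)" for n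
  proof (rule Bochner_Integration.integrable_bound)
    show "integrable M (\<lambda>\<omega>. 2 * (1 / Y s \<omega>))" by (intro integrable_mult_right inverse_Y_integrable s)
    show "AE \<omega> in M. norm (2 * upfrac (N n * Y s \<omega>) / Y s \<omega>) \<le> norm (2 * (1 / Y s \<omega>))"
      using upfrac_bounds by (intro always_eventually allI) (auto simp: abs_mult abs_divide abs_of_pos intro!: divide_right_mono)
  qed measurable
  have bnd: "\<bar>(\<integral>\<omega>. level_sum \<theta> n (Mx s \<omega>) \<partial>M) - sqrt (2 / (pi * s))\<bar> \<le> C / N n" for n
  proof -
    have "(\<integral>\<omega>. level_sum \<theta> n (Mx s \<omega>) \<partial>M) - sqrt (2 / (pi * s)) =
      (\<integral>\<omega>. 2 * upfrac (N n * Y s \<omega>) / Y s \<omega> \<partial>M) - (\<integral>\<omega>. 1 / Y s \<omega> \<partial>M)"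
      unfolding expectation_level_sum(2)[OF s] expectation_inverse_Y[OF s] d N_def by (simp add: mult.commute)
    also have "\<dots> = (\<integral>\<omega>. (2 * upfrac (N n * Y s \<omega>) - 1) / Y s \<omega> \<partial>M)"
      using iu inverse_Y_integrable[OF s] by (subst Bochner_Integration.integral_diff[symmetric]) (auto simp: diff_divide_distrib)
    also have "\<dots> = (\<integral>\<rho>. wdens s \<rho> * (2 * upfrac (N n * \<rho>) - 1) * indicator {0..} \<rho> \<partial>lborel)"
      by (rule integral_over_Y[OF s]) measurable
    finally show ?thesis using wdens_upfrac_bound[OF s N[of n]] by (simp add: C_def)
  qed
  have "(\<lambda>n. C / N n) \<longlonglongrightarrow> 0"
  proof -
    have "(\<lambda>n. C * r * (1/2) ^ n) \<longlonglongrightarrow> 0" by (intro tendsto_mult_right_zero LIMSEQ_realpow_zero) auto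
    then show ?thesis by (simp add: N_def power_one_over)
  qed
  then have "(\<lambda>n. (\<integral>\<omega>. level_sum \<theta> n (Mx s \<omega>) \<partial>M) - sqrt (2 / (pi * s))) \<longlonglongrightarrow> 0"
    by (rule Lim_null_comparison[rotated]) (use bnd in \<open>simp only: real_norm_def eventually_True\<close>)
  then show ?thesis by (rule LIM_zero_cancel)
qed

lemma inverse_dlevel_le_two_over:
  assumes "m > 0"
  shows "1 / dlevel \<theta> (dindex \<theta> m) \<le> 2 / m"
  using dlevel_dindex[OF assms, of \<theta>] assms unfolding dlevel_Suc by (simp add: field_simps)

text \<open>The expectation is squeezed between limits of expected level sums, with offset theta for
  the upper bound and with theta - e for the lower one.\<close>

lemma expectation_inverse_level:
  assumes s: "s > 0"
  shows "integrable M (\<lambda>\<omega>. 1 / dlevel \<theta> (dindex \<theta> (Mx s \<omega>)))"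
    and "(\<integral>\<omega>. 1 / dlevel \<theta> (dindex \<theta> (Mx s \<omega>)) \<partial>M) = sqrt (2 / (pi * s))"
proof -
  have [measurable]: "Mx s \<in> borel_measurable M" "Y s \<in> borel_measurable M"
    using s by (auto intro: Mx_measurable Y_measurable)
  have [measurable]: "(\<lambda>m. dindex \<theta> m) \<in> borel \<rightarrow>\<^sub>M count_space UNIV" unfolding dindex_def by measurable
  have [measurable]: "(\<lambda>m. dlevel \<theta> (dindex \<theta> m)) \<in> borel_measurable borel" unfolding dlevel_def by measurable
  let ?f = "\<lambda>\<omega>. 1 / dlevel \<theta> (dindex \<theta> (Mx s \<omega>))"
  have i2: "integrable M (\<lambda>\<omega>. 2 * (1 / Y s \<omega>))" by (intro integrable_mult_right inverse_Y_integrable s)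
  have bound: "AE \<omega> in M. ?f \<omega> \<le> 2 * (1 / Y s \<omega>)"
    using Y_pos[OF s] Mx_ge_Y[OF s]
  proof eventually_elim
    case (elim \<omega>)
    have "?f \<omega> \<le> 2 / Mx s \<omega>" using elim by (intro inverse_dlevel_le_two_over) simp
    also have "\<dots> \<le> 2 * (1 / Y s \<omega>)" using elim by (simp add: frac_le)
    finally show ?case .
  qed
  show int: "integrable M ?f"
  proof (rule Bochner_Integration.integrable_bound[OF i2])
    show "AE \<omega> in M. norm (?f \<omega>) \<le> norm (2 * (1 / Y s \<omega>))"
      using bound by eventually_elim (simp only: real_norm_def, subst abs_of_nonneg, simp, erule order_trans[OF _ abs_ge_self])
  qed measurable
  have le: "(\<integral>\<omega>. ?f \<omega> \<partial>M) \<le> sqrt (2 / (pi * s))"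
  proof (rule LIMSEQ_le[OF _ expectation_level_sum_tendsto[OF s, of \<theta>]])
    \<comment> \<open>Keeps only outcomes whose index is admissible for the cut at -n; for each
      outcome this is no restriction once n is large.\<close>
    let ?g = "\<lambda>n \<omega>. if - int n \<le> dindex \<theta> (Mx s \<omega>) + 1 then ?f \<omega> else 0"
    have gm: "?g n \<in> borel_measurable M" for n
    proof -
      have "Measurable.pred M (\<lambda>\<omega>. - int n \<le> dindex \<theta> (Mx s \<omega>) + 1)"
        by (rule measurable_compose[of "\<lambda>\<omega>. dindex \<theta> (Mx s \<omega>)" M "count_space UNIV"]) measurable
      then show ?thesis by measurable
    qed
    show "(\<lambda>n. \<integral>\<omega>. ?g n \<omega> \<partial>M) \<longlonglongrightarrow> (\<integral>\<omega>. ?f \<omega> \<partial>M)"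
    proof (rule integral_dominated_convergence[OF _ _ int])
      show "AE \<omega> in M. (\<lambda>n. ?g n \<omega>) \<longlonglongrightarrow> ?f \<omega>"
      proof (rule always_eventually, rule allI, rule tendsto_eventually)
        fix \<omega>
        show "\<forall>\<^sub>F n in sequentially. ?g n \<omega> = ?f \<omega>"
          using eventually_ge_at_top[of "nat (- dindex \<theta> (Mx s \<omega>))"] by eventually_elim auto
      qed
    qed (use gm in auto)
    have "(\<integral>\<omega>. ?g n \<omega> \<partial>M) \<le> (\<integral>\<omega>. level_sum \<theta> n (Mx s \<omega>) \<partial>M)" for n
    proof (rule integral_mono_AE)
      show "integrable M (?g n)"
        by (rule Bochner_Integration.integrable_bound[OF int gm]) auto
      show "AE \<omega> in M. ?g n \<omega> \<le> level_sum \<theta> n (Mx s \<omega>)"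
        using Mx_pos[OF s]
        by eventually_elim (auto intro: inverse_dlevel_le_level_sum level_sum_nonneg)
    qed (rule expectation_level_sum(1)[OF s])
    then show "\<exists>N. \<forall>n\<ge>N. (\<integral>\<omega>. ?g n \<omega> \<partial>M) \<le> (\<integral>\<omega>. level_sum \<theta> n (Mx s \<omega>) \<partial>M)" by blast
  qed
  have ge: "sqrt (2 / (pi * s)) \<le> 2 powr e * (\<integral>\<omega>. ?f \<omega> \<partial>M)" if e: "e > 0" for e
  proof (rule LIMSEQ_le_const2[OF expectation_level_sum_tendsto[OF s, of "\<theta> - e"]])
    have "(\<integral>\<omega>. level_sum (\<theta> - e) n (Mx s \<omega>) \<partial>M) \<le> (\<integral>\<omega>. 2 powr e * ?f \<omega> \<partial>M)" for n
    proof (rule integral_mono_AE[OF expectation_level_sum(1)[OF s]])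
      show "integrable M (\<lambda>\<omega>. 2 powr e * ?f \<omega>)" using int by (rule integrable_mult_right)
      show "AE \<omega> in M. level_sum (\<theta> - e) n (Mx s \<omega>) \<le> 2 powr e * ?f \<omega>"
        using Mx_pos[OF s] by eventually_elim (use level_sum_le_inverse_dlevel[OF _ e] in simp)
    qed
    then show "\<exists>N. \<forall>n\<ge>N. (\<integral>\<omega>. level_sum (\<theta> - e) n (Mx s \<omega>) \<partial>M) \<le> 2 powr e * (\<integral>\<omega>. ?f \<omega> \<partial>M)"
      unfolding integral_mult_right_zero by blast
  qed
  \<comment> \<open>The limit is the same for every offset, so e may tend to 0 and the lost factor
    disappears.\<close>
  have "((\<lambda>e. 2 powr e * (\<integral>\<omega>. ?f \<omega> \<partial>M)) \<longlongrightarrow> 2 powr 0 * (\<integral>\<omega>. ?f \<omega> \<partial>M)) (at_right 0)"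
    by (intro tendsto_intros) auto
  then have "sqrt (2 / (pi * s)) \<le> 2 powr 0 * (\<integral>\<omega>. ?f \<omega> \<partial>M)"
    by (rule tendsto_lowerbound) (use ge in \<open>auto simp: eventually_at_right_less eventually_at_filter\<close>)
  with le show "(\<integral>\<omega>. ?f \<omega> \<partial>M) = sqrt (2 / (pi * s))" by simp
qed

end

section \<open>Random grid cells\<close>

definition trunc_shift :: "nat \<Rightarrow> (int \<Rightarrow> int) \<Rightarrow> int \<Rightarrow> real" where
  "trunc_shift n w j = (\<Sum>m<n. (if w (j - 1 - int m) = -1 then 1 else 0) / 2 ^ Suc m)"

lemma trunc_shift_Suc:
  "trunc_shift (Suc n) w j = ((if w (j - 1) = -1 then 1 else 0) + trunc_shift n w (j - 1)) / 2"
proof -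
  have "trunc_shift (Suc n) w j = (if w (j - 1) = -1 then 1 else 0) / 2 +
      (\<Sum>m<n. (if w (j - 1 - int (Suc m)) = -1 then 1 else 0) / 2 ^ Suc (Suc m))"
    unfolding trunc_shift_def by (subst sum.lessThan_Suc_shift) simp
  also have "(\<Sum>m<n. (if w (j - 1 - int (Suc m)) = -1 then 1 else 0) / 2 ^ Suc (Suc m)) = trunc_shift n w (j - 1) / (2::real)"
    unfolding trunc_shift_def sum_divide_distrib by (intro sum.cong) (simp_all add: algebra_simps)
  finally show ?thesis by (simp add: add_divide_distrib)
qed

lemma trunc_shift_bounds: "0 \<le> trunc_shift n w j" "trunc_shift n w j \<le> 1"
proof -
  show "0 \<le> trunc_shift n w j" unfolding trunc_shift_def by (intro sum_nonneg) simp
  show "trunc_shift n w j \<le> 1"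
    by (induction n arbitrary: j) (auto simp: trunc_shift_Suc, simp add: trunc_shift_def, smt (verit))
qed

lemma bit_shift_trunc: "bit_shift w j = trunc_shift n w j + bit_shift w (j - int n) / 2 ^ n"
proof (induction n arbitrary: j)
  case (Suc n)
  have "bit_shift w j = ((if w (j - 1) = -1 then 1 else 0) + bit_shift w (j - 1)) / 2" by (rule bit_shift_rec)
  also have "bit_shift w (j - 1) = trunc_shift n w (j - 1) + bit_shift w (j - 1 - int n) / 2 ^ n" by (rule Suc)
  finally show ?case unfolding trunc_shift_Suc by (simp add: field_simps)
qed (simp add: trunc_shift_def)

text \<open>Hermite's identity for two terms.\<close>

lemma floor_double: "\<lfloor>2 * x\<rfloor> = \<lfloor>x\<rfloor> + \<lfloor>x + 1 / 2\<rfloor>" for x :: real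
proof -
  define k where "k = \<lfloor>x\<rfloor>"
  have k: "of_int k \<le> x" "x < of_int k + 1" unfolding k_def by linarith+
  show ?thesis
  proof (cases "x < of_int k + 1 / 2")
    case True
    then have "\<lfloor>x + 1 / 2\<rfloor> = k" "\<lfloor>2 * x\<rfloor> = 2 * k" using k by linarith+
    then show ?thesis unfolding k_def[symmetric] by simp
  next
    case False
    then have "\<lfloor>x + 1 / 2\<rfloor> = k + 1" "\<lfloor>2 * x\<rfloor> = 2 * k + 1" using k by linarith+
    then show ?thesis unfolding k_def[symmetric] by simp
  qed
qed

lemma abs_floor_le: "0 \<le> u \<Longrightarrow> u \<le> 1 \<Longrightarrow> \<bar>real_of_int \<lfloor>x + u\<rfloor>\<bar> \<le> \<bar>x\<bar> + 3"
proof -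
  assume u: "0 \<le> u" "u \<le> 1"
  have "\<bar>f\<bar> \<le> \<bar>x\<bar> + 3" if "f \<le> x + u" "x + u < f + 1" for f using that u by linarith
  from this[of "of_int \<lfloor>x + u\<rfloor>"] show ?thesis by simp
qed

locale fair_signs = prob_space M for M :: "'a measure" +
  fixes W :: "int \<Rightarrow> 'a \<Rightarrow> int"
  assumes W_indep: "indep_vars (\<lambda>_. count_space UNIV) W UNIV"
    and W_law: "\<And>i. distr M (count_space UNIV) (W i) = measure_pmf (pmf_of_set {1, -1})"
begin

lemma W_measurable [measurable]: "W i \<in> M \<rightarrow>\<^sub>M count_space UNIV"
  using W_indep by (simp add: indep_vars_def)

lemma W_signs: "AE \<omega> in M. \<forall>i. W i \<omega> \<in> {1, -1}"
proof (rule AE_all_countable[THEN iffD2], rule allI)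
  fix i
  have "AE x in measure_pmf (pmf_of_set {1, -1 :: int}). x \<in> {1, -1}"
    by (simp add: AE_measure_pmf_iff)
  then have "AE x in distr M (count_space UNIV) (W i). x \<in> {1, -1}" by (simp only: W_law)
  then show "AE \<omega> in M. W i \<omega> \<in> {1, -1}" by (subst (asm) AE_distr_iff) auto
qed

lemma integral_W:
  fixes h :: "int \<Rightarrow> real"
  shows "(\<integral>\<omega>. h (W i \<omega>) \<partial>M) = (h 1 + h (-1)) / 2"
proof -
  have "(\<integral>\<omega>. h (W i \<omega>) \<partial>M) = (\<integral>x. h x \<partial>distr M (count_space UNIV) (W i))"
    by (subst integral_distr) auto
  also have "\<dots> = (h 1 + h (-1)) / 2" unfolding W_law by (subst integral_pmf_of_set) auto
  finally show ?thesis .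
qed

lemma trunc_shift_measurable [measurable]: "(\<lambda>\<omega>. trunc_shift n (\<lambda>i. W i \<omega>) j) \<in> borel_measurable M"
  unfolding trunc_shift_def by measurable

lemma bit_shift_measurable [measurable]: "(\<lambda>\<omega>. bit_shift (\<lambda>i. W i \<omega>) j) \<in> borel_measurable M"
  unfolding bit_shift_def by measurable

lemma floor_integrable:
  fixes x :: real
  assumes [measurable]: "V \<in> borel_measurable M" and V: "\<And>\<omega>. 0 \<le> V \<omega>" "\<And>\<omega>. V \<omega> \<le> 1"
  shows "integrable M (\<lambda>\<omega>. real_of_int \<lfloor>x + V \<omega>\<rfloor>)"
proof (rule integrable_const_bound[where B = "\<bar>x\<bar> + 3"])
  have "\<bar>real_of_int \<lfloor>x + V \<omega>\<rfloor>\<bar> \<le> \<bar>x\<bar> + 3" for \<omega> using V[of \<omega>] by (intro abs_floor_le)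
  then show "AE \<omega> in M. norm (real_of_int \<lfloor>x + V \<omega>\<rfloor>) \<le> \<bar>x\<bar> + 3" by simp
qed measurable

text \<open>Averaging over the first bit is \<open>\<lfloor>2 x\<rfloor> = \<lfloor>x\<rfloor> + \<lfloor>x + 1/2\<rfloor>\<close>.\<close>

lemma expectation_floor_trunc:
  "(\<integral>\<omega>. real_of_int \<lfloor>x + trunc_shift n (\<lambda>i. W i \<omega>) j\<rfloor> \<partial>M) = of_int \<lfloor>2 ^ n * x\<rfloor> / 2 ^ n"
proof (induction n arbitrary: x j)
  case 0
  then show ?case by (simp add: trunc_shift_def prob_space)
next
  case (Suc n)
  \<comment> \<open>The leading digit and the n digits after it, which involve disjoint sets of
    signs.\<close>
  define A B where "A = {j - 1}" and "B = {j - 1 - int n..<j - 1}"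
  define bit :: "int \<Rightarrow> real" where "bit v = (if v = -1 then 1 else 0)" for v
  have "indep_var (PiM A (\<lambda>_. count_space UNIV)) (\<lambda>\<omega>. restrict (\<lambda>i. W i \<omega>) A) (PiM B (\<lambda>_. count_space UNIV)) (\<lambda>\<omega>. restrict (\<lambda>i. W i \<omega>) B)"
    by (intro indep_var_restrict[OF W_indep]) (auto simp: A_def B_def)
  then have "indep_var borel ((\<lambda>f. bit (f (j - 1))) \<circ> (\<lambda>\<omega>. restrict (\<lambda>i. W i \<omega>) A)) borel ((\<lambda>f. trunc_shift n f (j - 1)) \<circ> (\<lambda>\<omega>. restrict (\<lambda>i. W i \<omega>) B))"
  proof (rule indep_var_compose)
    have [measurable]: "(\<lambda>f. f (j - 1)) \<in> PiM A (\<lambda>_. count_space UNIV) \<rightarrow>\<^sub>M count_space UNIV"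
      by (rule measurable_component_singleton) (simp add: A_def)
    show "(\<lambda>f. bit (f (j - 1))) \<in> borel_measurable (PiM A (\<lambda>_. count_space UNIV))"
      by measurable
    have "(\<lambda>f. (if f (j - 1 - 1 - int m) = -1 then 1 else 0) / 2 ^ Suc m :: real) \<in> borel_measurable (PiM B (\<lambda>_. count_space UNIV :: int measure))"
      if "m < n" for m
    proof -
      have [measurable]: "(\<lambda>f. f (j - 1 - 1 - int m)) \<in> PiM B (\<lambda>_. count_space UNIV) \<rightarrow>\<^sub>M count_space (UNIV :: int set)"
        using that by (intro measurable_component_singleton) (simp add: B_def)
      show ?thesis by measurable
    qed
    then show "(\<lambda>f. trunc_shift n f (j - 1)) \<in> borel_measurable (PiM B (\<lambda>_. count_space UNIV))"
      unfolding trunc_shift_def by (intro borel_measurable_sum) simp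
  qed
  moreover have "trunc_shift n (restrict (\<lambda>i. W i \<omega>) B) (j - 1) = trunc_shift n (\<lambda>i. W i \<omega>) (j - 1)" for \<omega>
    unfolding trunc_shift_def by (intro sum.cong) (auto simp: B_def)
  ultimately have iv: "indep_var borel (\<lambda>\<omega>. bit (W (j - 1) \<omega>)) borel (\<lambda>\<omega>. trunc_shift n (\<lambda>i. W i \<omega>) (j - 1))"
    by (simp add: comp_def A_def)
  \<comment> \<open>Clamping makes g bounded for all arguments, as the freezing lemma demands;
    digits and truncated shifts already lie between 0 and 1 and are left alone.\<close>
  define cl :: "real \<Rightarrow> real" where "cl a = min 1 (max 0 a)" for a
  define g where "g a b = real_of_int \<lfloor>x + (cl a + cl b) / 2\<rfloor>" for a b
  have clid: "cl a = a" if "0 \<le> a" "a \<le> 1" for a using that by (simp add: cl_def)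
  have clb: "0 \<le> cl a" "cl a \<le> 1" for a by (auto simp: cl_def)
  have gb: "\<bar>g a b\<bar> \<le> \<bar>x\<bar> + 3" for a b unfolding g_def using clb[of a] clb[of b] by (intro abs_floor_le) auto
  have gm: "case_prod g \<in> borel_measurable (borel \<Otimes>\<^sub>M borel)"
    unfolding g_def cl_def by measurable
  let ?T = "\<lambda>\<omega>. trunc_shift n (\<lambda>i. W i \<omega>) (j - 1)"
  have gT: "g (bit v) (?T \<omega>) = real_of_int \<lfloor>x + (bit v + ?T \<omega>) / 2\<rfloor>" for v \<omega>
    unfolding g_def using clid trunc_shift_bounds by (simp add: bit_def)
  have fi: "integrable M (\<lambda>\<omega>. real_of_int \<lfloor>y + ?T \<omega> / 2\<rfloor>)" for y
  proof (rule floor_integrable)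
    show "0 \<le> ?T \<omega> / 2" "?T \<omega> / 2 \<le> 1" for \<omega>
      using trunc_shift_bounds[of n "\<lambda>i. W i \<omega>" "j - 1"] by simp_all
  qed measurable
  have "(\<integral>\<omega>. real_of_int \<lfloor>x + trunc_shift (Suc n) (\<lambda>i. W i \<omega>) j\<rfloor> \<partial>M) = (\<integral>\<omega>. g (bit (W (j - 1) \<omega>)) (?T \<omega>) \<partial>M)"
    unfolding gT trunc_shift_Suc by (simp add: bit_def)
  also have "\<dots> = (\<integral>\<omega>. (\<integral>\<omega>'. g (bit (W (j - 1) \<omega>)) (?T \<omega>') \<partial>M) \<partial>M)"
    by (rule integral_indep_var_pair[OF iv gm gb])
  also have "\<dots> = ((\<integral>\<omega>'. g (bit 1) (?T \<omega>') \<partial>M) + (\<integral>\<omega>'. g (bit (-1)) (?T \<omega>') \<partial>M)) / 2"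
    by (rule integral_W)
  also have "\<dots> = (\<integral>\<omega>'. real_of_int \<lfloor>2 * x + ?T \<omega>'\<rfloor> \<partial>M) / 2"
  proof -
    have "real_of_int \<lfloor>2 * x + ?T \<omega>'\<rfloor> = g (bit 1) (?T \<omega>') + g (bit (-1)) (?T \<omega>')" for \<omega>'
      using floor_double[of "x + ?T \<omega>' / 2"] unfolding gT by (simp add: bit_def add_divide_distrib add_ac)
    moreover have "integrable M (\<lambda>\<omega>'. g (bit v) (?T \<omega>'))" for v
      unfolding gT using fi[of "x + bit v / 2"] by (simp add: add_divide_distrib add_ac)
    ultimately show ?thesis by simp
  qed
  also have "\<dots> = of_int \<lfloor>2 ^ Suc n * x\<rfloor> / 2 ^ Suc n"
    unfolding Suc by (simp add: mult.assoc mult.left_commute)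
  finally show ?case .
qed

text \<open>Cutting the expansion after n digits lowers the shift by at most 2^(-n), so the mean
  lies between the truncated means at x and at x + 2^(-n). This is how the uniform law of the shift
  enters the cell probabilities.\<close>

lemma expectation_floor_shift:
  "(\<integral>\<omega>. real_of_int \<lfloor>x + bit_shift (\<lambda>i. W i \<omega>) j\<rfloor> \<partial>M) = x"
proof -
  let ?U = "\<lambda>\<omega>. bit_shift (\<lambda>i. W i \<omega>) j"
  let ?E = "\<integral>\<omega>. real_of_int \<lfloor>x + ?U \<omega>\<rfloor> \<partial>M"
  have iU: "integrable M (\<lambda>\<omega>. real_of_int \<lfloor>x + ?U \<omega>\<rfloor>)"
    by (intro floor_integrable) (auto simp: bit_shift_bounds)
  have iT: "integrable M (\<lambda>\<omega>. real_of_int \<lfloor>y + trunc_shift n (\<lambda>i. W i \<omega>) j\<rfloor>)" for y n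
    by (intro floor_integrable) (auto simp: trunc_shift_bounds)
  have "\<bar>?E - x\<bar> \<le> (1/2) ^ n" for n
  proof -
    have b: "0 \<le> bit_shift w (j - int n) / 2 ^ n" "bit_shift w (j - int n) / 2 ^ n \<le> 1 / 2 ^ n" for w
      using bit_shift_bounds[of w "j - int n"] by (auto intro: divide_right_mono)
    have U: "trunc_shift n w j \<le> bit_shift w j" "bit_shift w j \<le> 1 / 2 ^ n + trunc_shift n w j" for w
      using bit_shift_trunc[of w j n] b[of w] by linarith+
    have "?E \<ge> (\<integral>\<omega>. real_of_int \<lfloor>x + trunc_shift n (\<lambda>i. W i \<omega>) j\<rfloor> \<partial>M)"
      using U by (intro integral_mono iT iU of_int_le_iff[THEN iffD2] floor_mono add_left_mono)
    then have 1: "?E \<ge> of_int \<lfloor>2 ^ n * x\<rfloor> / 2 ^ n" unfolding expectation_floor_trunc .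
    have "?E \<le> (\<integral>\<omega>. real_of_int \<lfloor>(x + 1 / 2 ^ n) + trunc_shift n (\<lambda>i. W i \<omega>) j\<rfloor> \<partial>M)"
      using U by (intro integral_mono iT iU of_int_le_iff[THEN iffD2] floor_mono) (simp add: add.assoc)
    then have 2: "?E \<le> of_int \<lfloor>2 ^ n * x + 1\<rfloor> / 2 ^ n" unfolding expectation_floor_trunc by (simp add: distrib_left)
    define p :: real where "p = 2 ^ n"
    have p: "p > 0" by (simp add: p_def)
    have "?E * p \<ge> p * x - 1" using 1 p unfolding p_def[symmetric] by (simp add: field_simps) linarith
    moreover have "?E * p \<le> p * x + 1" using 2 p unfolding p_def[symmetric] by (simp add: field_simps) linarith
    ultimately have "\<bar>(?E - x) * p\<bar> \<le> 1" by (simp add: algebra_simps abs_le_iff)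
    then have "\<bar>?E - x\<bar> * p \<le> 1" using p by (simp add: abs_mult)
    then show ?thesis using p by (simp add: p_def[symmetric] power_one_over field_simps)
  qed
  moreover have "(\<lambda>n. (1/2) ^ n :: real) \<longlonglongrightarrow> 0" by (intro LIMSEQ_realpow_zero) auto
  ultimately have "\<bar>?E - x\<bar> \<le> 0" by (intro LIMSEQ_le_const) auto
  then show ?thesis by simp
qed

text \<open>For points closer than 1 the two floors differ by at most one, so the indicator is their
  difference and has mean b - a; points at distance 1 or more never share a cell.\<close>

lemma prob_cells_differ:
  assumes ab: "a < b"
  shows "(\<integral>\<omega>. of_bool (\<lfloor>a + bit_shift (\<lambda>i. W i \<omega>) j\<rfloor> \<noteq> \<lfloor>b + bit_shift (\<lambda>i. W i \<omega>) j\<rfloor>) \<partial>M) = min 1 (b - a)"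
proof (cases "b - a \<ge> 1")
  case True
  have "\<lfloor>a + u\<rfloor> \<noteq> \<lfloor>b + u\<rfloor>" for u using True by linarith
  then show ?thesis using True by (simp add: prob_space)
next
  case False
  let ?U = "\<lambda>\<omega>. bit_shift (\<lambda>i. W i \<omega>) j"
  have "of_bool (\<lfloor>a + u\<rfloor> \<noteq> \<lfloor>b + u\<rfloor>) = real_of_int \<lfloor>b + u\<rfloor> - real_of_int \<lfloor>a + u\<rfloor>" for u
  proof -
    have "\<lfloor>a + u\<rfloor> \<le> \<lfloor>b + u\<rfloor>" "\<lfloor>b + u\<rfloor> \<le> \<lfloor>a + u\<rfloor> + 1" using False ab by linarith+
    then have "\<lfloor>b + u\<rfloor> = \<lfloor>a + u\<rfloor> \<or> \<lfloor>b + u\<rfloor> = \<lfloor>a + u\<rfloor> + 1" by linarith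
    then show ?thesis by auto
  qed
  then have "(\<integral>\<omega>. of_bool (\<lfloor>a + ?U \<omega>\<rfloor> \<noteq> \<lfloor>b + ?U \<omega>\<rfloor>) \<partial>M) = (\<integral>\<omega>. real_of_int \<lfloor>b + ?U \<omega>\<rfloor> - real_of_int \<lfloor>a + ?U \<omega>\<rfloor> \<partial>M)"
    by simp
  also have "\<dots> = b - a"
    by (subst Bochner_Integration.integral_diff)
       (auto intro!: floor_integrable simp: bit_shift_bounds expectation_floor_shift)
  finally show ?thesis using False by simp
qed

end

section \<open>The survival function as an iterated expectation\<close>

lemma indep_of_integral:
  fixes g :: "'b \<Rightarrow> 'c \<Rightarrow> real"
  assumes "prob_space M" and ind: "indep_of M N X N' X'"
    and g[measurable]: "case_prod g \<in> borel_measurable (N \<Otimes>\<^sub>M N')" and bnd: "\<And>x y. \<bar>g x y\<bar> \<le> c"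
  shows "(\<integral>\<omega>. g (X \<omega>) (X' \<omega>) \<partial>M) = (\<integral>\<omega>. (\<integral>\<omega>'. g (X \<omega>) (X' \<omega>') \<partial>M) \<partial>M)"
proof -
  interpret prob_space M by fact
  have X[measurable]: "X \<in> M \<rightarrow>\<^sub>M N" and Y[measurable]: "X' \<in> M \<rightarrow>\<^sub>M N'"
    and iset: "indep_set (sets (vimage_algebra (space M) X N)) (sets (vimage_algebra (space M) X' N'))"
    using ind by (auto simp: indep_of_def)
  interpret X: prob_space "distr M N X" by (rule prob_space_distr) fact
  interpret Y: prob_space "distr M N' X'" by (rule prob_space_distr) fact
  interpret XY: pair_prob_space "distr M N X" "distr M N' X'" ..
  have d: "distr M N X \<Otimes>\<^sub>M distr M N' X' = distr M (N \<Otimes>\<^sub>M N') (\<lambda>x. (X x, X' x))"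
  proof (rule pair_measure_eqI)
    show "sigma_finite_measure (distr M N X)" "sigma_finite_measure (distr M N' X')" by unfold_locales
    fix A B assume "A \<in> sets (distr M N X)" "B \<in> sets (distr M N' X')"
    then have [measurable]: "A \<in> sets N" "B \<in> sets N'" by auto
    have "emeasure (distr M (N \<Otimes>\<^sub>M N') (\<lambda>x. (X x, X' x))) (A \<times> B) = emeasure M ((X -` A \<inter> space M) \<inter> (X' -` B \<inter> space M))"
      by (subst emeasure_distr) (auto intro!: arg_cong[where f = "emeasure M"])
    also have "\<dots> = ennreal (prob ((X -` A \<inter> space M) \<inter> (X' -` B \<inter> space M)))" by (rule emeasure_eq_measure)
    also have "prob ((X -` A \<inter> space M) \<inter> (X' -` B \<inter> space M)) = prob (X -` A \<inter> space M) * prob (X' -` B \<inter> space M)"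
      by (intro indep_setD[OF iset] in_vimage_algebra) auto
    finally show "emeasure (distr M N X) A * emeasure (distr M N' X') B = emeasure (distr M (N \<Otimes>\<^sub>M N') (\<lambda>x. (X x, X' x))) (A \<times> B)"
      by (simp add: emeasure_distr emeasure_eq_measure ennreal_mult)
  qed simp
  have int: "integrable (distr M N X \<Otimes>\<^sub>M distr M N' X') (case_prod g)"
    by (rule XY.integrable_const_bound[where B = c]) (use bnd in \<open>auto simp: case_prod_beta'\<close>)
  have "(\<integral>\<omega>. g (X \<omega>) (X' \<omega>) \<partial>M) = (\<integral>p. case_prod g p \<partial>distr M (N \<Otimes>\<^sub>M N') (\<lambda>x. (X x, X' x)))"
    by (subst integral_distr) auto
  also have "\<dots> = (\<integral>x. (\<integral>y. g x y \<partial>distr M N' X') \<partial>distr M N X)"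
    unfolding d[symmetric] using XY.integral_fst[OF int] by simp
  also have "\<dots> = (\<integral>\<omega>. (\<integral>y. g (X \<omega>) y \<partial>distr M N' X') \<partial>M)"
    by (subst integral_distr) auto
  also have "\<dots> = (\<integral>\<omega>. (\<integral>\<omega>'. g (X \<omega>) (X' \<omega>') \<partial>M) \<partial>M)"
  proof (intro Bochner_Integration.integral_cong refl)
    fix \<omega> assume "\<omega> \<in> space M"
    then have "X \<omega> \<in> space N" using measurable_space[OF X] by simp
    then have "(\<lambda>y. case_prod g (X \<omega>, y)) \<in> borel_measurable N'"
      by (rule measurable_compose[OF measurable_Pair1' g])
    then show "(\<integral>y. g (X \<omega>) y \<partial>distr M N' X') = (\<integral>\<omega>'. g (X \<omega>) (X' \<omega>') \<partial>M)"
      by (intro integral_distr[OF Y]) simp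
  qed
  finally show ?thesis .
qed

text \<open>Events about coalescence depend on uncountably many times. They are compared almost
  surely with an event of M, which makes them measurable in the completion with the same
  probability.\<close>

lemma measure_completion_AE_eq:
  assumes E: "E \<in> sets M" and S: "S \<subseteq> space M" and ae: "AE \<omega> in M. \<omega> \<in> S \<longleftrightarrow> \<omega> \<in> E"
  shows "S \<in> sets (completion M)" "measure (completion M) S = measure M E"
proof -
  have "Measurable.pred (completion M) (\<lambda>\<omega>. (\<omega> \<in> S) \<noteq> (\<omega> \<in> E))"
    by (rule sets_completion_AE) (use ae in simp)
  then have D: "{\<omega>\<in>space M. (\<omega> \<in> S) \<noteq> (\<omega> \<in> E)} \<in> sets (completion M)" (is "?D \<in> _")
    by (simp add: pred_def)
  have E': "E \<in> sets (completion M)" using E by auto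
  have "S = (E - ?D) \<union> (?D - E)" using S sets.sets_into_space[OF E] by auto
  also have "\<dots> \<in> sets (completion M)" using D E' by auto
  finally show S': "S \<in> sets (completion M)" .
  have "measure (completion M) S = measure (completion M) E"
    using S' E' AE_completion[OF ae] by (intro measure_eq_AE) auto
  then show "measure (completion M) S = measure M E" using E by simp
qed

text \<open>A strict bound at s persists a little beyond s. The rational end point is for almost
  sure statements that are available at countably many times only.\<close>

lemma continuous_less_extends:
  fixes y :: "real \<Rightarrow> real"
  assumes y: "continuous_on {0..} y" and s: "0 \<le> s" and lt: "\<And>u. u \<in> {0..s} \<Longrightarrow> y u < b"
  shows "\<exists>q::rat. s < of_rat q \<and> (\<forall>u\<in>{0..of_rat q}. y u < b)"
proof -
  have "continuous (at s within {0..}) y" using y s by (auto simp: continuous_on_eq_continuous_within)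
  moreover have "b - y s > 0" using lt[of s] s by simp
  ultimately obtain d where d: "d > 0" "\<And>x. x \<in> {0..} \<Longrightarrow> dist x s < d \<Longrightarrow> dist (y x) (y s) < b - y s"
    unfolding continuous_within_eps_delta by (elim allE[of _ "b - y s"]) auto
  obtain q :: rat where q: "s < of_rat q" "of_rat q < s + d"
    using of_rat_dense[of s "s + d"] d by auto
  have "y u < b" if "u \<in> {0..of_rat q}" for u
    using that lt[of u] d(2)[of u] q by (cases "u \<le> s") (auto simp: dist_real_def)
  then show ?thesis using q by blast
qed

lemma bit_shift_sign_measurable [measurable]: "(\<lambda>w. bit_shift w j) \<in> borel_measurable sign_space"
proof -
  have [measurable]: "(\<lambda>w. w i) \<in> sign_space \<rightarrow>\<^sub>M count_space UNIV" for i :: int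
    by (rule measurable_component_singleton) simp
  show ?thesis unfolding bit_shift_def by measurable
qed

locale dyadic_coupling =
  fixes M :: "'a measure" and Y :: "real \<Rightarrow> 'a \<Rightarrow> real" and W :: "int \<Rightarrow> 'a \<Rightarrow> int" and \<Theta> :: "'a \<Rightarrow> real"
  assumes driving: "dyadic_driving M Y W \<Theta>"
begin

sublocale bessel M Y
  using driving by unfold_locales (simp add: dyadic_driving_def)

sublocale fair_signs M W
  using driving by unfold_locales (auto simp: dyadic_driving_def)

lemma Theta_measurable [measurable]: "\<Theta> \<in> borel_measurable M"
  using driving by (simp add: dyadic_driving_def)

definition coalescence :: "real \<Rightarrow> real \<Rightarrow> 'a \<Rightarrow> ereal" where
  "coalescence \<alpha> \<beta> \<omega> = coalescence_time {\<alpha>..\<beta>} (\<lambda>\<gamma> t. dyadic_X (\<lambda>u. Y u \<omega>) (\<lambda>i. W i \<omega>) (\<Theta> \<omega>) \<gamma> t)"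

text \<open>Written as a function of the offset and of the pair of path and signs, the form in which
  the two independence assumptions apply.\<close>

definition apart :: "real \<Rightarrow> real \<Rightarrow> real \<Rightarrow> real \<Rightarrow> (real \<Rightarrow> real) \<times> (int \<Rightarrow> int) \<Rightarrow> bool" where
  "apart \<alpha> \<beta> s \<theta> = (\<lambda>(p, w). cell w \<theta> (dindex \<theta> (runmax s p)) \<alpha> \<noteq> cell w \<theta> (dindex \<theta> (runmax s p)) \<beta>)"

text \<open>The scale takes countably many values, so measurability need only be checked at each
  fixed scale.\<close>

lemma apart_measurable:
  assumes s: "s > 0"
  shows "(\<lambda>(\<theta>, x). of_bool (apart \<alpha> \<beta> s \<theta> x) :: real) \<in> borel_measurable (borel \<Otimes>\<^sub>M (path_space \<Otimes>\<^sub>M sign_space))"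
proof -
  let ?N = "borel \<Otimes>\<^sub>M (path_space \<Otimes>\<^sub>M sign_space) :: (real \<times> (real \<Rightarrow> real) \<times> (int \<Rightarrow> int)) measure"
  note [measurable] = runmax_measurable[OF s]
  have [measurable]: "(\<lambda>x. bit_shift (snd (snd x)) j) \<in> borel_measurable ?N" for j
    by measurable
  have [measurable]: "(\<lambda>x. runmax s (fst (snd x))) \<in> borel_measurable ?N" by measurable
  have h: "(\<lambda>x. log 2 (runmax s (fst (snd x))) - fst x) \<in> borel_measurable ?N" by measurable
  have "(\<lambda>z::real. \<lfloor>z\<rfloor> + 1) \<in> borel \<rightarrow>\<^sub>M count_space UNIV" by measurable
  from measurable_compose[OF h this]
  have idx: "(\<lambda>x. dindex (fst x) (runmax s (fst (snd x)))) \<in> ?N \<rightarrow>\<^sub>M count_space UNIV"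
    by (simp only: dindex_def)
  have [measurable]: "(\<lambda>x. cell (snd (snd x)) (fst x) j \<gamma>) \<in> ?N \<rightarrow>\<^sub>M count_space UNIV" for j \<gamma>
    unfolding cell_def dlevel_def by measurable
  have "(\<lambda>x. of_bool (cell (snd (snd x)) (fst x) j \<alpha> \<noteq> cell (snd (snd x)) (fst x) j \<beta>) :: real) \<in> borel_measurable ?N" for j
    by measurable
  from measurable_compose_countable[OF this idx]
  show ?thesis by (simp add: apart_def case_prod_beta')
qed

definition differ :: "real \<Rightarrow> real \<Rightarrow> real \<Rightarrow> 'a \<Rightarrow> bool" where
  "differ \<alpha> \<beta> s \<omega> = apart \<alpha> \<beta> s (\<Theta> \<omega>) (path_of Y \<omega>, \<lambda>i. W i \<omega>)"

lemma driving_maps: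
  "path_of Y \<in> M \<rightarrow>\<^sub>M path_space" "(\<lambda>\<omega> i. W i \<omega>) \<in> M \<rightarrow>\<^sub>M sign_space"
  using driving by (auto simp: dyadic_driving_def indep_of_def)

lemma differ_measurable:
  assumes "s > 0"
  shows "{\<omega>\<in>space M. differ \<alpha> \<beta> s \<omega>} \<in> sets M"
proof -
  have "(\<lambda>\<omega>. (\<Theta> \<omega>, path_of Y \<omega>, \<lambda>i. W i \<omega>)) \<in> M \<rightarrow>\<^sub>M borel \<Otimes>\<^sub>M (path_space \<Otimes>\<^sub>M sign_space)"
    using driving_maps by (intro measurable_Pair) auto
  from measurable_compose[OF this apart_measurable[OF assms, of \<alpha> \<beta>]]
  have "(\<lambda>\<omega>. of_bool (differ \<alpha> \<beta> s \<omega>) :: real) \<in> borel_measurable M" by (simp add: differ_def)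
  then have "{\<omega>\<in>space M. (of_bool (differ \<alpha> \<beta> s \<omega>) :: real) = 1} \<in> sets M" by measurable
  then show ?thesis by simp
qed

text \<open>The offset is frozen first, then the path. With both fixed the scale is a constant, and
  only the shift at that scale is averaged, in units of the cell length.\<close>

lemma prob_differ:
  assumes s: "s > 0" and ab: "\<alpha> < \<beta>"
  shows "prob {\<omega>\<in>space M. differ \<alpha> \<beta> s \<omega>} =
    (\<integral>\<omega>. (\<integral>\<omega>'. min 1 ((\<beta> - \<alpha>) / (2 * dlevel (\<Theta> \<omega>) (dindex (\<Theta> \<omega>) (Mx s \<omega>')))) \<partial>M) \<partial>M)"
proof -
  have ind1: "indep_of M borel \<Theta> (path_space \<Otimes>\<^sub>M sign_space) (\<lambda>\<omega>. (path_of Y \<omega>, \<lambda>i. W i \<omega>))"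
    and ind2: "indep_of M path_space (path_of Y) sign_space (\<lambda>\<omega> i. W i \<omega>)"
    using driving by (auto simp: dyadic_driving_def)
  have pm: "prob_space M" by unfold_locales
  have "prob {\<omega>\<in>space M. differ \<alpha> \<beta> s \<omega>} = (\<integral>\<omega>. indicator {\<omega>\<in>space M. differ \<alpha> \<beta> s \<omega>} \<omega> \<partial>M)"
    by simp (auto intro!: arg_cong[where f = prob])
  also have "\<dots> = (\<integral>\<omega>. of_bool (apart \<alpha> \<beta> s (\<Theta> \<omega>) (path_of Y \<omega>, \<lambda>i. W i \<omega>)) \<partial>M)"
    by (intro Bochner_Integration.integral_cong refl) (auto simp: differ_def)
  also have "\<dots> = (\<integral>\<omega>. (\<integral>\<omega>'. of_bool (apart \<alpha> \<beta> s (\<Theta> \<omega>) (path_of Y \<omega>', \<lambda>i. W i \<omega>')) \<partial>M) \<partial>M)"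
    by (rule indep_of_integral[OF pm ind1, where g = "\<lambda>\<theta> x. of_bool (apart \<alpha> \<beta> s \<theta> x)" and c = 1]) (simp_all add: apart_measurable[OF s])
  also have "\<dots> = (\<integral>\<omega>. (\<integral>\<omega>'. min 1 ((\<beta> - \<alpha>) / (2 * dlevel (\<Theta> \<omega>) (dindex (\<Theta> \<omega>) (Mx s \<omega>')))) \<partial>M) \<partial>M)"
  proof (rule Bochner_Integration.integral_cong[OF refl])
    fix \<omega>
    let ?\<theta> = "\<Theta> \<omega>"
    have m: "(\<lambda>(p, w). of_bool (apart \<alpha> \<beta> s ?\<theta> (p, w)) :: real) \<in> borel_measurable (path_space \<Otimes>\<^sub>M sign_space)"
      using measurable_compose[OF measurable_Pair1'[of ?\<theta> borel "path_space \<Otimes>\<^sub>M sign_space"] apart_measurable[OF s, of \<alpha> \<beta>]]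
      by (simp add: case_prod_beta')
    have "(\<integral>\<omega>'. of_bool (apart \<alpha> \<beta> s ?\<theta> (path_of Y \<omega>', \<lambda>i. W i \<omega>')) \<partial>M :: real) =
      (\<integral>\<omega>'. (\<integral>\<omega>''. of_bool (apart \<alpha> \<beta> s ?\<theta> (path_of Y \<omega>', \<lambda>i. W i \<omega>'')) \<partial>M) \<partial>M)"
      by (rule indep_of_integral[OF pm ind2, where g = "\<lambda>p w. of_bool (apart \<alpha> \<beta> s ?\<theta> (p, w))" and c = 1]) (simp_all add: m)
    also have "\<dots> = (\<integral>\<omega>'. min 1 ((\<beta> - \<alpha>) / (2 * dlevel ?\<theta> (dindex ?\<theta> (Mx s \<omega>')))) \<partial>M)"
    proof (rule Bochner_Integration.integral_cong[OF refl])
      fix \<omega>'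
      define j where "j = dindex ?\<theta> (Mx s \<omega>')"
      have "(\<integral>\<omega>''. of_bool (apart \<alpha> \<beta> s ?\<theta> (path_of Y \<omega>', \<lambda>i. W i \<omega>'')) \<partial>M :: real) =
         (\<integral>\<omega>''. of_bool (\<lfloor>\<alpha> / (2 * dlevel ?\<theta> j) + bit_shift (\<lambda>i. W i \<omega>'') j\<rfloor> \<noteq> \<lfloor>\<beta> / (2 * dlevel ?\<theta> j) + bit_shift (\<lambda>i. W i \<omega>'') j\<rfloor>) \<partial>M :: real)"
        by (simp add: apart_def cell_def j_def Mx_def runmax_path_of[OF s])
      also have "\<dots> = min 1 (\<beta> / (2 * dlevel ?\<theta> j) - \<alpha> / (2 * dlevel ?\<theta> j))"
        using ab by (intro prob_cells_differ divide_strict_right_mono) auto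
      finally show "(\<integral>\<omega>''. of_bool (apart \<alpha> \<beta> s ?\<theta> (path_of Y \<omega>', \<lambda>i. W i \<omega>'')) \<partial>M) =
         min 1 ((\<beta> - \<alpha>) / (2 * dlevel ?\<theta> (dindex ?\<theta> (Mx s \<omega>'))))"
        by (simp add: j_def diff_divide_distrib)
    qed
    finally show "(\<integral>\<omega>'. of_bool (apart \<alpha> \<beta> s ?\<theta> (path_of Y \<omega>', \<lambda>i. W i \<omega>')) \<partial>M) =
      (\<integral>\<omega>'. min 1 ((\<beta> - \<alpha>) / (2 * dlevel ?\<theta> (dindex ?\<theta> (Mx s \<omega>')))) \<partial>M)" .
  qed
  finally show ?thesis .
qed

text \<open>If the cells agree at the last scale reached by time s, the processes have merged by
  then. If they differ, the next level stays out of reach slightly beyond s and the processes are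
  still apart there.\<close>

lemma coalescence_gt_iff_differ:
  assumes s: "s > 0" and ab: "\<alpha> < \<beta>"
  shows "AE \<omega> in M. coalescence \<alpha> \<beta> \<omega> > ereal s \<longleftrightarrow> differ \<alpha> \<beta> s \<omega>"
proof -
  \<comment> \<open>Positivity at each fixed time holds almost surely; restricting to rational times
    gives one null set for all of them.\<close>
  have "AE \<omega> in M. \<forall>q::rat. 0 < q \<longrightarrow> Y (of_rat q) \<omega> > 0"
  proof (rule AE_all_countable[THEN iffD2], rule allI)
    fix q :: rat
    show "AE \<omega> in M. 0 < q \<longrightarrow> Y (of_rat q) \<omega> > 0"
      using Y_pos[of "of_rat q"] by (cases "0 < q") auto
  qed
  then show ?thesis using W_signs Y_continuous Y_start
  proof eventually_elim
    case (elim \<omega>)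
    let ?y = "\<lambda>u. Y u \<omega>" and ?w = "\<lambda>i. W i \<omega>" and ?\<theta> = "\<Theta> \<omega>"
    interpret dyadic_path ?w ?y ?\<theta>
    proof
      fix t :: real assume "t > 0"
      then obtain q :: rat where "0 < real_of_rat q" "real_of_rat q < t" using of_rat_dense by blast
      then show "\<exists>u\<in>{0..t}. Y u \<omega> > 0" using elim(1) by (intro bexI[of _ "of_rat q"]) auto
    qed (use elim in auto)
    define m where "m = Mx s \<omega>"
    define j where "j = dindex ?\<theta> m"
    obtain u where u: "u \<in> {0..s}" "m = Y u \<omega>" "\<And>v. v \<in> {0..s} \<Longrightarrow> Y v \<omega> \<le> m"
      using runmax_attained[OF elim(3) s] unfolding m_def Mx_def by auto
    have "m > 0"
    proof -
      obtain v where "v \<in> {0..s}" "Y v \<omega> > 0" using leaves[OF s] by blast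
      then show ?thesis using u(3)[of v] by linarith
    qed
    note dl = dlevel_dindex[OF this, of ?\<theta>, folded j_def]
    have d: "differ \<alpha> \<beta> s \<omega> \<longleftrightarrow> cell ?w ?\<theta> j \<alpha> \<noteq> cell ?w ?\<theta> j \<beta>"
      by (simp add: differ_def apart_def j_def m_def Mx_def runmax_path_of[OF s])
    show ?case
    proof (cases "cell ?w ?\<theta> j \<alpha> = cell ?w ?\<theta> j \<beta>")
      case True
      then have "coalescence \<alpha> \<beta> \<omega> \<le> ereal s"
        unfolding coalescence_def using s u dl by (intro coalescence_time_le[of j _ _ s u]) auto
      then show ?thesis using True d by (simp add: not_less)
    next
      case False
      have "Y v \<omega> < dlevel ?\<theta> (j + 1)" if "v \<in> {0..s}" for v using u(3)[OF that] dl by linarith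
      \<comment> \<open>The lower bound is applied at a later rational time: this makes the
        inequality strict, and positivity of the path is known there.\<close>
      then obtain q :: rat where q: "s < of_rat q" "\<And>v. v \<in> {0..of_rat q} \<Longrightarrow> Y v \<omega> < dlevel ?\<theta> (j + 1)"
        using continuous_less_extends[OF elim(3), of s "dlevel ?\<theta> (j + 1)"] s by auto
      have qp: "0 < real_of_rat q" using q s by linarith
      then have "ereal (of_rat q) \<le> coalescence \<alpha> \<beta> \<omega>"
        unfolding coalescence_def using False ab q elim(1) by (intro coalescence_time_ge) auto
      moreover have "ereal s < ereal (of_rat q)" using q(1) by simp
      ultimately have "ereal s < coalescence \<alpha> \<beta> \<omega>" by (rule less_le_trans[rotated])
      then show ?thesis using False d by simp
    qed
  qed
qed

lemma coalescence_tail: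
  assumes s: "s > 0" and ab: "\<alpha> < \<beta>"
  shows "{\<omega>\<in>space M. coalescence \<alpha> \<beta> \<omega> > ereal s} \<in> sets (completion M)"
    and "measure (completion M) {\<omega>\<in>space M. coalescence \<alpha> \<beta> \<omega> > ereal s} =
      (\<integral>\<omega>. (\<integral>\<omega>'. min 1 ((\<beta> - \<alpha>) / (2 * dlevel (\<Theta> \<omega>) (dindex (\<Theta> \<omega>) (Mx s \<omega>')))) \<partial>M) \<partial>M)"
proof -
  have "AE \<omega> in M. \<omega> \<in> {\<omega>\<in>space M. coalescence \<alpha> \<beta> \<omega> > ereal s} \<longleftrightarrow> \<omega> \<in> {\<omega>\<in>space M. differ \<alpha> \<beta> s \<omega>}"
    using coalescence_gt_iff_differ[OF s ab] by eventually_elim auto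
  note E = measure_completion_AE_eq[OF differ_measurable[OF s] _ this]
  show "{\<omega>\<in>space M. coalescence \<alpha> \<beta> \<omega> > ereal s} \<in> sets (completion M)" by (rule E) auto
  show "measure (completion M) {\<omega>\<in>space M. coalescence \<alpha> \<beta> \<omega> > ereal s} =
      (\<integral>\<omega>. (\<integral>\<omega>'. min 1 ((\<beta> - \<alpha>) / (2 * dlevel (\<Theta> \<omega>) (dindex (\<Theta> \<omega>) (Mx s \<omega>')))) \<partial>M) \<partial>M)"
    unfolding prob_differ[OF s ab, symmetric] by (rule E) auto
qed

end

section \<open>The error function and the reflection coupling\<close>

lemma erf_antiderivative:
  "\<exists>F :: real \<Rightarrow> real. (\<forall>x. (F has_real_derivative exp (- x\<^sup>2) / sqrt pi) (at x)) \<and> (\<forall>\<gamma>. erf \<gamma> = F \<gamma> - F (- \<gamma>))"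
proof -
  let ?f = "\<lambda>x::real. exp (- x\<^sup>2) / sqrt pi"
  have c: "isCont ?f x" for x by (intro continuous_intros) auto
  obtain F where F: "\<And>x. (F has_vector_derivative ?f x) (at x)"
    using einterval_antiderivative[of "-\<infinity>" "\<infinity>" ?f] c by auto
  have "erf \<gamma> = F \<gamma> - F (- \<gamma>)" for \<gamma>
    unfolding erf_def
  proof (rule interval_integral_FTC_finite)
    show "continuous_on {min (- \<gamma>) \<gamma>..max (- \<gamma>) \<gamma>} ?f" by (intro continuous_intros) auto
    show "(F has_vector_derivative ?f x) (at x within {min (- \<gamma>) \<gamma>..max (- \<gamma>) \<gamma>})" for x
      by (rule has_vector_derivative_at_within[OF F])
  qed
  then show ?thesis using F by (auto simp: has_real_derivative_iff_has_vector_derivative)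
qed

lemma erf_minus: "erf (- x) = - erf x"
proof -
  obtain F :: "real \<Rightarrow> real" where "\<And>\<gamma>. erf \<gamma> = F \<gamma> - F (- \<gamma>)" using erf_antiderivative by blast
  then show ?thesis by simp
qed

lemma erf_0 [simp]: "erf 0 = 0"
  using erf_minus[of 0] by simp

lemma erf_has_derivative: "(erf has_real_derivative 2 * exp (- x\<^sup>2) / sqrt pi) (at x)"
proof -
  obtain F :: "real \<Rightarrow> real" where F: "\<And>x. (F has_real_derivative exp (- x\<^sup>2) / sqrt pi) (at x)" "\<And>\<gamma>. erf \<gamma> = F \<gamma> - F (- \<gamma>)"
    using erf_antiderivative by blast
  have "erf = (\<lambda>\<gamma>. F \<gamma> - F (- \<gamma>))" using F(2) by auto
  moreover have "((\<lambda>\<gamma>. F \<gamma> - F (- \<gamma>)) has_real_derivative (exp (- x\<^sup>2) / sqrt pi - exp (- (- x)\<^sup>2) / sqrt pi * (-1))) (at x)"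
    by (intro DERIV_diff F(1) DERIV_chain2[OF F(1)]) (auto intro!: derivative_eq_intros)
  ultimately show ?thesis by simp
qed

lemma isCont_erf: "isCont erf x"
  using erf_has_derivative by (rule DERIV_isCont)

lemma tendsto_erf: "(f \<longlongrightarrow> a) F \<Longrightarrow> ((\<lambda>x. erf (f x)) \<longlongrightarrow> erf a) F"
  by (rule isCont_tendsto_compose[OF isCont_erf])

lemma erf_strict_mono: "x < y \<Longrightarrow> erf x < erf y"
  by (rule DERIV_pos_imp_increasing) (auto intro!: exI erf_has_derivative)

lemma erf_mono: "x \<le> y \<Longrightarrow> erf x \<le> erf y"
  using erf_strict_mono[of x y] by (cases "x = y") auto

lemma erf_normal:
  assumes s: "\<sigma> > 0" and c: "c \<ge> 0"
  shows "(\<integral>z. indicator {-c..c} z * normal_density 0 \<sigma> z \<partial>lborel) = erf (c / (\<sigma> * sqrt 2))"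
proof -
  obtain F :: "real \<Rightarrow> real" where F: "\<And>x. (F has_real_derivative exp (- x\<^sup>2) / sqrt pi) (at x)" "\<And>\<gamma>. erf \<gamma> = F \<gamma> - F (- \<gamma>)"
    using erf_antiderivative by blast
  let ?k = "1 / (\<sigma> * sqrt 2)"
  have "(\<integral>z. normal_density 0 \<sigma> z * indicator {-c..c} z \<partial>lborel) = F (?k * c) - F (?k * - c)"
  proof (rule integral_FTC_Icc_real)
    show "-c \<le> c" using c by simp
    fix x :: real
    have "normal_density 0 \<sigma> x = exp (- (?k * x)\<^sup>2) / sqrt pi * ?k"
      using s by (simp add: normal_density_def power_mult_distrib power_divide real_sqrt_mult mult_ac)
    moreover have "((\<lambda>x. F (?k * x)) has_real_derivative exp (- (?k * x)\<^sup>2) / sqrt pi * ?k) (at x)"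
      by (rule DERIV_chain2[OF F(1)]) (rule DERIV_cmult_Id)
    ultimately show "((\<lambda>x. F (?k * x)) has_real_derivative normal_density 0 \<sigma> x) (at x)" by simp
    show "isCont (normal_density 0 \<sigma>) x" unfolding normal_density_def using s by (intro continuous_intros) auto
  qed
  then show ?thesis using F(2)[of "?k * c"] by (simp add: mult.commute)
qed

lemma erf_le_1: "erf x \<le> 1"
proof (cases "x \<ge> 0")
  case True
  have "erf x = (\<integral>z. indicator {-(x * sqrt 2)..x * sqrt 2} z * normal_density 0 1 z \<partial>lborel)"
    using True by (subst erf_normal) auto
  also have "\<dots> \<le> (\<integral>z. normal_density 0 1 z \<partial>lborel)"
  proof (rule integral_mono)
    show "integrable lborel (\<lambda>z. indicator {-(x * sqrt 2)..x * sqrt 2} z * normal_density 0 1 z)"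
      by (rule Bochner_Integration.integrable_bound[OF integrable_normal_density[of 1 0]]) (auto split: split_indicator)
  qed (auto split: split_indicator)
  finally show ?thesis by simp
next
  case False
  then show ?thesis using erf_mono[of x 0] by simp
qed

lemma erf_tendsto_1: "(erf \<longlongrightarrow> 1) at_top"
proof -
  have "(\<lambda>n. erf (real n)) \<longlonglongrightarrow> 1"
  proof -
    have "(\<lambda>n. \<integral>z. indicator {-(real n * sqrt 2)..real n * sqrt 2} z * normal_density 0 1 z \<partial>lborel) \<longlonglongrightarrow> (\<integral>z. normal_density 0 1 z \<partial>lborel)"
    proof (rule integral_dominated_convergence[where w = "normal_density 0 1"])
      show "AE z in lborel. (\<lambda>n. indicator {-(real n * sqrt 2)..real n * sqrt 2} z * normal_density 0 1 z) \<longlonglongrightarrow> normal_density 0 1 z"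
      proof (rule always_eventually, rule allI, rule tendsto_eventually)
        fix z :: real
        show "\<forall>\<^sub>F n in sequentially. indicator {-(real n * sqrt 2)..real n * sqrt 2} z * normal_density 0 1 z = normal_density 0 1 z"
          using eventually_ge_at_top[of "nat \<lceil>\<bar>z\<bar>\<rceil>"]
        proof eventually_elim
          case (elim n)
          then have "\<bar>z\<bar> \<le> real n" by linarith
          also have "real n * 1 \<le> real n * sqrt 2" by (intro mult_left_mono) auto
          then have "real n \<le> real n * sqrt 2" by simp
          finally show ?case by (auto split: split_indicator simp: abs_le_iff)
        qed
      qed
    qed (auto split: split_indicator)
    moreover have "(\<integral>z. indicator {-(real n * sqrt 2)..real n * sqrt 2} z * normal_density 0 1 z \<partial>lborel) = erf (real n)" for n
      by (subst erf_normal) auto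
    ultimately show ?thesis by simp
  qed
  then have ev: "\<exists>n. erf (real n) > 1 - e" if "e > 0" for e
    using that order_tendstoD(1)[of _ 1 sequentially "1 - e"] by (auto simp: eventually_sequentially)
  show ?thesis
  proof (rule order_tendstoI)
    fix a :: real assume "a < 1"
    then obtain n where n: "erf (real n) > a" using ev[of "1 - a"] by auto
    show "\<forall>\<^sub>F x in at_top. a < erf x"
      using eventually_ge_at_top[of "real n"]
    proof eventually_elim
      case (elim x)
      have "erf (real n) \<le> erf x" using elim by (rule erf_mono)
      then show ?case using n by simp
    qed
  next
    fix a :: real assume "1 < a"
    then show "\<forall>\<^sub>F x in at_top. erf x < a" using erf_le_1 by (intro always_eventually allI) (auto intro: le_less_trans)
  qed
qed

text \<open>For non-negative c the sign function is 1 on the interval from -c to c and odd outside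
  it, so by symmetry only the interval contributes. Negative c follows by reflecting z.\<close>

lemma integral_sign_normal:
  assumes s: "\<sigma> > 0"
  shows "(\<integral>z. normal_density 0 \<sigma> z * (if z \<le> c then 1 else -1) \<partial>lborel) = erf (c / (\<sigma> * sqrt 2))"
proof -
  have int: "integrable lborel (\<lambda>z. normal_density 0 \<sigma> z * g z)" if [measurable]: "g \<in> borel_measurable borel" and g: "\<And>z. \<bar>g z\<bar> \<le> 1" for g :: "real \<Rightarrow> real"
  proof (rule Bochner_Integration.integrable_bound[OF integrable_normal_density[OF s, of 0]])
    show "AE z in lborel. norm (normal_density 0 \<sigma> z * g z) \<le> norm (normal_density 0 \<sigma> z)"
      using g by (auto simp: abs_mult intro!: mult_left_le)
  qed measurable
  have even: "normal_density 0 \<sigma> (- z) = normal_density 0 \<sigma> z" for z by (simp add: normal_density_def)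
  have pos: "(\<integral>z. normal_density 0 \<sigma> z * (if z \<le> c then 1 else -1) \<partial>lborel) = erf (c / (\<sigma> * sqrt 2))" if c: "c \<ge> 0" for c
  proof -
    define g :: "real \<Rightarrow> real" where "g z = indicator {..<-c} z - indicator {c<..} z" for z
    have [measurable]: "g \<in> borel_measurable borel" unfolding g_def by measurable
    have gi: "integrable lborel (\<lambda>z. normal_density 0 \<sigma> z * g z)"
      by (rule int) (auto simp: g_def split: split_indicator)
    have "(\<integral>z. normal_density 0 \<sigma> z * g z \<partial>lborel) = (\<integral>z. normal_density 0 \<sigma> (-z) * g (-z) \<partial>lborel)"
      by (subst lborel_integral_real_affine[where c = "-1" and t = 0]) simp_all
    also have "\<dots> = (\<integral>z. - (normal_density 0 \<sigma> z * g z) \<partial>lborel)"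
      by (intro Bochner_Integration.integral_cong) (auto simp: even g_def split: split_indicator)
    finally have g0: "(\<integral>z. normal_density 0 \<sigma> z * g z \<partial>lborel) = 0" by simp
    have "(\<integral>z. normal_density 0 \<sigma> z * (if z \<le> c then 1 else -1) \<partial>lborel) =
      (\<integral>z. normal_density 0 \<sigma> z * indicator {-c..c} z + normal_density 0 \<sigma> z * g z \<partial>lborel)"
      using c by (intro Bochner_Integration.integral_cong) (auto simp: g_def split: split_indicator)
    also have "\<dots> = (\<integral>z. normal_density 0 \<sigma> z * indicator {-c..c} z \<partial>lborel) + (\<integral>z. normal_density 0 \<sigma> z * g z \<partial>lborel)"
      by (intro Bochner_Integration.integral_add gi int) (auto split: split_indicator)
    finally show ?thesis unfolding g0 using erf_normal[OF s c] by (simp add: mult.commute)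
  qed
  show ?thesis
  proof (cases "c \<ge> 0")
    case False
    have "(\<integral>z. normal_density 0 \<sigma> z * (if z \<le> c then 1 else -1) \<partial>lborel) = (\<integral>z. normal_density 0 \<sigma> (-z) * (if - z \<le> c then 1 else -1) \<partial>lborel)"
      by (subst lborel_integral_real_affine[where c = "-1" and t = 0]) simp_all
    also have "\<dots> = (\<integral>z. - (normal_density 0 \<sigma> z * (if z \<le> - c then 1 else -1)) \<partial>lborel)"
    proof (rule integral_cong_AE)
      show "AE z in lborel. normal_density 0 \<sigma> (-z) * (if - z \<le> c then 1 else -1) = - (normal_density 0 \<sigma> z * (if z \<le> - c then 1 else -1))"
        using AE_lborel_singleton[of "-c"] by eventually_elim (auto simp: even)
    qed measurable
    finally show ?thesis using pos[of "- c"] False erf_minus[of "c / (\<sigma> * sqrt 2)"] by simp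
  qed (rule pos)
qed

section \<open>Reflection principle on the line and the reflection coupling\<close>

lemma brownian_motion_sign_mean:
  assumes bm: "brownian_motion N a X" and u: "0 \<le> u" "u < s"
  shows "(\<integral>\<omega>. (if x + (X s \<omega> - X u \<omega>) \<le> R then 1 else -1) \<partial>N) = erf ((R - x) / sqrt (2 * (s - u)))"
proof -
  have d: "distributed N lborel (\<lambda>\<omega>. X s \<omega> - X u \<omega>) (\<lambda>z. ennreal (normal_density 0 (sqrt (s - u)) z))"
    using bm u by (simp add: brownian_motion_def)
  have "(\<integral>\<omega>. (if x + (X s \<omega> - X u \<omega>) \<le> R then 1 else -1) \<partial>N) = (\<integral>\<omega>. (if X s \<omega> - X u \<omega> \<le> R - x then 1 else -1 :: real) \<partial>N)"
    by (intro Bochner_Integration.integral_cong refl) auto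
  also have "\<dots> = (\<integral>z. normal_density 0 (sqrt (s - u)) z * (if z \<le> R - x then 1 else -1) \<partial>lborel)"
    by (rule distributed_integral[symmetric, OF d]) auto
  also have "\<dots> = erf ((R - x) / (sqrt (s - u) * sqrt 2))" using u by (intro integral_sign_normal) simp
  also have "sqrt (s - u) * sqrt 2 = sqrt (2 * (s - u))" unfolding real_sqrt_mult by (rule mult.commute)
  finally show ?thesis .
qed

locale real_brownian =
  fixes N :: "'b measure" and \<alpha> :: real and X :: "real \<Rightarrow> 'b \<Rightarrow> real"
  assumes bm: "brownian_motion N \<alpha> X"
begin

sublocale independent_increments N X \<alpha>
  by (rule independent_increments_brownian_motion[OF bm])

lemma runmax_X_measurable: "s > 0 \<Longrightarrow> (\<lambda>\<omega>. runmax s (\<lambda>u. X u \<omega>)) \<in> borel_measurable N"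
  using measurable_compose[OF path_of_measurable[OF B_measurable] runmax_measurable[of s]]
  by (simp add: runmax_path_of)

text \<open>The same exit estimate in dimension one: the image extension of the constant 1 is 1
  below R and -1 above, and its mean from a start at R is 0 by symmetry.\<close>

lemma prob_runmax_le:
  assumes s: "s > 0" and R: "\<alpha> \<le> R"
  shows "prob {\<omega>\<in>space N. runmax s (\<lambda>u. X u \<omega>) \<le> R} = erf ((R - \<alpha>) / sqrt (2 * s))"
proof -
  define A where "A n = {\<omega>\<in>space N. \<forall>k\<le>2^n. X (real k * (s / 2 ^ n)) \<omega> \<le> R}" for n :: nat
  have Am: "A n \<in> sets N" for n
  proof -
    have [measurable]: "X (real k * (s / 2 ^ n)) \<in> borel_measurable N" for k using s by (intro B_measurable) simp
    have "A n = {\<omega>\<in>space N. \<forall>k\<in>{..2^n}. X (real k * (s / 2 ^ n)) \<omega> \<le> R}" by (auto simp: A_def)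
    moreover have "{\<omega>\<in>space N. \<forall>k\<in>{..2^n}. X (real k * (s / 2 ^ n)) \<omega> \<le> R} \<in> sets N" by measurable
    ultimately show ?thesis by simp
  qed
  have "decseq A"
  proof (rule decseq_SucI, rule subsetI)
    fix n \<omega> assume w: "\<omega> \<in> A (Suc n)"
    have "X (real k * (s / 2 ^ n)) \<omega> \<le> R" if "k \<le> 2 ^ n" for k
    proof -
      have "\<forall>j\<le>2 ^ Suc n. X (real j * (s / 2 ^ Suc n)) \<omega> \<le> R" using w unfolding A_def by blast
      moreover have "2 * k \<le> 2 ^ Suc n" using that by simp
      ultimately have "X (real (2 * k) * (s / 2 ^ Suc n)) \<omega> \<le> R" by blast
      moreover have "real (2 * k) * (s / 2 ^ Suc n) = real k * (s / 2 ^ n)" by simp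
      ultimately show ?thesis by (simp only:)
    qed
    then show "\<omega> \<in> A n" using w by (simp add: A_def)
  qed
  then have "(\<lambda>n. prob (A n)) \<longlonglongrightarrow> prob (\<Inter>n. A n)"
    using Am by (intro finite_Lim_measure_decseq) auto
  moreover have "(\<lambda>n. prob (A n)) \<longlonglongrightarrow> (\<integral>\<omega>. (if X s \<omega> \<le> R then 1 else -1) \<partial>N)"
    unfolding A_def
  proof (rule grid_exit_probability[OF s, where \<rho> = "\<lambda>x. x" and v = "\<lambda>t x. erf ((R - x) / sqrt (2 * t))"])
    fix t x and tn xn :: "nat \<Rightarrow> real"
    assume "t > 0" "x = R" "tn \<longlonglongrightarrow> t" "xn \<longlonglongrightarrow> x"
    then have "(\<lambda>n. erf ((R - xn n) / sqrt (2 * tn n))) \<longlonglongrightarrow> erf ((R - R) / sqrt (2 * t))"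
      by (intro tendsto_erf tendsto_intros) auto
    then show "(\<lambda>n. erf ((R - xn n) / sqrt (2 * tn n))) \<longlonglongrightarrow> 0" by simp
  qed (use R brownian_motion_sign_mean[OF bm] in auto)
  ultimately have "prob (\<Inter>n. A n) = (\<integral>\<omega>. (if X s \<omega> \<le> R then 1 else -1) \<partial>N)" by (rule LIMSEQ_unique)
  also have "\<dots> = (\<integral>\<omega>. (if \<alpha> + (X s \<omega> - X 0 \<omega>) \<le> R then 1 else -1) \<partial>N)"
  proof (rule integral_cong_AE)
    have [measurable]: "X s \<in> borel_measurable N" "X 0 \<in> borel_measurable N" using s by (auto intro: B_measurable)
    show "(\<lambda>\<omega>. if X s \<omega> \<le> R then 1 else -1 :: real) \<in> borel_measurable N"
      "(\<lambda>\<omega>. if \<alpha> + (X s \<omega> - X 0 \<omega>) \<le> R then 1 else -1 :: real) \<in> borel_measurable N" by measurable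
    show "AE \<omega> in N. (if X s \<omega> \<le> R then 1 else -1 :: real) = (if \<alpha> + (X s \<omega> - X 0 \<omega>) \<le> R then 1 else -1)"
      using start by eventually_elim simp
  qed
  also have "\<dots> = erf ((R - \<alpha>) / sqrt (2 * s))" using brownian_motion_sign_mean[OF bm, of 0 s \<alpha> R] s by simp
  finally have "prob (\<Inter>n. A n) = erf ((R - \<alpha>) / sqrt (2 * s))" .
  moreover have "prob {\<omega>\<in>space N. runmax s (\<lambda>u. X u \<omega>) \<le> R} = prob (\<Inter>n. A n)"
  proof (rule finite_measure_eq_AE)
    show "AE \<omega> in N. \<omega> \<in> {\<omega>\<in>space N. runmax s (\<lambda>u. X u \<omega>) \<le> R} \<longleftrightarrow> \<omega> \<in> (\<Inter>n. A n)"
      using path_continuous AE_space by eventually_elim (auto simp: A_def runmax_le_iff_grid s)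
    show "{\<omega>\<in>space N. runmax s (\<lambda>u. X u \<omega>) \<le> R} \<in> sets N" using runmax_X_measurable[OF s] by measurable
    show "(\<Inter>n. A n) \<in> sets N" using Am by (intro sets.countable_INT) auto
  qed
  ultimately show ?thesis by simp
qed

text \<open>Survival of the reflection coupling means staying strictly below the midpoint;
  continuity in R shows that the strict and the weak event have the same probability.\<close>

lemma prob_runmax_less:
  assumes s: "s > 0" and R: "\<alpha> < R"
  shows "prob {\<omega>\<in>space N. runmax s (\<lambda>u. X u \<omega>) < R} = erf ((R - \<alpha>) / sqrt (2 * s))"
proof (rule antisym)
  note [measurable] = runmax_X_measurable[OF s]
  show "prob {\<omega>\<in>space N. runmax s (\<lambda>u. X u \<omega>) < R} \<le> erf ((R - \<alpha>) / sqrt (2 * s))"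
    unfolding prob_runmax_le[OF s less_imp_le[OF R], symmetric] by (rule finite_measure_mono) auto
  have "((\<lambda>r. erf ((r - \<alpha>) / sqrt (2 * s))) \<longlongrightarrow> erf ((R - \<alpha>) / sqrt (2 * s))) (at_left R)"
    using s by (intro tendsto_erf tendsto_intros) auto
  moreover have "\<forall>\<^sub>F r in at_left R. erf ((r - \<alpha>) / sqrt (2 * s)) \<le> prob {\<omega>\<in>space N. runmax s (\<lambda>u. X u \<omega>) < R}"
    unfolding eventually_at_left[OF R]
  proof (intro exI[of _ \<alpha>] conjI allI impI R)
    fix r assume "\<alpha> < r" "r < R"
    then show "erf ((r - \<alpha>) / sqrt (2 * s)) \<le> prob {\<omega>\<in>space N. runmax s (\<lambda>u. X u \<omega>) < R}"
      by (subst prob_runmax_le[symmetric, OF s]) (auto intro!: finite_measure_mono)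
  qed
  ultimately show "erf ((R - \<alpha>) / sqrt (2 * s)) \<le> prob {\<omega>\<in>space N. runmax s (\<lambda>u. X u \<omega>) < R}"
    by (rule tendsto_upperbound) simp
qed

end

text \<open>Before the hitting time a path agrees with its mirror image only at the midpoint, which
  it has not yet visited; from the hitting time on the two coincide by definition.\<close>

lemma reflection_time_eq_hitting_time: "reflection_time \<alpha> \<beta> x = hitting_time x ((\<alpha> + \<beta>) / 2)"
proof -
  let ?T = "hitting_time x ((\<alpha> + \<beta>) / 2)"
  have T0: "0 \<le> ?T" unfolding hitting_time_def by (intro Inf_greatest) auto
  have "{ereal s |s. 0 \<le> s \<and> (\<forall>t\<ge>s. x t = reflected \<alpha> \<beta> x t)} = {ereal s |s. ?T \<le> ereal s}"
  proof (intro Collect_cong ex_cong1 conj_cong refl iffI)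
    fix s assume a: "0 \<le> s \<and> (\<forall>t\<ge>s. x t = reflected \<alpha> \<beta> x t)"
    show "?T \<le> ereal s"
    proof (rule ccontr)
      assume lt: "\<not> ?T \<le> ereal s"
      then have "x s = \<alpha> + \<beta> - x s" using a by (auto simp: reflected_def not_le)
      then have "x s = (\<alpha> + \<beta>) / 2" by simp
      then have "?T \<le> ereal s" unfolding hitting_time_def using a by (intro Inf_lower) auto
      then show False using lt by simp
    qed
  next
    fix s assume h: "?T \<le> ereal s"
    have "\<not> ereal t < ?T" if "s \<le> t" for t using order_trans[OF h, of "ereal t"] that by (simp add: not_less)
    moreover have "0 \<le> s" using order_trans[OF T0 h] by simp
    ultimately show "0 \<le> s \<and> (\<forall>t\<ge>s. x t = reflected \<alpha> \<beta> x t)" by (simp add: reflected_def)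
  qed
  then have "reflection_time \<alpha> \<beta> x = Inf {ereal s |s. ?T \<le> ereal s}"
    unfolding reflection_time_def by simp
  also have "\<dots> = ?T"
  proof (rule antisym)
    show "?T \<le> Inf {ereal s |s. ?T \<le> ereal s}" by (intro Inf_greatest) auto
    show "Inf {ereal s |s. ?T \<le> ereal s} \<le> ?T"
    proof (cases ?T)
      case (real r)
      then show ?thesis by (intro Inf_lower) auto
    qed (use T0 in auto)
  qed
  finally show ?thesis .
qed

text \<open>The path starts below c and cannot pass c without hitting it. Staying below on the
  closed interval extends past s, which yields the strict inequality.\<close>

lemma hitting_time_gt_iff:
  assumes y: "continuous_on {0..} y" and y0: "y 0 < c" and s: "s > 0"
  shows "ereal s < hitting_time y c \<longleftrightarrow> (\<forall>u\<in>{0..s}. y u < c)"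
proof
  assume h: "ereal s < hitting_time y c"
  show "\<forall>u\<in>{0..s}. y u < c"
  proof (rule ballI, rule ccontr)
    fix u assume u: "u \<in> {0..s}" "\<not> y u < c"
    have "\<exists>x\<ge>0. x \<le> u \<and> y x = c"
      using u y0 y by (intro IVT') (auto intro: continuous_on_subset)
    then obtain x where "0 \<le> x" "x \<le> u" "y x = c" by auto
    then have "hitting_time y c \<le> ereal x" unfolding hitting_time_def by (intro Inf_lower) auto
    also have "ereal x \<le> ereal s" using \<open>x \<le> u\<close> u by simp
    finally show False using h by simp
  qed
next
  assume a: "\<forall>u\<in>{0..s}. y u < c"
  then obtain q :: rat where q: "s < of_rat q" "\<forall>u\<in>{0..of_rat q}. y u < c"
    using continuous_less_extends[OF y, of s c] s by auto
  have "ereal (of_rat q) \<le> hitting_time y c"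
    unfolding hitting_time_def
  proof (rule Inf_greatest)
    fix z assume "z \<in> {ereal t |t. 0 \<le> t \<and> y t = c}"
    then obtain t where t: "z = ereal t" "0 \<le> t" "y t = c" by auto
    then have "\<not> t \<le> of_rat q" using q by auto
    then show "ereal (of_rat q) \<le> z" using t by simp
  qed
  moreover have "ereal s < ereal (of_rat q)" using q by simp
  ultimately show "ereal s < hitting_time y c" by (rule less_le_trans[rotated])
qed

lemma (in real_brownian) reflection_tail:
  assumes s: "s > 0" and ab: "\<alpha> < \<beta>"
  shows "{\<omega>\<in>space N. reflection_time \<alpha> \<beta> (\<lambda>t. X t \<omega>) > ereal s} \<in> sets (completion N)"
    and "measure (completion N) {\<omega>\<in>space N. reflection_time \<alpha> \<beta> (\<lambda>t. X t \<omega>) > ereal s} = erf ((\<beta> - \<alpha>) / (2 * sqrt (2 * s)))"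
proof -
  let ?c = "(\<alpha> + \<beta>) / 2"
  have c: "\<alpha> < ?c" "?c - \<alpha> = (\<beta> - \<alpha>) / 2" using ab by (auto simp: field_simps)
  let ?E = "{\<omega>\<in>space N. runmax s (\<lambda>u. X u \<omega>) < ?c}"
  have E: "?E \<in> sets N" using runmax_X_measurable[OF s] by measurable
  have "AE \<omega> in N. \<omega> \<in> {\<omega>\<in>space N. reflection_time \<alpha> \<beta> (\<lambda>t. X t \<omega>) > ereal s} \<longleftrightarrow> \<omega> \<in> ?E"
    using start path_continuous
  proof eventually_elim
    case (elim \<omega>)
    have "runmax s (\<lambda>u. X u \<omega>) < ?c \<longleftrightarrow> (\<forall>u\<in>{0..s}. X u \<omega> < ?c)"
      using runmax_attained[OF elim(2) s] by (auto intro: le_less_trans)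
    then show ?case using hitting_time_gt_iff[OF elim(2), of ?c s] elim(1) c s
      by (simp add: reflection_time_eq_hitting_time)
  qed
  note T = measure_completion_AE_eq[OF E _ this]
  show "{\<omega>\<in>space N. reflection_time \<alpha> \<beta> (\<lambda>t. X t \<omega>) > ereal s} \<in> sets (completion N)" by (rule T) auto
  have "measure (completion N) {\<omega>\<in>space N. reflection_time \<alpha> \<beta> (\<lambda>t. X t \<omega>) > ereal s} = prob ?E" by (rule T) auto
  also have "\<dots> = erf ((?c - \<alpha>) / sqrt (2 * s))" by (rule prob_runmax_less[OF s c(1)])
  finally show "measure (completion N) {\<omega>\<in>space N. reflection_time \<alpha> \<beta> (\<lambda>t. X t \<omega>) > ereal s} = erf ((\<beta> - \<alpha>) / (2 * sqrt (2 * s)))"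
    unfolding c(2) by (simp add: mult.commute)
qed

section \<open>Bounds for the survival function\<close>

text \<open>Conditional probability, given \<open>\<Theta> = \<theta>\<close> and running maximum \<open>m\<close>, that two points at distance
  \<open>D\<close> lie in different cells.\<close>

definition split_prob :: "real \<Rightarrow> real \<Rightarrow> real \<Rightarrow> real" where
  "split_prob D \<theta> m = min 1 (D / (2 * dlevel \<theta> (dindex \<theta> m)))"

lemma dlevel_dindex_eq: "dlevel \<theta> (dindex \<theta> m) = 2 powr (of_int \<lfloor>log 2 m - \<theta>\<rfloor> + \<theta>)"
  by (simp add: dlevel_def dindex_def)

lemma split_prob_measurable [measurable (raw)]:
  assumes [measurable]: "f \<in> borel_measurable N" "g \<in> borel_measurable N"
  shows "(\<lambda>x. split_prob D (f x) (g x)) \<in> borel_measurable N"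
  unfolding split_prob_def dlevel_dindex_eq by measurable

lemma split_prob_bounds: "D \<ge> 0 \<Longrightarrow> 0 \<le> split_prob D \<theta> m" "split_prob D \<theta> m \<le> 1"
  by (auto simp: split_prob_def)

lemma split_prob_antimono:
  assumes "D \<ge> 0" "0 < m" "m \<le> m'"
  shows "split_prob D \<theta> m' \<le> split_prob D \<theta> m"
proof -
  have "dindex \<theta> m \<le> dindex \<theta> m'" using assms unfolding dindex_def by (intro add_right_mono floor_mono diff_right_mono) simp
  then have "dlevel \<theta> (dindex \<theta> m) \<le> dlevel \<theta> (dindex \<theta> m')" by (rule dlevel_mono)
  then show ?thesis unfolding split_prob_def using assms
    by (intro min.mono order_refl divide_left_mono) auto
qed

lemma split_prob_small:
  assumes "0 < m" "2 * m \<le> D"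
  shows "split_prob D \<theta> m = 1"
proof -
  have "2 * dlevel \<theta> (dindex \<theta> m) \<le> D" using dlevel_dindex(1)[OF assms(1), of \<theta>] assms by linarith
  then show ?thesis by (simp add: split_prob_def)
qed

text \<open>The minimum with 1 loses something only if the cell length 2d is below D. Then y is at
  most m, which is below 2d, so the subtracted term D / y already exceeds D / (2d).\<close>

lemma split_prob_lower:
  assumes D: "D > 0" and y: "0 < y" "y \<le> m"
  shows "D / 2 * (1 / dlevel \<theta> (dindex \<theta> m)) - D * (indicator {..<D} y / y) \<le> split_prob D \<theta> m"
proof -
  have m: "m > 0" using y by simp
  let ?d = "dlevel \<theta> (dindex \<theta> m)"
  have e: "D / 2 * (1 / ?d) = D / (2 * ?d)" by simp
  show ?thesis
  proof (cases "D / (2 * ?d) \<le> 1")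
    case True
    then show ?thesis unfolding e split_prob_def using D y by (auto split: split_indicator)
  next
    case False
    then have "2 * ?d < D" by (simp add: field_simps)
    then have yD: "y < D" using dlevel_dindex(2)[OF m, of \<theta>] y unfolding dlevel_Suc by linarith
    have "D / (2 * ?d) \<le> D / y"
      using dlevel_dindex(2)[OF m, of \<theta>] y D unfolding dlevel_Suc by (intro divide_left_mono) auto
    then show ?thesis unfolding e split_prob_def using yD D y by (auto simp: min_def)
  qed
qed

lemma (in prob_space) expectation_ge_of_bounded:
  fixes f :: "'a \<Rightarrow> real"
  assumes [measurable]: "f \<in> borel_measurable M" and "\<And>x. \<bar>f x\<bar> \<le> b" and "\<And>x. x \<in> space M \<Longrightarrow> c \<le> f x"
  shows "c \<le> (\<integral>x. f x \<partial>M)"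
  using assms by (intro integral_ge_const integrable_const_bound[where B = b]) auto

lemma (in prob_space) expectation_le_of_bounded:
  fixes f :: "'a \<Rightarrow> real"
  assumes [measurable]: "f \<in> borel_measurable M" and "\<And>x. \<bar>f x\<bar> \<le> b" and "\<And>x. x \<in> space M \<Longrightarrow> f x \<le> c"
  shows "(\<integral>x. f x \<partial>M) \<le> c"
  using assms by (intro integral_le_const integrable_const_bound[where B = b]) auto

text \<open>For uniform theta the binary logarithm of the last level below R is uniform on the unit
  interval that ends at log R. The integrand is positive only where that level exceeds D /
  2.\<close>

lemma integral_level_profile:
  assumes D: "D > 0" and R: "D / 2 \<le> R" "R \<le> D"
  shows "(ln (2 * R / D) + D / (2 * R) - 1) / ln 2 \<le> (\<integral>\<theta>. (1 - split_prob D \<theta> R) * indicator {0..1} \<theta> \<partial>lborel)"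
proof -
  have Rp: "R > 0" using D R by simp
  define c where "c = log 2 R"
  define k where "k = \<lfloor>c\<rfloor>"
  define G where "G y = 1 - min 1 (D / 2 * 2 powr (- y))" for y :: real
  define a where "a = log 2 (D / 2)"
  have [measurable]: "G \<in> borel_measurable borel" unfolding G_def by measurable
  have kc: "of_int k \<le> c" "c < of_int k + 1" unfolding k_def by linarith+
  \<comment> \<open>The bounds on R place the threshold log (D / 2) inside the window from c - 1 to
    c, so the explicit integral runs over one piece.\<close>
  have ac: "a \<le> c" "c - 1 \<le> a"
  proof -
    show "a \<le> c" unfolding a_def c_def using D R by simp
    have "log 2 (D / 2) = log 2 D - 1" using D by (simp add: log_divide)
    moreover have "log 2 R \<le> log 2 D" using Rp R by simp
    ultimately show "c - 1 \<le> a" unfolding a_def c_def by simp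
  qed
  have h: "1 - split_prob D \<theta> R = G (of_int \<lfloor>c - \<theta>\<rfloor> + \<theta>)" for \<theta>
    unfolding split_prob_def dlevel_dindex_eq G_def c_def powr_minus by (simp add: field_simps)
  have Gb: "0 \<le> G y" "G y \<le> 1" for y unfolding G_def using D by auto
  have Gi: "integrable lborel (\<lambda>y. G (y + r) * indicator {l..u} y)" for l u r
  proof (rule Bochner_Integration.integrable_bound)
    show "integrable lborel (indicator {l..u} :: real \<Rightarrow> real)"
      by (rule integrable_real_indicator) (auto simp: emeasure_lborel_Icc_eq)
  qed (use Gb in \<open>auto split: split_indicator\<close>)
  have shift: "(\<integral>y. G (y + r) * indicator {l..u} y \<partial>lborel) = (\<integral>y. G y * indicator {l + r..u + r} y \<partial>lborel)" for l u r
    by (subst lborel_integral_real_affine[where c = 1 and t = r and f = "\<lambda>y. G y * indicator {l + r..u + r} y"])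
       (auto intro!: Bochner_Integration.integral_cong split: split_indicator simp: add.commute)
  \<comment> \<open>As theta runs through the unit interval the logarithm of the level covers the
    window once, jumping from c to c - 1 at theta = c - k.\<close>
  have "(\<integral>\<theta>. (1 - split_prob D \<theta> R) * indicator {0..1} \<theta> \<partial>lborel) =
    (\<integral>\<theta>. G (\<theta> + of_int k) * indicator {0..c - of_int k} \<theta> + G (\<theta> + (of_int k - 1)) * indicator {c - of_int k..1} \<theta> \<partial>lborel)"
  proof (rule integral_cong_AE)
    show "AE \<theta> in lborel. (1 - split_prob D \<theta> R) * indicator {0..1} \<theta> =
      G (\<theta> + of_int k) * indicator {0..c - of_int k} \<theta> + G (\<theta> + (of_int k - 1)) * indicator {c - of_int k..1} \<theta>"
      using AE_lborel_singleton[of "c - of_int k"]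
    proof eventually_elim
      case (elim \<theta>)
      show ?case
      proof (cases "\<theta> \<in> {0..1}")
        case False
        then show ?thesis using kc by (auto split: split_indicator)
      next
        case True
        show ?thesis
        proof (cases "\<theta> < c - of_int k")
          case less: True
          then have "\<lfloor>c - \<theta>\<rfloor> = k" using True kc by (simp; linarith)
          then show ?thesis using True less unfolding h by (auto split: split_indicator simp: add.commute)
        next
          case False
          then have "\<lfloor>c - \<theta>\<rfloor> = k - 1" using True kc elim by (simp; linarith)
          then show ?thesis using True False elim unfolding h by (auto split: split_indicator simp: algebra_simps)
        qed
      qed
    qed
  qed measurable
  also have "\<dots> = (\<integral>y. G y * indicator {of_int k..c} y \<partial>lborel) + (\<integral>y. G y * indicator {c - 1..of_int k} y \<partial>lborel)"
    using Gi by (subst Bochner_Integration.integral_add) (auto simp: shift)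
  also have "\<dots> = (\<integral>y. G y * indicator {of_int k..c} y + G y * indicator {c - 1..of_int k} y \<partial>lborel)"
    using Gi[of 0] by (subst Bochner_Integration.integral_add) auto
  also have "\<dots> \<ge> (\<integral>y. (1 - D / 2 * 2 powr (- y)) * indicator {a..c} y \<partial>lborel)"
  proof (rule integral_mono)
    show "integrable lborel (\<lambda>y. G y * indicator {of_int k..c} y + G y * indicator {c - 1..of_int k} y)"
      using Gi[of 0] by (intro Bochner_Integration.integrable_add) auto
    have "set_integrable lborel {a..c} (\<lambda>y. 1 - D / 2 * 2 powr (- y))"
      by (intro borel_integrable_atLeastAtMost') (intro continuous_intros, auto)
    then show "integrable lborel (\<lambda>y. (1 - D / 2 * 2 powr (- y)) * indicator {a..c} y)"
      by (simp add: set_integrable_def mult.commute)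
    show "(1 - D / 2 * 2 powr (- y)) * indicator {a..c} y \<le> G y * indicator {of_int k..c} y + G y * indicator {c - 1..of_int k} y" for y
    proof -
      have "1 - D / 2 * 2 powr (- y) \<le> G y" by (simp add: G_def)
      then show ?thesis using Gb[of y] ac kc by (auto split: split_indicator)
    qed
  qed
  also have "(\<integral>y. (1 - D / 2 * 2 powr (- y)) * indicator {a..c} y \<partial>lborel) =
     (c + D / 2 * 2 powr (- c) / ln 2) - (a + D / 2 * 2 powr (- a) / ln 2)"
  proof (rule integral_FTC_Icc_real[OF ac(1)])
    fix y
    show "((\<lambda>y. y + D / 2 * 2 powr (- y) / ln 2) has_real_derivative 1 - D / 2 * 2 powr (- y)) (at y)"
      by (auto intro!: derivative_eq_intros)
    show "isCont (\<lambda>y. 1 - D / 2 * 2 powr (- y)) y" by (intro continuous_intros) auto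
  qed
  also have "\<dots> = (ln (2 * R / D) + D / (2 * R) - 1) / ln 2"
  proof -
    have "2 powr c = R" "2 powr a = D / 2" unfolding c_def a_def using D Rp by auto
    then have "D / 2 * 2 powr (- c) = D / (2 * R)" "D / 2 * 2 powr (- a) = 1" using D by (auto simp: powr_minus field_simps)
    moreover have "c - a = ln (2 * R / D) / ln 2" unfolding c_def a_def log_def
      using D Rp by (simp add: ln_div ln_mult diff_divide_distrib[symmetric])
    ultimately show ?thesis by (simp add: add_divide_distrib diff_divide_distrib)
  qed
  finally show ?thesis .
qed

section \<open>The Bessel process at a fixed time\<close>

context bessel
begin

text \<open>The density at time s is compared with the one at the later time s /
  \<open>\<delta>\<close>. Their ratio is \<open>\<delta>\<close> to the power -3/2 times a Gaussian
  factor that is largest at R on the range beyond R, and the later density integrates to 1.\<close>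

lemma prob_Y_gt_le_exp:
  assumes s: "s > 0" and d: "0 < \<delta>" "\<delta> < 1" and R: "R > 0"
  shows "prob {\<omega>\<in>space M. Y s \<omega> > R} \<le> \<delta> powr (-3/2) * exp (- (1 - \<delta>) * R\<^sup>2 / (2 * s))"
proof -
  have [measurable]: "Y s \<in> borel_measurable M" using s by (auto intro: Y_measurable)
  define t where "t = s / \<delta>"
  have t: "t > 0" using s d by (simp add: t_def)
  have one: "(\<integral>\<rho>. radial_density (sqrt t) 0 \<rho> \<partial>lborel) = 1"
    using Y_integral[OF t, of "\<lambda>_. 1"] by (simp add: prob_space)
  have ti: "integrable lborel (radial_density (sqrt t) 0)"
    using one not_integrable_integral_eq by fastforce
  have si: "integrable lborel (radial_density (sqrt s) 0)"
    using Y_integral[OF s, of "\<lambda>_. 1"] not_integrable_integral_eq by (fastforce simp: prob_space)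
  have "prob {\<omega>\<in>space M. Y s \<omega> > R} = (\<integral>\<omega>. indicator {R<..} (Y s \<omega>) \<partial>M)"
  proof -
    have "(\<integral>\<omega>. indicator {R<..} (Y s \<omega>) \<partial>M) = (\<integral>\<omega>. indicator {\<omega>\<in>space M. Y s \<omega> > R} \<omega> \<partial>M :: real)"
      by (intro Bochner_Integration.integral_cong) (auto split: split_indicator)
    then show ?thesis by simp
  qed
  also have "\<dots> = (\<integral>\<rho>. radial_density (sqrt s) 0 \<rho> * indicator {R<..} \<rho> \<partial>lborel)"
    by (rule Y_integral[OF s]) measurable
  also have "\<dots> \<le> (\<integral>\<rho>. \<delta> powr (-3/2) * exp (- (1 - \<delta>) * R\<^sup>2 / (2 * s)) * radial_density (sqrt t) 0 \<rho> \<partial>lborel)"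
  proof (rule integral_mono)
    show "integrable lborel (\<lambda>\<rho>. radial_density (sqrt s) 0 \<rho> * indicator {R<..} \<rho>)"
      by (rule Bochner_Integration.integrable_bound[OF si]) (auto split: split_indicator)
    show "integrable lborel (\<lambda>\<rho>. \<delta> powr (-3/2) * exp (- (1 - \<delta>) * R\<^sup>2 / (2 * s)) * radial_density (sqrt t) 0 \<rho>)"
      using ti by (rule integrable_mult_right)
    fix \<rho> :: real
    have nn: "0 \<le> radial_density (sqrt t) 0 \<rho>" using t by (intro radial_density_nonneg) auto
    show "radial_density (sqrt s) 0 \<rho> * indicator {R<..} \<rho> \<le> \<delta> powr (-3/2) * exp (- (1 - \<delta>) * R\<^sup>2 / (2 * s)) * radial_density (sqrt t) 0 \<rho>"
    proof (cases "\<rho> > R")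
      case True
      have rp: "\<rho> > 0" using True R by simp
      have c: "\<delta> powr (-3/2) * (2 * \<rho>\<^sup>2 / t / sqrt (2 * pi * t)) = 2 * \<rho>\<^sup>2 / s / sqrt (2 * pi * s)"
      proof -
        have "\<delta> powr (3/2) = \<delta> powr 1 * \<delta> powr (1/2)" unfolding powr_add[symmetric] by simp
        then have "\<delta> powr (3/2) = \<delta> * sqrt \<delta>" using d by (simp add: powr_half_sqrt)
        then have A: "\<delta> powr (-3/2) = 1 / ((sqrt \<delta>)\<^sup>2 * sqrt \<delta>)" using powr_minus[of \<delta> "3/2"] d by (simp add: field_simps)
        have B: "sqrt (2 * pi * t) = sqrt (2 * pi * s) / sqrt \<delta>" unfolding t_def real_sqrt_divide[symmetric] by simp
        have T: "t = s / (sqrt \<delta>)\<^sup>2" using d by (simp add: t_def)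
        have gen: "1 / (q\<^sup>2 * q) * (2 * \<rho>\<^sup>2 / (s / q\<^sup>2) / (P / q)) = 2 * \<rho>\<^sup>2 / s / P" if "q > 0" "P > 0" for P q :: real
          using that s by (simp add: field_simps power2_eq_square)
        show ?thesis unfolding A B unfolding T by (rule gen) (use d s in auto)
      qed
      have "exp (- \<rho>\<^sup>2 / (2 * s)) = exp (- (1 - \<delta>) * \<rho>\<^sup>2 / (2 * s)) * exp (- \<rho>\<^sup>2 / (2 * t))"
        unfolding exp_add[symmetric] t_def using s d by (intro arg_cong[where f = exp]) (simp add: field_simps)
      also have "\<dots> \<le> exp (- (1 - \<delta>) * R\<^sup>2 / (2 * s)) * exp (- \<rho>\<^sup>2 / (2 * t))"
      proof -
        have "R\<^sup>2 \<le> \<rho>\<^sup>2" using True R by (intro power_mono) auto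
        then have "- (1 - \<delta>) * \<rho>\<^sup>2 \<le> - (1 - \<delta>) * R\<^sup>2" using d by (intro mult_left_mono_neg) auto
        then show ?thesis using s by (intro mult_right_mono) (auto intro: divide_right_mono)
      qed
      finally have e: "exp (- \<rho>\<^sup>2 / (2 * s)) \<le> exp (- (1 - \<delta>) * R\<^sup>2 / (2 * s)) * exp (- \<rho>\<^sup>2 / (2 * t))" .
      have rd: "radial_density (sqrt v) 0 \<rho> = 2 * \<rho>\<^sup>2 / v / sqrt (2 * pi * v) * exp (- \<rho>\<^sup>2 / (2 * v))" if "v > 0" for v
        using that rp by (simp add: radial_density_def normal_density_def)
      have "radial_density (sqrt s) 0 \<rho> \<le> 2 * \<rho>\<^sup>2 / s / sqrt (2 * pi * s) * (exp (- (1 - \<delta>) * R\<^sup>2 / (2 * s)) * exp (- \<rho>\<^sup>2 / (2 * t)))"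
        unfolding rd[OF s] using e s by (intro mult_left_mono) auto
      also have "\<dots> = \<delta> powr (-3/2) * exp (- (1 - \<delta>) * R\<^sup>2 / (2 * s)) * radial_density (sqrt t) 0 \<rho>"
        unfolding c[symmetric] rd[OF t] by (simp only: mult_ac)
      finally show ?thesis using True by simp
    next
      case False
      then show ?thesis using nn by simp
    qed
  qed
  also have "\<dots> = \<delta> powr (-3/2) * exp (- (1 - \<delta>) * R\<^sup>2 / (2 * s))" using one by simp
  finally show ?thesis .
qed

lemma prob_Y_le_erf:
  assumes s: "s > 0" and R: "R \<ge> 0"
  shows "prob {\<omega>\<in>space M. Y s \<omega> \<le> R} \<le> erf (R / sqrt (2 * s)) ^ 3"
proof -
  obtain N :: "(real \<Rightarrow> real ^ 3) measure" and X where X: "brownian_motion_3d_0 N X"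
    "distr M path_space (path_of Y) = distr N path_space (path_of (\<lambda>t \<omega>. norm (X t \<omega>)))"
    "path_of (\<lambda>t \<omega>. norm (X t \<omega>)) \<in> N \<rightarrow>\<^sub>M path_space"
    by (rule norm_brownian_law)
  have bm: "brownian_motion N 0 (\<lambda>t \<omega>. X t \<omega> $ i)" for i
    using X(1) by (simp add: brownian_motion_3d_0_def)
  have pN: "prob_space N" using bm[of 1] by (simp add: brownian_motion_def)
  have paths: "prob_space.indep_vars N (\<lambda>_. path_space) (\<lambda>i. path_of (\<lambda>t \<omega>. X t \<omega> $ i)) UNIV"
    using X(1) by (simp add: brownian_motion_3d_0_def)
  have Xm[measurable]: "(\<lambda>\<omega>. X s \<omega> $ i) \<in> borel_measurable N" "(\<lambda>\<omega>. X 0 \<omega> $ i) \<in> borel_measurable N" for i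
    using bm[of i] s by (auto simp: brownian_motion_def)
  have m: "(\<lambda>p. p s) \<in> borel_measurable (path_space :: (real \<Rightarrow> real) measure)"
    using s by (intro measurable_component_singleton) simp
  have Xn[measurable]: "(\<lambda>\<omega>. norm (X s \<omega>)) \<in> borel_measurable N"
    using measurable_compose[OF X(3) m] s by (simp add: path_of_def)
  let ?A = "{p \<in> space path_space. p s \<le> R}"
  have A: "?A \<in> sets path_space" using m by measurable
  let ?C = "{p \<in> space path_space. p s \<in> {-R..R}}"
  have C: "?C \<in> sets path_space" using m by measurable
  have "prob {\<omega>\<in>space M. Y s \<omega> \<le> R} = measure (distr M path_space (path_of Y)) ?A"
    by (subst measure_distr[OF path_of_measurable[OF Y_measurable] A])
       (use s in \<open>auto intro!: arg_cong[where f = prob] simp: path_of_def space_PiM\<close>)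
  also have "\<dots> = measure N {\<omega>\<in>space N. norm (X s \<omega>) \<le> R}"
    unfolding X(2) by (subst measure_distr[OF X(3) A])
       (use s in \<open>auto intro!: arg_cong[where f = "measure N"] simp: path_of_def space_PiM\<close>)
  also have "\<dots> \<le> measure N (\<Inter>i\<in>UNIV. path_of (\<lambda>t \<omega>. X t \<omega> $ i) -` ?C \<inter> space N)"
  proof (rule finite_measure.finite_measure_mono)
    show "finite_measure N" using pN by (rule prob_space.finite_measure)
    show "{\<omega>\<in>space N. norm (X s \<omega>) \<le> R} \<subseteq> (\<Inter>i\<in>UNIV. path_of (\<lambda>t \<omega>. X t \<omega> $ i) -` ?C \<inter> space N)"
    proof
      fix \<omega> assume w: "\<omega> \<in> {\<omega>\<in>space N. norm (X s \<omega>) \<le> R}"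
      have "\<bar>X s \<omega> $ i\<bar> \<le> R" for i using component_le_norm_cart[of "X s \<omega>" i] w by simp
      then have "-R \<le> X s \<omega> $ i" "X s \<omega> $ i \<le> R" for i by (simp_all add: abs_le_iff minus_le_iff)
      then show "\<omega> \<in> (\<Inter>i\<in>UNIV. path_of (\<lambda>t \<omega>. X t \<omega> $ i) -` ?C \<inter> space N)"
        using w s by (auto simp: path_of_def space_PiM)
    qed
    have pm: "path_of (\<lambda>t \<omega>. X t \<omega> $ i) \<in> N \<rightarrow>\<^sub>M path_space" for i
      using bm[of i] by (intro path_of_measurable) (simp add: brownian_motion_def)
    show "(\<Inter>i\<in>UNIV. path_of (\<lambda>t \<omega>. X t \<omega> $ i) -` ?C \<inter> space N) \<in> sets N"
      using measurable_sets[OF pm C] by (intro sets.finite_INT) auto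
  qed
  also have "\<dots> = (\<Prod>i\<in>(UNIV :: 3 set). measure N (path_of (\<lambda>t \<omega>. X t \<omega> $ i) -` ?C \<inter> space N))"
    by (intro prob_space.indep_varsD_finite[OF pN paths]) (simp, simp, rule C)
  also have "\<dots> = (\<Prod>i\<in>(UNIV :: 3 set). erf (R / sqrt (2 * s)))"
  proof (rule prod.cong[OF refl])
    fix i :: 3
    have d: "distributed N lborel (\<lambda>\<omega>. X s \<omega> $ i - X 0 \<omega> $ i) (\<lambda>z. ennreal (normal_density 0 (sqrt s) z))"
    proof -
      have "distributed N lborel (\<lambda>\<omega>. X s \<omega> $ i - X u \<omega> $ i) (\<lambda>z. ennreal (normal_density 0 (sqrt (s - u)) z))"
        if "0 \<le> u" "u < s" for u
        using bm[of i] that by (simp add: brownian_motion_def)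
      from this[of 0] show ?thesis using s by simp
    qed
    have "measure N (path_of (\<lambda>t \<omega>. X t \<omega> $ i) -` ?C \<inter> space N) = measure N {\<omega>\<in>space N. X s \<omega> $ i \<in> {-R..R}}"
      using s by (auto intro!: arg_cong[where f = "measure N"] simp: path_of_def space_PiM)
    also have "\<dots> = (\<integral>\<omega>. indicator {\<omega>\<in>space N. X s \<omega> $ i \<in> {-R..R}} \<omega> \<partial>N)" by (simp add: Int_def conj_commute)
    also have "\<dots> = (\<integral>\<omega>. indicator {-R..R} (X s \<omega> $ i - X 0 \<omega> $ i) \<partial>N)"
    proof (rule integral_cong_AE)
      have "AE \<omega> in N. X 0 \<omega> $ i = 0" using bm[of i] by (simp add: brownian_motion_def)
      then show "AE \<omega> in N. indicator {\<omega>\<in>space N. X s \<omega> $ i \<in> {-R..R}} \<omega> = (indicator {-R..R} (X s \<omega> $ i - X 0 \<omega> $ i) :: real)"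
        using AE_space by eventually_elim (auto split: split_indicator)
    qed measurable
    also have "\<dots> = (\<integral>z. normal_density 0 (sqrt s) z * indicator {-R..R} z \<partial>lborel)"
      by (rule distributed_integral[symmetric, OF d]) auto
    also have "\<dots> = erf (R / (sqrt s * sqrt 2))" using erf_normal[of "sqrt s" R] s R by (simp add: mult.commute)
    also have "sqrt s * sqrt 2 = sqrt (2 * s)" unfolding real_sqrt_mult by (rule mult.commute)
    finally show "measure N (path_of (\<lambda>t \<omega>. X t \<omega> $ i) -` ?C \<inter> space N) = erf (R / sqrt (2 * s))" .
  qed
  also have "\<dots> = erf (R / sqrt (2 * s)) ^ 3" by simp
  finally show ?thesis .
qed

end

section \<open>Bounds after averaging over path and offset\<close>

context dyadic_coupling
begin

lemma Theta_integral:
  fixes h :: "real \<Rightarrow> real"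
  assumes [measurable]: "h \<in> borel_measurable borel"
  shows "(\<integral>\<omega>. h (\<Theta> \<omega>) \<partial>M) = (\<integral>\<theta>. h \<theta> * indicator {0..1} \<theta> \<partial>lborel)"
proof -
  have "(\<integral>\<omega>. h (\<Theta> \<omega>) \<partial>M) = (\<integral>\<theta>. h \<theta> \<partial>distr M borel \<Theta>)" by (subst integral_distr) auto
  also have "\<dots> = (\<integral>\<theta>. h \<theta> \<partial>uniform_measure lborel {0..1})" using driving by (simp add: dyadic_driving_def)
  also have "uniform_measure lborel {0..1} = density lborel (\<lambda>\<theta>. ennreal (indicator {0..1::real} \<theta>))"
    unfolding uniform_measure_def by (intro density_cong) (auto simp: divide_ennreal_def split: split_indicator)
  also have "(\<integral>\<theta>. h \<theta> \<partial>\<dots>) = (\<integral>\<theta>. h \<theta> * indicator {0..1} \<theta> \<partial>lborel)"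
    by (subst integral_real_density) (simp_all add: mult.commute)
  finally show ?thesis .
qed

definition survival :: "real \<Rightarrow> real \<Rightarrow> real" where
  "survival D s = (\<integral>\<omega>. (\<integral>\<omega>'. split_prob D (\<Theta> \<omega>) (Mx s \<omega>') \<partial>M) \<partial>M)"

lemma split_prob_mean_measurable:
  assumes s: "s > 0"
  shows "(\<lambda>\<omega>. \<integral>\<omega>'. split_prob D (\<Theta> \<omega>) (Mx s \<omega>') \<partial>M) \<in> borel_measurable M"
proof -
  note [measurable] = Mx_measurable[OF s]
  show ?thesis by measurable
qed

lemma split_prob_mean_abs_le:
  assumes s: "s > 0" and D: "D > 0"
  shows "\<bar>\<integral>\<omega>'. split_prob D \<theta> (Mx s \<omega>') \<partial>M\<bar> \<le> 1"
proof -
  note [measurable] = Mx_measurable[OF s]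
  have "\<bar>split_prob D \<theta> m\<bar> \<le> 1" for m using split_prob_bounds[of D \<theta> m] D by auto
  then have "0 \<le> (\<integral>\<omega>'. split_prob D \<theta> (Mx s \<omega>') \<partial>M)" "(\<integral>\<omega>'. split_prob D \<theta> (Mx s \<omega>') \<partial>M) \<le> 1"
    using split_prob_bounds[of D \<theta>] D by (auto intro!: expectation_le_of_bounded[where b = 1] Bochner_Integration.integral_nonneg)
  then show ?thesis by simp
qed

lemma split_prob_Mx_integrable:
  assumes s: "s > 0" and D: "D > 0"
  shows "integrable M (\<lambda>\<omega>'. split_prob D \<theta> (Mx s \<omega>'))"
proof -
  note [measurable] = Mx_measurable[OF s]
  have "\<bar>split_prob D \<theta> m\<bar> \<le> 1" for m using split_prob_bounds[of D \<theta> m] D by auto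
  then show ?thesis by (intro integrable_const_bound[where B = 1]) auto
qed

text \<open>Dropping the minimum with 1 leaves D / 2 times the inverse level, whose mean is explicit
  for every offset.\<close>

lemma survival_le:
  assumes s: "s > 0" and D: "D > 0"
  shows "survival D s \<le> D / sqrt (2 * pi * s)"
  unfolding survival_def
proof (rule expectation_le_of_bounded[OF split_prob_mean_measurable[OF s] split_prob_mean_abs_le[OF s D]])
  fix \<omega>
  have "(\<integral>\<omega>'. split_prob D (\<Theta> \<omega>) (Mx s \<omega>') \<partial>M) \<le> (\<integral>\<omega>'. D / 2 * (1 / dlevel (\<Theta> \<omega>) (dindex (\<Theta> \<omega>) (Mx s \<omega>'))) \<partial>M)"
  proof (rule integral_mono[OF split_prob_Mx_integrable[OF s D]])
    show "integrable M (\<lambda>\<omega>'. D / 2 * (1 / dlevel (\<Theta> \<omega>) (dindex (\<Theta> \<omega>) (Mx s \<omega>'))))"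
      by (rule integrable_mult_right[OF expectation_inverse_level(1)[OF s]])
  qed (simp add: split_prob_def)
  also have "\<dots> = D / 2 * sqrt (2 / (pi * s))"
    unfolding integral_mult_right_zero expectation_inverse_level(2)[OF s] ..
  also have "\<dots> = D / sqrt (2 * pi * s)"
  proof -
    have "sqrt (2 / (pi * s)) = sqrt (4 / (2 * pi * s))" by simp
    also have "\<dots> = 2 / sqrt (2 * pi * s)" unfolding real_sqrt_divide by simp
    finally show ?thesis by simp
  qed
  finally show "(\<integral>\<omega>'. split_prob D (\<Theta> \<omega>) (Mx s \<omega>') \<partial>M) \<le> D / sqrt (2 * pi * s)" .
qed

text \<open>The loss from the minimum with 1 is controlled by the mean of D / Y_s on Y_s < D, which
  is of smaller order than the main term for large s.\<close>

lemma survival_ge: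
  assumes s: "s > 0" and D: "D > 0"
  shows "D / sqrt (2 * pi * s) * (2 * exp (- D\<^sup>2 / (2 * s)) - 1) \<le> survival D s"
  unfolding survival_def
proof (rule expectation_ge_of_bounded[OF split_prob_mean_measurable[OF s] split_prob_mean_abs_le[OF s D]])
  fix \<omega>
  have [measurable]: "Y s \<in> borel_measurable M" using s by (auto intro: Y_measurable)
  have Yi: "integrable M (\<lambda>\<omega>'. indicator {..<D} (Y s \<omega>') / Y s \<omega>')"
    by (rule Bochner_Integration.integrable_bound[OF inverse_Y_integrable[OF s]]) (auto split: split_indicator)
  have Yv: "(\<integral>\<omega>'. indicator {..<D} (Y s \<omega>') / Y s \<omega>' \<partial>M) = 2 / sqrt (2 * pi * s) * (1 - exp (- D\<^sup>2 / (2 * s)))"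
  proof -
    have "(\<integral>\<omega>'. indicator {..<D} (Y s \<omega>') / Y s \<omega>' \<partial>M) = (\<integral>\<rho>. wdens s \<rho> * indicator {..<D} \<rho> * indicator {0..} \<rho> \<partial>lborel)"
      by (rule integral_over_Y[OF s]) measurable
    also have "\<dots> = (\<integral>\<rho>. wdens s \<rho> * indicator {0..D} \<rho> \<partial>lborel)"
    proof (rule integral_cong_AE)
      have [measurable]: "wdens s \<in> borel_measurable borel" unfolding wdens_def by measurable
      show "(\<lambda>\<rho>. wdens s \<rho> * indicator {..<D} \<rho> * indicator {0..} \<rho>) \<in> borel_measurable lborel"
        "(\<lambda>\<rho>. wdens s \<rho> * indicator {0..D} \<rho>) \<in> borel_measurable lborel" by measurable
      show "AE \<rho> in lborel. wdens s \<rho> * indicator {..<D} \<rho> * indicator {0..} \<rho> = wdens s \<rho> * indicator {0..D} \<rho>"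
        using AE_lborel_singleton[of D] by eventually_elim (auto split: split_indicator)
    qed
    also have "\<dots> = 2 / sqrt (2 * pi * s) * (1 - exp (- D\<^sup>2 / (2 * s)))"
      unfolding integral_wdens_Icc[OF s less_imp_le[OF D]] normal_density_def using s by (simp add: right_diff_distrib)
    finally show ?thesis .
  qed
  have c: "D / 2 * sqrt (2 / (pi * s)) = D / sqrt (2 * pi * s)"
  proof -
    have "sqrt (2 / (pi * s)) = sqrt (4 / (2 * pi * s))" by simp
    also have "\<dots> = 2 / sqrt (2 * pi * s)" unfolding real_sqrt_divide by simp
    finally show ?thesis by simp
  qed
  have Li: "integrable M (\<lambda>\<omega>'. D / 2 * (1 / dlevel (\<Theta> \<omega>) (dindex (\<Theta> \<omega>) (Mx s \<omega>'))))"
    by (rule integrable_mult_right[OF expectation_inverse_level(1)[OF s]])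
  have Yi': "integrable M (\<lambda>\<omega>'. D * (indicator {..<D} (Y s \<omega>') / Y s \<omega>'))" using Yi by (rule integrable_mult_right)
  have "D / sqrt (2 * pi * s) * (2 * exp (- D\<^sup>2 / (2 * s)) - 1) =
     D / 2 * sqrt (2 / (pi * s)) - D * (2 / sqrt (2 * pi * s) * (1 - exp (- D\<^sup>2 / (2 * s))))"
    unfolding c by (simp add: algebra_simps)
  also have "\<dots> = (\<integral>\<omega>'. D / 2 * (1 / dlevel (\<Theta> \<omega>) (dindex (\<Theta> \<omega>) (Mx s \<omega>'))) - D * (indicator {..<D} (Y s \<omega>') / Y s \<omega>') \<partial>M)"
    unfolding Bochner_Integration.integral_diff[OF Li Yi'] integral_mult_right_zero expectation_inverse_level(2)[OF s] Yv ..
  also have "\<dots> \<le> (\<integral>\<omega>'. split_prob D (\<Theta> \<omega>) (Mx s \<omega>') \<partial>M)"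
  proof (rule integral_mono_AE[OF Bochner_Integration.integrable_diff[OF Li Yi'] split_prob_Mx_integrable[OF s D]])
    show "AE \<omega>' in M. D / 2 * (1 / dlevel (\<Theta> \<omega>) (dindex (\<Theta> \<omega>) (Mx s \<omega>'))) - D * (indicator {..<D} (Y s \<omega>') / Y s \<omega>')
      \<le> split_prob D (\<Theta> \<omega>) (Mx s \<omega>')"
      using Y_pos[OF s] Mx_ge_Y[OF s] by eventually_elim (rule split_prob_lower[OF D])
  qed
  finally show "D / sqrt (2 * pi * s) * (2 * exp (- D\<^sup>2 / (2 * s)) - 1) \<le> (\<integral>\<omega>'. split_prob D (\<Theta> \<omega>) (Mx s \<omega>') \<partial>M)" .
qed

text \<open>Where Y_s > R the maximum also exceeds R, so the conditional probability is at most its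
  value at R, averaged by \<open>integral_level_profile\<close>; elsewhere it is bounded by
  1.\<close>

lemma survival_le_level:
  assumes s: "s > 0" and D: "D > 0" and R: "D / 2 \<le> R" "R \<le> D"
  shows "survival D s \<le> 1 - prob {\<omega>\<in>space M. Y s \<omega> > R} * ((ln (2 * R / D) + D / (2 * R) - 1) / ln 2)"
proof -
  have Rp: "R > 0" using D R by simp
  have [measurable]: "Y s \<in> borel_measurable M" using s by (auto intro: Y_measurable)
  define p where "p = prob {\<omega>\<in>space M. Y s \<omega> > R}"
  have p: "0 \<le> p" "p \<le> 1" by (auto simp: p_def)
  have hb: "\<bar>1 - split_prob D \<theta> R\<bar> \<le> 1" for \<theta> using split_prob_bounds[of D \<theta> R] D by auto
  have inner: "(\<integral>\<omega>'. split_prob D \<theta> (Mx s \<omega>') \<partial>M) \<le> 1 - p * (1 - split_prob D \<theta> R)" for \<theta>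
  proof -
    let ?I = "\<lambda>\<omega>'. indicator {\<omega>\<in>space M. Y s \<omega> > R} \<omega>' :: real"
    have i: "integrable M ?I" by (rule integrable_const_bound[where B = 1]) auto
    have "(\<integral>\<omega>'. split_prob D \<theta> (Mx s \<omega>') \<partial>M) \<le> (\<integral>\<omega>'. 1 - (1 - split_prob D \<theta> R) * ?I \<omega>' \<partial>M)"
    proof (rule integral_mono_AE[OF split_prob_Mx_integrable[OF s D]])
      show "integrable M (\<lambda>\<omega>'. 1 - (1 - split_prob D \<theta> R) * ?I \<omega>')"
        using i by (intro Bochner_Integration.integrable_diff integrable_mult_right) auto
      show "AE \<omega>' in M. split_prob D \<theta> (Mx s \<omega>') \<le> 1 - (1 - split_prob D \<theta> R) * ?I \<omega>'"
        using Mx_ge_Y[OF s]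
      proof eventually_elim
        case (elim \<omega>')
        show ?case
        proof (cases "Y s \<omega>' > R \<and> \<omega>' \<in> space M")
          case True
          then show ?thesis using split_prob_antimono[of D R "Mx s \<omega>'" \<theta>] D Rp elim by simp
        next
          case False
          then show ?thesis using split_prob_bounds(2)[of D \<theta>] by (auto split: split_indicator)
        qed
      qed
    qed
    also have "\<dots> = 1 - (1 - split_prob D \<theta> R) * p"
      using i by (simp add: prob_space p_def)
    finally show ?thesis by (simp add: mult.commute)
  qed
  have hi: "integrable M (\<lambda>\<omega>. 1 - split_prob D (\<Theta> \<omega>) R)"
    by (rule integrable_const_bound[where B = 1]) (use hb in auto)
  have "survival D s \<le> (\<integral>\<omega>. 1 - p * (1 - split_prob D (\<Theta> \<omega>) R) \<partial>M)"
    unfolding survival_def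
  proof (rule integral_mono)
    show "integrable M (\<lambda>\<omega>. \<integral>\<omega>'. split_prob D (\<Theta> \<omega>) (Mx s \<omega>') \<partial>M)"
      by (rule integrable_const_bound[where B = 1]) (use split_prob_mean_measurable[OF s] split_prob_mean_abs_le[OF s D] in auto)
    show "integrable M (\<lambda>\<omega>. 1 - p * (1 - split_prob D (\<Theta> \<omega>) R))"
      by (rule Bochner_Integration.integrable_diff[OF integrable_const integrable_mult_right[OF hi]])
  qed (rule inner)
  also have "\<dots> = 1 - p * (\<integral>\<omega>. 1 - split_prob D (\<Theta> \<omega>) R \<partial>M)"
    unfolding Bochner_Integration.integral_diff[OF integrable_const integrable_mult_right[OF hi]] integral_mult_right_zero
    by (simp add: prob_space)
  also have "(\<integral>\<omega>. 1 - split_prob D (\<Theta> \<omega>) R \<partial>M) = (\<integral>\<theta>. (1 - split_prob D \<theta> R) * indicator {0..1} \<theta> \<partial>lborel)"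
    by (rule Theta_integral) measurable
  also have "1 - p * \<dots> \<le> 1 - p * ((ln (2 * R / D) + D / (2 * R) - 1) / ln 2)"
    using integral_level_profile[OF D R] p by (intro diff_left_mono mult_left_mono) auto
  finally show ?thesis by (simp add: p_def)
qed

text \<open>As long as the maximum is at most D / 2, cells have length at most D and the two points
  are certainly separated.\<close>

lemma survival_ge_small:
  assumes s: "s > 0" and D: "D > 0"
  shows "1 - 2 * prob {\<omega>\<in>space M. Y s \<omega> > D / 2} \<le> survival D s"
  unfolding survival_def
proof (rule expectation_ge_of_bounded[OF split_prob_mean_measurable[OF s] split_prob_mean_abs_le[OF s D]])
  fix \<omega>
  note [measurable] = Mx_measurable[OF s]
  let ?I = "\<lambda>\<omega>'. indicator {\<omega>\<in>space M. Mx s \<omega> > D / 2} \<omega>' :: real"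
  have i: "integrable M ?I" by (rule integrable_const_bound[where B = 1]) auto
  have "1 - 2 * prob {\<omega>\<in>space M. Y s \<omega> > D / 2} \<le> 1 - prob {\<omega>\<in>space M. Mx s \<omega> > D / 2}"
    using prob_Mx_gt_le[OF s, of "D / 2"] D by simp
  also have "\<dots> = (\<integral>\<omega>'. 1 - ?I \<omega>' \<partial>M)" using i by (simp add: prob_space)
  also have "\<dots> \<le> (\<integral>\<omega>'. split_prob D (\<Theta> \<omega>) (Mx s \<omega>') \<partial>M)"
  proof (rule integral_mono_AE[OF _ split_prob_Mx_integrable[OF s D]])
    show "integrable M (\<lambda>\<omega>'. 1 - ?I \<omega>')" using i by (intro Bochner_Integration.integrable_diff) auto
    show "AE \<omega>' in M. 1 - ?I \<omega>' \<le> split_prob D (\<Theta> \<omega>) (Mx s \<omega>')"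
      using Mx_pos[OF s] AE_space
    proof eventually_elim
      case (elim \<omega>')
      then show ?case using split_prob_small[of "Mx s \<omega>'" D "\<Theta> \<omega>"] split_prob_bounds(1)[of D "\<Theta> \<omega>" "Mx s \<omega>'"] D
        by (auto split: split_indicator)
    qed
  qed
  finally show "1 - 2 * prob {\<omega>\<in>space M. Y s \<omega> > D / 2} \<le> (\<integral>\<omega>'. split_prob D (\<Theta> \<omega>) (Mx s \<omega>') \<partial>M)" .
qed

lemma coalescence_survival:
  assumes s: "s > 0" and ab: "\<alpha> < \<beta>"
  shows "measure (completion M) {\<omega>\<in>space M. coalescence \<alpha> \<beta> \<omega> > ereal s} = survival (\<beta> - \<alpha>) s"
  using coalescence_tail(2)[OF s ab] by (simp add: survival_def split_prob_def)

end

section \<open>Quantiles and asymptotics\<close>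

lemma erf_nonneg: "0 \<le> x \<Longrightarrow> 0 \<le> erf x"
  using erf_mono[of 0 x] by simp

lemma erf_ge_cubic:
  assumes "0 \<le> y"
  shows "2 / sqrt pi * (y - y ^ 3 / 3) \<le> erf y"
proof -
  have "erf 0 - 2 / sqrt pi * (0 - 0 ^ 3 / 3) \<le> erf y - 2 / sqrt pi * (y - y ^ 3 / 3)"
  proof (rule DERIV_nonneg_imp_nondecreasing[OF assms])
    fix x :: real
    have "((\<lambda>y. erf y - 2 / sqrt pi * (y - y ^ 3 / 3)) has_real_derivative 2 * exp (- x\<^sup>2) / sqrt pi - 2 / sqrt pi * (1 - x\<^sup>2)) (at x)"
      by (rule DERIV_cong[OF DERIV_diff[OF erf_has_derivative DERIV_cmult[OF DERIV_diff[OF DERIV_ident DERIV_cdivide[OF DERIV_power[OF DERIV_ident]]]]]])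
        (simp add: power2_eq_square)
    moreover have "2 / sqrt pi * (1 - x\<^sup>2) \<le> 2 / sqrt pi * exp (- x\<^sup>2)"
      using exp_ge_add_one_self[of "- x\<^sup>2"] by (intro mult_left_mono) auto
    ultimately show "\<exists>y'. ((\<lambda>y. erf y - 2 / sqrt pi * (y - y ^ 3 / 3)) has_real_derivative y') (at x) \<and> 0 \<le> y'"
      by (intro exI conjI) (assumption, simp)
  qed
  then show ?thesis by simp
qed

lemma erf_le_linear:
  assumes "0 \<le> y"
  shows "erf y \<le> 2 / sqrt pi * y"
proof -
  have "2 / sqrt pi * 0 - erf 0 \<le> 2 / sqrt pi * y - erf y"
  proof (rule DERIV_nonneg_imp_nondecreasing[OF assms])
    fix x :: real
    have "((\<lambda>y. 2 / sqrt pi * y - erf y) has_real_derivative 2 / sqrt pi - 2 * exp (- x\<^sup>2) / sqrt pi) (at x)"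
      by (rule DERIV_cong[OF DERIV_diff[OF DERIV_cmult[OF DERIV_ident] erf_has_derivative]]) simp
    moreover have "2 / sqrt pi * exp (- x\<^sup>2) \<le> 2 / sqrt pi * 1" by (intro mult_left_mono) auto
    ultimately show "\<exists>y'. ((\<lambda>y. 2 / sqrt pi * y - erf y) has_real_derivative y') (at x) \<and> 0 \<le> y'"
      by (intro exI conjI) (assumption, simp)
  qed
  then show ?thesis by simp
qed

text \<open>The mean value theorem on an interval of length 1. The shift of the exponent is crude,
  but only the leading exponential rate is needed.\<close>

lemma erfc_ge:
  assumes "0 \<le> z"
  shows "2 / sqrt pi * exp (- (z + 1)\<^sup>2) \<le> 1 - erf z"
proof -
  obtain x where x: "z < x" "x < z + 1" "erf (z + 1) - erf z = (z + 1 - z) * (2 * exp (- x\<^sup>2) / sqrt pi)"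
    using MVT2[of z "z + 1" erf "\<lambda>x. 2 * exp (- x\<^sup>2) / sqrt pi"] erf_has_derivative by auto
  have "x\<^sup>2 \<le> (z + 1)\<^sup>2" using x assms by (intro power_mono) auto
  then have "2 / sqrt pi * exp (- (z + 1)\<^sup>2) \<le> 2 / sqrt pi * exp (- x\<^sup>2)" by (intro mult_left_mono) auto
  then show ?thesis using x(3) erf_le_1[of "z + 1"] by simp
qed

text \<open>Turns comparisons of Gaussian tails, which vanish at infinity, into comparisons of their
  derivatives.\<close>

lemma nonincreasing_tendsto_0_nonneg:
  fixes h h' :: "real \<Rightarrow> real"
  assumes "\<And>x. a \<le> x \<Longrightarrow> (h has_real_derivative h' x) (at x)" "\<And>x. a \<le> x \<Longrightarrow> h' x \<le> 0"
    and "(h \<longlongrightarrow> 0) at_top" "a \<le> x"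
  shows "0 \<le> h x"
proof (rule tendsto_upperbound[OF assms(3)])
  show "\<forall>\<^sub>F y in at_top. h y \<le> h x"
    using eventually_ge_at_top[of x]
  proof eventually_elim
    case (elim y)
    then show ?case
    proof (rule DERIV_nonpos_imp_nonincreasing)
      fix z assume "x \<le> z"
      then have "a \<le> z" using assms(4) by simp
      then show "\<exists>d. (h has_real_derivative d) (at z) \<and> d \<le> 0" using assms(1,2) by blast
    qed
  qed
qed simp

lemma exp_minus_square_tendsto_0: "((\<lambda>x::real. exp (- x\<^sup>2)) \<longlongrightarrow> 0) at_top"
  by real_asymp

lemma erfc_le:
  assumes "1 \<le> z"
  shows "1 - erf z \<le> exp (- z\<^sup>2)"
proof -
  have "0 \<le> exp (- z\<^sup>2) - (1 - erf z)"
  proof (rule nonincreasing_tendsto_0_nonneg[OF _ _ _ assms])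
    fix x :: real assume x: "1 \<le> x"
    show "((\<lambda>x. exp (- x\<^sup>2) - (1 - erf x)) has_real_derivative - 2 * x * exp (- x\<^sup>2) + 2 * exp (- x\<^sup>2) / sqrt pi) (at x)"
      by (auto intro!: derivative_eq_intros erf_has_derivative)
    have "1 / sqrt pi \<le> 1" using pi_gt3 by simp
    then have "1 / sqrt pi \<le> x" using x by (rule order_trans)
    then have "2 * exp (- x\<^sup>2) * (1 / sqrt pi) \<le> 2 * exp (- x\<^sup>2) * x" by (rule mult_left_mono) simp
    then show "- 2 * x * exp (- x\<^sup>2) + 2 * exp (- x\<^sup>2) / sqrt pi \<le> 0" by (simp add: mult_ac)
  next
    have "((\<lambda>x. exp (- x\<^sup>2) - (1 - erf x)) \<longlongrightarrow> 0 - (1 - 1)) at_top"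
      by (intro tendsto_intros exp_minus_square_tendsto_0 erf_tendsto_1)
    then show "((\<lambda>x. exp (- x\<^sup>2) - (1 - erf x)) \<longlongrightarrow> 0) at_top" by simp
  qed
  then show ?thesis by simp
qed

lemma exp_1_bounds: "27/10 \<le> exp (1::real)" "exp (1::real) \<le> 272/100"
proof -
  have "(\<Sum>n<5. (1::real) ^ n / fact n) \<le> exp 1"
    using summable_exp[of "1::real"] unfolding exp_def
    by (simp add: divide_inverse) (intro sum_le_suminf, auto)
  then show "27/10 \<le> exp (1::real)" by (simp add: eval_nat_numeral)
  show "exp (1::real) \<le> 272/100"
  proof -
    have "exp 1 \<le> 5837465777 / 2147483648 + inverse (2 ^ 32 :: real)" using abs_le_D1[OF e_approx_32] by linarith
    also have "\<dots> \<le> 272/100" by simp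
    finally show ?thesis .
  qed
qed

text \<open>With y = e x / 2 at most 1 the cubic bound gives \<open>erf\<close> y at least 4 y / (3
  sqrt pi), and 2 e / 3 exceeds 1 / sqrt 2. For larger y the left side is at most 1 / sqrt pi, which
  lies below \<open>erf\<close> 1; here x up to sqrt 2 is used.\<close>

lemma linear_le_erf:
  assumes "0 < x" "x \<le> sqrt 2"
  shows "x / sqrt (2 * pi) \<le> erf (exp 1 * x / 2)"
proof -
  define y where "y = exp 1 * x / 2"
  have y0: "0 \<le> y" using assms by (simp add: y_def)
  have s2: "1 / sqrt 2 \<le> (1::real)" by simp
  have e: "(1::real) \<le> exp 1 / 2 * (4 / 3)" using exp_1_bounds by simp
  have c: "x / sqrt (2 * pi) = x / sqrt 2 / sqrt pi" by (simp add: real_sqrt_mult)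
  show ?thesis
  proof (cases "y \<le> 1")
    case True
    have "y ^ 3 = y * y\<^sup>2" by (simp add: power3_eq_cube power2_eq_square)
    also have "\<dots> \<le> y * 1" using True y0 by (intro mult_left_mono) (auto simp: power_le_one)
    finally have "y * (2/3) \<le> y - y ^ 3 / 3" by simp
    then have "2 / sqrt pi * (y * (2/3)) \<le> 2 / sqrt pi * (y - y ^ 3 / 3)" by (intro mult_left_mono) auto
    also have "\<dots> \<le> erf y" by (rule erf_ge_cubic[OF y0])
    finally have l: "y * (4/3) / sqrt pi \<le> erf y" by (simp add: field_simps)
    have "x / sqrt 2 = x * (1 / sqrt 2)" by simp
    also have "\<dots> \<le> x * (exp 1 / 2 * (4/3))" by (rule mult_left_mono[OF order_trans[OF s2 e]]) (use assms in simp)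
    also have "\<dots> = y * (4/3)" by (simp add: y_def)
    finally have "x / sqrt 2 / sqrt pi \<le> y * (4/3) / sqrt pi" by (rule divide_right_mono) simp
    then show ?thesis unfolding c using l by (simp add: y_def)
  next
    case False
    have "x / sqrt 2 \<le> 1" using assms by simp
    then have "x / sqrt 2 / sqrt pi \<le> 1 / sqrt pi" by (rule divide_right_mono) simp
    also have "\<dots> \<le> 2 / sqrt pi * (1 - 1 ^ 3 / 3)" by (simp add: field_simps)
    also have "\<dots> \<le> erf 1" by (rule erf_ge_cubic) simp
    also have "\<dots> \<le> erf y" using False by (intro erf_mono) simp
    finally show ?thesis unfolding c by (simp add: y_def)
  qed
qed

text \<open>The left side is the bound of \<open>survival_le_level_erf\<close> at R = D. Once the
  cube is weakened to a first power, two Gaussian tails remain to be compared, and their weighted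
  difference h decreases to 0.\<close>

lemma level_one_le_erf:
  assumes x: "sqrt 2 \<le> x"
  shows "1 - (1 - erf (x / sqrt 2) ^ 3) * ((ln 2 + 1 / 2 - 1) / ln 2) \<le> erf (exp 1 * x / 2)"
proof -
  define c :: real where "c = (ln 2 + 1 / 2 - 1) / ln 2"
  have l2: "2/3 \<le> ln (2::real)" by (rule ln2_ge_two_thirds)
  have "c = 1 - 1 / (2 * ln 2)" unfolding c_def using l2 by (simp add: field_simps)
  moreover have "1 / (2 * ln (2::real)) \<le> 3/4" using l2 by (simp add: field_simps)
  ultimately have c: "1/4 \<le> c" by simp
  define h where "h x = c * (1 - erf (1 / sqrt 2 * x)) - (1 - erf (exp 1 / 2 * x))" for x
  define h' where "h' x = c * (- (2 * exp (- (1 / sqrt 2 * x)\<^sup>2) / sqrt pi * (1 / sqrt 2))) + 2 * exp (- (exp 1 / 2 * x)\<^sup>2) / sqrt pi * (exp 1 / 2)" for x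
  have "0 \<le> h x"
  proof (rule nonincreasing_tendsto_0_nonneg[OF _ _ _ x])
    fix x :: real assume x: "sqrt 2 \<le> x"
    show "(h has_real_derivative h' x) (at x)"
      unfolding h_def[abs_def] h'_def
      by (rule DERIV_cong[OF DERIV_diff[OF DERIV_cmult[OF DERIV_diff[OF DERIV_const DERIV_chain2[OF erf_has_derivative DERIV_cmult_Id]]]
            DERIV_diff[OF DERIV_const DERIV_chain2[OF erf_has_derivative DERIV_cmult_Id]]]]) simp
    have x2: "2 \<le> x\<^sup>2" using x by (metis real_sqrt_le_iff real_sqrt_unique[symmetric] abs_le_square_iff abs_of_nonneg order_trans real_sqrt_ge_zero real_sqrt_pow2 power_mono zero_le_numeral)
    have e2: "(27/10)\<^sup>2 \<le> (exp (1::real))\<^sup>2" using exp_1_bounds by (intro power_mono) auto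
    have "(exp 1 / 2 * x)\<^sup>2 - (1 / sqrt 2 * x)\<^sup>2 = ((exp 1)\<^sup>2 / 4 - 1 / 2) * x\<^sup>2"
      by (simp add: power_mult_distrib power_divide algebra_simps)
    \<comment> \<open>From e at least 27/10 and x^2 at least 2. The resulting factor exp (13/5), at
      least 10, outweighs the ratio of the prefactors e / 2 and c / sqrt 2, the latter being at
      least 1/6.\<close>
    also have "\<dots> \<ge> (13/10) * 2"
      using x2 e2 by (intro mult_mono) (auto simp: power2_eq_square)
    finally have gap: "(exp 1 / 2 * x)\<^sup>2 \<ge> 13/5 + (1 / sqrt 2 * x)\<^sup>2" by simp
    have e135: "10 \<le> exp (13/5 :: real)"
    proof -
      have "(27/10)\<^sup>2 \<le> (exp (1::real))\<^sup>2" by (rule e2)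
      also have "\<dots> = exp 2" by (simp add: power2_eq_square exp_add[symmetric])
      finally have "7 \<le> exp (2::real)" by (simp add: power2_eq_square)
      moreover have "16/10 \<le> exp (3/5 :: real)" using exp_ge_add_one_self[of "3/5"] by simp
      ultimately have "7 * (16/10) \<le> exp 2 * exp (3/5 :: real)" by (intro mult_mono) auto
      also have "\<dots> = exp (13/5)" by (simp add: exp_add[symmetric])
      finally show ?thesis by simp
    qed
    have "exp (- (exp 1 / 2 * x)\<^sup>2) \<le> exp (- (13/5) + - (1 / sqrt 2 * x)\<^sup>2)" using gap by simp
    also have "\<dots> = exp (- (1 / sqrt 2 * x)\<^sup>2) / exp (13/5)" unfolding exp_add by (simp add: exp_minus field_simps)
    also have "\<dots> \<le> exp (- (1 / sqrt 2 * x)\<^sup>2) / 10" using e135 by (intro divide_left_mono) auto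
    finally have "exp (- (exp 1 / 2 * x)\<^sup>2) * (exp 1 / 2) \<le> exp (- (1 / sqrt 2 * x)\<^sup>2) / 10 * (exp 1 / 2)"
      by (intro mult_right_mono) auto
    also have "\<dots> = exp (- (1 / sqrt 2 * x)\<^sup>2) * (exp 1 / 20)" by simp
    also have "\<dots> \<le> exp (- (1 / sqrt 2 * x)\<^sup>2) * (c * (1 / sqrt 2))"
    proof (intro mult_left_mono)
      have "sqrt 2 \<le> (3/2 :: real)" by (rule real_le_lsqrt) (simp_all add: power2_eq_square)
      then have "2/3 \<le> 1 / sqrt (2::real)" by (simp add: field_simps)
      then have "1/4 * (2/3) \<le> c * (1 / sqrt 2)" using c by (intro mult_mono) auto
      moreover have "exp 1 / 20 \<le> 1/4 * (2/3 :: real)" using exp_1_bounds by simp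
      ultimately show "exp 1 / 20 \<le> c * (1 / sqrt 2)" by (rule order_trans[rotated])
    qed simp
    finally have "2 / sqrt pi * (exp (- (exp 1 / 2 * x)\<^sup>2) * (exp 1 / 2)) \<le> 2 / sqrt pi * (exp (- (1 / sqrt 2 * x)\<^sup>2) * (c * (1 / sqrt 2)))"
      by (intro mult_left_mono) auto
    then show "h' x \<le> 0" unfolding h'_def by (simp add: mult_ac)
  next
    have "filterlim (\<lambda>x. 1 / sqrt 2 * x) at_top at_top" "filterlim (\<lambda>x. exp 1 / 2 * x) at_top (at_top :: real filter)"
      by (intro filterlim_tendsto_pos_mult_at_top[OF tendsto_const] filterlim_ident; simp)+
    then have "((\<lambda>x. c * (1 - erf (1 / sqrt 2 * x)) - (1 - erf (exp 1 / 2 * x))) \<longlongrightarrow> c * (1 - 1) - (1 - 1)) at_top"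
      by (intro tendsto_intros filterlim_compose[OF erf_tendsto_1])
    then show "(h \<longlongrightarrow> 0) at_top" unfolding h_def[abs_def] by simp
  qed
  then have 1: "1 - c * (1 - erf (x / sqrt 2)) \<le> erf (exp 1 * x / 2)" unfolding h_def by simp
  have "0 \<le> x" using x by (rule order_trans[rotated]) simp
  then have n: "0 \<le> erf (x / sqrt 2)" by (intro erf_nonneg) simp
  have "erf (x / sqrt 2) ^ 3 \<le> erf (x / sqrt 2) ^ 1" using n erf_le_1 by (intro power_decreasing) auto
  then have "(1 - erf (x / sqrt 2)) * c \<le> (1 - erf (x / sqrt 2) ^ 3) * c" using c by (intro mult_right_mono) auto
  then show ?thesis using 1 unfolding c_def[symmetric] by (simp add: mult.commute)
qed

section \<open>From tails to quantiles\<close>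

lemma Inf_level_bounds:
  fixes F :: "real \<Rightarrow> real"
  assumes mono: "\<And>s t. s \<le> t \<Longrightarrow> F s \<le> F t" and u: "F u < p" and v: "p \<le> F v"
  shows "u \<le> Inf {s. p \<le> F s}" "Inf {s. p \<le> F s} \<le> v"
proof -
  have lb: "u \<le> s" if "p \<le> F s" for s
  proof (rule ccontr)
    assume "\<not> u \<le> s"
    then have "F s \<le> F u" by (intro mono) simp
    then show False using that u by simp
  qed
  show "u \<le> Inf {s. p \<le> F s}" using v lb by (intro cInf_greatest) auto
  show "Inf {s. p \<le> F s} \<le> v" using v lb by (intro cInf_lower bdd_belowI[of _ u]) auto
qed

text \<open>If ln F(s) behaves like -K / s, then p = F(s) is solved by s close to K / (- ln p).
  Testing F at k / (- ln p) with k on either side of K traps the infimum.\<close>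

lemma quantile_at_0:
  fixes F :: "real \<Rightarrow> real"
  assumes mono: "\<And>s t. s \<le> t \<Longrightarrow> F s \<le> F t" and K: "K > 0"
    and pos: "\<forall>\<^sub>F s in at_right 0. F s > 0"
    and lim: "((\<lambda>s. s * ln (F s)) \<longlongrightarrow> - K) (at_right 0)"
  shows "((\<lambda>p. Inf {s. p \<le> F s} * - ln p) \<longlongrightarrow> K) (at_right 0)"
proof -
  have L: "filterlim (\<lambda>p::real. - ln p) at_top (at_right 0)"
    by real_asymp
  have small: "filterlim (\<lambda>p. k / - ln p) (at_right 0) (at_right 0)" if "k > 0" for k :: real
    using that by real_asymp
  have Lpos: "\<forall>\<^sub>F p::real in at_right 0. 0 < - ln p" using L[unfolded filterlim_at_top_dense, rule_format, of 0] .
  have ppos: "\<forall>\<^sub>F p::real in at_right 0. 0 < p" by (simp add: eventually_at_right_less)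
  have lower: "\<forall>\<^sub>F p in at_right 0. F (k / - ln p) < p" if k: "0 < k" "k < K" for k
  proof -
    have "\<forall>\<^sub>F s in at_right 0. s * ln (F s) < - k" using lim k by (intro order_tendstoD) auto
    with pos have "\<forall>\<^sub>F s in at_right 0. s * ln (F s) < - k \<and> F s > 0" by eventually_elim auto
    then have "\<forall>\<^sub>F p in at_right 0. k / - ln p * ln (F (k / - ln p)) < - k \<and> F (k / - ln p) > 0"
      using small[OF k(1)] by (rule eventually_compose_filterlim)
    with Lpos ppos show ?thesis
    proof eventually_elim
      case (elim p)
      then have "ln (F (k / - ln p)) < ln p" using k by (simp add: field_simps)
      then show ?case using elim by simp
    qed
  qed
  have upper: "\<forall>\<^sub>F p in at_right 0. p \<le> F (k / - ln p)" if k: "K < k" for k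
  proof -
    have k0: "0 < k" using k K by simp
    have "\<forall>\<^sub>F s in at_right 0. - k < s * ln (F s)" using lim k by (intro order_tendstoD) auto
    with pos have "\<forall>\<^sub>F s in at_right 0. - k < s * ln (F s) \<and> F s > 0" by eventually_elim auto
    then have "\<forall>\<^sub>F p in at_right 0. - k < k / - ln p * ln (F (k / - ln p)) \<and> F (k / - ln p) > 0"
      using small[OF k0] by (rule eventually_compose_filterlim)
    with Lpos ppos show ?thesis
    proof eventually_elim
      case (elim p)
      then have "ln p < ln (F (k / - ln p))" using k0 by (simp add: field_simps)
      then show ?case using elim by simp
    qed
  qed
  show ?thesis
  proof (rule order_tendstoI)
    fix a assume a: "a < K"
    define k where "k = (max a 0 + K) / 2"
    have k: "0 < k" "k < K" "a < k" using a K by (auto simp: k_def)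
    show "\<forall>\<^sub>F p in at_right 0. a < Inf {s. p \<le> F s} * - ln p"
      \<comment> \<open>The instance K + 1 only supplies a point where F reaches p, so that the
        infimum is over a nonempty set.\<close>
      using lower[OF k(1,2)] upper[OF less_add_one] Lpos
    proof eventually_elim
      case (elim p)
      then have "k / - ln p \<le> Inf {s. p \<le> F s}" by (intro Inf_level_bounds(1)[OF mono])
      then have "k \<le> Inf {s. p \<le> F s} * - ln p" using elim by (simp add: field_simps)
      then show ?case using k by simp
    qed
  next
    fix a assume a: "K < a"
    define k where "k = (a + K) / 2"
    have k: "K < k" "k < a" using a by (auto simp: k_def)
    have half: "0 < K / 2" "K / 2 < K" using K by auto
    show "\<forall>\<^sub>F p in at_right 0. Inf {s. p \<le> F s} * - ln p < a"
      using lower[OF half] upper[OF k(1)] Lpos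
    proof eventually_elim
      case (elim p)
      then have "Inf {s. p \<le> F s} \<le> k / - ln p" by (intro Inf_level_bounds(2)[OF mono])
      then have "Inf {s. p \<le> F s} * - ln p \<le> k" using elim by (simp add: field_simps)
      then show ?case using k by simp
    qed
  qed
qed

text \<open>A tail c / sqrt s equals 1 - p at s = (c / (1 - p))^2; values k on either side of c trap
  the infimum as before.\<close>

lemma quantile_at_1:
  fixes F :: "real \<Rightarrow> real"
  assumes mono: "\<And>s t. s \<le> t \<Longrightarrow> F s \<le> F t" and c: "c > 0"
    and lim: "((\<lambda>s. sqrt s * (1 - F s)) \<longlongrightarrow> c) at_top"
  shows "((\<lambda>p. Inf {s. p \<le> F s} * (1 - p)\<^sup>2) \<longlongrightarrow> c\<^sup>2) (at_left 1)"
proof -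
  have big: "filterlim (\<lambda>p. (k / (1 - p))\<^sup>2) at_top (at_left 1)" if "k > 0" for k :: real
    using that by real_asymp
  have p1: "\<forall>\<^sub>F p::real in at_left 1. p < 1" by (simp add: eventually_at_filter)
  have lower: "\<forall>\<^sub>F p in at_left 1. F ((k / (1 - p))\<^sup>2) < p" if k: "0 < k" "k < c" for k
  proof -
    have "\<forall>\<^sub>F s in at_top. k < sqrt s * (1 - F s)" using lim k by (intro order_tendstoD) auto
    then have "\<forall>\<^sub>F p in at_left 1. k < sqrt ((k / (1 - p))\<^sup>2) * (1 - F ((k / (1 - p))\<^sup>2))"
      using big[OF k(1)] by (rule eventually_compose_filterlim)
    with p1 show ?thesis
    proof eventually_elim
      case (elim p)
      have "sqrt ((k / (1 - p))\<^sup>2) = k / (1 - p)" using elim k by simp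
      then have "k < k / (1 - p) * (1 - F ((k / (1 - p))\<^sup>2))" using elim by simp
      then have "k * (1 - p) < k * (1 - F ((k / (1 - p))\<^sup>2))" using elim by (simp add: pos_less_divide_eq)
      then show ?case using k by simp
    qed
  qed
  have upper: "\<forall>\<^sub>F p in at_left 1. p \<le> F ((k / (1 - p))\<^sup>2)" if k: "c < k" for k
  proof -
    have k0: "0 < k" using k c by simp
    have "\<forall>\<^sub>F s in at_top. sqrt s * (1 - F s) < k" using lim k by (intro order_tendstoD) auto
    then have "\<forall>\<^sub>F p in at_left 1. sqrt ((k / (1 - p))\<^sup>2) * (1 - F ((k / (1 - p))\<^sup>2)) < k"
      using big[OF k0] by (rule eventually_compose_filterlim)
    with p1 show ?thesis
    proof eventually_elim
      case (elim p)
      have "sqrt ((k / (1 - p))\<^sup>2) = k / (1 - p)" using elim k0 by simp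
      then have "k / (1 - p) * (1 - F ((k / (1 - p))\<^sup>2)) < k" using elim by simp
      then have "k * (1 - F ((k / (1 - p))\<^sup>2)) < k * (1 - p)" using elim by (simp add: pos_divide_less_eq)
      then show ?case using k0 by simp
    qed
  qed
  show ?thesis
  proof (rule order_tendstoI)
    fix a assume a: "a < c\<^sup>2"
    define b where "b = sqrt (max a 0)"
    have b: "b < c" "a \<le> b\<^sup>2" "0 \<le> b" using a c unfolding b_def by (auto simp: real_less_lsqrt)
    define k where "k = (b + c) / 2"
    have k: "0 < k" "k < c" "b < k" using b c by (auto simp: k_def)
    have ak: "a < k\<^sup>2" using b k by (intro le_less_trans[OF b(2)] power_strict_mono) auto
    show "\<forall>\<^sub>F p in at_left 1. a < Inf {s. p \<le> F s} * (1 - p)\<^sup>2"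
      using lower[OF k(1,2)] upper[OF less_add_one] p1
    proof eventually_elim
      case (elim p)
      then have "(k / (1 - p))\<^sup>2 \<le> Inf {s. p \<le> F s}" by (intro Inf_level_bounds(1)[OF mono])
      then have "(k / (1 - p))\<^sup>2 * (1 - p)\<^sup>2 \<le> Inf {s. p \<le> F s} * (1 - p)\<^sup>2" by (rule mult_right_mono) simp
      moreover have "(k / (1 - p))\<^sup>2 * (1 - p)\<^sup>2 = k\<^sup>2" using elim by (simp add: power_divide)
      ultimately show ?case using ak by simp
    qed
  next
    fix a assume a: "c\<^sup>2 < a"
    define b where "b = sqrt a"
    have b: "c < b" "b\<^sup>2 = a" using a c less_trans[OF zero_less_power[OF c] a] unfolding b_def by (auto simp: real_less_rsqrt)
    define k where "k = (b + c) / 2"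
    have k: "c < k" "k < b" using b by (auto simp: k_def)
    have ak: "k\<^sup>2 < a" unfolding b(2)[symmetric] using k c by (intro power_strict_mono) auto
    have half: "0 < c / 2" "c / 2 < c" using c by auto
    show "\<forall>\<^sub>F p in at_left 1. Inf {s. p \<le> F s} * (1 - p)\<^sup>2 < a"
      using lower[OF half] upper[OF k(1)] p1
    proof eventually_elim
      case (elim p)
      then have "Inf {s. p \<le> F s} \<le> (k / (1 - p))\<^sup>2" by (intro Inf_level_bounds(2)[OF mono])
      then have "Inf {s. p \<le> F s} * (1 - p)\<^sup>2 \<le> (k / (1 - p))\<^sup>2 * (1 - p)\<^sup>2" by (rule mult_right_mono) simp
      moreover have "(k / (1 - p))\<^sup>2 * (1 - p)\<^sup>2 = k\<^sup>2" using elim by (simp add: power_divide)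
      ultimately show ?case using ak by simp
    qed
  qed
qed

text \<open>The common shape of both coalescence times; measurability and tail are taken in the
  completion and at positive times.\<close>

locale random_time = prob_space M for M :: "'a measure" +
  fixes Z :: "'a \<Rightarrow> ereal" and S :: "real \<Rightarrow> real"
  assumes Z_nonneg: "\<And>\<omega>. 0 \<le> Z \<omega>"
    and Z_measurable: "\<And>s. s > 0 \<Longrightarrow> {\<omega>\<in>space M. Z \<omega> > ereal s} \<in> sets (completion M)"
    and Z_tail: "\<And>s. s > 0 \<Longrightarrow> measure (completion M) {\<omega>\<in>space M. Z \<omega> > ereal s} = S s"
begin

lemma prob_completion: "prob_space (completion M)"
  by (rule prob_space_completion)

lemma cdf_eq:
  assumes "s > 0"
  shows "{\<omega>\<in>space M. Z \<omega> \<le> ereal s} \<in> sets (completion M)"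
    and "measure (completion M) {\<omega>\<in>space M. Z \<omega> \<le> ereal s} = 1 - S s"
proof -
  have e: "{\<omega>\<in>space M. Z \<omega> \<le> ereal s} = space (completion M) - {\<omega>\<in>space M. Z \<omega> > ereal s}"
    by auto
  show "{\<omega>\<in>space M. Z \<omega> \<le> ereal s} \<in> sets (completion M)"
    unfolding e using Z_measurable[OF assms] by (rule sets.compl_sets)
  show "measure (completion M) {\<omega>\<in>space M. Z \<omega> \<le> ereal s} = 1 - S s"
    unfolding e using prob_space.prob_compl[OF prob_completion Z_measurable[OF assms]] Z_tail[OF assms] by simp
qed

text \<open>Monotonicity of the measure needs the larger event to be measurable, which is available
  for t > 0. For t at most 0 and s < t the smaller event is empty.\<close>

lemma cdf_mono:
  assumes "s \<le> t"
  shows "measure (completion M) {\<omega>\<in>space M. Z \<omega> \<le> ereal s} \<le> measure (completion M) {\<omega>\<in>space M. Z \<omega> \<le> ereal t}"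
proof (cases "t > 0")
  case True
  show ?thesis
    using assms cdf_eq(1)[OF True]
    by (intro finite_measure.finite_measure_mono prob_space.finite_measure prob_completion) (auto intro: order_trans)
next
  case False
  show ?thesis
  proof (cases "s = t")
    case False
    then have "s < 0" using assms \<open>\<not> t > 0\<close> by simp
    then have "\<not> Z \<omega> \<le> ereal s" for \<omega> using Z_nonneg[of \<omega>] by (auto simp: not_le intro: less_le_trans[of _ 0])
    then show ?thesis by simp
  qed simp
qed

lemma quantile_ratio_at_0:
  assumes K: "K > 0" and pos: "\<forall>\<^sub>F s in at_right 0. 1 - S s > 0" and lim: "((\<lambda>s. s * ln (1 - S s)) \<longlongrightarrow> - K) (at_right 0)"
  shows "((\<lambda>p. quantile M Z p * - ln p) \<longlongrightarrow> K) (at_right 0)"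
proof -
  let ?F = "\<lambda>s. measure (completion M) {\<omega>\<in>space M. Z \<omega> \<le> ereal s}"
  have ev: "\<forall>\<^sub>F s in at_right 0. ?F s = 1 - S s"
    using eventually_at_right_less[of "0::real"] by eventually_elim (rule cdf_eq(2))
  have "((\<lambda>p. Inf {s. p \<le> ?F s} * - ln p) \<longlongrightarrow> K) (at_right 0)"
  proof (rule quantile_at_0[OF cdf_mono K])
    show "\<forall>\<^sub>F s in at_right 0. ?F s > 0" using ev pos by eventually_elim simp
    have "\<forall>\<^sub>F s in at_right 0. s * ln (1 - S s) = s * ln (?F s)" using ev by eventually_elim simp
    with lim show "((\<lambda>s. s * ln (?F s)) \<longlongrightarrow> - K) (at_right 0)" by (rule Lim_transform_eventually)
  qed
  then show ?thesis by (simp add: quantile_def)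
qed

lemma quantile_ratio_at_1:
  assumes c: "c > 0" and lim: "((\<lambda>s. sqrt s * S s) \<longlongrightarrow> c) at_top"
  shows "((\<lambda>p. quantile M Z p * (1 - p)\<^sup>2) \<longlongrightarrow> c\<^sup>2) (at_left 1)"
proof -
  let ?F = "\<lambda>s. measure (completion M) {\<omega>\<in>space M. Z \<omega> \<le> ereal s}"
  have "((\<lambda>p. Inf {s. p \<le> ?F s} * (1 - p)\<^sup>2) \<longlongrightarrow> c\<^sup>2) (at_left 1)"
  proof (rule quantile_at_1[OF cdf_mono c])
    have "\<forall>\<^sub>F s in at_top. sqrt s * S s = sqrt s * (1 - ?F s)"
      using eventually_gt_at_top[of "0::real"] by eventually_elim (simp add: cdf_eq(2))
    with lim show "((\<lambda>s. sqrt s * (1 - ?F s)) \<longlongrightarrow> c) at_top" by (rule Lim_transform_eventually)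
  qed
  then show ?thesis by (simp add: quantile_def)
qed

lemma ge_measurable:
  assumes t: "t > 0"
  shows "{\<omega>\<in>space M. ereal t \<le> Z \<omega>} \<in> sets (completion M)"
proof -
  \<comment> \<open>The thresholds increase to t from below; the offset n + 2 keeps all of them
    positive.\<close>
  have "{\<omega>\<in>space M. ereal t \<le> Z \<omega>} = (\<Inter>n::nat. {\<omega>\<in>space M. Z \<omega> > ereal (t * (1 - 1 / real (n + 2)))})"
  proof (intro equalityI subsetI INT_I)
    fix \<omega> n assume w: "\<omega> \<in> {\<omega>\<in>space M. ereal t \<le> Z \<omega>}"
    have "t * (1 - 1 / real (n + 2)) < t * 1" using t by (intro mult_strict_left_mono) auto
    then have "ereal (t * (1 - 1 / real (n + 2))) < ereal t" by simp
    then have "ereal (t * (1 - 1 / real (n + 2))) < Z \<omega>" using w by (metis (no_types, lifting) less_le_trans mem_Collect_eq)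
    then show "\<omega> \<in> {\<omega>\<in>space M. Z \<omega> > ereal (t * (1 - 1 / real (n + 2)))}" using w by simp
  next
    fix \<omega> assume w: "\<omega> \<in> (\<Inter>n::nat. {\<omega>\<in>space M. Z \<omega> > ereal (t * (1 - 1 / real (n + 2)))})"
    have "(\<lambda>n. t * (1 - 1 / real (n + 2))) \<longlonglongrightarrow> t" by real_asymp
    then have "(\<lambda>n. ereal (t * (1 - 1 / real (n + 2)))) \<longlonglongrightarrow> ereal t" by (rule tendsto_ereal)
    then have "ereal t \<le> Z \<omega>" by (rule LIMSEQ_le_const2) (use w in \<open>auto intro!: exI[of _ 0] less_imp_le\<close>)
    then show "\<omega> \<in> {\<omega>\<in>space M. ereal t \<le> Z \<omega>}" using w by auto
  qed
  also have "\<dots> \<in> sets (completion M)"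
  proof (intro sets.countable_INT subsetI)
    fix A assume "A \<in> range (\<lambda>n::nat. {\<omega>\<in>space M. Z \<omega> > ereal (t * (1 - 1 / real (n + 2)))})"
    then obtain n :: nat where "A = {\<omega>\<in>space M. Z \<omega> > ereal (t * (1 - 1 / real (n + 2)))}" by blast
    moreover have "0 < t * (1 - 1 / real (n + 2))" using t by (intro mult_pos_pos) (auto simp: field_simps)
    ultimately show "A \<in> sets (completion M)" by (simp only: Z_measurable)
  qed simp
  finally show ?thesis .
qed

end

section \<open>Tail asymptotics of the two coalescence times\<close>

lemma reflection_survival_at_top:
  assumes D: "D > 0"
  shows "((\<lambda>s. sqrt s * erf (D / (2 * sqrt (2 * s)))) \<longlongrightarrow> D / sqrt (2 * pi)) at_top"
proof (rule tendsto_sandwich)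
  have eq: "sqrt s * (2 / sqrt pi * (D / (2 * sqrt (2 * s)))) = D / sqrt (2 * pi)" if "0 < s" for s
    using that by (simp add: real_sqrt_mult)
  show "\<forall>\<^sub>F s in at_top. sqrt s * erf (D / (2 * sqrt (2 * s))) \<le> D / sqrt (2 * pi)"
    using eventually_gt_at_top[of "0::real"]
  proof eventually_elim
    case (elim s)
    have "sqrt s * erf (D / (2 * sqrt (2 * s))) \<le> sqrt s * (2 / sqrt pi * (D / (2 * sqrt (2 * s))))"
      using D elim by (intro mult_left_mono erf_le_linear) auto
    then show ?case unfolding eq[OF elim] .
  qed
  show "\<forall>\<^sub>F s in at_top. D / sqrt (2 * pi) * (1 - D\<^sup>2 / (24 * s)) \<le> sqrt s * erf (D / (2 * sqrt (2 * s)))"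
    using eventually_gt_at_top[of "0::real"]
  proof eventually_elim
    case (elim s)
    define z where "z = D / (2 * sqrt (2 * s))"
    have z: "0 \<le> z" using D elim by (simp add: z_def)
    have "z\<^sup>2 = D\<^sup>2 / (8 * s)" using elim by (simp add: z_def power_divide power_mult_distrib)
    then have "D / sqrt (2 * pi) * (1 - D\<^sup>2 / (24 * s)) = sqrt s * (2 / sqrt pi * z) * (1 - z\<^sup>2 / 3)"
      using eq[OF elim] by (simp add: z_def)
    also have "\<dots> = sqrt s * (2 / sqrt pi * (z - z ^ 3 / 3))"
    proof -
      have "z - z ^ 3 / 3 = z * (1 - z\<^sup>2 / 3)" by (simp add: right_diff_distrib power2_eq_square power3_eq_cube)
      then show ?thesis by (simp only: mult.assoc)
    qed
    also have "\<dots> \<le> sqrt s * erf z" using elim z by (intro mult_left_mono erf_ge_cubic) auto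
    finally show ?case unfolding z_def .
  qed
  have "((\<lambda>s. D\<^sup>2 / (24 * s)) \<longlongrightarrow> 0) at_top" by real_asymp
  then have "((\<lambda>s. D / sqrt (2 * pi) * (1 - D\<^sup>2 / (24 * s))) \<longlongrightarrow> D / sqrt (2 * pi) * (1 - 0)) at_top"
    by (intro tendsto_intros)
  then show "((\<lambda>s. D / sqrt (2 * pi) * (1 - D\<^sup>2 / (24 * s))) \<longlongrightarrow> D / sqrt (2 * pi)) at_top" by simp
qed simp

text \<open>The summand 1 comes from \<open>erfc_ge\<close>; after multiplication by s it
  contributes only terms of order sqrt s, and the constant k only a term of order s.\<close>

lemma scaled_square_tendsto:
  "((\<lambda>s. s * ln k - s * (R / sqrt (2 * s) + 1)\<^sup>2) \<longlongrightarrow> - (R\<^sup>2 / 2)) (at_right 0)"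
proof -
  have "((\<lambda>s. s * ln k - (R\<^sup>2 / 2 + R * sqrt 2 * sqrt s + s)) \<longlongrightarrow> 0 * ln k - (R\<^sup>2 / 2 + R * sqrt 2 * sqrt 0 + 0)) (at_right 0)"
    by (intro tendsto_intros)
  moreover have "\<forall>\<^sub>F s in at_right 0. s * ln k - (R\<^sup>2 / 2 + R * sqrt 2 * sqrt s + s) = s * ln k - s * (R / sqrt (2 * s) + 1)\<^sup>2"
    using eventually_at_right_less[of "0::real"]
  proof eventually_elim
    case (elim s)
    have "s * (R / sqrt (2 * s) + 1)\<^sup>2 = s * (R / sqrt (2 * s))\<^sup>2 + R * (2 * s / sqrt (2 * s)) + s"
      by (simp add: power2_sum algebra_simps)
    also have "2 * s / sqrt (2 * s) = sqrt 2 * sqrt s" using elim by (subst real_div_sqrt) (simp_all add: real_sqrt_mult)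
    also have "s * (R / sqrt (2 * s))\<^sup>2 = R\<^sup>2 / 2" using elim by (simp add: power_divide)
    finally show ?case by simp
  qed
  ultimately show ?thesis using Lim_transform_eventually by fastforce
qed

lemma reflection_survival_at_0:
  assumes D: "D > 0"
  shows "((\<lambda>s. s * ln (1 - erf (D / (2 * sqrt (2 * s))))) \<longlongrightarrow> - (D\<^sup>2 / 8)) (at_right 0)"
proof (rule tendsto_sandwich)
  show "\<forall>\<^sub>F s in at_right 0. s * ln (2 / sqrt pi) - s * (D / 2 / sqrt (2 * s) + 1)\<^sup>2 \<le> s * ln (1 - erf (D / (2 * sqrt (2 * s))))"
    using eventually_at_right_less[of "0::real"]
  proof eventually_elim
    case (elim s)
    let ?z = "D / (2 * sqrt (2 * s))"
    have "2 / sqrt pi * exp (- (?z + 1)\<^sup>2) \<le> 1 - erf ?z" using D elim by (intro erfc_ge) auto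
    moreover have "0 < 2 / sqrt pi * exp (- (?z + 1)\<^sup>2)" by simp
    ultimately have "ln (2 / sqrt pi * exp (- (?z + 1)\<^sup>2)) \<le> ln (1 - erf ?z)" by (subst ln_le_cancel_iff) linarith+
    moreover have "ln (2 / sqrt pi * exp (- (?z + 1)\<^sup>2)) = ln (2 / sqrt pi) - (?z + 1)\<^sup>2"
      by (subst ln_mult) auto
    ultimately have "s * (ln (2 / sqrt pi) - (?z + 1)\<^sup>2) \<le> s * ln (1 - erf ?z)" using elim by (intro mult_left_mono) auto
    then show ?case by (simp add: right_diff_distrib)
  qed
  have "filterlim (\<lambda>s. D / (2 * sqrt (2 * s))) at_top (at_right 0)" using D by real_asymp
  then have "\<forall>\<^sub>F s in at_right 0. 1 \<le> D / (2 * sqrt (2 * s))" by (simp add: filterlim_at_top)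
  with eventually_at_right_less[of "0::real"]
  show "\<forall>\<^sub>F s in at_right 0. s * ln (1 - erf (D / (2 * sqrt (2 * s)))) \<le> - (D\<^sup>2 / 8)"
  proof eventually_elim
    case (elim s)
    let ?z = "D / (2 * sqrt (2 * s))"
    have "0 < 1 - erf ?z" using erf_strict_mono[of ?z "?z + 1"] erf_le_1[of "?z + 1"] by simp
    then have "ln (1 - erf ?z) \<le> ln (exp (- ?z\<^sup>2))" using erfc_le[OF elim(2)] by (subst ln_le_cancel_iff) auto
    then have "s * ln (1 - erf ?z) \<le> s * - ?z\<^sup>2" using elim by (intro mult_left_mono) auto
    also have "\<dots> = - (D\<^sup>2 / 8)" using elim by (simp add: power_divide power_mult_distrib)
    finally show ?case .
  qed
  show "((\<lambda>s. s * ln (2 / sqrt pi) - s * (D / 2 / sqrt (2 * s) + 1)\<^sup>2) \<longlongrightarrow> - (D\<^sup>2 / 8)) (at_right 0)"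
    using scaled_square_tendsto[of "2 / sqrt pi" "D / 2"] by (simp add: power_divide)
qed simp

text \<open>Strictness of ln x \<open>\<le>\<close> x - 1 away from x = 1, at the inverse of 1 +
  \<open>\<delta>\<close>.\<close>

lemma ln_plus_inverse_pos:
  assumes "0 < (\<delta>::real)"
  shows "0 < ln (1 + \<delta>) + inverse (1 + \<delta>) - 1"
proof -
  have "ln (inverse (1 + \<delta>)) \<le> inverse (1 + \<delta>) - 1" using assms by (intro ln_le_minus_one) simp
  moreover have "ln (inverse (1 + \<delta>)) \<noteq> inverse (1 + \<delta>) - 1"
    using ln_eq_minus_one[of "inverse (1 + \<delta>)"] assms by auto
  ultimately have "ln (inverse (1 + \<delta>)) < inverse (1 + \<delta>) - 1" by simp
  then show ?thesis using assms by (simp add: ln_inverse)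
qed

context dyadic_coupling
begin

lemma survival_at_top:
  assumes D: "D > 0"
  shows "((\<lambda>s. sqrt s * survival D s) \<longlongrightarrow> D / sqrt (2 * pi)) at_top"
proof (rule tendsto_sandwich)
  have eq: "sqrt s * (D / sqrt (2 * pi * s)) = D / sqrt (2 * pi)" if "0 < s" for s
    using that by (simp add: real_sqrt_mult)
  show "\<forall>\<^sub>F s in at_top. sqrt s * survival D s \<le> D / sqrt (2 * pi)"
    using eventually_gt_at_top[of "0::real"]
  proof eventually_elim
    case (elim s)
    have "sqrt s * survival D s \<le> sqrt s * (D / sqrt (2 * pi * s))"
      using elim by (intro mult_left_mono survival_le D) auto
    then show ?case unfolding eq[OF elim] .
  qed
  show "\<forall>\<^sub>F s in at_top. D / sqrt (2 * pi) * (2 * exp (- D\<^sup>2 / (2 * s)) - 1) \<le> sqrt s * survival D s"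
    using eventually_gt_at_top[of "0::real"]
  proof eventually_elim
    case (elim s)
    have "sqrt s * (D / sqrt (2 * pi * s) * (2 * exp (- D\<^sup>2 / (2 * s)) - 1)) \<le> sqrt s * survival D s"
      using elim by (intro mult_left_mono survival_ge D) auto
    then show ?case unfolding mult.assoc[symmetric] eq[OF elim] .
  qed
  have "((\<lambda>s. - D\<^sup>2 / (2 * s)) \<longlongrightarrow> 0) at_top" by real_asymp
  then have "((\<lambda>s. D / sqrt (2 * pi) * (2 * exp (- D\<^sup>2 / (2 * s)) - 1)) \<longlongrightarrow> D / sqrt (2 * pi) * (2 * exp 0 - 1)) at_top"
    by (intro tendsto_intros)
  then show "((\<lambda>s. D / sqrt (2 * pi) * (2 * exp (- D\<^sup>2 / (2 * s)) - 1)) \<longlongrightarrow> D / sqrt (2 * pi)) at_top" by simp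
qed simp

lemma survival_le_level_erf:
  assumes s: "s > 0" and D: "D > 0" and R: "D / 2 \<le> R" "R \<le> D"
  shows "survival D s \<le> 1 - (1 - erf (R / sqrt (2 * s)) ^ 3) * ((ln (2 * R / D) + inverse (2 * R / D) - 1) / ln 2)"
proof -
  have R0: "0 < R" using D R by simp
  have [measurable]: "Y s \<in> borel_measurable M" using s by (auto intro: Y_measurable)
  have "{\<omega>\<in>space M. Y s \<omega> > R} = space M - {\<omega>\<in>space M. Y s \<omega> \<le> R}" by auto
  moreover have "{\<omega>\<in>space M. Y s \<omega> \<le> R} \<in> sets M" by measurable
  ultimately have "prob {\<omega>\<in>space M. Y s \<omega> > R} = 1 - prob {\<omega>\<in>space M. Y s \<omega> \<le> R}"
    using prob_compl by metis
  then have p: "1 - erf (R / sqrt (2 * s)) ^ 3 \<le> prob {\<omega>\<in>space M. Y s \<omega> > R}"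
    using prob_Y_le_erf[OF s, of R] R0 by simp
  have "ln (inverse (2 * R / D)) \<le> inverse (2 * R / D) - 1" using R0 D by (intro ln_le_minus_one) simp
  then have "0 \<le> ln (2 * R / D) + inverse (2 * R / D) - 1" by (simp only: ln_inverse)
  then have "(1 - erf (R / sqrt (2 * s)) ^ 3) * ((ln (2 * R / D) + inverse (2 * R / D) - 1) / ln 2)
      \<le> prob {\<omega>\<in>space M. Y s \<omega> > R} * ((ln (2 * R / D) + inverse (2 * R / D) - 1) / ln 2)"
    by (intro mult_right_mono p) simp
  then show ?thesis using survival_le_level[OF s D R] by simp
qed

text \<open>The level bound at R = (D / 2) (1 + 8 / \<open>\<phi>\<close>^2). The exponent R^2 / (2
  s) then exceeds its value at D / 2 only by a bounded amount, 2 + 8 / \<open>\<phi>\<close>^2, and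
  the assumption on \<open>\<phi>\<close> is what keeps R at most D.\<close>

lemma survival_le_small_time:
  assumes s: "s > 0" and D: "D > 0" and \<psi>: "2 * sqrt 2 \<le> D / sqrt s"
  shows "survival D s \<le> 1 - (1 - erf ((D / sqrt s + 8 / (D / sqrt s)) / (2 * sqrt 2)) ^ 3)
    * ((ln (1 + 8 / (D / sqrt s)\<^sup>2) + inverse (1 + 8 / (D / sqrt s)\<^sup>2) - 1) / ln 2)"
proof -
  define \<phi> where "\<phi> = D / sqrt s"
  have p0: "0 < \<phi>" using s D by (simp add: \<phi>_def)
  define R where "R = D / 2 * (1 + 8 / \<phi>\<^sup>2)"
  have "(2 * sqrt 2)\<^sup>2 \<le> \<phi>\<^sup>2" using \<psi> unfolding \<phi>_def by (intro power_mono) auto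
  then have "8 \<le> \<phi>\<^sup>2" by (simp add: power_mult_distrib)
  then have e: "0 \<le> 8 / \<phi>\<^sup>2" "8 / \<phi>\<^sup>2 \<le> 1" using p0 by auto
  have "D / 2 * 1 \<le> R" "R \<le> D / 2 * 2" unfolding R_def using e D by (intro mult_left_mono; simp)+
  then have R: "D / 2 \<le> R" "R \<le> D" by auto
  have 1: "2 * R / D = 1 + 8 / \<phi>\<^sup>2" using D by (simp add: R_def)
  have "R / sqrt (2 * s) = \<phi> * (1 + 8 / \<phi>\<^sup>2) / (2 * sqrt 2)" by (simp add: R_def \<phi>_def real_sqrt_mult)
  also have "\<phi> * (1 + 8 / \<phi>\<^sup>2) = \<phi> + 8 / \<phi>" using p0 by (simp add: distrib_left power2_eq_square)
  finally have 2: "R / sqrt (2 * s) = (\<phi> + 8 / \<phi>) / (2 * sqrt 2)" .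
  show ?thesis using survival_le_level_erf[OF s D R] unfolding 1 2 unfolding \<phi>_def .
qed

text \<open>Up to sqrt 2 the linear bound suffices; beyond it the linear bound grows without limit
  and the level bound at R = D takes over.\<close>

lemma survival_le_erf:
  assumes s: "s > 0" and D: "D > 0"
  shows "survival D s \<le> erf (exp 1 * (D / sqrt s) / 2)"
proof (cases "D / sqrt s \<le> sqrt 2")
  case True
  have "survival D s \<le> D / sqrt s / sqrt (2 * pi)" using survival_le[OF s D] by (simp add: real_sqrt_mult mult_ac)
  also have "\<dots> \<le> erf (exp 1 * (D / sqrt s) / 2)" using True s D by (intro linear_le_erf) auto
  finally show ?thesis .
next
  case False
  have "D / sqrt (2 * s) = D / sqrt s / sqrt 2" by (simp add: real_sqrt_mult mult_ac)
  moreover have "2 * D / D = 2" using D by simp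
  ultimately have "survival D s \<le> 1 - (1 - erf (D / sqrt s / sqrt 2) ^ 3) * ((ln 2 + 1 / 2 - 1) / ln 2)"
    using survival_le_level_erf[OF s D, of D] D by (simp add: inverse_eq_divide)
  also have "\<dots> \<le> erf (exp 1 * (D / sqrt s) / 2)" using False by (intro level_one_le_erf) simp
  finally show ?thesis .
qed

text \<open>The level bound with a relative excess \<open>\<delta>\<close> that does not depend on
  s: the prefactor stays constant as s tends to 0, at the price of a slightly larger
  exponent.\<close>

lemma survival_less_1_bound:
  assumes s: "s > 0" and D: "D > 0" and d: "0 < \<delta>" "\<delta> \<le> 1"
  shows "2 / sqrt pi * ((ln (1 + \<delta>) + inverse (1 + \<delta>) - 1) / ln 2) * exp (- (D / 2 * (1 + \<delta>) / sqrt (2 * s) + 1)\<^sup>2) \<le> 1 - survival D s"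
proof -
  define R where "R = D / 2 * (1 + \<delta>)"
  have "D / 2 * 1 \<le> R" "R \<le> D / 2 * 2" unfolding R_def using d D by (intro mult_left_mono; simp)+
  then have R: "D / 2 \<le> R" "R \<le> D" by auto
  define z where "z = R / sqrt (2 * s)"
  have z: "0 \<le> z" using R D s by (simp add: z_def)
  have "2 / sqrt pi * exp (- (z + 1)\<^sup>2) \<le> 1 - erf z" by (rule erfc_ge[OF z])
  also have "\<dots> \<le> 1 - erf z ^ 3" using power_decreasing[of 1 3 "erf z"] erf_nonneg[OF z] erf_le_1[of z] by simp
  finally have "2 / sqrt pi * exp (- (z + 1)\<^sup>2) * ((ln (1 + \<delta>) + inverse (1 + \<delta>) - 1) / ln 2)
      \<le> (1 - erf z ^ 3) * ((ln (1 + \<delta>) + inverse (1 + \<delta>) - 1) / ln 2)"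
    using ln_plus_inverse_pos[OF d(1)] by (intro mult_right_mono) auto
  moreover have d': "2 * R / D = 1 + \<delta>" using D by (simp add: R_def)
  have "(1 - erf z ^ 3) * ((ln (1 + \<delta>) + inverse (1 + \<delta>) - 1) / ln 2) \<le> 1 - survival D s"
    using survival_le_level_erf[OF s D R] unfolding d' z_def by linarith
  ultimately show ?thesis unfolding z_def R_def by (simp only: mult_ac)
qed

lemma survival_less_1:
  assumes s: "s > 0" and D: "D > 0"
  shows "0 < 1 - survival D s"
proof -
  have "0 < 2 / sqrt pi * ((ln (1 + 1) + inverse (1 + 1) - 1) / ln 2) * exp (- (D / 2 * (1 + 1) / sqrt (2 * s) + 1)\<^sup>2)"
    using ln_plus_inverse_pos[of 1] by (intro mult_pos_pos divide_pos_pos) auto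
  also have "\<dots> \<le> 1 - survival D s" by (rule survival_less_1_bound[OF s D]) auto
  finally show ?thesis .
qed

text \<open>On the exponential scale both sides reach the rate D^2 / 8 up to an arbitrarily small
  \<open>\<delta>\<close>: from below by the level R = (1 + \<open>\<delta>\<close>) D / 2, from
  above by the chance that Y_s exceeds D / 2.\<close>

lemma survival_at_0:
  assumes D: "D > 0"
  shows "((\<lambda>s. s * ln (1 - survival D s)) \<longlongrightarrow> - (D\<^sup>2 / 8)) (at_right 0)"
proof (rule order_tendstoI)
  fix a assume a: "a < - (D\<^sup>2 / 8)"
  have "((\<lambda>\<delta>. - ((D / 2 * (1 + \<delta>))\<^sup>2 / 2)) \<longlongrightarrow> - ((D / 2 * (1 + 0))\<^sup>2 / 2)) (at_right 0)"
    by (intro tendsto_intros) auto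
  then have "\<forall>\<^sub>F \<delta> in at_right 0. a < - ((D / 2 * (1 + \<delta>))\<^sup>2 / 2)"
    using a by (intro order_tendstoD) (auto simp: power_divide)
  moreover have "\<forall>\<^sub>F \<delta> in at_right 0. \<delta> \<in> {0<..<1::real}" by (rule eventually_at_right_real) simp
  ultimately have "\<forall>\<^sub>F \<delta> in at_right 0. a < - ((D / 2 * (1 + \<delta>))\<^sup>2 / 2) \<and> \<delta> \<in> {0<..<1}" by eventually_elim simp
  \<comment> \<open>Fixed before s tends to 0, so that the prefactor k below is a constant and
    disappears after multiplication by s.\<close>
  then obtain \<delta> where \<delta>: "a < - ((D / 2 * (1 + \<delta>))\<^sup>2 / 2)" "0 < \<delta>" "\<delta> \<le> 1"
    using eventually_happens by force
  define k where "k = 2 / sqrt pi * ((ln (1 + \<delta>) + inverse (1 + \<delta>) - 1) / ln 2)"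
  have k: "0 < k" unfolding k_def using ln_plus_inverse_pos[OF \<delta>(2)] by (intro mult_pos_pos divide_pos_pos) auto
  have "\<forall>\<^sub>F s in at_right 0. a < s * ln k - s * (D / 2 * (1 + \<delta>) / sqrt (2 * s) + 1)\<^sup>2"
    using \<delta>(1) by (rule order_tendstoD(1)[OF scaled_square_tendsto])
  with eventually_at_right_less[of "0::real"]
  show "\<forall>\<^sub>F s in at_right 0. a < s * ln (1 - survival D s)"
  proof eventually_elim
    case (elim s)
    let ?e = "exp (- (D / 2 * (1 + \<delta>) / sqrt (2 * s) + 1)\<^sup>2)"
    have "k * ?e \<le> 1 - survival D s" unfolding k_def by (rule survival_less_1_bound[OF elim(1) D \<delta>(2,3)])
    then have "ln (k * ?e) \<le> ln (1 - survival D s)" using k survival_less_1[OF elim(1) D] by (subst ln_le_cancel_iff) auto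
    moreover have "ln (k * ?e) = ln k - (D / 2 * (1 + \<delta>) / sqrt (2 * s) + 1)\<^sup>2" using k by (subst ln_mult) auto
    ultimately have "s * (ln k - (D / 2 * (1 + \<delta>) / sqrt (2 * s) + 1)\<^sup>2) \<le> s * ln (1 - survival D s)"
      using elim by (intro mult_left_mono) auto
    then show ?case using elim(2) by (simp add: right_diff_distrib)
  qed
next
  fix a assume a: "- (D\<^sup>2 / 8) < a"
  have "((\<lambda>\<delta>. - ((1 - \<delta>) * (D\<^sup>2 / 8))) \<longlongrightarrow> - ((1 - 0) * (D\<^sup>2 / 8))) (at_right 0)"
    by (intro tendsto_intros)
  then have "\<forall>\<^sub>F \<delta> in at_right 0. - ((1 - \<delta>) * (D\<^sup>2 / 8)) < a" using a by (intro order_tendstoD) auto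
  moreover have "\<forall>\<^sub>F \<delta> in at_right 0. \<delta> \<in> {0<..<1::real}" by (rule eventually_at_right_real) simp
  ultimately have "\<forall>\<^sub>F \<delta> in at_right 0. - ((1 - \<delta>) * (D\<^sup>2 / 8)) < a \<and> \<delta> \<in> {0<..<1}" by eventually_elim simp
  then obtain \<delta> where \<delta>: "- ((1 - \<delta>) * (D\<^sup>2 / 8)) < a" "0 < \<delta>" "\<delta> < 1"
    using eventually_happens by force
  \<comment> \<open>The factor 2 comes from \<open>survival_ge_small\<close>, the power from
    \<open>prob_Y_gt_le_exp\<close>; being constant in s, both drop out in the limit.\<close>
  define k where "k = 2 * \<delta> powr (-3/2)"
  have k: "0 < k" using \<delta> by (simp add: k_def)
  have "((\<lambda>s. s * ln k - (1 - \<delta>) * (D\<^sup>2 / 8)) \<longlongrightarrow> 0 * ln k - (1 - \<delta>) * (D\<^sup>2 / 8)) (at_right 0)"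
    by (intro tendsto_intros)
  then have "\<forall>\<^sub>F s in at_right 0. s * ln k - (1 - \<delta>) * (D\<^sup>2 / 8) < a"
    using \<delta>(1) by (intro order_tendstoD) auto
  with eventually_at_right_less[of "0::real"]
  show "\<forall>\<^sub>F s in at_right 0. s * ln (1 - survival D s) < a"
  proof eventually_elim
    case (elim s)
    have "1 - survival D s \<le> 2 * prob {\<omega>\<in>space M. Y s \<omega> > D / 2}" using survival_ge_small[OF elim(1) D] by simp
    also have "\<dots> \<le> 2 * (\<delta> powr (-3/2) * exp (- (1 - \<delta>) * (D / 2)\<^sup>2 / (2 * s)))"
      using prob_Y_gt_le_exp[OF elim(1) \<delta>(2,3), of "D / 2"] D by simp
    also have "\<dots> = k * exp (- (1 - \<delta>) * (D / 2)\<^sup>2 / (2 * s))" by (simp add: k_def)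
    finally have "ln (1 - survival D s) \<le> ln (k * exp (- (1 - \<delta>) * (D / 2)\<^sup>2 / (2 * s)))"
      using survival_less_1[OF elim(1) D] k by (subst ln_le_cancel_iff) auto
    also have "\<dots> = ln k + - (1 - \<delta>) * (D / 2)\<^sup>2 / (2 * s)" using k by (simp only: ln_mult_pos[OF _ exp_gt_zero] ln_exp)
    finally have "s * ln (1 - survival D s) \<le> s * (ln k + - (1 - \<delta>) * (D / 2)\<^sup>2 / (2 * s))" using elim by (intro mult_left_mono) auto
    also have "\<dots> = s * ln k - (1 - \<delta>) * (D\<^sup>2 / 8)" using elim by (simp add: field_simps power_divide)
    finally show ?case using elim(2) by simp
  qed
qed

lemma random_time_coalescence:
  assumes "\<alpha> < \<beta>"
  shows "random_time M (coalescence \<alpha> \<beta>) (survival (\<beta> - \<alpha>))"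
proof unfold_locales
  show "0 \<le> coalescence \<alpha> \<beta> \<omega>" for \<omega>
    unfolding coalescence_def coalescence_time_def by (intro Inf_greatest) auto
qed (use coalescence_tail(1) coalescence_survival assms in auto)

end

lemma (in real_brownian) random_time_reflection:
  assumes "\<alpha> < \<beta>"
  shows "random_time N (\<lambda>\<omega>. reflection_time \<alpha> \<beta> (\<lambda>t. X t \<omega>)) (\<lambda>s. erf ((\<beta> - \<alpha>) / (2 * sqrt (2 * s))))"
proof unfold_locales
  show "0 \<le> reflection_time \<alpha> \<beta> (\<lambda>t. X t \<omega>)" for \<omega>
    unfolding reflection_time_def by (intro Inf_greatest) auto
qed (use reflection_tail assms in auto)

text \<open>Scaling: at u = t / (2 e^2) the survival function of the reflection coupling equals
  \<open>erf\<close> (e D / (2 sqrt t)), the bound for the dyadic coupling at t.\<close>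

lemma (in random_time) dominated_by_reflection:
  assumes V: "random_time N Z' (\<lambda>s. erf (D / (2 * sqrt (2 * s))))"
    and le: "\<And>s. s > 0 \<Longrightarrow> S s \<le> erf (exp 1 * (D / sqrt s) / 2)"
  shows "measure (completion M) {\<omega>\<in>space M. ereal t \<le> Z \<omega>}
    \<le> measure (completion N) {\<omega>\<in>space N. ereal t \<le> ereal (2 * (exp 1)\<^sup>2) * Z' \<omega>}"
proof (cases "t > 0")
  case False
  have "\<And>\<omega>. 0 \<le> Z' \<omega>" by (rule random_time.Z_nonneg[OF V])
  then have "0 \<le> ereal (2 * (exp 1)\<^sup>2) * Z' \<omega>" for \<omega>
    using ereal_0_le_mult[of "ereal (2 * (exp 1)\<^sup>2)"] by simp
  moreover have "ereal t \<le> 0" using False by simp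
  ultimately have "ereal t \<le> ereal (2 * (exp 1)\<^sup>2) * Z' \<omega>" for \<omega> by (blast intro: order_trans)
  then have "{\<omega>\<in>space N. ereal t \<le> ereal (2 * (exp 1)\<^sup>2) * Z' \<omega>} = space (completion N)" by simp
  moreover have "prob_space (completion N)" by (rule random_time.prob_completion[OF V])
  ultimately have "measure (completion N) {\<omega>\<in>space N. ereal t \<le> ereal (2 * (exp 1)\<^sup>2) * Z' \<omega>} = 1"
    by (simp only: prob_space.prob_space)
  then show ?thesis using prob_space.prob_le_1[OF prob_completion] by simp
next
  case t: True
  define u where "u = t / (2 * (exp 1)\<^sup>2)"
  have u: "0 < u" using t by (simp add: u_def)
  \<comment> \<open>The claim concerns weak inequalities while tails are known for strict ones, so
    the bound is taken at s < t and carried to t by continuity of \<open>erf\<close>.\<close>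
  have "((\<lambda>s. erf (exp 1 * (D / sqrt s) / 2)) \<longlongrightarrow> erf (exp 1 * (D / sqrt t) / 2)) (at_left t)"
    using t by (intro tendsto_erf tendsto_intros) auto
  moreover have "\<forall>\<^sub>F s in at_left t. measure (completion M) {\<omega>\<in>space M. ereal t \<le> Z \<omega>} \<le> erf (exp 1 * (D / sqrt s) / 2)"
    using eventually_at_left_real[OF t]
  proof eventually_elim
    case (elim s)
    then have s: "0 < s" "s < t" by auto
    have "measure (completion M) {\<omega>\<in>space M. ereal t \<le> Z \<omega>} \<le> measure (completion M) {\<omega>\<in>space M. ereal s < Z \<omega>}"
      using s Z_measurable[OF s(1)]
      by (intro finite_measure.finite_measure_mono prob_space.finite_measure prob_completion) (auto intro: less_le_trans[of _ "ereal t"])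
    then show ?case using Z_tail[OF s(1)] le[OF s(1)] by simp
  qed
  ultimately have "measure (completion M) {\<omega>\<in>space M. ereal t \<le> Z \<omega>} \<le> erf (exp 1 * (D / sqrt t) / 2)"
    by (rule tendsto_lowerbound) simp
  also have "2 * sqrt (2 * u) = 2 * (sqrt t / exp 1)" by (simp add: u_def real_sqrt_divide)
  then have "exp 1 * (D / sqrt t) / 2 = D / (2 * sqrt (2 * u))" by (simp add: mult.commute)
  also have "erf (D / (2 * sqrt (2 * u))) = measure (completion N) {\<omega>\<in>space N. ereal u < Z' \<omega>}"
    using random_time.Z_tail[OF V u] by simp
  also have "\<dots> \<le> measure (completion N) {\<omega>\<in>space N. ereal u \<le> Z' \<omega>}"
    using random_time.ge_measurable[OF V u]
    by (intro finite_measure.finite_measure_mono prob_space.finite_measure random_time.prob_completion[OF V]) auto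
  also have "ereal u \<le> z \<longleftrightarrow> ereal t \<le> ereal (2 * (exp 1)\<^sup>2) * z" for z
    by (cases z) (auto simp: u_def field_simps)
  then have "{\<omega>\<in>space N. ereal u \<le> Z' \<omega>} = {\<omega>\<in>space N. ereal t \<le> ereal (2 * (exp 1)\<^sup>2) * Z' \<omega>}" by simp
  finally show ?thesis .
qed

text \<open>The common normalisation h lets each of the two functions be treated on its own.\<close>

lemma ratio_tendsto_1:
  fixes f g h :: "real \<Rightarrow> real"
  assumes "((\<lambda>x. f x * h x) \<longlongrightarrow> c) F" "((\<lambda>x. g x * h x) \<longlongrightarrow> c) F" "c \<noteq> 0" "\<forall>\<^sub>F x in F. h x \<noteq> 0"
  shows "((\<lambda>x. f x / g x) \<longlongrightarrow> 1) F"
proof -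
  have "((\<lambda>x. (f x * h x) / (g x * h x)) \<longlongrightarrow> c / c) F" by (intro tendsto_divide assms)
  moreover have "\<forall>\<^sub>F x in F. (f x * h x) / (g x * h x) = f x / g x" using assms(4) by eventually_elim simp
  ultimately show ?thesis using assms(3) Lim_transform_eventually by fastforce
qed

theorem corollary3:
  fixes M :: "'a measure" and Y :: "real \<Rightarrow> 'a \<Rightarrow> real" and W :: "int \<Rightarrow> 'a \<Rightarrow> int"
    and \<Theta> :: "'a \<Rightarrow> real"
    and N :: "'b measure" and Xhat :: "real \<Rightarrow> 'b \<Rightarrow> real"
    and \<alpha> \<beta> :: real
    and X :: "real \<Rightarrow> real \<Rightarrow> 'a \<Rightarrow> real"
    and \<Upsilon> :: "'a \<Rightarrow> ereal" and \<Upsilon>hat :: "'b \<Rightarrow> ereal"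
    and \<psi> :: "real \<Rightarrow> real"
  assumes driving: "dyadic_driving M Y W \<Theta>"
    and reflection: "brownian_motion N \<alpha> Xhat"
    and less: "\<alpha> < \<beta>"
  defines "X \<equiv> (\<lambda>\<gamma> t \<omega>. dyadic_X (\<lambda>u. Y u \<omega>) (\<lambda>i. W i \<omega>) (\<Theta> \<omega>) \<gamma> t)"
    and "\<Upsilon> \<equiv> (\<lambda>\<omega>. coalescence_time {\<alpha>..\<beta>} (\<lambda>\<gamma> t. X \<gamma> t \<omega>))"
    and "\<Upsilon>hat \<equiv> (\<lambda>\<omega>. reflection_time \<alpha> \<beta> (\<lambda>t. Xhat t \<omega>))"
    and "\<psi> \<equiv> (\<lambda>s. \<bar>\<alpha> - \<beta>\<bar> / sqrt s)"
  shows
    "(\<forall>s>0. \<P>(\<omega> in completion M. \<Upsilon> \<omega> > ereal s) \<le> \<psi> s / sqrt (2 * pi)) \<and>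
     ((\<lambda>s. \<P>(\<omega> in completion M. \<Upsilon> \<omega> > ereal s) /
           \<P>(\<omega> in completion N. \<Upsilon>hat \<omega> > ereal s)) \<longlongrightarrow> 1) at_top \<and>
     ((\<lambda>p. quantile M \<Upsilon> p / quantile N \<Upsilon>hat p) \<longlongrightarrow> 1) (at_left 1) \<and>
     (\<forall>s>0. \<psi> s \<ge> 2 * sqrt 2 \<longrightarrow>
        \<P>(\<omega> in completion M. \<Upsilon> \<omega> > ereal s) \<le>
          1 - (1 - (erf ((\<psi> s + 8 / \<psi> s) / (2 * sqrt 2))) ^ 3) *
              ((ln (1 + 8 / (\<psi> s)\<^sup>2) + inverse (1 + 8 / (\<psi> s)\<^sup>2) - 1) / ln 2)) \<and>
     ((\<lambda>p. quantile M \<Upsilon> p / quantile N \<Upsilon>hat p) \<longlongrightarrow> 1) (at_right 0) \<and>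
     (\<forall>s>0. \<P>(\<omega> in completion M. \<Upsilon> \<omega> > ereal s) \<le> erf (exp 1 * \<psi> s / 2)) \<and>
     (\<forall>t::real. \<P>(\<omega> in completion M. \<Upsilon> \<omega> \<ge> ereal t) \<le>
        \<P>(\<omega> in completion N. ereal (2 * (exp 1)\<^sup>2) * \<Upsilon>hat \<omega> \<ge> ereal t))"
proof -
  have dc: "dyadic_coupling M Y W \<Theta>" by (rule dyadic_coupling.intro[OF driving])
  define D where "D = \<beta> - \<alpha>"
  define S where "S = dyadic_coupling.survival M Y \<Theta> D"
  have D: "D > 0" using less by (simp add: D_def)
  have \<psi>: "\<psi> s = D / sqrt s" for s using less by (simp add: \<psi>_def D_def)
  have "\<Upsilon> = dyadic_coupling.coalescence Y W \<Theta> \<alpha> \<beta>"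
    by (simp add: \<Upsilon>_def X_def dyadic_coupling.coalescence_def[OF dc] fun_eq_iff)
  then have U: "random_time M \<Upsilon> S"
    using dyadic_coupling.random_time_coalescence[OF dc less] by (simp add: S_def D_def)
  have V: "random_time N \<Upsilon>hat (\<lambda>s. erf (D / (2 * sqrt (2 * s))))"
    unfolding \<Upsilon>hat_def D_def by (rule real_brownian.random_time_reflection[OF real_brownian.intro[OF reflection] less])
  have tail: "\<P>(\<omega> in completion M. \<Upsilon> \<omega> > ereal s) = S s"
    "\<P>(\<omega> in completion N. \<Upsilon>hat \<omega> > ereal s) = erf (D / (2 * sqrt (2 * s)))" if "s > 0" for s
    using random_time.Z_tail[OF U that] random_time.Z_tail[OF V that] by simp_all
  note S_top = dyadic_coupling.survival_at_top[OF dc D, folded S_def]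
  note S_0 = dyadic_coupling.survival_at_0[OF dc D, folded S_def]
  note S_le = dyadic_coupling.survival_le_erf[OF dc _ D, folded S_def]
  have c: "0 < D / sqrt (2 * pi)" "0 < D\<^sup>2 / 8" using D by auto
  have pos_S: "\<forall>\<^sub>F s in at_right 0. 0 < 1 - S s"
    unfolding S_def using eventually_at_right_less[of "0::real"]
    by eventually_elim (rule dyadic_coupling.survival_less_1[OF dc _ D])
  have pos_erf: "\<forall>\<^sub>F s in at_right 0. 0 < 1 - erf (D / (2 * sqrt (2 * s)))"
    using erf_strict_mono[OF less_add_one] erf_le_1 by (intro always_eventually allI) (metis diff_gt_0_iff_gt less_le_trans)
  show ?thesis
  proof (intro conjI allI impI)
    fix s :: real assume s: "0 < s"
    show "\<P>(\<omega> in completion M. \<Upsilon> \<omega> > ereal s) \<le> \<psi> s / sqrt (2 * pi)"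
      using dyadic_coupling.survival_le[OF dc s D, folded S_def]
      unfolding tail[OF s] \<psi> by (simp add: real_sqrt_mult mult_ac)
    show "\<P>(\<omega> in completion M. \<Upsilon> \<omega> > ereal s) \<le> erf (exp 1 * \<psi> s / 2)"
      using S_le[OF s] unfolding tail[OF s] \<psi> .
    show "\<P>(\<omega> in completion M. \<Upsilon> \<omega> > ereal s) \<le>
          1 - (1 - (erf ((\<psi> s + 8 / \<psi> s) / (2 * sqrt 2))) ^ 3) *
              ((ln (1 + 8 / (\<psi> s)\<^sup>2) + inverse (1 + 8 / (\<psi> s)\<^sup>2) - 1) / ln 2)" if "2 * sqrt 2 \<le> \<psi> s"
      using dyadic_coupling.survival_le_small_time[OF dc s D, folded S_def] that
      unfolding tail[OF s] \<psi> .
  next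
    have "((\<lambda>s. S s / erf (D / (2 * sqrt (2 * s)))) \<longlongrightarrow> 1) at_top"
    \<comment> \<open>Both tails have the same leading term D / sqrt (2 pi s).\<close>
    proof (rule ratio_tendsto_1[where h = sqrt and c = "D / sqrt (2 * pi)"])
      show "((\<lambda>s. S s * sqrt s) \<longlongrightarrow> D / sqrt (2 * pi)) at_top" using S_top by (subst mult.commute)
      show "((\<lambda>s. erf (D / (2 * sqrt (2 * s))) * sqrt s) \<longlongrightarrow> D / sqrt (2 * pi)) at_top"
        using reflection_survival_at_top[OF D] by (subst mult.commute)
      show "\<forall>\<^sub>F s in at_top. sqrt s \<noteq> 0" using eventually_gt_at_top[of 0] by eventually_elim simp
    qed (use c in auto)
    moreover have "\<forall>\<^sub>F s in at_top. S s / erf (D / (2 * sqrt (2 * s))) =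
        \<P>(\<omega> in completion M. \<Upsilon> \<omega> > ereal s) / \<P>(\<omega> in completion N. \<Upsilon>hat \<omega> > ereal s)"
      using eventually_gt_at_top[of "0::real"] by eventually_elim (simp only: tail)
    ultimately show "((\<lambda>s. \<P>(\<omega> in completion M. \<Upsilon> \<omega> > ereal s) /
           \<P>(\<omega> in completion N. \<Upsilon>hat \<omega> > ereal s)) \<longlongrightarrow> 1) at_top"
      by (rule Lim_transform_eventually)
  next
    show "((\<lambda>p. quantile M \<Upsilon> p / quantile N \<Upsilon>hat p) \<longlongrightarrow> 1) (at_left 1)"
      \<comment> \<open>Equal leading terms of the tails give both quantiles the same limit c^2
        after multiplication by (1 - p)^2.\<close>
      using c by (intro ratio_tendsto_1[OF random_time.quantile_ratio_at_1[OF U _ S_top]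
            random_time.quantile_ratio_at_1[OF V _ reflection_survival_at_top[OF D]]])
        (auto simp: eventually_at_filter)
  next
    have "\<forall>\<^sub>F p in at_right 0. - ln p \<noteq> (0::real)"
      using eventually_at_right_real[of 0 "1::real"] by (rule eventually_mono) auto
    then show "((\<lambda>p. quantile M \<Upsilon> p / quantile N \<Upsilon>hat p) \<longlongrightarrow> 1) (at_right 0)"
      using c by (intro ratio_tendsto_1[OF random_time.quantile_ratio_at_0[OF U _ pos_S S_0]
            random_time.quantile_ratio_at_0[OF V _ pos_erf reflection_survival_at_0[OF D]]]) auto
  next
    fix t :: real
    show "\<P>(\<omega> in completion M. \<Upsilon> \<omega> \<ge> ereal t) \<le>
        \<P>(\<omega> in completion N. ereal (2 * (exp 1)\<^sup>2) * \<Upsilon>hat \<omega> \<ge> ereal t)"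
      using random_time.dominated_by_reflection[OF U V S_le] by simp
  qed
qed

end
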